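(* For each $n\ge 1$ let $P_n(z)=\sum_{i=0}^n b_i z^i$ be a random log-concave polynomial of degree $n$ drawn from the beta model, and denote its roots in $\mathbb{C}$, counted with multiplicity, by $\zeta_{n,1},\dots,\zeta_{n,n}$. Then, as $n\to\infty$, $$ d_L\Big(\frac1n\sum_{k=1}^n\delta_{\zeta_{n,k}},\ \mu\Big)\to 0\quad\text{in probability},$$ where $d_L$ is the Lévy–Prokhorov metric on probability measures on $\mathbb{C}$ and $\mu$ is the absolutely continuous (with respect to planar Lebesgue measure) probability measure on $\mathbb{C}$ with density $$\frac{d\mu}{dz}=\frac{1}{\pi|z|^2\bigl(4+|\log|z||\bigr)^2},\qquad z\in\mathbb{C}\setminus\{0\}.$$
   Context: Beta model: let $U_0,\dots,U_n$ be i.i.d. uniform random variables on $(0,1)$ and let $\mathcal{L}=\{U_{i-1}U_{i+1}\le U_i^2 \text{ for all } 1\le i\le n-1\}$. Let $(a_0,\dots,a_n)$ have the conditional law of $(U_0,\dots,U_n)$ given $\mathcal{L}$, and set $(b_0,\dots,b_n)=(a_0^n,a_1^n,\dots,a_n^n)$. The polynomial $P_n(z)=\sum_{i=0}^n b_i z^i$ is said to be drawn from the beta model. Almost surely $b_n>0$, so $P_n$ has degree $n$. *)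

theory Defs
  imports "HOL-Probability.Probability" "HOL-Computational_Algebra.Polynomial"
begin

definition iid_uniform :: "nat \<Rightarrow> (nat \<Rightarrow> real) measure" where
  "iid_uniform n = PiM {..n} (\<lambda>_. uniform_measure lborel {0<..<1})"

definition log_concave_event :: "nat \<Rightarrow> (nat \<Rightarrow> real) set" where
  "log_concave_event n =
     {u \<in> space (iid_uniform n). \<forall>i\<in>{1..<n}. u (i - 1) * u (i + 1) \<le> (u i)\<^sup>2}"

text \<open>
  \<^term>\<open>uniform_measure M A\<close> is the conditional measure of \<^term>\<open>M\<close> given \<^term>\<open>A\<close>, so the
  following is the joint law of \<open>(a\<^sub>0\<^sup>n, \<dots>, a\<^sub>n\<^sup>n)\<close>, where \<open>(a\<^sub>0, \<dots>, a\<^sub>n)\<close> is an i.i.d. uniform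
  vector conditioned on log-concavity.
\<close>

definition beta_model :: "nat \<Rightarrow> (nat \<Rightarrow> real) measure" where
  "beta_model n =
     distr (uniform_measure (iid_uniform n) (log_concave_event n))
       (PiM {..n} (\<lambda>_. borel)) (\<lambda>a. \<lambda>i\<in>{..n}. a i ^ n)"

definition coeff_poly :: "nat \<Rightarrow> (nat \<Rightarrow> real) \<Rightarrow> complex poly" where
  "coeff_poly n c = (\<Sum>i\<le>n. monom (complex_of_real (c i)) i)"

text \<open>
  The root \<open>z\<close> carries mass \<open>order z p / degree p\<close>, so this is the sum of \<open>1 / n\<close> times the point
  masses at the roots, counted with multiplicity, when \<open>n = degree p \<ge> 1\<close>. For constant
  polynomials, including \<open>0\<close>, it is the null measure, since \<open>x / 0 = 0\<close>.
\<close>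

definition root_measure :: "complex poly \<Rightarrow> complex measure" where
  "root_measure p =
     distr (point_measure {z. poly p z = 0} (\<lambda>z. ennreal (real (order z p) / real (degree p))))
       borel (\<lambda>z. z)"

definition levy_prokhorov :: "'a::metric_space measure \<Rightarrow> 'a measure \<Rightarrow> real" where
  "levy_prokhorov M N =
     Inf {e. 0 < e \<and> (\<forall>A\<in>sets borel.
            measure M A \<le> measure N (\<Union>x\<in>A. ball x e) + e \<and>
            measure N A \<le> measure M (\<Union>x\<in>A. ball x e) + e)}"

text \<open>
  On \<^typ>\<open>complex\<close>, \<^term>\<open>lborel\<close> is planar Lebesgue measure. The value of the density at \<open>0\<close> is
  irrelevant.
\<close>

definition limit_measure :: "complex measure" where
  "limit_measure =
     density lborel (\<lambda>z. ennreal (1 / (pi * (cmod z)\<^sup>2 * (4 + \<bar>ln (cmod z)\<bar>)\<^sup>2)))"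

end

theory Submission
  imports Defs "HOL-Complex_Analysis.Complex_Analysis" "HOL-Real_Asymp.Real_Asymp"
    "HOL-Computational_Algebra.Fundamental_Theorem_Algebra"
begin

text \<open>
  On the log-concave event \<open>i \<mapsto> ln (u i)\<close> is concave, so it splits according to the index \<open>j\<close> of its
  maximum into two monotone chains with monotone increments. Integrating the coordinates out
  successively gives every mixed moment in closed form, as a sum over \<open>j\<close> of products of linear
  forms in the exponents. The maximum lies at \<open>n / 2 + O(sqrt n)\<close> by an exact second-moment
  identity, and the first two moments of \<open>u i\<close> then show that \<open>- ln (u i)\<close> converges in probability
  to the limit shape at \<open>lim i / n\<close>.

  The polynomial satisfies \<open>ln |P v| / n \<le> max\<^sub>k (ln (u k) + k ln |v| / n) + ln (n + 1) / n\<close>,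
  and by concavity the right-hand side is controlled by three nodes near the maximiser; it converges
  to the Legendre transform of the limit shape, which is the logarithmic potential of the limit
  measure. For the matching lower bound, only one coordinate \<open>u i\<close> is varied with the others fixed:
  log-concavity leaves it an interval of length about \<open>n\<^sup>-\<^sup>3\<close>, while \<open>|P v|\<close> is much smaller than the
  \<open>i\<close>-th term only on a much shorter one. Integrating over \<open>v\<close> gives convergence of the potentials
  in \<open>L\<^sup>1\<close> on annuli, in probability.

  The difference of the means of \<open>ln |v - w|\<close> over circles of radius \<open>s\<close> and \<open>r < s\<close> around \<open>v\<close> is
  a nonnegative kernel supported on \<open>|v - w| < s\<close>. Integrating it over a neighbourhood of a Borel
  set compares the root measure with the limit measure through the \<open>L\<^sup>1\<close> distance of the potentials,
  and so bounds the Levy-Prokhorov distance.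
\<close>


section \<open>Chain integrals and the exact law of the conditioned vector\<close>

text \<open>Right of \<open>1/2\<close> the limit shape has slope \<open>2 / (1 - t) - 4\<close>;
  the \<open>4\<close> is the value of \<open>2 / (1 - t)\<close> at the maximum \<open>1/2\<close>.
  By duality the limiting fraction of roots in the disc of radius \<open>r\<close> is the
  \<open>t\<close> where the slope equals \<open>ln r\<close>, and differentiating it gives the
  density of the limit measure. The tail of this measure is so heavy that \<open>ln |z|\<close> has
  infinite mean over \<open>|z| > 1\<close>. Its potential is therefore renormalised by
  \<open>ln (max 1 |z|)\<close>. Only differences of circle means are compared, and there the
  renormalisation and the leading coefficient both cancel. Closeness to the limit shape bounds
  \<open>|P v|\<close> from above for every \<open>v\<close>, but terms of comparable size may
  cancel at a given \<open>v\<close>; hence the average over \<open>v\<close> in the lower bound.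
  The point \<open>t = 1/2\<close>, dual to \<open>|v| = 1\<close>, is left out, since the random
  maximum sits there. Nothing is lost: points with \<open>|v|\<close> near \<open>1\<close> are
  handled by neighbouring tilts. The distance must also be shown measurable although roots admit no
  continuous labelling by the coefficients; compactness takes the place of one.\<close>

abbreviation unif01 :: "real measure" where
  "unif01 \<equiv> uniform_measure lborel {0<..<1}"

lemma prob_space_unif01: "prob_space unif01"
  by (rule prob_space_uniform_measure) auto

interpretation unif01: product_sigma_finite "\<lambda>_::nat. unif01"
  by (simp add: product_sigma_finite_def
      prob_space_unif01 prob_space_imp_sigma_finite)

lemma nn_integral_unif01:
  assumes "f \<in> borel_measurable borel"
  shows "(\<integral>\<^sup>+y. f y \<partial>unif01) = (\<integral>\<^sup>+y. f y * indicator {0<..<1} y \<partial>lborel)"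
  using assms by (subst nn_integral_uniform_measure) (auto simp: mult.commute divide_ennreal_def)

text \<open>One integration step: an upper bound \<open>l\<close> on the logarithm of a coordinate
  leaves the factor \<open>1 / w\<close> and the \<open>w\<close>-th power of the bound. The flag
  \<open>s\<close> covers strict and weak bounds at once, as they differ by a null set.\<close>

lemma nn_integral_unif01_powr:
  assumes w: "w > 0" and l: "l \<le> 0"
  shows "(\<integral>\<^sup>+y. ennreal (exp ((w - 1) * ln y)) *
            indicator {y. if s then ln y < l else ln y \<le> l} y \<partial>unif01) = ennreal (exp (w * l) / w)"
proof -
  let ?b = "exp l"
  have "(\<integral>\<^sup>+y. ennreal (exp ((w - 1) * ln y)) *
            indicator {y. if s then ln y < l else ln y \<le> l} y \<partial>unif01)
      = (\<integral>\<^sup>+y. ennreal (exp ((w - 1) * ln y)) *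
            indicator {y. if s then ln y < l else ln y \<le> l} y * indicator {0<..<1} y \<partial>lborel)"
    by (rule nn_integral_unif01) measurable
  also have "\<dots> = (\<integral>\<^sup>+y. ennreal (y powr (w - 1) * indicator {0..?b} y) \<partial>lborel)"
  proof (rule nn_integral_cong_AE)
    have "AE y in lborel. y \<noteq> ?b \<and> y \<noteq> 0 \<and> y \<noteq> (1::real)"
      using AE_lborel_singleton[of ?b] AE_lborel_singleton[of 0] AE_lborel_singleton[of "1::real"]
      by eventually_elim auto
    then show "AE y in lborel. ennreal (exp ((w - 1) * ln y)) *
            indicator {y. if s then ln y < l else ln y \<le> l} y * indicator {0<..<1} y
        = ennreal (y powr (w - 1) * indicator {0..?b} y)"
    proof eventually_elim
      case (elim y)
      have b1: "?b \<le> 1" using l by simp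
      consider "y < 0" | "y > 1" | "0 < y" "y < 1" using elim by linarith
      then show ?case
      proof cases
        case 3
        then obtain x where y: "y = exp x" by (metis exp_ln)
        then have "x \<noteq> l" using elim by auto
        then show ?thesis using 3 by (auto simp: y powr_def indicator_def)
      next
        case 2
        then have "?b < y" using b1 by linarith
        then show ?thesis using 2 by (auto simp: indicator_def)
      qed (auto simp: indicator_def)
    qed
  qed
  also have "\<dots> = ennreal (?b powr w / w)"
  proof (rule nn_integral_has_integral_lborel)
    have "((\<lambda>y. y powr (w - 1)) has_integral ?b powr w / w) {0..?b}"
      using has_integral_powr_from_0[of "w - 1" ?b] w by simp
    then have "((\<lambda>y. if y \<in> {0..?b} then y powr (w - 1) else 0) has_integral ?b powr w / w) UNIV"
      by (simp only: has_integral_restrict_UNIV)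
    then show "((\<lambda>y. y powr (w - 1) * indicator {0..?b} y) has_integral ?b powr w / w) UNIV"
      by (rule has_integral_eq[rotated]) auto
  qed auto
  finally show ?thesis by (simp add: powr_def)
qed

section \<open>Chains of coordinates running away from the maximum\<close>

definition chain_bound :: "(nat \<Rightarrow> nat) \<Rightarrow> nat \<Rightarrow> (nat \<Rightarrow> real) \<Rightarrow> real" where
  "chain_bound e k u = (if k = 0 then ln (u (e 0)) else 2 * ln (u (e k)) - ln (u (e (k - 1))))"

text \<open>The enumeration \<open>e\<close> starts at the maximum \<open>e 0\<close>, and concavity
  bounds each new logarithm by linear extrapolation of the last two. The flag makes only the first
  step strict; used on one side of the maximum, it assigns a tied maximum to a single index.\<close>

definition chain :: "bool \<Rightarrow> (nat \<Rightarrow> nat) \<Rightarrow> nat \<Rightarrow> (nat \<Rightarrow> real) \<Rightarrow> bool" where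
  "chain s e m u \<longleftrightarrow> (\<forall>k<m. if s \<and> k = 0 then ln (u (e (Suc k))) < chain_bound e k u
                             else ln (u (e (Suc k))) \<le> chain_bound e k u)"

lemma chain_Suc: "chain s e (Suc m) u \<longleftrightarrow> chain s e m u \<and>
   (if s \<and> m = 0 then ln (u (e (Suc m))) < chain_bound e m u
                             else ln (u (e (Suc m))) \<le> chain_bound e m u)"
  unfolding chain_def All_less_Suc by (rule conj_commute)

text \<open>Increments along a chain start nonpositive and never increase, so the next bound does
  not exceed the current value. This keeps the bound nonpositive, as the one-step integral
  requires.\<close>

lemma chain_bound_le:
  assumes "chain s e m u" "ln (u (e 0)) \<le> 0"
  shows "chain_bound e m u \<le> ln (u (e m)) \<and> ln (u (e m)) \<le> 0"
  using assms
proof (induction m)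
  case 0
  then show ?case by (simp add: chain_bound_def)
next
  case (Suc m)
  then have "ln (u (e (Suc m))) \<le> chain_bound e m u" "chain_bound e m u \<le> ln (u (e m)) \<and> ln (u (e m)) \<le> 0"
    by (auto simp: chain_Suc split: if_splits)
  then show ?case by (auto simp: chain_bound_def)
qed

lemma chain_bound_cong:
  "(\<And>k. k \<le> m \<Longrightarrow> u (e k) = v (e k)) \<Longrightarrow> chain_bound e m u = chain_bound e m v"
  by (auto simp: chain_bound_def)

lemma chain_cong:
  "(\<And>k. k \<le> m \<Longrightarrow> u (e k) = v (e k)) \<Longrightarrow> chain s e m u = chain s e m v"
  by (auto simp: chain_def chain_bound_def Suc_le_eq)

lemma measurable_PiM_ln:
  "i \<in> I \<Longrightarrow> (\<lambda>u. ln (u i)) \<in> borel_measurable (PiM I (\<lambda>_. unif01))"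
  by measurable

lemma measurable_chain_bound:
  "(\<And>k. k \<le> m \<Longrightarrow> e k \<in> I) \<Longrightarrow> chain_bound e m \<in> borel_measurable (PiM I (\<lambda>_. unif01))"
  unfolding chain_bound_def
  by (cases "m = 0") (auto intro!: borel_measurable_diff borel_measurable_times borel_measurable_const measurable_PiM_ln)

lemma measurable_chain:
  assumes "\<And>k. k \<le> m \<Longrightarrow> e k \<in> I"
  shows "Measurable.pred (PiM I (\<lambda>_. unif01)) (chain s e m)"
proof -
  have m: "chain_bound e k \<in> borel_measurable (PiM I (\<lambda>_. unif01))" if "k < m" for k
    using assms that by (intro measurable_chain_bound) auto
  have m': "(\<lambda>u. ln (u (e k))) \<in> borel_measurable (PiM I (\<lambda>_. unif01))" if "k \<le> m" for k
    using assms[OF that] by (rule measurable_PiM_ln)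
  have "chain s e m = (\<lambda>u. \<forall>k\<in>{..<m}. if s \<and> k = 0 then ln (u (e (Suc k))) < chain_bound e k u
                             else ln (u (e (Suc k))) \<le> chain_bound e k u)"
    by (auto simp: chain_def fun_eq_iff)
  also have "Measurable.pred (PiM I (\<lambda>_. unif01)) \<dots>"
  proof (rule pred_intros_finite)
    fix k assume "k \<in> {..<m}"
    then have k: "k < m" "Suc k \<le> m" by auto
    show "Measurable.pred (Pi\<^sub>M I (\<lambda>_. unif01)) (\<lambda>u. if s \<and> k = 0 then ln (u (e (Suc k))) < chain_bound e k u
                             else ln (u (e (Suc k))) \<le> chain_bound e k u)"
    proof (cases "s \<and> k = 0")
      case True
      show ?thesis unfolding if_P[OF True] pred_def
        by (rule borel_measurable_less[OF m'[OF k(2)] m[OF k(1)]])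
    next
      case False
      show ?thesis unfolding if_not_P[OF False] pred_def
        by (rule borel_measurable_le[OF m'[OF k(2)] m[OF k(1)]])
    qed
  qed simp
  finally show ?thesis .
qed

text \<open>The exponent collected by coordinate \<open>k\<close> once all later ones have been
  integrated out: \<open>i - k + 1\<close> is the coefficient of the value at \<open>k\<close> when
  the values at \<open>k - 1\<close> and \<open>k\<close> are extrapolated linearly to
  \<open>i\<close>.\<close>

definition chain_rate :: "nat \<Rightarrow> (nat \<Rightarrow> real) \<Rightarrow> nat \<Rightarrow> real" where
  "chain_rate m w k = (\<Sum>i=k..m. (real i - real k + 1) * w i)"

text \<open>Integrating out coordinate \<open>m + 1\<close> leaves \<open>w (m + 1)\<close> times
  its extrapolated bound in the exponent: twice this weight at \<open>m\<close>, minus once at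
  \<open>m - 1\<close>. For \<open>m = 0\<close> the bound is the value at the start itself, hence
  the factor \<open>1\<close>.\<close>

definition fold_weight :: "nat \<Rightarrow> (nat \<Rightarrow> real) \<Rightarrow> nat \<Rightarrow> real" where
  "fold_weight m w i = w i + (if i = m then (if m = 0 then 1 else 2) * w (Suc m) else 0)
      - (if Suc i = m then w (Suc m) else 0)"

lemma sum_fold_weight:
  fixes g :: "nat \<Rightarrow> real"
  assumes "k \<le> m"
  shows "(\<Sum>i=k..m. g i * fold_weight m w i) = (\<Sum>i=k..m. g i * w i)
     + (if m = 0 then 1 else 2) * g m * w (Suc m) - (if k < m then g (m - 1) * w (Suc m) else 0)"
proof -
  have "(\<Sum>i=k..m. g i * fold_weight m w i) = (\<Sum>i=k..m. g i * w i)
      + (\<Sum>i=k..m. if i = m then g m * ((if m = 0 then 1 else 2) * w (Suc m)) else 0)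
      - (\<Sum>i=k..m. if i = m - 1 then (if m > 0 then g i * w (Suc m) else 0) else 0)"
    unfolding sum.distrib[symmetric] sum_subtractf[symmetric]
    by (rule sum.cong) (auto simp: fold_weight_def algebra_simps)
  also have "\<dots> = (\<Sum>i=k..m. g i * w i)
     + (if m = 0 then 1 else 2) * g m * w (Suc m) - (if k < m then g (m - 1) * w (Suc m) else 0)"
    using assms by (subst (1 2) sum.delta) auto
  finally show ?thesis .
qed

text \<open>The coefficients in a rate are linear in the index, and linear extrapolation reproduces
  linear functions, so folding the outermost weight inwards preserves the rates. For the start of
  the chain the invariant is the plain sum of the weights, as in
  \<open>sum_fold_weight_1\<close>.\<close>

lemma chain_rate_fold_weight:
  assumes "1 \<le> k" "k \<le> m"
  shows "chain_rate m (fold_weight m w) k = chain_rate (Suc m) w k"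
  unfolding chain_rate_def using assms
  by (subst sum_fold_weight) (auto simp: algebra_simps of_nat_diff)

lemma sum_fold_weight_1: "(\<Sum>i\<le>m. fold_weight m w i) = (\<Sum>i\<le>Suc m. w i)"
  using sum_fold_weight[of 0 m "\<lambda>_. 1" w] by (auto simp: atLeast0AtMost)

lemma fold_weight_exponent:
  fixes L :: "nat \<Rightarrow> real"
  shows "(\<Sum>i\<le>m. (fold_weight m w i - of_bool (i \<noteq> 0)) * L i)
     = (\<Sum>i\<le>m. (w i - of_bool (i \<noteq> 0)) * L i)
       + w (Suc m) * (if m = 0 then L 0 else 2 * L m - L (m - 1))"
proof -
  have "(\<Sum>i\<le>m. (fold_weight m w i - of_bool (i \<noteq> 0)) * L i)
     = (\<Sum>i=0..m. L i * fold_weight m w i) - (\<Sum>i\<le>m. of_bool (i \<noteq> 0) * L i)"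
    by (simp add: algebra_simps sum_subtractf atLeast0AtMost)
  also have "\<dots> = (\<Sum>i\<le>m. (w i - of_bool (i \<noteq> 0)) * L i)
       + w (Suc m) * (if m = 0 then L 0 else 2 * L m - L (m - 1))"
    by (subst sum_fold_weight) (auto simp: algebra_simps sum_subtractf atLeast0AtMost)
  finally show ?thesis .
qed

lemma measurable_chain_integrand:
  assumes ek: "\<And>k. k \<le> m \<Longrightarrow> e k \<in> J" and "I \<subseteq> J" and f: "f \<in> borel_measurable (PiM I (\<lambda>_. unif01))"
  shows "(\<lambda>u. f (restrict u I) * indicator {u. chain s e m u} u *
             ennreal (exp (\<Sum>k\<le>m. c k * ln (u (e k))))) \<in> borel_measurable (PiM J (\<lambda>_. unif01))"
proof (intro borel_measurable_times_ennreal)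
  show "(\<lambda>u. f (restrict u I)) \<in> borel_measurable (PiM J (\<lambda>_. unif01))"
    using assms by (intro measurable_compose[OF measurable_restrict_subset f])
  have [measurable]: "Measurable.pred (PiM J (\<lambda>_. unif01)) (chain s e m)"
    using ek by (intro measurable_chain)
  show "(indicator {u. chain s e m u} :: _ \<Rightarrow> ennreal) \<in> borel_measurable (PiM J (\<lambda>_. unif01))"
    by measurable
  have "(\<lambda>u. \<Sum>k\<le>m. c k * ln (u (e k))) \<in> borel_measurable (PiM J (\<lambda>_. unif01))"
    using ek by (intro borel_measurable_sum borel_measurable_times borel_measurable_const measurable_PiM_ln) auto
  then show "(\<lambda>u. ennreal (exp (\<Sum>k\<le>m. c k * ln (u (e k))))) \<in> borel_measurable (PiM J (\<lambda>_. unif01))"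
    by (intro measurable_compose[OF _ measurable_ennreal] measurable_compose[OF _ borel_measurable_exp])
qed

text \<open>The outermost coordinate is integrated first and the induction continues with the folded
  weights, which is why \<open>w\<close> is generalised. The factor \<open>f\<close> carries
  everything on the other coordinates and on the start \<open>e 0\<close>, whose own integral is
  postponed; so the exponent at \<open>e 0\<close> is \<open>w 0\<close> and not
  \<open>w 0 - 1\<close>.\<close>

lemma chain_integral:
  fixes e :: "nat \<Rightarrow> nat" and f :: "(nat \<Rightarrow> real) \<Rightarrow> ennreal"
  assumes I: "finite I" "e 0 \<in> I" and inj: "inj_on e {..m}"
    and out: "\<And>k. 1 \<le> k \<Longrightarrow> k \<le> m \<Longrightarrow> e k \<notin> I"
    and f [measurable]: "f \<in> borel_measurable (PiM I (\<lambda>_. unif01))"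
    and f0: "\<And>u. ln (u (e 0)) > 0 \<Longrightarrow> f u = 0"
    and pos: "\<And>k. 1 \<le> k \<Longrightarrow> k \<le> m \<Longrightarrow> chain_rate m w k > 0"
  shows "(\<integral>\<^sup>+u. f (restrict u I) * indicator {u. chain s e m u} u *
             ennreal (exp (\<Sum>k\<le>m. (w k - of_bool (k \<noteq> 0)) * ln (u (e k)))) \<partial>PiM (I \<union> e ` {1..m}) (\<lambda>_. unif01))
       = (\<integral>\<^sup>+u. f u * ennreal (exp ((\<Sum>k\<le>m. w k) * ln (u (e 0)))) \<partial>PiM I (\<lambda>_. unif01))
           * ennreal (\<Prod>k=1..m. 1 / chain_rate m w k)"
  using inj out pos
proof (induction m arbitrary: w)
  case 0
  have "restrict u I = u" if "u \<in> space (PiM I (\<lambda>_. unif01))" for u :: "nat \<Rightarrow> real"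
    using that by (auto simp: space_PiM PiE_def extensional_restrict)
  then show ?case
    by (auto simp: chain_def simp del: restrict_apply intro!: nn_integral_cong)
next
  case (Suc m)
  let ?J = "I \<union> e ` {1..m}"
  let ?c = "w (Suc m)"
  let ?P = "\<lambda>u. f (restrict u I) * indicator {u. chain s e m u} u *
             ennreal (exp (\<Sum>k\<le>m. (w k - of_bool (k \<noteq> 0)) * ln (u (e k))))"
  have c: "?c > 0"
    using Suc.prems(3)[of "Suc m"] by (simp add: chain_rate_def)
  have new: "e (Suc m) \<notin> ?J"
    using Suc.prems(1,2) by (auto dest: inj_onD)
  have ek: "e k \<in> ?J" if "k \<le> m" for k
    using that I(2) by (cases "k = 0") auto
  have ne: "e k \<noteq> e (Suc m)" if "k \<le> m" for k
    using ek[OF that] new by metis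
  have P: "(\<lambda>u. f (restrict u I) * indicator {u. chain s e m u} u *
             ennreal (exp (\<Sum>k\<le>m. c k * ln (u (e k))))) \<in> borel_measurable (PiM ?J (\<lambda>_. unif01))" for c
    using ek f by (intro measurable_chain_integrand) auto
  have ek': "e k \<in> insert (e (Suc m)) ?J" if "k \<le> Suc m" for k
    using that ek by (cases "k = Suc m") (auto simp: le_Suc_eq)
  have "I \<union> e ` {1..Suc m} = insert (e (Suc m)) ?J"
    by (auto simp: atLeastAtMostSuc_conv)
  then have "(\<integral>\<^sup>+u. f (restrict u I) * indicator {u. chain s e (Suc m) u} u *
             ennreal (exp (\<Sum>k\<le>Suc m. (w k - of_bool (k \<noteq> 0)) * ln (u (e k)))) \<partial>PiM (I \<union> e ` {1..Suc m}) (\<lambda>_. unif01))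
     = (\<integral>\<^sup>+u. f (restrict u I) * indicator {u. chain s e (Suc m) u} u *
             ennreal (exp (\<Sum>k\<le>Suc m. (w k - of_bool (k \<noteq> 0)) * ln (u (e k)))) \<partial>PiM (insert (e (Suc m)) ?J) (\<lambda>_. unif01))"
    by simp
  also have "\<dots> = (\<integral>\<^sup>+u. \<integral>\<^sup>+y. f (restrict (u(e (Suc m) := y)) I) * indicator {u. chain s e (Suc m) u} (u(e (Suc m) := y)) *
             ennreal (exp (\<Sum>k\<le>Suc m. (w k - of_bool (k \<noteq> 0)) * ln ((u(e (Suc m) := y)) (e k)))) \<partial>unif01 \<partial>PiM ?J (\<lambda>_. unif01))"
    using new I(1) ek' f
    by (intro unif01.product_nn_integral_insert measurable_chain_integrand) auto
  also have "\<dots> = (\<integral>\<^sup>+u. \<integral>\<^sup>+y. ?P u * (ennreal (exp ((?c - 1) * ln y)) *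
       indicator {y. if s \<and> m = 0 then ln y < chain_bound e m u else ln y \<le> chain_bound e m u} y) \<partial>unif01 \<partial>PiM ?J (\<lambda>_. unif01))"
  proof (intro nn_integral_cong)
    fix u :: "nat \<Rightarrow> real" and y :: real
    let ?v = "u(e (Suc m) := y)"
    have r: "restrict ?v I = restrict u I"
      using new by (auto simp: restrict_def)
    have ch: "chain s e m ?v = chain s e m u" "chain_bound e m ?v = chain_bound e m u"
      using ne by (auto intro!: chain_cong[of m] chain_bound_cong simp del: fun_upd_apply simp: fun_upd_other)
    have sm: "(\<Sum>k\<le>m. (w k - of_bool (k \<noteq> 0)) * ln (?v (e k))) = (\<Sum>k\<le>m. (w k - of_bool (k \<noteq> 0)) * ln (u (e k)))"
      using ne by (intro sum.cong) auto
    have ind: "(indicator {u. chain s e (Suc m) u} ?v :: ennreal) = indicator {u. chain s e m u} u *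
       indicator {y. if s \<and> m = 0 then ln y < chain_bound e m u else ln y \<le> chain_bound e m u} y"
      by (simp only: indicator_def mem_Collect_eq chain_Suc ch fun_upd_same of_bool_conj)
    show "f (restrict ?v I) * indicator {u. chain s e (Suc m) u} ?v *
             ennreal (exp (\<Sum>k\<le>Suc m. (w k - of_bool (k \<noteq> 0)) * ln (?v (e k)))) =
       ?P u * (ennreal (exp ((?c - 1) * ln y)) *
       indicator {y. if s \<and> m = 0 then ln y < chain_bound e m u else ln y \<le> chain_bound e m u} y)"
      unfolding sum.atMost_Suc sm r ind by (simp add: exp_add ennreal_mult' mult_ac)
  qed
  also have "\<dots> = (\<integral>\<^sup>+u. ?P u * ennreal (exp (?c * chain_bound e m u) / ?c) \<partial>PiM ?J (\<lambda>_. unif01))"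
  proof (rule nn_integral_cong)
    fix u :: "nat \<Rightarrow> real"
    show "(\<integral>\<^sup>+y. ?P u * (ennreal (exp ((?c - 1) * ln y)) *
       indicator {y. if s \<and> m = 0 then ln y < chain_bound e m u else ln y \<le> chain_bound e m u} y) \<partial>unif01)
       = ?P u * ennreal (exp (?c * chain_bound e m u) / ?c)"
    \<comment> \<open>Off the chain, or where the start has a positive logarithm, both sides vanish.
      Otherwise the bound is nonpositive and the one-step integral applies.\<close>
    proof (cases "chain s e m u \<and> ln (u (e 0)) \<le> 0")
      case True
      then have "chain_bound e m u \<le> 0"
        using chain_bound_le[of s e m u] by auto
      then show ?thesis
        using nn_integral_unif01_powr[OF c, of "chain_bound e m u" "s \<and> m = 0"]
        by (subst nn_integral_cmult) auto
    next
      case False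
      then consider "\<not> chain s e m u" | "ln (restrict u I (e 0)) > 0" using I(2) by fastforce
      then have "f (restrict u I) * indicator {u. chain s e m u} u = 0"
        by cases (simp_all only: f0 indicator_def mem_Collect_eq of_bool_eq mult_zero_left mult_zero_right simp_thms)
      then show ?thesis by (simp only: mult_zero_left nn_integral_0_iff_AE nn_integral_const)
    qed
  qed
  also have "\<dots> = (\<integral>\<^sup>+u. (f (restrict u I) * indicator {u. chain s e m u} u *
             ennreal (exp (\<Sum>k\<le>m. (fold_weight m w k - of_bool (k \<noteq> 0)) * ln (u (e k))))) * ennreal (1 / ?c) \<partial>PiM ?J (\<lambda>_. unif01))"
  proof (rule nn_integral_cong)
    fix u :: "nat \<Rightarrow> real"
    have "exp (\<Sum>k\<le>m. (fold_weight m w k - of_bool (k \<noteq> 0)) * ln (u (e k))) * (1 / ?c)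
      = exp (\<Sum>k\<le>m. (w k - of_bool (k \<noteq> 0)) * ln (u (e k))) * (exp (?c * chain_bound e m u) / ?c)"
      unfolding fold_weight_exponent chain_bound_def exp_add by (auto simp: exp_diff)
    then show "?P u * ennreal (exp (?c * chain_bound e m u) / ?c) = (f (restrict u I) * indicator {u. chain s e m u} u *
             ennreal (exp (\<Sum>k\<le>m. (fold_weight m w k - of_bool (k \<noteq> 0)) * ln (u (e k))))) * ennreal (1 / ?c)"
      using c by (simp only: mult.assoc ennreal_mult'[symmetric] exp_ge_zero less_imp_le divide_nonneg_pos)
  qed
  also have "\<dots> = (\<integral>\<^sup>+u. f (restrict u I) * indicator {u. chain s e m u} u *
             ennreal (exp (\<Sum>k\<le>m. (fold_weight m w k - of_bool (k \<noteq> 0)) * ln (u (e k)))) \<partial>PiM ?J (\<lambda>_. unif01)) * ennreal (1 / ?c)"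
    by (rule nn_integral_multc) (rule P)
  also have "\<dots> = ((\<integral>\<^sup>+u. f u * ennreal (exp ((\<Sum>k\<le>m. fold_weight m w k) * ln (u (e 0)))) \<partial>PiM I (\<lambda>_. unif01))
           * ennreal (\<Prod>k=1..m. 1 / chain_rate m (fold_weight m w) k)) * ennreal (1 / ?c)"
  proof (subst Suc.IH)
    show "inj_on e {..m}" using Suc.prems(1) by (rule inj_on_subset) auto
    show "e k \<notin> I" if "1 \<le> k" "k \<le> m" for k using Suc.prems(2) that by auto
    show "chain_rate m (fold_weight m w) k > 0" if "1 \<le> k" "k \<le> m" for k
      using Suc.prems(3)[of k] that by (simp add: chain_rate_fold_weight)
  qed simp
  also have "(\<Sum>k\<le>m. fold_weight m w k) = (\<Sum>k\<le>Suc m. w k)"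
    by (rule sum_fold_weight_1)
  also have "(\<Prod>k=1..m. 1 / chain_rate m (fold_weight m w) k) = (\<Prod>k=1..m. 1 / chain_rate (Suc m) w k)"
    by (rule prod.cong) (auto simp: chain_rate_fold_weight)
  also have "X * ennreal (\<Prod>k=1..m. 1 / chain_rate (Suc m) w k) * ennreal (1 / ?c)
     = X * ennreal (\<Prod>k=1..Suc m. 1 / chain_rate (Suc m) w k)" for X
  proof -
    have "chain_rate (Suc m) w (Suc m) = ?c" by (simp add: chain_rate_def)
    moreover have "0 \<le> (\<Prod>k=1..m. 1 / chain_rate (Suc m) w k)"
      using Suc.prems(3) by (intro prod_nonneg) (simp add: less_imp_le)
    ultimately show ?thesis
      using c by (simp add: mult.assoc ennreal_mult'[symmetric] del: prod_dividef)
  qed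
  finally show ?case .
qed

section \<open>The integral over one location of the maximum\<close>

definition rateR :: "nat \<Rightarrow> (nat \<Rightarrow> real) \<Rightarrow> nat \<Rightarrow> real" where
  "rateR n w p = (\<Sum>i=p..n. (real i - real p + 1) * w i)"

definition rateL :: "(nat \<Rightarrow> real) \<Rightarrow> nat \<Rightarrow> real" where
  "rateL w p = (\<Sum>i\<le>p. (real p - real i + 1) * w i)"

text \<open>Every coordinate other than \<open>j\<close> contributes the reciprocal of its rate; the
  coordinate at the maximum comes last and has by then collected the total weight.\<close>

definition sector_weight :: "nat \<Rightarrow> (nat \<Rightarrow> real) \<Rightarrow> nat \<Rightarrow> real" where
  "sector_weight n w j = 1 / (\<Sum>i\<le>n. w i) * (\<Prod>p\<in>{j<..n}. 1 / rateR n w p) * (\<Prod>p<j. 1 / rateL w p)"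

text \<open>The right chain starts weakly and the left chain strictly, so \<open>j\<close> is the
  leftmost maximiser.\<close>

definition sector :: "nat \<Rightarrow> nat \<Rightarrow> (nat \<Rightarrow> real) \<Rightarrow> bool" where
  "sector n j u \<longleftrightarrow> chain False (\<lambda>k. j + k) (n - j) u \<and> chain True (\<lambda>k. j - k) j u"

lemma chain_rate_right:
  assumes "1 \<le> k" "k \<le> n - j"
  shows "chain_rate (n - j) (\<lambda>k. if k = 0 then c else w (j + k)) k = rateR n w (j + k)"
  unfolding chain_rate_def rateR_def
  by (rule sum.reindex_bij_witness[where i = "\<lambda>i. i - j" and j = "\<lambda>i. j + i"]) (use assms in auto)

lemma chain_rate_left:
  assumes "1 \<le> k" "k \<le> j"
  shows "chain_rate j (\<lambda>k. if k = 0 then c else w (j - k)) k = rateL w (j - k)"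
  unfolding chain_rate_def rateL_def
  by (rule sum.reindex_bij_witness[where i = "\<lambda>i. j - i" and j = "\<lambda>i. j - i"]) (use assms in \<open>auto simp: of_nat_diff\<close>)

lemma sum_split_at:
  fixes f :: "nat \<Rightarrow> real"
  assumes "j \<le> n"
  shows "(\<Sum>i\<le>n. f i) = f j + (\<Sum>k=1..n-j. f (j + k)) + (\<Sum>k=1..j. f (j - k))"
proof -
  have "(\<Sum>k=1..n-j. f (j + k)) = (\<Sum>i\<in>{j<..n}. f i)"
    by (rule sum.reindex_bij_witness[where i = "\<lambda>i. i - j" and j = "\<lambda>i. j + i"]) auto
  moreover have "(\<Sum>k=1..j. f (j - k)) = (\<Sum>i<j. f i)"
    by (rule sum.reindex_bij_witness[where i = "\<lambda>i. j - i" and j = "\<lambda>i. j - i"]) auto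
  moreover have "{..n} = insert j ({j<..n} \<union> {..<j})" using assms by auto
  moreover have "sum f (insert j ({j<..n} \<union> {..<j})) = f j + (sum f {j<..n} + sum f {..<j})"
    by (subst sum.insert) (auto intro!: sum.union_disjoint)
  ultimately show ?thesis by simp
qed

lemma atMost_eq_insert_0: "{..m} = insert 0 {1..m::nat}"
  by auto

text \<open>The right chain is integrated first, with everything at or left of \<open>j\<close> as
  passive factor, then the left chain, and finally coordinate \<open>j\<close>, whose exponent has
  become the sum of all weights minus one.\<close>

lemma sector_integral:
  assumes j: "j \<le> n" and S: "(\<Sum>i\<le>n. w i) > 0"
    and R: "\<And>p. j < p \<Longrightarrow> p \<le> n \<Longrightarrow> rateR n w p > 0" and L: "\<And>p. p < j \<Longrightarrow> rateL w p > 0"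
  shows "(\<integral>\<^sup>+u. indicator {u. sector n j u} u * ennreal (exp (\<Sum>i\<le>n. (w i - 1) * ln (u i))) \<partial>PiM {..n} (\<lambda>_. unif01))
     = ennreal (sector_weight n w j)"
proof -
  let ?M = "\<lambda>I. PiM I (\<lambda>_::nat. unif01)"
  let ?e = "\<lambda>k. j + k" and ?e' = "\<lambda>k. j - k"
  \<comment> \<open>The exponent \<open>w j - 1\<close> of the maximum is kept in \<open>f1\<close>,
    so the right chain starts with weight \<open>0\<close>. What it hands back to coordinate
    \<open>j\<close> enters the start weight of the left chain.\<close>
  define wR where "wR = (\<lambda>k. if k = 0 then 0 else w (j + k))"
  define wL where "wL = (\<lambda>k. if k = 0 then (\<Sum>k\<le>n-j. wR k) + (w j - 1) else w (j - k))"
  \<comment> \<open>Equal to \<open>1\<close> almost everywhere; it supplies the vanishing for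
    positive \<open>ln (u j)\<close> that \<open>chain_integral\<close> asks for.\<close>
  define f0 :: "(nat \<Rightarrow> real) \<Rightarrow> ennreal" where "f0 = indicator {u. ln (u j) \<le> 0}"
  define f1 where "f1 = (\<lambda>u. f0 (restrict u {j}) * indicator {u. chain True ?e' j u} u *
     ennreal (exp (\<Sum>k\<le>j. ((if k = 0 then w j - 1 else w (j - k)) - of_bool (k \<noteq> 0)) * ln (u (?e' k)))))"
  have f0 [measurable]: "f0 \<in> borel_measurable (?M {j})"
    unfolding f0_def by measurable
  have f1: "f1 \<in> borel_measurable (?M {..j})"
    unfolding f1_def using f0 by (intro measurable_chain_integrand) auto
  have sets_J: "{..j} \<union> ?e ` {1..n - j} = {..n}"
  proof -
    have "i \<in> ?e ` {1..n - j}" if "i \<le> n" "\<not> i \<le> j" for i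
      using that by (intro image_eqI[of _ _ "i - j"]) auto
    then show ?thesis using j by auto
  qed
  have sets_J': "{j} \<union> ?e' ` {1..j} = {..j}"
  proof -
    have "?e' ` {1..j} = {..<j}"
    proof (intro equalityI subsetI)
      fix i assume "i \<in> {..<j}"
      then show "i \<in> ?e' ` {1..j}"
        by (intro image_eqI[of _ _ "j - i"]) auto
    qed auto
    moreover have "{j} \<union> {..<j} = {..j}" by auto
    ultimately show ?thesis by simp
  qed
  have sumL: "(\<Sum>k\<le>j. wL k) = (\<Sum>i\<le>n. w i) - 1"
    using sum_split_at[OF j, of w]
    unfolding wL_def wR_def atMost_eq_insert_0[of j] atMost_eq_insert_0[of "n-j"] by simp
  have "AE u in ?M {..n}. ln (u j) \<le> 0"
  proof (rule AE_PiM_component)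
    show "j \<in> {..n}" using j by simp
    have "AE x in lborel. x \<in> {0<..<1} \<longrightarrow> ln x \<le> (0::real)" by auto
    then show "AE x in unif01. ln x \<le> 0" by (subst AE_uniform_measure) auto
  qed (rule prob_space_unif01)
  then have "(\<integral>\<^sup>+u. indicator {u. sector n j u} u * ennreal (exp (\<Sum>i\<le>n. (w i - 1) * ln (u i))) \<partial>?M {..n})
     = (\<integral>\<^sup>+u. f1 (restrict u {..j}) * indicator {u. chain False ?e (n - j) u} u *
           ennreal (exp (\<Sum>k\<le>n-j. (wR k - of_bool (k \<noteq> 0)) * ln (u (?e k)))) \<partial>?M {..n})"
  proof (intro nn_integral_cong_AE, eventually_elim)
    fix u :: "nat \<Rightarrow> real" assume u: "ln (u j) \<le> 0"
    have f0u: "f0 (restrict (restrict u {..j}) {j}) = 1"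
      using u by (simp add: f0_def)
    have ch: "chain True ?e' j (restrict u {..j}) = chain True ?e' j u"
      by (rule chain_cong) auto
    have rs: "restrict u {..j} (j - k) = u (j - k)" for k by simp
    have sm: "(\<Sum>k\<le>j. ((if k = 0 then w j - 1 else w (j - k)) - of_bool (k \<noteq> 0)) * ln (restrict u {..j} (?e' k)))
       + (\<Sum>k\<le>n-j. (wR k - of_bool (k \<noteq> 0)) * ln (u (?e k))) = (\<Sum>i\<le>n. (w i - 1) * ln (u i))"
      using sum_split_at[OF j, of "\<lambda>i. (w i - 1) * ln (u i)"]
      unfolding rs unfolding wR_def atMost_eq_insert_0[of j] atMost_eq_insert_0[of "n-j"] by simp
    show "indicator {u. sector n j u} u * ennreal (exp (\<Sum>i\<le>n. (w i - 1) * ln (u i)))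
      = f1 (restrict u {..j}) * indicator {u. chain False ?e (n - j) u} u *
           ennreal (exp (\<Sum>k\<le>n-j. (wR k - of_bool (k \<noteq> 0)) * ln (u (?e k))))"
      unfolding f1_def f0u sm[symmetric] exp_add
      by (auto simp: indicator_def ch sector_def ennreal_mult' simp del: restrict_apply)
  qed
  also have "\<dots> = (\<integral>\<^sup>+u. f1 u * ennreal (exp ((\<Sum>k\<le>n-j. wR k) * ln (u (?e 0)))) \<partial>?M {..j})
           * ennreal (\<Prod>k=1..n-j. 1 / chain_rate (n-j) wR k)"
  proof (subst sets_J[symmetric], rule chain_integral)
    fix u :: "nat \<Rightarrow> real" assume "0 < ln (u (j + 0))"
    then show "f1 u = 0" by (simp add: f1_def f0_def)
  next
    fix k assume "1 \<le> k" "k \<le> n - j"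
    then show "chain_rate (n - j) wR k > 0"
      using R[of "j + k"] j by (simp add: wR_def chain_rate_right)
  qed (auto intro: f1 inj_onI)
  also have "(\<integral>\<^sup>+u. f1 u * ennreal (exp ((\<Sum>k\<le>n-j. wR k) * ln (u (?e 0)))) \<partial>?M {..j})
      = (\<integral>\<^sup>+u. f0 (restrict u {j}) * indicator {u. chain True ?e' j u} u *
           ennreal (exp (\<Sum>k\<le>j. (wL k - of_bool (k \<noteq> 0)) * ln (u (?e' k)))) \<partial>?M {..j})"
  proof (rule nn_integral_cong)
    fix u :: "nat \<Rightarrow> real"
    have sm: "(\<Sum>k\<le>j. (wL k - of_bool (k \<noteq> 0)) * ln (u (?e' k)))
      = (\<Sum>k\<le>j. ((if k = 0 then w j - 1 else w (j - k)) - of_bool (k \<noteq> 0)) * ln (u (?e' k)))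
       + (\<Sum>k\<le>n-j. wR k) * ln (u (?e 0))"
      unfolding wL_def atMost_eq_insert_0[of j] by (simp add: algebra_simps)
    show "f1 u * ennreal (exp ((\<Sum>k\<le>n-j. wR k) * ln (u (?e 0)))) = f0 (restrict u {j}) * indicator {u. chain True ?e' j u} u *
           ennreal (exp (\<Sum>k\<le>j. (wL k - of_bool (k \<noteq> 0)) * ln (u (?e' k))))"
      unfolding sm exp_add f1_def by (simp only: ennreal_mult' exp_ge_zero mult.assoc)
  qed
  also have "\<dots> = (\<integral>\<^sup>+u. f0 u * ennreal (exp ((\<Sum>k\<le>j. wL k) * ln (u (?e' 0)))) \<partial>?M {j})
           * ennreal (\<Prod>k=1..j. 1 / chain_rate j wL k)"
  proof (subst sets_J'[symmetric], rule chain_integral)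
    show "f0 \<in> borel_measurable (?M {j})" by (rule f0)
    fix u :: "nat \<Rightarrow> real" assume "0 < ln (u (j - 0))"
    then show "f0 u = 0" by (simp add: f0_def)
  next
    fix k assume "1 \<le> k" "k \<le> j"
    then show "chain_rate j wL k > 0"
      using L[of "j - k"] by (simp add: wL_def chain_rate_left)
  qed (auto intro!: inj_onI)
  also have "(\<integral>\<^sup>+u. f0 u * ennreal (exp ((\<Sum>k\<le>j. wL k) * ln (u (?e' 0)))) \<partial>?M {j})
     = (\<integral>\<^sup>+u. (\<lambda>y. ennreal (exp (((\<Sum>i\<le>n. w i) - 1) * ln y)) *
            indicator {y. if False then ln y < 0 else ln y \<le> 0} y) (u j) \<partial>?M {j})"
    unfolding sumL by (auto intro!: nn_integral_cong simp: f0_def indicator_def)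
  also have "\<dots> = (\<integral>\<^sup>+y. ennreal (exp (((\<Sum>i\<le>n. w i) - 1) * ln y)) *
            indicator {y. if False then ln y < 0 else ln y \<le> 0} y \<partial>unif01)"
    by (rule unif01.product_nn_integral_singleton) measurable
  also have "\<dots> = ennreal (1 / (\<Sum>i\<le>n. w i))"
    using S by (subst nn_integral_unif01_powr) auto
  also have "(\<Prod>k=1..j. 1 / chain_rate j wL k) = (\<Prod>p<j. 1 / rateL w p)"
    by (rule prod.reindex_bij_witness[where i = "\<lambda>i. j - i" and j = "\<lambda>i. j - i"]) (auto simp: wL_def chain_rate_left)
  also have "(\<Prod>k=1..n-j. 1 / chain_rate (n-j) wR k) = (\<Prod>p\<in>{j<..n}. 1 / rateR n w p)"
    by (rule prod.reindex_bij_witness[where i = "\<lambda>i. i - j" and j = "\<lambda>i. j + i"]) (auto simp: wR_def chain_rate_right)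
  also have "ennreal (1 / (\<Sum>i\<le>n. w i)) * ennreal (\<Prod>p<j. 1 / rateL w p) * ennreal (\<Prod>p\<in>{j<..n}. 1 / rateR n w p)
     = ennreal (sector_weight n w j)"
  proof -
    have "0 \<le> (\<Prod>p<j. 1 / rateL w p)" "0 \<le> (\<Prod>p\<in>{j<..n}. 1 / rateR n w p)"
      using R L by (auto intro!: less_imp_le[OF prod_pos] simp del: prod_dividef)
    then show ?thesis
      using S by (simp add: sector_weight_def ennreal_mult'[symmetric] mult_ac del: prod_dividef)
  qed
  finally show ?thesis .
qed

section \<open>Splitting the log-concave event by the location of the maximum\<close>

definition first_descent :: "nat \<Rightarrow> (nat \<Rightarrow> real) \<Rightarrow> nat" where
  "first_descent n u = (LEAST j. j = n \<or> ln (u (Suc j)) \<le> ln (u j))"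

lemma chain_right_iff:
  assumes "j \<le> n"
  shows "chain False (\<lambda>k. j + k) (n - j) u \<longleftrightarrow> (j < n \<longrightarrow> ln (u (Suc j)) \<le> ln (u j)) \<and>
     (\<forall>i. j < i \<and> i < n \<longrightarrow> ln (u (i - 1)) + ln (u (Suc i)) \<le> 2 * ln (u i))"
proof -
  have "chain False (\<lambda>k. j + k) (n - j) u \<longleftrightarrow> (\<forall>i. j \<le> i \<and> i < n \<longrightarrow>
      ln (u (Suc i)) \<le> (if i = j then ln (u j) else 2 * ln (u i) - ln (u (i - 1))))" (is "?l \<longleftrightarrow> ?r")
  proof
    assume l: ?l
    show ?r
    proof (intro allI impI)
      fix i assume "j \<le> i \<and> i < n"
      then show "ln (u (Suc i)) \<le> (if i = j then ln (u j) else 2 * ln (u i) - ln (u (i - 1)))"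
        using l[unfolded chain_def, rule_format, of "i - j"] by (auto simp: chain_bound_def split: if_splits)
    qed
  next
    assume r: ?r
    show ?l unfolding chain_def
    proof (intro allI impI)
      fix k assume "k < n - j"
      then show "if False \<and> k = 0 then ln (u (j + Suc k)) < chain_bound ((+) j) k u
           else ln (u (j + Suc k)) \<le> chain_bound ((+) j) k u"
        using r[rule_format, of "j + k"] by (auto simp: chain_bound_def)
    qed
  qed
  also have "\<dots> \<longleftrightarrow> (j < n \<longrightarrow> ln (u (Suc j)) \<le> ln (u j)) \<and>
     (\<forall>i. j < i \<and> i < n \<longrightarrow> ln (u (i - 1)) + ln (u (Suc i)) \<le> 2 * ln (u i))"
    (is "_ \<longleftrightarrow> ?r1 \<and> ?r2")
  proof
    assume r: ?r
    have ?r1 using r[rule_format, of j] by simp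
    moreover have ?r2
    proof (intro allI impI)
      fix i assume "j < i \<and> i < n"
      then show "ln (u (i - 1)) + ln (u (Suc i)) \<le> 2 * ln (u i)" using r[rule_format, of i] by simp
    qed
    ultimately show "?r1 \<and> ?r2" by blast
  next
    assume r: "?r1 \<and> ?r2"
    show ?r
    proof (intro allI impI)
      fix i assume i: "j \<le> i \<and> i < n"
      show "ln (u (Suc i)) \<le> (if i = j then ln (u j) else 2 * ln (u i) - ln (u (i - 1)))"
      proof (cases "i = j")
        case False
        then show ?thesis using i r[THEN conjunct2, rule_format, of i] by simp
      qed (use r i in simp)
    qed
  qed
  finally show ?thesis .
qed

lemma chain_left_iff:
  "chain True (\<lambda>k. j - k) j u \<longleftrightarrow> (0 < j \<longrightarrow> ln (u (j - 1)) < ln (u j)) \<and>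
     (\<forall>i. 0 < i \<and> i < j \<longrightarrow> ln (u (i - 1)) + ln (u (Suc i)) \<le> 2 * ln (u i))"
  (is "?l \<longleftrightarrow> ?r1 \<and> ?r2")
proof
  assume l: ?l
  show "?r1 \<and> ?r2"
  proof (intro conjI allI impI)
    assume "0 < j"
    then show "ln (u (j - 1)) < ln (u j)"
      using l[unfolded chain_def, rule_format, of 0] by (simp add: chain_bound_def)
  next
    fix i assume "0 < i \<and> i < j"
    moreover have "j - Suc (j - i) = i - 1" "j - (j - Suc i) = Suc i" if "0 < i" "i < j" using that by auto
    ultimately show "ln (u (i - 1)) + ln (u (Suc i)) \<le> 2 * ln (u i)"
      using l[unfolded chain_def, rule_format, of "j - i"] by (auto simp: chain_bound_def split: if_splits)
  qed
next
  assume r: "?r1 \<and> ?r2"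
  show ?l unfolding chain_def
  proof (intro allI impI)
    fix k assume k: "k < j"
    show "if True \<and> k = 0 then ln (u (j - Suc k)) < chain_bound ((-) j) k u
           else ln (u (j - Suc k)) \<le> chain_bound ((-) j) k u"
    proof (cases "k = 0")
      case True
      then show ?thesis using r k by (auto simp: chain_bound_def)
    next
      case False
      then have "j - k - 1 = j - Suc k" "Suc (j - k) = j - (k - 1)" using k by auto
      then show ?thesis using r[THEN conjunct2, rule_format, of "j - k"] k False
        by (auto simp: chain_bound_def)
    qed
  qed
qed

text \<open>A concave sequence rises strictly up to its first descent and never rises afterwards.
  Hence the sectors are disjoint and cover the log-concave event.\<close>

lemma sector_iff:
  assumes j: "j \<le> n"
  shows "sector n j u \<longleftrightarrow> (\<forall>i. 0 < i \<and> i < n \<longrightarrow> ln (u (i - 1)) + ln (u (Suc i)) \<le> 2 * ln (u i)) \<and> j = first_descent n u"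
    (is "?l \<longleftrightarrow> ?c \<and> ?f")
proof
  assume "?c \<and> ?f"
  then have c: ?c and f: ?f by auto
  have 1: "j = n \<or> ln (u (Suc j)) \<le> ln (u j)"
    unfolding f first_descent_def by (rule LeastI[of _ n]) simp
  have 2: "i \<noteq> n \<and> ln (u (Suc i)) > ln (u i)" if "i < j" for i
    using not_less_Least[of i "\<lambda>j. j = n \<or> ln (u (Suc j)) \<le> ln (u j)"] that
    unfolding f first_descent_def by auto
  show ?l
    unfolding sector_def chain_right_iff[OF j] chain_left_iff
    using 1 2[of "j - 1"] c j by auto
next
  assume ?l
  then have l: "j < n \<Longrightarrow> ln (u (Suc j)) \<le> ln (u j)"
     "\<And>i. j < i \<Longrightarrow> i < n \<Longrightarrow> ln (u (i - 1)) + ln (u (Suc i)) \<le> 2 * ln (u i)"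
     "0 < j \<Longrightarrow> ln (u (j - 1)) < ln (u j)"
     "\<And>i. 0 < i \<Longrightarrow> i < j \<Longrightarrow> ln (u (i - 1)) + ln (u (Suc i)) \<le> 2 * ln (u i)"
    unfolding sector_def chain_right_iff[OF j] chain_left_iff by auto
  have c: ?c
  proof (intro allI impI)
    fix i assume i: "0 < i \<and> i < n"
    consider "i < j" | "i = j" | "j < i" by linarith
    then show "ln (u (i - 1)) + ln (u (Suc i)) \<le> 2 * ln (u i)"
      using l i by cases fastforce+
  qed
  \<comment> \<open>A strict rise into \<open>j\<close> propagates to the left by concavity, so no
    earlier index is a descent.\<close>
  have inc: "k < j \<Longrightarrow> ln (u (j - Suc k)) < ln (u (j - k))" for k
  proof (induction k)
    case 0
    then show ?case using l(3) by simp
  next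
    case (Suc k)
    have "j - Suc k - 1 = j - Suc (Suc k)" "Suc (j - Suc k) = j - k" using Suc.prems by auto
    then show ?case using Suc.IH Suc.prems l(4)[of "j - Suc k"] by auto
  qed
  have "first_descent n u = j"
    unfolding first_descent_def
  proof (rule Least_equality)
    show "j = n \<or> ln (u (Suc j)) \<le> ln (u j)" using l(1) j by (cases "j < n") auto
    fix i assume i: "i = n \<or> ln (u (Suc i)) \<le> ln (u i)"
    show "j \<le> i"
    proof (rule ccontr)
      assume "\<not> j \<le> i"
      moreover have "j - Suc (j - Suc i) = i" "j - (j - Suc i) = Suc i" if "i < j" using that by auto
      ultimately show False using inc[of "j - Suc i"] i j by auto
    qed
  qed
  with c show "?c \<and> ?f" by simp
qed

lemma first_descent_le: "first_descent n u \<le> n"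
  unfolding first_descent_def by (rule Least_le) simp

lemma AE_iid_uniform: "AE u in iid_uniform n. \<forall>i\<le>n. 0 < u i \<and> u i < 1"
proof -
  have "AE u in iid_uniform n. \<forall>i\<in>{..n}. 0 < u i \<and> u i < 1"
    unfolding iid_uniform_def
  proof (rule AE_finite_allI)
    fix i :: nat assume i: "i \<in> {..n}"
    have "AE x in unif01. 0 < x \<and> x < (1::real)" by (subst AE_uniform_measure) auto
    then show "AE u in PiM {..n} (\<lambda>_. unif01). 0 < u i \<and> u i < 1"
      using i by (intro AE_PiM_component prob_space_unif01) auto
  qed simp
  then show ?thesis by auto
qed

lemma log_concave_event_iff:
  assumes "u \<in> space (iid_uniform n)" "\<forall>i\<le>n. 0 < u i \<and> u i < 1"
  shows "u \<in> log_concave_event n \<longleftrightarrow> (\<forall>i. 0 < i \<and> i < n \<longrightarrow> ln (u (i - 1)) + ln (u (Suc i)) \<le> 2 * ln (u i))"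
proof -
  have "u (i - 1) * u (i + 1) \<le> (u i)\<^sup>2 \<longleftrightarrow> ln (u (i - 1)) + ln (u (Suc i)) \<le> 2 * ln (u i)"
    if "0 < i" "i < n" for i
  proof -
    have *: "0 < u (i - 1)" "0 < u (Suc i)" "0 < u i"
      using assms(2) that by auto
    have "u (i - 1) * u (i + 1) \<le> (u i)\<^sup>2 \<longleftrightarrow> ln (u (i - 1) * u (i + 1)) \<le> ln ((u i)\<^sup>2)"
      using * by (subst ln_le_cancel_iff) auto
    then show ?thesis using * by (simp add: ln_mult_pos ln_realpow)
  qed
  then show ?thesis using assms(1) by (auto simp: log_concave_event_def)
qed

lemma measurable_iid_component:
  "i \<le> n \<Longrightarrow> (\<lambda>u. u i) \<in> borel_measurable (iid_uniform n)"
  unfolding iid_uniform_def by measurable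

lemma sets_log_concave_event [measurable]: "log_concave_event n \<in> sets (iid_uniform n)"
proof -
  have "log_concave_event n = {u \<in> space (iid_uniform n). \<forall>i\<in>{1..<n}. u (i - 1) * u (i + 1) \<le> (u i)\<^sup>2}"
    by (simp add: log_concave_event_def)
  also have "\<dots> \<in> sets (iid_uniform n)"
  proof (intro sets.sets_Collect_finite_All)
    fix i assume "i \<in> {1..<n}"
    then show "{u \<in> space (iid_uniform n). u (i - 1) * u (i + 1) \<le> (u i)\<^sup>2} \<in> sets (iid_uniform n)"
      by (intro borel_measurable_le borel_measurable_times borel_measurable_power measurable_iid_component) auto
  qed simp
  finally show ?thesis .
qed

text \<open>A joint Mellin transform of the vector on the log-concave event. The normalising
  constant, the moments of one coordinate and the curvature bounds are all obtained by choosing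
  \<open>w\<close>.\<close>

theorem log_concave_integral:
  assumes S: "(\<Sum>i\<le>n. w i) > 0"
    and R: "\<And>p. 0 < p \<Longrightarrow> p \<le> n \<Longrightarrow> rateR n w p > 0" and L: "\<And>p. p < n \<Longrightarrow> rateL w p > 0"
  shows "(\<integral>\<^sup>+u. indicator (log_concave_event n) u * ennreal (exp (\<Sum>i\<le>n. (w i - 1) * ln (u i))) \<partial>iid_uniform n)
     = ennreal (\<Sum>j\<le>n. sector_weight n w j)"
proof -
  let ?g = "\<lambda>u::nat \<Rightarrow> real. ennreal (exp (\<Sum>i\<le>n. (w i - 1) * ln (u i)))"
  have "(\<integral>\<^sup>+u. indicator (log_concave_event n) u * ?g u \<partial>iid_uniform n)
     = (\<integral>\<^sup>+u. (\<Sum>j\<le>n. indicator {u. sector n j u} u * ?g u) \<partial>iid_uniform n)"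
  proof (rule nn_integral_cong_AE, use AE_iid_uniform AE_space in eventually_elim)
    fix u :: "nat \<Rightarrow> real" assume u: "\<forall>i\<le>n. 0 < u i \<and> u i < 1" "u \<in> space (iid_uniform n)"
    have "(\<Sum>j\<le>n. indicator {u. sector n j u} u * ?g u)
       = (\<Sum>j\<le>n. if j = first_descent n u then indicator (log_concave_event n) u * ?g u else 0)"
      using log_concave_event_iff[OF u(2,1)] by (intro sum.cong) (auto simp: sector_iff indicator_def)
    also have "\<dots> = indicator (log_concave_event n) u * ?g u"
      using first_descent_le[of n u] by (subst sum.delta) auto
    finally show "indicator (log_concave_event n) u * ?g u = (\<Sum>j\<le>n. indicator {u. sector n j u} u * ?g u)" ..
  qed
  also have "\<dots> = (\<Sum>j\<le>n. \<integral>\<^sup>+u. indicator {u. sector n j u} u * ?g u \<partial>iid_uniform n)"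
  proof (rule nn_integral_sum)
    fix j assume j: "j \<in> {..n}"
    have [measurable]: "Measurable.pred (iid_uniform n) (sector n j)"
      unfolding sector_def iid_uniform_def using j
      by (intro pred_intros_logic measurable_chain) auto
    have "(\<lambda>u. \<Sum>i\<le>n. (w i - 1) * ln (u i)) \<in> borel_measurable (iid_uniform n)"
      unfolding iid_uniform_def
      by (intro borel_measurable_sum borel_measurable_times borel_measurable_const measurable_PiM_ln)
    then show "(\<lambda>u. indicator {u. sector n j u} u * ?g u) \<in> borel_measurable (iid_uniform n)"
      by measurable
  qed
  also have "\<dots> = (\<Sum>j\<le>n. ennreal (sector_weight n w j))"
    unfolding iid_uniform_def by (intro sum.cong sector_integral) (auto intro!: S R L)
  also have "\<dots> = ennreal (\<Sum>j\<le>n. sector_weight n w j)"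
  proof (rule sum_ennreal)
    fix j assume "j \<in> {..n}"
    then show "0 \<le> sector_weight n w j"
      using S R L unfolding sector_weight_def
      by (intro mult_nonneg_nonneg less_imp_le[OF prod_pos] ballI) auto
  qed
  finally show ?thesis .
qed

section \<open>The law of the location of the maximum\<close>

lemma rateR_1:
  assumes "p \<le> n"
  shows "rateR n (\<lambda>_. 1) p = (real n - real p + 1) * (real n - real p + 2) / 2"
  using assms
proof (induction n rule: dec_induct)
  case (step n)
  then show ?case by (simp add: rateR_def field_simps)
qed (simp add: rateR_def)

lemma rateL_conv_rateR: "rateL w p = rateR p (\<lambda>i. w (p - i)) 0"
  unfolding rateL_def rateR_def
  by (rule sum.reindex_bij_witness[where i = "\<lambda>i. p - i" and j = "\<lambda>i. p - i"]) (auto simp: of_nat_diff)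

lemma rateL_1: "rateL (\<lambda>_. 1) p = (real p + 1) * (real p + 2) / 2"
  by (simp add: rateL_conv_rateR rateR_1)

lemma rateR_rev: "p \<le> n \<Longrightarrow> rateR n (\<lambda>i. w (n - i)) p = rateL w (n - p)"
  unfolding rateL_def rateR_def
  by (rule sum.reindex_bij_witness[where i = "\<lambda>i. n - i" and j = "\<lambda>i. n - i"]) (auto simp: of_nat_diff)

lemma rateL_rev: "p \<le> n \<Longrightarrow> rateL (\<lambda>i. w (n - i)) p = rateR n w (n - p)"
  unfolding rateL_def rateR_def
  by (rule sum.reindex_bij_witness[where i = "\<lambda>i. n - i" and j = "\<lambda>i. n - i"]) (auto simp: of_nat_diff)

lemma sector_weight_rev:
  assumes "j \<le> n"
  shows "sector_weight n (\<lambda>i. w (n - i)) j = sector_weight n w (n - j)"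
proof -
  have "(\<Sum>i\<le>n. w (n - i)) = (\<Sum>i\<le>n. w i)"
    by (rule sum.reindex_bij_witness[where i = "\<lambda>i. n - i" and j = "\<lambda>i. n - i"]) auto
  moreover have "(\<Prod>p\<in>{j<..n}. 1 / rateR n (\<lambda>i. w (n - i)) p) = (\<Prod>p<n-j. 1 / rateL w p)"
    by (rule prod.reindex_bij_witness[where i = "\<lambda>i. n - i" and j = "\<lambda>i. n - i"]) (auto simp: rateR_rev)
  moreover have "(\<Prod>p<j. 1 / rateL (\<lambda>i. w (n - i)) p) = (\<Prod>p\<in>{n-j<..n}. 1 / rateR n w p)"
    using assms
    by (intro prod.reindex_bij_witness[where i = "\<lambda>i. n - i" and j = "\<lambda>i. n - i"]) (auto simp: rateL_rev)
  ultimately show ?thesis by (simp add: sector_weight_def)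
qed

lemma sum_sector_weight_rev:
  "(\<Sum>j\<le>n. sector_weight n (\<lambda>i. w (n - i)) j) = (\<Sum>j\<le>n. sector_weight n w j)"
proof -
  have "(\<Sum>j\<le>n. sector_weight n (\<lambda>i. w (n - i)) j) = (\<Sum>j\<le>n. sector_weight n w (n - j))"
    by (intro sum.cong) (auto simp: sector_weight_rev)
  also have "\<dots> = (\<Sum>j\<le>n. sector_weight n w j)"
    by (rule sum.reindex_bij_witness[where i = "\<lambda>i. n - i" and j = "\<lambda>i. n - i"]) auto
  finally show ?thesis .
qed

abbreviation argmax_weight :: "nat \<Rightarrow> nat \<Rightarrow> real" where
  "argmax_weight n j \<equiv> sector_weight n (\<lambda>_. 1) j"

definition total_weight :: "nat \<Rightarrow> real" where
  "total_weight n = (\<Sum>j\<le>n. argmax_weight n j)"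

lemma rateR_1_pos: "p \<le> n \<Longrightarrow> rateR n (\<lambda>_. 1) p > 0"
  by (simp add: rateR_1)

lemma rateL_1_pos: "rateL (\<lambda>_. 1) p > 0"
  by (simp add: rateL_1)

lemma argmax_weight_pos: "argmax_weight n j > 0"
  unfolding sector_weight_def by (intro mult_pos_pos prod_pos) (auto simp: rateR_1_pos rateL_1_pos)

lemma total_weight_pos: "total_weight n > 0"
  unfolding total_weight_def by (intro sum_pos) (auto simp: argmax_weight_pos)

text \<open>Passing from \<open>j\<close> to \<open>j + 1\<close> drops one right rate and adds one
  left rate, both triangular numbers. The recursion makes the weights proportional to
  \<open>(n choose j) * ((n + 2) choose (j + 1))\<close>.\<close>

lemma argmax_weight_Suc:
  assumes "j < n"
  shows "argmax_weight n (Suc j) * ((real j + 1) * (real j + 2)) = argmax_weight n j * ((real n - real j) * (real n - real j + 1))"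
proof -
  have eq: "{j<..n} = insert (Suc j) {Suc j<..n}" using assms by auto
  have R: "(\<Prod>p\<in>{j<..n}. 1 / rateR n (\<lambda>_. 1) p) = 1 / rateR n (\<lambda>_. 1) (Suc j) * (\<Prod>p\<in>{Suc j<..n}. 1 / rateR n (\<lambda>_. 1) p)"
    unfolding eq by (rule prod.insert) auto
  have L: "(\<Prod>p<Suc j. 1 / rateL (\<lambda>_. 1) p) = (\<Prod>p<j. 1 / rateL (\<lambda>_. 1) p) * (2 / ((real j + 1) * (real j + 2)))"
    by (simp add: rateL_1 del: prod_dividef)
  have r: "rateR n (\<lambda>_. 1) (Suc j) = (real n - real j) * (real n - real j + 1) / 2"
    using assms by (simp add: rateR_1)
  have alg: "S * P * (Q * (2 / b)) * b = S * (1 / (a / 2) * P) * Q * a" if "a > 0" "b > 0" for S P Q a b :: real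
    using that by (simp add: field_simps)
  show ?thesis
    unfolding sector_weight_def R L r using assms by (intro alg) auto
qed

text \<open>Summation by parts through the recursion. The boundary terms vanish because of the
  factor \<open>j\<close> at \<open>0\<close> and the factor \<open>n - j\<close> at
  \<open>n\<close>.\<close>

lemma argmax_weight_shift:
  "(\<Sum>j\<le>n. argmax_weight n j * (real j * (real j + 1) * f j))
     = (\<Sum>j\<le>n. argmax_weight n j * ((real n - real j) * (real n - real j + 1) * f (Suc j)))"
proof -
  have "(\<Sum>j\<le>n. argmax_weight n j * (real j * (real j + 1) * f j))
     = (\<Sum>j<n. argmax_weight n (Suc j) * (real (Suc j) * (real (Suc j) + 1) * f (Suc j)))"
    unfolding lessThan_Suc_atMost[of n, symmetric] by (subst sum.lessThan_Suc_shift) simp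
  also have "\<dots> = (\<Sum>j<n. argmax_weight n j * ((real n - real j) * (real n - real j + 1) * f (Suc j)))"
  proof (rule sum.cong)
    fix j assume "j \<in> {..<n}"
    then have "argmax_weight n (Suc j) * ((real j + 1) * (real j + 2)) * f (Suc j)
        = argmax_weight n j * ((real n - real j) * (real n - real j + 1)) * f (Suc j)"
      by (simp add: argmax_weight_Suc)
    then show "argmax_weight n (Suc j) * (real (Suc j) * (real (Suc j) + 1) * f (Suc j))
        = argmax_weight n j * ((real n - real j) * (real n - real j + 1) * f (Suc j))"
      by (simp add: algebra_simps)
  qed simp
  also have "\<dots> = (\<Sum>j\<le>n. argmax_weight n j * ((real n - real j) * (real n - real j + 1) * f (Suc j)))"
    unfolding lessThan_Suc_atMost[of n, symmetric] by simp
  finally show ?thesis .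
qed

text \<open>The shift identity with \<open>f = 1\<close> gives the mean \<open>n / 2\<close>. With
  \<open>f j = j\<close> the cubic terms cancel, and the remaining quadratic relation determines the
  variance without evaluating the normalising constant.\<close>

lemma argmax_variance:
  "(\<Sum>j\<le>n. argmax_weight n j * (real j - real n / 2)\<^sup>2) = (real n / 2 + 1) * (real n / 2) / (2 * real n + 1) * total_weight n"
proof -
  let ?S = "\<lambda>f. \<Sum>j\<le>n. argmax_weight n j * f j"
  have A: "?S (\<lambda>j. (real n + 1) * (2 * real j - real n)) = 0"
  proof -
    have "?S (\<lambda>j. (real n + 1) * (2 * real j - real n)) = ?S (\<lambda>j. real j * (real j + 1) * 1)
        - ?S (\<lambda>j. (real n - real j) * (real n - real j + 1) * 1)"
      unfolding sum_subtractf[symmetric] by (rule sum.cong) (simp_all add: algebra_simps)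
    then show ?thesis using argmax_weight_shift[of n "\<lambda>_. 1"] by simp
  qed
  have B: "?S (\<lambda>j. (real j + 1) * ((2 * real n + 1) * real j - real n * (real n + 1))) = 0"
  proof -
    have "?S (\<lambda>j. (real j + 1) * ((2 * real n + 1) * real j - real n * (real n + 1))) = ?S (\<lambda>j. real j * (real j + 1) * real j)
        - ?S (\<lambda>j. (real n - real j) * (real n - real j + 1) * real (Suc j))"
      unfolding sum_subtractf[symmetric] by (rule sum.cong) (simp_all add: algebra_simps)
    then show ?thesis using argmax_weight_shift[of n "\<lambda>j. real j"] by simp
  qed
  have A': "?S (\<lambda>j. 2 * real j - real n) = 0"
  proof -
    have "(real n + 1) * ?S (\<lambda>j. 2 * real j - real n) = 0"
      unfolding A[symmetric] sum_distrib_left by (rule sum.cong) (simp_all add: algebra_simps)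
    then show ?thesis by simp
  qed
  have "(2 * real n + 1) * ?S (\<lambda>j. (real j - real n / 2)\<^sup>2)
     = ?S (\<lambda>j. (real j + 1) * ((2 * real n + 1) * real j - real n * (real n + 1)))
       - ((2 * real n + 1) * real n + (2 * real n + 1) - real n * (real n + 1)) / 2 * ?S (\<lambda>j. 2 * real j - real n)
       + (real n / 2 + 1) * (real n / 2) * total_weight n"
    unfolding total_weight_def sum_distrib_left sum_subtractf[symmetric] sum.distrib[symmetric]
    by (rule sum.cong) (auto simp: power2_eq_square field_simps)
  also have "\<dots> = (real n / 2 + 1) * (real n / 2) * total_weight n"
    unfolding A' B by simp
  finally have eq: "(2 * real n + 1) * ?S (\<lambda>j. (real j - real n / 2)\<^sup>2) = (real n / 2 + 1) * (real n / 2) * total_weight n" by simp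
  have alg: "x = b / c * d" if "c * x = b * d" "c > 0" for b c d x :: real
    using that by (simp add: field_simps)
  show ?thesis by (rule alg[OF eq]) simp
qed

text \<open>Chebyshev's inequality, with the variance bounded by \<open>(n + 2) / 8\<close>.\<close>

lemma argmax_tail:
  assumes "a > 0"
  shows "(\<Sum>j | j \<le> n \<and> \<bar>real j - n / 2\<bar> \<ge> a. argmax_weight n j) \<le> (n + 2) / (8 * a\<^sup>2) * total_weight n"
proof -
  have "a\<^sup>2 * (\<Sum>j | j \<le> n \<and> \<bar>real j - n / 2\<bar> \<ge> a. argmax_weight n j)
     \<le> (\<Sum>j | j \<le> n \<and> \<bar>real j - n / 2\<bar> \<ge> a. argmax_weight n j * (real j - n / 2)\<^sup>2)"
    unfolding sum_distrib_left
  proof (rule sum_mono)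
    fix j assume "j \<in> {j. j \<le> n \<and> \<bar>real j - n / 2\<bar> \<ge> a}"
    then have "a\<^sup>2 \<le> (real j - n / 2)\<^sup>2"
      using assms by (metis (mono_tags, lifting) less_eq_real_def mem_Collect_eq power2_abs power_mono)
    then show "a\<^sup>2 * argmax_weight n j \<le> argmax_weight n j * (real j - n / 2)\<^sup>2"
      using argmax_weight_pos[of n j] by (simp add: mult.commute)
  qed
  also have "\<dots> \<le> (\<Sum>j\<le>n. argmax_weight n j * (real j - n / 2)\<^sup>2)"
    by (rule sum_mono2) (auto simp: less_imp_le[OF argmax_weight_pos])
  also have "\<dots> = (real n / 2 + 1) * (real n / 2) / (2 * real n + 1) * total_weight n"
    by (rule argmax_variance)
  also have "\<dots> \<le> (n + 2) / 8 * total_weight n"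
    using total_weight_pos[of n] by (intro mult_right_mono) (auto simp: field_simps)
  finally show ?thesis
    using assms by (simp add: field_simps)
qed

text \<open>For positive rates this is the conditional mean of
  \<open>exp (\<Sum>i\<le>n. (w i - 1) * ln (u i))\<close> given that the maximum is at
  \<open>j\<close>, written as a product of quotients of rates.\<close>

definition weight_ratio :: "nat \<Rightarrow> (nat \<Rightarrow> real) \<Rightarrow> nat \<Rightarrow> real" where
  "weight_ratio n w j = (n + 1) / (\<Sum>i\<le>n. w i) * (\<Prod>p\<in>{j<..n}. rateR n (\<lambda>_. 1) p / rateR n w p)
      * (\<Prod>p<j. rateL (\<lambda>_. 1) p / rateL w p)"

lemma sector_weight_eq: "sector_weight n w j = argmax_weight n j * weight_ratio n w j"
proof -
  have "(\<Prod>p\<in>{j<..n}. 1 / rateR n w p) = (\<Prod>p\<in>{j<..n}. 1 / rateR n (\<lambda>_. 1) p) * (\<Prod>p\<in>{j<..n}. rateR n (\<lambda>_. 1) p / rateR n w p)"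
    unfolding prod.distrib[symmetric] using rateR_1_pos[of _ n] by (intro prod.cong) (auto simp: less_imp_neq[symmetric] less_imp_neq)
  moreover have "(\<Prod>p<j. 1 / rateL w p) = (\<Prod>p<j. 1 / rateL (\<lambda>_. 1) p) * (\<Prod>p<j. rateL (\<lambda>_. 1) p / rateL w p)"
    unfolding prod.distrib[symmetric] using rateL_1_pos by (intro prod.cong) (auto simp: less_imp_neq[symmetric] less_imp_neq)
  ultimately show ?thesis
    by (simp add: sector_weight_def weight_ratio_def divide_simps del: prod_dividef)
qed

section \<open>Moments and the limit shape\<close>

definition cond_law :: "nat \<Rightarrow> (nat \<Rightarrow> real) measure" where
  "cond_law n = uniform_measure (iid_uniform n) (log_concave_event n)"

lemma emeasure_log_concave_event: "emeasure (iid_uniform n) (log_concave_event n) = ennreal (total_weight n)"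
  using log_concave_integral[where n = n and w = "\<lambda>_. 1"]
  by (simp add: total_weight_def rateR_1_pos rateL_1_pos)

lemma prob_space_cond_law: "prob_space (cond_law n)"
  unfolding cond_law_def using total_weight_pos[of n]
  by (intro prob_space_uniform_measure) (auto simp: emeasure_log_concave_event)

lemma sets_cond_law [measurable_cong, simp]: "sets (cond_law n) = sets (iid_uniform n)"
  by (simp add: cond_law_def)

lemma space_cond_law [simp]: "space (cond_law n) = space (iid_uniform n)"
  by (simp add: cond_law_def)

lemma AE_cond_law:
  "AE u in cond_law n. u \<in> log_concave_event n \<and> (\<forall>i\<le>n. 0 < u i \<and> u i < 1)"
  unfolding cond_law_def
  by (rule AE_uniform_measureI) (use AE_iid_uniform[of n] in auto)

lemma cond_law_integral:
  assumes S: "(\<Sum>i\<le>n. 1 + c i) > 0"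
    and R: "\<And>p. 0 < p \<Longrightarrow> p \<le> n \<Longrightarrow> rateR n (\<lambda>i. 1 + c i) p > 0" and L: "\<And>p. p < n \<Longrightarrow> rateL (\<lambda>i. 1 + c i) p > 0"
  shows "(\<integral>\<^sup>+u. ennreal (exp (\<Sum>i\<le>n. c i * ln (u i))) \<partial>cond_law n)
     = ennreal ((\<Sum>j\<le>n. sector_weight n (\<lambda>i. 1 + c i) j) / total_weight n)"
proof -
  have "(\<lambda>u. \<Sum>i\<le>n. c i * ln (u i)) \<in> borel_measurable (iid_uniform n)"
    unfolding iid_uniform_def
    by (intro borel_measurable_sum borel_measurable_times borel_measurable_const measurable_PiM_ln)
  then have "(\<integral>\<^sup>+u. ennreal (exp (\<Sum>i\<le>n. c i * ln (u i))) \<partial>cond_law n)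
    = (\<integral>\<^sup>+u. indicator (log_concave_event n) u * ennreal (exp (\<Sum>i\<le>n. c i * ln (u i))) \<partial>iid_uniform n) / ennreal (total_weight n)"
    unfolding cond_law_def
    by (subst nn_integral_uniform_measure) (auto simp: emeasure_log_concave_event mult.commute)
  also have "\<dots> = ennreal (\<Sum>j\<le>n. sector_weight n (\<lambda>i. 1 + c i) j) / ennreal (total_weight n)"
    using log_concave_integral[where n = n and w = "\<lambda>i. 1 + c i"] S R L by simp
  also have "\<dots> = ennreal ((\<Sum>j\<le>n. sector_weight n (\<lambda>i. 1 + c i) j) / total_weight n)"
  proof (rule divide_ennreal)
    show "0 \<le> (\<Sum>j\<le>n. sector_weight n (\<lambda>i. 1 + c i) j)"
      using S R L unfolding sector_weight_def
      by (intro sum_nonneg mult_nonneg_nonneg less_imp_le[OF prod_pos] ballI) auto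
  qed (rule total_weight_pos)
  finally show ?thesis .
qed

lemma rateR_add: "rateR n (\<lambda>i. 1 + c i) p = rateR n (\<lambda>_. 1) p + rateR n c p"
  by (simp add: rateR_def sum.distrib[symmetric] algebra_simps)

lemma rateL_add: "rateL (\<lambda>i. 1 + c i) p = rateL (\<lambda>_. 1) p + rateL c p"
  by (simp add: rateL_def sum.distrib[symmetric] algebra_simps)

lemma rateR_single:
  "rateR n (\<lambda>k. if k = i then l else 0) p = (if p \<le> i \<and> i \<le> n then (real i - real p + 1) * l else 0)"
proof -
  have "rateR n (\<lambda>k. if k = i then l else 0) p = (\<Sum>k=p..n. if k = i then (real k - real p + 1) * l else 0)"
    unfolding rateR_def by (rule sum.cong) auto
  then show ?thesis by simp
qed

lemma rateL_single:
  "rateL (\<lambda>k. if k = i then l else 0) p = (if i \<le> p then (real p - real i + 1) * l else 0)"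
proof -
  have "rateL (\<lambda>k. if k = i then l else 0) p = (\<Sum>k\<le>p. if k = i then (real p - real k + 1) * l else 0)"
    unfolding rateL_def by (rule sum.cong) auto
  then show ?thesis by simp
qed

text \<open>If the perturbation \<open>c\<close> has nonnegative rates, every factor of the ratio
  lies between \<open>0\<close> and \<open>1\<close>, so the product is bounded by any one of them.
  The entries of \<open>c\<close> themselves may be negative, which the curvature weights
  exploit.\<close>

lemma weight_ratio_bounds:
  assumes S: "(\<Sum>i\<le>n. c i) \<ge> 0" and R: "\<And>p. 0 < p \<Longrightarrow> p \<le> n \<Longrightarrow> rateR n c p \<ge> 0"
    and L: "\<And>p. p < n \<Longrightarrow> rateL c p \<ge> 0" and j: "j \<le> n"
  shows "0 \<le> weight_ratio n (\<lambda>i. 1 + c i) j"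
    and "weight_ratio n (\<lambda>i. 1 + c i) j \<le> 1"
    and "j < p \<Longrightarrow> p \<le> n \<Longrightarrow> weight_ratio n (\<lambda>i. 1 + c i) j \<le> rateR n (\<lambda>_. 1) p / rateR n (\<lambda>i. 1 + c i) p"
    and "p < j \<Longrightarrow> weight_ratio n (\<lambda>i. 1 + c i) j \<le> rateL (\<lambda>_. 1) p / rateL (\<lambda>i. 1 + c i) p"
proof -
  let ?a = "(n + 1) / (\<Sum>i\<le>n. 1 + c i)"
  let ?f = "\<lambda>p. rateR n (\<lambda>_. 1) p / rateR n (\<lambda>i. 1 + c i) p"
  let ?g = "\<lambda>p. rateL (\<lambda>_. 1) p / rateL (\<lambda>i. 1 + c i) p"
  have a: "0 \<le> ?a" "?a \<le> 1" using S by (auto simp: sum.distrib)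
  have f: "0 \<le> ?f p \<and> ?f p \<le> 1" if "0 < p" "p \<le> n" for p
    using R[OF that] rateR_1_pos[OF that(2)] by (auto simp: rateR_add)
  have g: "0 \<le> ?g p \<and> ?g p \<le> 1" if "p < n" for p
    using L[OF that] rateL_1_pos[of p] by (auto simp: rateL_add)
  let ?F = "\<Prod>p\<in>{j<..n}. ?f p" and ?G = "\<Prod>p<j. ?g p"
  have F: "0 \<le> ?F" "?F \<le> 1"
    using f by (auto intro!: prod_nonneg prod_le_1 simp del: prod_dividef)
  have G: "0 \<le> ?G" "?G \<le> 1"
    using g j by (auto intro!: prod_nonneg prod_le_1 simp del: prod_dividef)
  have eq: "weight_ratio n (\<lambda>i. 1 + c i) j = ?a * ?F * ?G"
    by (simp only: weight_ratio_def of_nat_add of_nat_1)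
  show "0 \<le> weight_ratio n (\<lambda>i. 1 + c i) j"
    unfolding eq using a F G by (intro mult_nonneg_nonneg)
  have "?a * ?F * ?G \<le> 1 * 1 * 1"
    using a F G by (intro mult_mono mult_nonneg_nonneg) auto
  then show "weight_ratio n (\<lambda>i. 1 + c i) j \<le> 1" unfolding eq by simp
  show "weight_ratio n (\<lambda>i. 1 + c i) j \<le> ?f p" if p: "j < p" "p \<le> n"
  proof -
    have "?F = ?f p * (\<Prod>p\<in>{j<..n} - {p}. ?f p)"
      using p by (intro prod.remove) auto
    moreover have "(\<Prod>p\<in>{j<..n} - {p}. ?f p) \<le> 1"
      using f by (intro prod_le_1) auto
    moreover have "0 \<le> ?f p" using f[of p] p by auto
    ultimately have "?F \<le> ?f p * 1"
      by (simp only: mult_left_mono)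
    moreover have "?a * ?F * ?G \<le> 1 * ?F * 1"
      using a F G by (intro mult_mono mult_nonneg_nonneg) auto
    ultimately show ?thesis unfolding eq by simp
  qed
  show "weight_ratio n (\<lambda>i. 1 + c i) j \<le> ?g p" if p: "p < j"
  proof -
    have "?G = ?g p * (\<Prod>p\<in>{..<j} - {p}. ?g p)"
      using p by (intro prod.remove) auto
    moreover have "(\<Prod>p\<in>{..<j} - {p}. ?g p) \<le> 1"
      using g j by (intro prod_le_1) auto
    moreover have "0 \<le> ?g p" using g[of p] p j by auto
    ultimately have "?G \<le> ?g p * 1"
      by (simp only: mult_left_mono)
    moreover have "?a * ?F * ?G \<le> 1 * 1 * ?G"
      using a F G by (intro mult_mono mult_nonneg_nonneg) auto
    ultimately show ?thesis unfolding eq by simp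
  qed
qed

section \<open>Moments of one coordinate\<close>

definition moment :: "nat \<Rightarrow> real \<Rightarrow> nat \<Rightarrow> real" where
  "moment n l i = (\<Sum>j\<le>n. sector_weight n (\<lambda>k. 1 + (if k = i then l else 0)) j) / total_weight n"

lemma moment_rev:
  assumes "i \<le> n"
  shows "moment n l (n - i) = moment n l i"
proof -
  have "(\<Sum>j\<le>n. sector_weight n (\<lambda>k. 1 + (if k = n - i then l else 0)) j)
    = (\<Sum>j\<le>n. sector_weight n (\<lambda>k. 1 + (if n - k = n - i then l else 0)) j)"
    by (rule sum_sector_weight_rev[symmetric])
  also have "\<dots> = (\<Sum>j\<le>n. sector_weight n (\<lambda>k. 1 + (if k = i then l else 0)) j)"
  proof (rule sum.cong)
    fix j assume "j \<in> {..n}"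
    moreover have "(n - k = n - i) = (k = i)" if "k \<le> n" for k using that assms by auto
    ultimately show "sector_weight n (\<lambda>k. 1 + (if n - k = n - i then l else 0)) j
       = sector_weight n (\<lambda>k. 1 + (if k = i then l else 0)) j"
      by (auto simp: sector_weight_def rateR_def rateL_def intro!: arg_cong2[of _ _ _ _ "(*)"] arg_cong2[of _ _ _ _ "(/)"] prod.cong sum.cong)
  qed simp
  finally show ?thesis by (simp add: moment_def)
qed

lemma moment_integral:
  assumes i: "i \<le> n" and l: "l \<ge> 0"
  shows "(\<integral>\<^sup>+u. ennreal (exp (l * ln (u i))) \<partial>cond_law n) = ennreal (moment n l i)"
proof -
  have "(\<integral>\<^sup>+u. ennreal (exp (\<Sum>k\<le>n. (if k = i then l else 0) * ln (u k))) \<partial>cond_law n)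
     = ennreal ((\<Sum>j\<le>n. sector_weight n (\<lambda>k. 1 + (if k = i then l else 0)) j) / total_weight n)"
  proof (rule cond_law_integral)
    show "0 < (\<Sum>k\<le>n. 1 + (if k = i then l else 0))"
      using l by (intro sum_pos) auto
    show "0 < rateR n (\<lambda>k. 1 + (if k = i then l else 0)) p" if "p \<le> n" for p
      using l rateR_1_pos[OF that] by (simp add: rateR_add rateR_single add_pos_nonneg)
    show "0 < rateL (\<lambda>k. 1 + (if k = i then l else 0)) p" for p
      using l rateL_1_pos[of p] by (simp add: rateL_add rateL_single add_pos_nonneg)
  qed
  also have "(\<lambda>u::nat\<Rightarrow>real. \<Sum>k\<le>n. (if k = i then l else 0) * ln (u k)) = (\<lambda>u. l * ln (u i))"
  proof
    fix u :: "nat \<Rightarrow> real"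
    have "(\<Sum>k\<le>n. (if k = i then l else 0) * ln (u k)) = (\<Sum>k\<le>n. if k = i then l * ln (u k) else 0)"
      by (rule sum.cong) auto
    then show "(\<Sum>k\<le>n. (if k = i then l else 0) * ln (u k)) = l * ln (u i)" using i by simp
  qed
  finally show ?thesis by (simp add: moment_def)
qed

text \<open>The right rate at \<open>p\<close> produced by a unit weight at \<open>i\<close>,
  relative to the unperturbed rate at \<open>p\<close>.\<close>

definition drift :: "nat \<Rightarrow> nat \<Rightarrow> nat \<Rightarrow> real" where
  "drift n i p = 2 * (real i - real p + 1) / ((real n - real p + 1) * (real n - real p + 2))"

lemma drift_nonneg: "p \<le> i \<Longrightarrow> i \<le> n \<Longrightarrow> 0 \<le> drift n i p"
  by (auto simp: drift_def intro!: divide_nonneg_nonneg)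

lemma drift_le:
  assumes "p \<le> i" "i < n"
  shows "drift n i p \<le> 2 / (real n - real i)"
proof -
  have "2 * (real i - real p + 1) / ((real n - real p + 1) * (real n - real p + 2))
     \<le> 2 * (real n - real p + 1) / ((real n - real p + 1) * (real n - real p + 2))"
    using assms by (intro divide_right_mono) auto
  also have "\<dots> = 2 / (real n - real p + 2)"
  proof -
    have "2 * a / (a * (a + 1)) = 2 / (a + 1)" if "a > 0" for a :: real
      using that by (simp add: mult.commute[of 2 a])
    from this[of "real n - real p + 1"] show ?thesis using assms by (simp add: add.assoc)
  qed
  also have "\<dots> \<le> 2 / (real n - real i)"
    using assms by (intro divide_left_mono) auto
  finally show ?thesis by (simp add: drift_def)
qed

text \<open>By partial fractions each drift is a combination of \<open>1 / (n - p + 1)\<close> and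
  \<open>1 / (n - p + 2)\<close>; harmonic numbers and one telescoping remainder result.\<close>

lemma sum_drift:
  assumes "j \<le> i" "i \<le> n"
  shows "(\<Sum>p\<in>{j<..i}. drift n i p) = 2 * (harm (n - j) - harm (n - i)) - 2 * (real i - real j) / (real n - real j + 1)"
  using assms
proof (induction j rule: inc_induct)
  case (step j)
  have "{j<..i} = insert (Suc j) {Suc j<..i}" using step by auto
  then have "(\<Sum>p\<in>{j<..i}. drift n i p) = drift n i (Suc j) + (\<Sum>p\<in>{Suc j<..i}. drift n i p)"
    by simp
  also have "\<dots> = drift n i (Suc j) + (2 * (harm (n - Suc j) - harm (n - i)) - 2 * (real i - real (Suc j)) / (real n - real (Suc j) + 1))"
    using step by simp
  also have "harm (n - Suc j) = harm (n - j) - 1 / (real n - real j)"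
  proof -
    have "n - j = Suc (n - Suc j)" using step by simp
    then have "harm (n - j) = harm (n - Suc j) + inverse (real (n - j))" by (metis harm_Suc)
    then show ?thesis using step by (simp add: of_nat_diff divide_inverse)
  qed
  also have "drift n i (Suc j) + (2 * (harm (n - j) - 1 / (real n - real j) - harm (n - i)) - 2 * (real i - real (Suc j)) / (real n - real (Suc j) + 1))
     = 2 * (harm (n - j) - harm (n - i)) - 2 * (real i - real j) / (real n - real j + 1)"
  proof -
    have alg: "2 * d / (a * (a + 1)) + (2 * (X - 1 / a - Y) - 2 * (d - 1) / a) = 2 * (X - Y) - 2 * d / (a + 1)"
      if "a > 0" for a d X Y :: real
      using that by (simp add: divide_simps) (simp add: algebra_simps)
    have d1: "drift n i (Suc j) = 2 * (real i - real j) / ((real n - real j) * (real n - real j + 1))"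
      unfolding drift_def by simp
    have d2: "real n - real (Suc j) + 1 = real n - real j" "real i - real (Suc j) = (real i - real j) - 1"
      by simp_all
    show ?thesis
      unfolding d1 d2 by (rule alg) (use step in simp)
  qed
  finally show ?case .
qed simp

text \<open>Given a maximum at \<open>j \<le> i\<close>, these are the moments for which
  \<open>- ln (u i)\<close> is a sum of independent exponential variables, one of mean
  \<open>drift n i p\<close> for each \<open>j < p \<le> i\<close> and one of mean
  \<open>1 / (n + 1)\<close> for the maximum itself.\<close>

lemma weight_ratio_single:
  assumes "j \<le> i" "i \<le> n" "l \<ge> 0"
  shows "weight_ratio n (\<lambda>k. 1 + (if k = i then l else 0)) j
     = (real n + 1) / (real n + 1 + l) * (\<Prod>p\<in>{j<..i}. 1 / (1 + l * drift n i p))"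
proof -
  let ?w = "\<lambda>k. 1 + (if k = i then l else 0)"
  have "(\<Sum>k\<le>n. ?w k) = real n + 1 + l" using assms by (simp add: sum.distrib)
  moreover have "(\<Prod>p<j. rateL (\<lambda>_. 1) p / rateL ?w p) = 1"
  proof (rule prod.neutral, rule ballI)
    fix p assume "p \<in> {..<j}"
    then show "rateL (\<lambda>_. 1) p / rateL ?w p = 1"
      using assms rateL_1_pos[of p] by (simp add: rateL_add rateL_single)
  qed
  moreover have "(\<Prod>p\<in>{j<..n}. rateR n (\<lambda>_. 1) p / rateR n ?w p) = (\<Prod>p\<in>{j<..i}. 1 / (1 + l * drift n i p))"
  proof (rule prod.mono_neutral_cong_right)
    show "\<forall>p\<in>{j<..n} - {j<..i}. rateR n (\<lambda>_. 1) p / rateR n ?w p = 1"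
      using rateR_1_pos[of _ n] by (auto simp: rateR_add rateR_single less_imp_neq[symmetric] less_imp_neq)
    fix p assume p: "p \<in> {j<..i}"
    have r: "rateR n (\<lambda>_. 1) p > 0" using p assms by (intro rateR_1_pos) auto
    have "rateR n ?w p = rateR n (\<lambda>_. 1) p + (real i - real p + 1) * l"
      using p assms by (simp add: rateR_add rateR_single)
    also have "\<dots> = rateR n (\<lambda>_. 1) p * (1 + l * drift n i p)"
    proof -
      have "n - p \<ge> 0" "p \<le> n" using p assms by auto
      then have "rateR n (\<lambda>_. 1) p * drift n i p = real i - real p + 1"
        by (simp add: rateR_1 drift_def)
      then have "(rateR n (\<lambda>_. 1) p * drift n i p) * l = (real i - real p + 1) * l" by simp
      then show ?thesis by (simp add: distrib_left mult.assoc mult.commute mult.left_commute)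
    qed
    finally show "rateR n (\<lambda>_. 1) p / rateR n ?w p = 1 / (1 + l * drift n i p)"
      using r by simp
  qed (use assms in auto)
  ultimately show ?thesis
    unfolding weight_ratio_def by (simp only: mult_1_right of_nat_add of_nat_1)
qed

text \<open>Locations outside the window are discarded, and inside it
  \<open>1 / (1 + x) \<ge> exp (- x)\<close> is applied. The drift sum is largest when the maximum
  is at the left end \<open>j1\<close>.\<close>

lemma moment_lower:
  assumes i: "i < n" and a: "a > 0" and j1: "j1 \<le> i"
    and good: "\<And>j. j \<le> n \<Longrightarrow> \<bar>real j - n / 2\<bar> < a \<Longrightarrow> j1 \<le> j \<and> j \<le> i"
  shows "moment n 1 i \<ge> (1 - (real n + 2) / (8 * a\<^sup>2)) * ((real n + 1) / (real n + 2) * exp (- (\<Sum>p\<in>{j1<..i}. drift n i p)))"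
proof -
  let ?B = "{j. j \<le> n \<and> \<bar>real j - n / 2\<bar> \<ge> a}" and ?w = "\<lambda>k. 1 + (if k = i then 1 else 0 :: real)"
  let ?G = "{j. j \<le> n \<and> \<bar>real j - n / 2\<bar> < a}"
  let ?x = "(real n + 1) / (real n + 2) * exp (- (\<Sum>p\<in>{j1<..i}. drift n i p))"
  have x: "0 \<le> ?x" by simp
  have GB: "{..n} = ?G \<union> ?B" "?G \<inter> ?B = {}" "finite ?G" "finite ?B" by (auto simp: not_le)
  have h: "?x \<le> weight_ratio n ?w j" if j: "j \<in> ?G" for j
  proof -
    have j': "j1 \<le> j" "j \<le> i" using good j by auto
    have "(\<Sum>p\<in>{j<..i}. drift n i p) \<le> (\<Sum>p\<in>{j1<..i}. drift n i p)"
      using j' i by (intro sum_mono2) (auto intro: drift_nonneg)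
    then have "exp (- (\<Sum>p\<in>{j1<..i}. drift n i p)) \<le> exp (- (\<Sum>p\<in>{j<..i}. drift n i p))"
      by simp
    also have "\<dots> = (\<Prod>p\<in>{j<..i}. exp (- drift n i p))"
      by (simp add: exp_sum sum_negf[symmetric])
    also have "\<dots> \<le> (\<Prod>p\<in>{j<..i}. 1 / (1 + 1 * drift n i p))"
    proof (rule prod_mono)
      fix p assume "p \<in> {j<..i}"
      then have "0 \<le> drift n i p" using i by (intro drift_nonneg) auto
      then have "1 + drift n i p \<le> exp (drift n i p)" "0 < 1 + drift n i p" by auto
      then have "inverse (exp (drift n i p)) \<le> inverse (1 + drift n i p)" by (intro le_imp_inverse_le)
      then show "0 \<le> exp (- drift n i p) \<and> exp (- drift n i p) \<le> 1 / (1 + 1 * drift n i p)"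
        by (simp add: exp_minus inverse_eq_divide)
    qed
    finally show ?thesis
      using weight_ratio_single[of j i n 1] i j' by (simp add: mult_left_mono add.assoc divide_right_mono)
  qed
  have nn: "0 \<le> weight_ratio n ?w j" if "j \<le> n" for j
    by (rule weight_ratio_bounds(1)) (use that i in \<open>auto simp: rateR_single rateL_single\<close>)
  have "(1 - (real n + 2) / (8 * a\<^sup>2)) * total_weight n \<le> total_weight n - (\<Sum>j\<in>?B. argmax_weight n j)"
    using argmax_tail[OF a, of n] by (simp add: algebra_simps)
  also have "\<dots> = (\<Sum>j\<in>?G. argmax_weight n j)"
    unfolding total_weight_def GB(1) using GB by (subst sum.union_disjoint) auto
  finally have "(1 - (real n + 2) / (8 * a\<^sup>2)) * total_weight n * ?x \<le> (\<Sum>j\<in>?G. argmax_weight n j) * ?x"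
    using x by (rule mult_right_mono)
  also have "\<dots> = (\<Sum>j\<in>?G. argmax_weight n j * ?x)"
    by (rule sum_distrib_right)
  also have "\<dots> \<le> (\<Sum>j\<in>?G. argmax_weight n j * weight_ratio n ?w j)"
    using h argmax_weight_pos[of n] by (intro sum_mono mult_left_mono) (auto intro: less_imp_le)
  also have "\<dots> \<le> (\<Sum>j\<le>n. argmax_weight n j * weight_ratio n ?w j)"
    using nn argmax_weight_pos[of n] by (intro sum_mono2) (auto intro!: mult_nonneg_nonneg intro: less_imp_le)
  also have "\<dots> = moment n 1 i * total_weight n"
    unfolding moment_def sector_weight_eq[of n ?w] using total_weight_pos[of n] by simp
  finally have le: "(1 - (real n + 2) / (8 * a\<^sup>2)) * total_weight n * ?x \<le> moment n 1 i * total_weight n" .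
  have alg: "A * x \<le> m" if "A * T * x \<le> m * T" "T > 0" for A T x m :: real
  proof -
    have "(A * x) * T \<le> m * T" using that(1) by (simp add: mult_ac)
    then show ?thesis using that(2) by (simp only: mult_le_cancel_right_pos)
  qed
  show ?thesis by (rule alg[OF le total_weight_pos])
qed

text \<open>The mean square deviation from \<open>y\<close> is small once the second moment is
  bounded above and the first below, so this bound concerns exponent \<open>2\<close> only.
  Locations outside the window contribute at most their probability.\<close>

lemma moment_upper:
  assumes i: "i < n" and a: "a > 0" and j2: "j2 \<le> i" and small: "4 / (real n - real i) \<le> 1"
    and good: "\<And>j. j \<le> n \<Longrightarrow> \<bar>real j - n / 2\<bar> < a \<Longrightarrow> j1 \<le> j \<and> j \<le> j2"
  shows "moment n 2 i \<le> (real n + 2) / (8 * a\<^sup>2) + exp (- 2 * (\<Sum>p\<in>{j2<..i}. drift n i p)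
            + 8 / (real n - real i) * (\<Sum>p\<in>{j1<..i}. drift n i p))"
proof -
  let ?B = "{j. j \<le> n \<and> \<bar>real j - n / 2\<bar> \<ge> a}" and ?w = "\<lambda>k. 1 + (if k = i then 2 else 0 :: real)"
  let ?G = "{j. j \<le> n \<and> \<bar>real j - n / 2\<bar> < a}"
  let ?S = "\<lambda>j. \<Sum>p\<in>{j<..i}. drift n i p"
  let ?x = "exp (- 2 * ?S j2 + 8 / (real n - real i) * ?S j1)"
  have GB: "{..n} = ?G \<union> ?B" "?G \<inter> ?B = {}" "finite ?G" "finite ?B" by (auto simp: not_le)
  have h: "weight_ratio n ?w j \<le> ?x" if j: "j \<in> ?G" for j
  proof -
    have j': "j1 \<le> j" "j \<le> j2" using good j by auto
    have "(\<Prod>p\<in>{j<..i}. 1 / (1 + 2 * drift n i p)) \<le> (\<Prod>p\<in>{j<..i}. exp (- 2 * drift n i p + 8 / (real n - real i) * drift n i p))"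
    proof (rule prod_mono)
      fix p assume p: "p \<in> {j<..i}"
      let ?d = "drift n i p"
      have d: "0 \<le> ?d" "?d \<le> 2 / (real n - real i)" using p i by (auto intro!: drift_nonneg drift_le)
      moreover have "4 / (real n - real i) = 2 * (2 / (real n - real i))" by simp
      ultimately have d1: "2 * ?d \<le> 1" using small by linarith
      \<comment> \<open>The quadratic error in \<open>ln (1 + x) \<ge> x - x^2\<close> becomes the
        small factor \<open>8 / (n - i)\<close> times the drift, so its sum is controlled by the
        drift sum.\<close>
      have "?d * ?d \<le> 2 / (real n - real i) * ?d"
        using d by (intro mult_right_mono)
      then have "2 * ?d - 8 / (real n - real i) * ?d \<le> 2 * ?d - (2 * ?d)\<^sup>2"
        by (simp add: power2_eq_square)
      also have "\<dots> \<le> ln (1 + 2 * ?d)"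
        using d d1 by (intro ln_one_plus_pos_lower_bound) auto
      finally have "exp (2 * ?d - 8 / (real n - real i) * ?d) \<le> 1 + 2 * ?d"
        using d by (simp add: ln_ge_iff)
      then have "inverse (1 + 2 * ?d) \<le> inverse (exp (2 * ?d - 8 / (real n - real i) * ?d))"
        by (rule le_imp_inverse_le) simp
      also have "\<dots> = exp (- 2 * ?d + 8 / (real n - real i) * ?d)"
        by (simp add: exp_minus[symmetric])
      finally show "0 \<le> 1 / (1 + 2 * ?d) \<and> 1 / (1 + 2 * ?d) \<le> exp (- 2 * ?d + 8 / (real n - real i) * ?d)"
        using d by (simp add: inverse_eq_divide)
    qed
    also have "\<dots> = exp (- 2 * ?S j + 8 / (real n - real i) * ?S j)"
      by (simp only: exp_sum[symmetric] finite_greaterThanAtMost sum.distrib sum_distrib_left)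
    also have "\<dots> \<le> ?x"
    proof -
      have "?S j \<le> ?S j1" "?S j2 \<le> ?S j"
        using j' i by (auto intro!: sum_mono2 drift_nonneg)
      then have "8 / (real n - real i) * ?S j \<le> 8 / (real n - real i) * ?S j1"
        using i by (intro mult_left_mono) auto
      then show ?thesis using \<open>?S j2 \<le> ?S j\<close> by simp
    qed
    finally have le: "(\<Prod>p\<in>{j<..i}. 1 / (1 + 2 * drift n i p)) \<le> ?x" .
    have nn: "0 \<le> (\<Prod>p\<in>{j<..i}. 1 / (1 + 2 * drift n i p))"
    proof (rule prod_nonneg)
      fix p assume "p \<in> {j<..i}"
      then have "0 \<le> drift n i p" using i by (intro drift_nonneg) auto
      then show "0 \<le> 1 / (1 + 2 * drift n i p)" by simp
    qed
    have "weight_ratio n ?w j = (real n + 1) / (real n + 1 + 2) * (\<Prod>p\<in>{j<..i}. 1 / (1 + 2 * drift n i p))"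
      using i j' j2 by (intro weight_ratio_single) auto
    also have "\<dots> \<le> 1 * ?x"
      using le nn by (intro mult_mono) auto
    finally show ?thesis by simp
  qed
  have le1: "weight_ratio n ?w j \<le> 1" if "j \<le> n" for j
    by (rule weight_ratio_bounds(2)) (use that i in \<open>auto simp: rateR_single rateL_single\<close>)
  have "moment n 2 i * total_weight n = (\<Sum>j\<le>n. argmax_weight n j * weight_ratio n ?w j)"
    unfolding moment_def sector_weight_eq[of n ?w] using total_weight_pos[of n] by simp
  also have "\<dots> = (\<Sum>j\<in>?G. argmax_weight n j * weight_ratio n ?w j) + (\<Sum>j\<in>?B. argmax_weight n j * weight_ratio n ?w j)"
    unfolding GB(1) using GB by (subst sum.union_disjoint) auto
  also have "\<dots> \<le> (\<Sum>j\<in>?G. argmax_weight n j * ?x) + (\<Sum>j\<in>?B. argmax_weight n j * 1)"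
    using h le1 argmax_weight_pos[of n] by (intro add_mono sum_mono mult_left_mono) (auto intro: less_imp_le)
  finally have m: "moment n 2 i * total_weight n \<le> (\<Sum>j\<in>?G. argmax_weight n j * ?x) + (\<Sum>j\<in>?B. argmax_weight n j * 1)" .
  have "(\<Sum>j\<in>?G. argmax_weight n j * ?x) \<le> (\<Sum>j\<le>n. argmax_weight n j * ?x)"
    using argmax_weight_pos[of n] by (intro sum_mono2) (auto intro!: mult_nonneg_nonneg intro: less_imp_le)
  also have "\<dots> = total_weight n * ?x"
    by (simp only: total_weight_def sum_distrib_right)
  finally have 1: "(\<Sum>j\<in>?G. argmax_weight n j * ?x) \<le> total_weight n * ?x" .
  have 2: "(\<Sum>j\<in>?B. argmax_weight n j * 1) \<le> (real n + 2) / (8 * a\<^sup>2) * total_weight n"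
    using argmax_tail[OF a, of n] by (simp only: mult_1_right)
  have alg: "m \<le> B + x" if "m * T \<le> s1 + s2" "s1 \<le> T * x" "s2 \<le> B * T" "T > 0" for m T s1 s2 x B :: real
  proof -
    have "m * T \<le> (B + x) * T" using that by (simp add: algebra_simps)
    then show ?thesis using that(4) by (simp only: mult_le_cancel_right_pos)
  qed
  show ?thesis by (rule alg[OF m 1 2 total_weight_pos])
qed

section \<open>Limits along indices of asymptotically proportional size\<close>

lemma filterlim_nat_of_ratio:
  fixes a :: "nat \<Rightarrow> nat"
  assumes "(\<lambda>n. real (a n) / real n) \<longlonglongrightarrow> c" "c > 0"
  shows "filterlim a at_top sequentially"
proof -
  have "filterlim (\<lambda>n. real (a n) / real n * real n) at_top sequentially"
    by (rule filterlim_tendsto_pos_mult_at_top[OF assms filterlim_real_sequentially])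
  moreover have "\<forall>\<^sub>F n in sequentially. real (a n) / real n * real n = real (a n)"
    using eventually_gt_at_top[of 0] by eventually_elim simp
  ultimately have "filterlim (\<lambda>n. real (a n)) at_top sequentially"
    by (simp cong: filterlim_cong)
  then show ?thesis
    unfolding filterlim_at_top
  proof (intro allI)
    fix Z assume "\<forall>Z. \<forall>\<^sub>F n in sequentially. Z \<le> real (a n)"
    then have "\<forall>\<^sub>F n in sequentially. real Z \<le> real (a n)" by blast
    then show "\<forall>\<^sub>F n in sequentially. Z \<le> a n" by simp
  qed
qed

text \<open>The Euler-Mascheroni constants cancel in the difference, and the logarithm of the
  quotient of the indices remains.\<close>

lemma harm_diff_limit:
  fixes a b :: "nat \<Rightarrow> nat"
  assumes a: "(\<lambda>n. real (a n) / real n) \<longlonglongrightarrow> c" "c > 0" and b: "(\<lambda>n. real (b n) / real n) \<longlonglongrightarrow> d" "d > 0"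
  shows "(\<lambda>n. harm (a n) - harm (b n)) \<longlonglongrightarrow> ln (c / d)"
proof -
  let ?f = "\<lambda>n. harm n - ln (real n)"
  have fa: "(\<lambda>n. ?f (a n)) \<longlonglongrightarrow> euler_mascheroni" and fb: "(\<lambda>n. ?f (b n)) \<longlonglongrightarrow> euler_mascheroni"
    using filterlim_compose[OF euler_mascheroni_LIMSEQ filterlim_nat_of_ratio[OF a]]
      filterlim_compose[OF euler_mascheroni_LIMSEQ filterlim_nat_of_ratio[OF b]] by simp_all
  have "(\<lambda>n. ln (real (a n) / real n / (real (b n) / real n))) \<longlonglongrightarrow> ln (c / d)"
    using a b by (intro tendsto_ln tendsto_divide) auto
  then have "(\<lambda>n. ?f (a n) - ?f (b n) + ln (real (a n) / real n / (real (b n) / real n))) \<longlonglongrightarrow> euler_mascheroni - euler_mascheroni + ln (c / d)"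
    by (intro tendsto_add[OF tendsto_diff[OF fa fb]])
  moreover have "\<forall>\<^sub>F n in sequentially. ?f (a n) - ?f (b n) + ln (real (a n) / real n / (real (b n) / real n)) = harm (a n) - harm (b n)"
    using eventually_gt_at_top[of 0] filterlim_nat_of_ratio[OF a, unfolded filterlim_at_top, rule_format, of 1]
      filterlim_nat_of_ratio[OF b, unfolded filterlim_at_top, rule_format, of 1]
    by eventually_elim (simp add: ln_div)
  ultimately have "(\<lambda>n. harm (a n) - harm (b n)) \<longlonglongrightarrow> euler_mascheroni - euler_mascheroni + ln (c / d)"
    by (rule Lim_transform_eventually)
  then show ?thesis by simp
qed

lemma sum_drift_limit:
  assumes j: "(\<lambda>n. real (j n) / real n) \<longlonglongrightarrow> s" and i: "(\<lambda>n. real (i n) / real n) \<longlonglongrightarrow> t"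
    and st: "s < 1" "t < 1" and le: "\<forall>\<^sub>F n in sequentially. j n \<le> i n \<and> i n \<le> n"
  shows "(\<lambda>n. \<Sum>p\<in>{j n<..i n}. drift n (i n) p) \<longlonglongrightarrow> 2 * ln ((1 - s) / (1 - t)) - 2 * (t - s) / (1 - s)"
proof -
  have *: "(\<lambda>n. real (n - k n) / real n) \<longlonglongrightarrow> 1 - r" if "(\<lambda>n. real (k n) / real n) \<longlonglongrightarrow> r" "\<forall>\<^sub>F n in sequentially. k n \<le> n" for k :: "nat \<Rightarrow> nat" and r
  proof -
    have "(\<lambda>n. 1 - real (k n) / real n) \<longlonglongrightarrow> 1 - r" by (intro tendsto_intros that)
    moreover have "\<forall>\<^sub>F n in sequentially. 1 - real (k n) / real n = real (n - k n) / real n"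
      using that(2) eventually_gt_at_top[of 0] by eventually_elim (simp add: of_nat_diff diff_divide_distrib)
    ultimately show ?thesis by (simp cong: tendsto_cong)
  qed
  have "(\<lambda>n. harm (n - j n) - harm (n - i n)) \<longlonglongrightarrow> ln ((1 - s) / (1 - t))"
    using st le by (intro harm_diff_limit * i j) (auto elim: eventually_mono)
  moreover have "(\<lambda>n. 2 * (real (i n) / real n - real (j n) / real n) / (1 - real (j n) / real n + 1 / real n))
       \<longlonglongrightarrow> 2 * (t - s) / (1 - s + 0)"
    using st by (intro tendsto_intros i j lim_1_over_n) auto
  ultimately have "(\<lambda>n. 2 * (harm (n - j n) - harm (n - i n)) - 2 * (real (i n) / real n - real (j n) / real n) / (1 - real (j n) / real n + 1 / real n))
      \<longlonglongrightarrow> 2 * ln ((1 - s) / (1 - t)) - 2 * (t - s) / (1 - s + 0)"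
    by (intro tendsto_diff[OF tendsto_mult[OF tendsto_const]])
  moreover have "\<forall>\<^sub>F n in sequentially. 2 * (harm (n - j n) - harm (n - i n)) - 2 * (real (i n) / real n - real (j n) / real n) / (1 - real (j n) / real n + 1 / real n)
     = (\<Sum>p\<in>{j n<..i n}. drift n (i n) p)"
    using le eventually_gt_at_top[of 0]
  proof eventually_elim
    case (elim n)
    have "2 * (real (i n) / real n - real (j n) / real n) / (1 - real (j n) / real n + 1 / real n)
       = (2 * (real (i n) - real (j n)) / real n) / ((real n - real (j n) + 1) / real n)"
      using elim by (simp add: diff_divide_distrib add_divide_distrib right_diff_distrib)
    also have "\<dots> = 2 * (real (i n) - real (j n)) / (real n - real (j n) + 1)"
      using elim by simp
    finally show ?case using elim by (simp add: sum_drift)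
  qed
  ultimately show ?thesis unfolding add_0_right by (rule Lim_transform_eventually)
qed

text \<open>The limit of the drift sums from the maximum at \<open>1/2\<close> to \<open>t\<close>,
  extended by reflection to \<open>t < 1/2\<close>.\<close>

definition limit_shape :: "real \<Rightarrow> real" where
  "limit_shape t = (if t \<ge> 1/2 then - 2 * ln (2 * (1 - t)) - 4 * t + 2 else - 2 * ln (2 * t) + 4 * t - 2)"

lemma limit_shape_rev: "limit_shape (1 - t) = limit_shape t"
proof (cases "t = 1/2")
  case True
  show ?thesis unfolding True by simp
qed (auto simp: limit_shape_def)

lemma nat_floor_ratio_limit:
  assumes x: "(\<lambda>n. x n / real n) \<longlonglongrightarrow> c" and pos: "\<forall>\<^sub>F n in sequentially. 0 \<le> x n"
    and k: "\<And>n. 0 \<le> x n \<Longrightarrow> \<bar>real (k n) - x n\<bar> \<le> 1"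
  shows "(\<lambda>n. real (k n) / real n) \<longlonglongrightarrow> c"
proof -
  have "(\<lambda>n. real (k n) / real n - x n / real n) \<longlonglongrightarrow> 0"
  proof (rule tendsto_0_le[OF lim_1_over_n])
    show "\<forall>\<^sub>F n in sequentially. norm (real (k n) / real n - x n / real n) \<le> norm (1 / real n) * 1"
      using pos eventually_gt_at_top[of 0]
    proof eventually_elim
      case (elim n)
      then show ?case using k[of n] by (simp add: diff_divide_distrib[symmetric] divide_right_mono)
    qed
  qed
  then have "(\<lambda>n. (real (k n) / real n - x n / real n) + x n / real n) \<longlonglongrightarrow> 0 + c"
    by (intro tendsto_intros x)
  then show ?thesis by simp
qed

text \<open>Since \<open>t > 1/2\<close>, the index \<open>i n\<close> eventually lies to the right
  of the whole window around \<open>n / 2\<close>. The window has length \<open>o(n)\<close>, so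
  both of its ends lead to the same limiting drift sum.\<close>

lemma moment_bounds_limit:
  assumes i: "(\<lambda>n. real (i n) / real n) \<longlonglongrightarrow> t" and t: "1/2 < t" "t < 1"
  obtains L U where "L \<longlonglongrightarrow> exp (- limit_shape t)" "U \<longlonglongrightarrow> exp (- limit_shape t)^2"
    "\<forall>\<^sub>F n in sequentially. L n \<le> moment n 1 (i n) \<and> moment n 2 (i n) \<le> U n"
proof -
  \<comment> \<open>Wider than the fluctuations of the maximum, which are of order
    \<open>sqrt n\<close>, and narrower than \<open>n\<close>; any exponent strictly between
    \<open>1/2\<close> and \<open>1\<close> serves.\<close>
  define a where "a = (\<lambda>n. real n powr (3/4))"
  define j1 where "j1 = (\<lambda>n. nat \<lfloor>real n / 2 - a n\<rfloor>)"
  define j2 where "j2 = (\<lambda>n. nat \<lceil>real n / 2 + a n\<rceil>)"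
  have lim1: "(\<lambda>n. real (j1 n) / real n) \<longlonglongrightarrow> 1/2"
  proof (rule nat_floor_ratio_limit)
    show "(\<lambda>n. (real n / 2 - a n) / real n) \<longlonglongrightarrow> 1/2" unfolding a_def by real_asymp
    show "\<forall>\<^sub>F n in sequentially. 0 \<le> real n / 2 - a n" unfolding a_def by real_asymp
    show "\<bar>real (j1 n) - (real n / 2 - a n)\<bar> \<le> 1" if "0 \<le> real n / 2 - a n" for n
    proof -
      have "real (j1 n) = of_int \<lfloor>real n / 2 - a n\<rfloor>" using that by (simp add: j1_def)
      then show ?thesis by linarith
    qed
  qed
  have lim2: "(\<lambda>n. real (j2 n) / real n) \<longlonglongrightarrow> 1/2"
  proof (rule nat_floor_ratio_limit)
    show "(\<lambda>n. (real n / 2 + a n) / real n) \<longlonglongrightarrow> 1/2" unfolding a_def by real_asymp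
    show "\<forall>\<^sub>F n in sequentially. 0 \<le> real n / 2 + a n" unfolding a_def by real_asymp
    show "\<bar>real (j2 n) - (real n / 2 + a n)\<bar> \<le> 1" if "0 \<le> real n / 2 + a n" for n
    proof -
      have "real (j2 n) = of_int \<lceil>real n / 2 + a n\<rceil>" using that by (simp add: j2_def)
      then show ?thesis by linarith
    qed
  qed
  have apos: "\<forall>\<^sub>F n in sequentially. 0 < a n" unfolding a_def by real_asymp
  define m where "m = (1/2 + t) / 2"
  have m: "1/2 < m" "m < t" using t by (auto simp: m_def)
  have ev_j2: "\<forall>\<^sub>F n in sequentially. j2 n \<le> i n"
    using order_tendstoD(2)[OF lim2 m(1)] order_tendstoD(1)[OF i m(2)] eventually_gt_at_top[of 0]
  proof eventually_elim
    case (elim n)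
    then have "real (j2 n) / real n < real (i n) / real n" by linarith
    then show ?case using elim(3) by (simp add: divide_less_cancel)
  qed
  have ev_i: "\<forall>\<^sub>F n in sequentially. i n < n"
    using order_tendstoD(2)[OF i t(2)] eventually_gt_at_top[of 0]
    by eventually_elim (simp add: divide_less_eq)
  have good: "j1 n \<le> j \<and> j \<le> j2 n" if "\<bar>real j - real n / 2\<bar> < a n" for n j
  proof
    have "\<lfloor>real n / 2 - a n\<rfloor> \<le> int j" using that by linarith
    then show "j1 n \<le> j" by (simp add: j1_def)
    have "int j \<le> \<lceil>real n / 2 + a n\<rceil>" using that by linarith
    then show "j \<le> j2 n" by (simp add: j2_def)
  qed
  have j12: "j1 n \<le> j2 n" if "0 < a n" for n
    unfolding j1_def j2_def using that by (intro nat_mono) linarith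
  let ?S1 = "\<lambda>n. \<Sum>p\<in>{j1 n<..i n}. drift n (i n) p" and ?S2 = "\<lambda>n. \<Sum>p\<in>{j2 n<..i n}. drift n (i n) p"
  have phi: "limit_shape t = 2 * ln ((1 - 1/2) / (1 - t)) - 2 * (t - 1/2) / (1 - 1/2)"
  proof -
    have "(1 - 1/2) / (1 - t) = inverse (2 * (1 - t))" by (simp add: field_simps)
    then have "ln ((1 - 1/2) / (1 - t)) = - ln (2 * (1 - t))" by (simp only: ln_inverse)
    then show ?thesis using t by (simp add: limit_shape_def)
  qed
  have S1: "?S1 \<longlonglongrightarrow> limit_shape t" unfolding phi
  proof (rule sum_drift_limit[OF lim1 i])
    show "\<forall>\<^sub>F n in sequentially. j1 n \<le> i n \<and> i n \<le> n"
      using ev_j2 ev_i apos by eventually_elim (use j12 le_trans less_imp_le in blast)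
  qed (use t in auto)
  have S2: "?S2 \<longlonglongrightarrow> limit_shape t" unfolding phi
  proof (rule sum_drift_limit[OF lim2 i])
    show "\<forall>\<^sub>F n in sequentially. j2 n \<le> i n \<and> i n \<le> n"
      using ev_j2 ev_i by eventually_elim auto
  qed (use t in auto)
  have B: "(\<lambda>n. (real n + 2) / (8 * (a n)\<^sup>2)) \<longlonglongrightarrow> 0" unfolding a_def by real_asymp
  have gap: "(\<lambda>n. 8 / (real n - real (i n))) \<longlonglongrightarrow> 0"
  proof -
    have "(\<lambda>n. 8 * (1 / real n) / (1 - real (i n) / real n)) \<longlonglongrightarrow> 8 * 0 / (1 - t)"
      using t by (intro tendsto_intros i lim_1_over_n) auto
    moreover have "\<forall>\<^sub>F n in sequentially. 8 * (1 / real n) / (1 - real (i n) / real n) = 8 / (real n - real (i n))"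
      using eventually_gt_at_top[of 0] ev_i
    proof eventually_elim
      case (elim n)
      then have "1 - real (i n) / real n = (real n - real (i n)) / real n" by (simp add: diff_divide_distrib)
      then show ?case using elim by simp
    qed
    ultimately have "(\<lambda>n. 8 / (real n - real (i n))) \<longlonglongrightarrow> 8 * 0 / (1 - t)"
      by (rule Lim_transform_eventually)
    then show ?thesis by simp
  qed
  have small: "\<forall>\<^sub>F n in sequentially. 4 / (real n - real (i n)) \<le> 1"
  proof -
    have "\<forall>\<^sub>F n in sequentially. 8 / (real n - real (i n)) < 2" by (rule order_tendstoD(2)[OF gap]) simp
    then show ?thesis by eventually_elim simp
  qed
  define L where "L = (\<lambda>n. (1 - (real n + 2) / (8 * (a n)\<^sup>2)) * ((real n + 1) / (real n + 2) * exp (- ?S1 n)))"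
  define U where "U = (\<lambda>n. (real n + 2) / (8 * (a n)\<^sup>2) + exp (- 2 * ?S2 n + 8 / (real n - real (i n)) * ?S1 n))"
  show thesis
  proof
    have "(\<lambda>n. (real n + 1) / (real n + 2)) \<longlonglongrightarrow> 1" by real_asymp
    then have "L \<longlonglongrightarrow> (1 - 0) * (1 * exp (- limit_shape t))"
      unfolding L_def by (intro tendsto_intros B S1)
    then show "L \<longlonglongrightarrow> exp (- limit_shape t)" by simp
    have "U \<longlonglongrightarrow> 0 + exp (- 2 * limit_shape t + 0 * limit_shape t)"
      unfolding U_def by (intro tendsto_intros B S1 S2 gap)
    then show "U \<longlonglongrightarrow> exp (- limit_shape t)^2" by (simp add: exp_double[symmetric])
    show "\<forall>\<^sub>F n in sequentially. L n \<le> moment n 1 (i n) \<and> moment n 2 (i n) \<le> U n"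
      using apos ev_j2 ev_i small
    proof eventually_elim
      case (elim n)
      show ?case unfolding L_def U_def
      proof (intro conjI)
        show "(1 - (real n + 2) / (8 * (a n)\<^sup>2)) * ((real n + 1) / (real n + 2) * exp (- ?S1 n)) \<le> moment n 1 (i n)"
          using elim good j12[of n] by (intro moment_lower) (auto intro: order_trans)
        show "moment n 2 (i n) \<le> (real n + 2) / (8 * (a n)\<^sup>2) + exp (- 2 * ?S2 n + 8 / (real n - real (i n)) * ?S1 n)"
          using elim good by (intro moment_upper) auto
      qed
    qed
  qed
qed

lemma cond_law_second_moment:
  assumes i: "i \<le> n"
  shows "(\<integral>\<^sup>+u. ennreal ((u i - y)\<^sup>2) \<partial>cond_law n) = ennreal (moment n 2 i - 2 * y * moment n 1 i + y\<^sup>2)"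
    and "0 \<le> moment n 2 i - 2 * y * moment n 1 i + y\<^sup>2"
proof -
  interpret prob_space "cond_law n" by (rule prob_space_cond_law)
  have [measurable]: "(\<lambda>u. u i) \<in> borel_measurable (cond_law n)"
    using measurable_iid_component[OF i] by simp
  have ae: "AE u in cond_law n. 0 < u i \<and> u i < 1"
    using AE_cond_law[of n] i by auto
  have int1: "integrable (cond_law n) (\<lambda>u. u i)"
    by (rule integrable_const_bound[of _ 1]) (use ae in auto)
  have int2: "integrable (cond_law n) (\<lambda>u. (u i)\<^sup>2)"
    by (rule integrable_const_bound[of _ 1]) (use ae in \<open>auto simp: power_le_one_iff\<close>)
  have m: "0 \<le> moment n l i" if "l \<ge> 0" for l
    unfolding moment_def sector_weight_eq[of n "\<lambda>k. 1 + (if k = i then l else 0)"]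
    using that i total_weight_pos[of n] argmax_weight_pos[of n]
    by (intro divide_nonneg_pos sum_nonneg mult_nonneg_nonneg weight_ratio_bounds(1))
      (auto simp: rateR_single rateL_single less_imp_le)
  have 1: "integral\<^sup>L (cond_law n) (\<lambda>u. u i) = moment n 1 i"
  proof -
    have "ennreal (integral\<^sup>L (cond_law n) (\<lambda>u. u i)) = (\<integral>\<^sup>+u. ennreal (u i) \<partial>cond_law n)"
      by (rule nn_integral_eq_integral[symmetric]) (use int1 ae in auto)
    also have "\<dots> = (\<integral>\<^sup>+u. ennreal (exp (1 * ln (u i))) \<partial>cond_law n)"
      by (rule nn_integral_cong_AE) (use ae in auto)
    also have "\<dots> = ennreal (moment n 1 i)"
      by (rule moment_integral[OF i]) simp
    finally have eq: "ennreal (integral\<^sup>L (cond_law n) (\<lambda>u. u i)) = ennreal (moment n 1 i)" .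
    have "0 \<le> integral\<^sup>L (cond_law n) (\<lambda>u. u i)"
      using ae by (intro integral_nonneg_AE) auto
    then show ?thesis
      by (rule ennreal_inj[THEN iffD1, OF _ m eq]) simp
  qed
  have 2: "integral\<^sup>L (cond_law n) (\<lambda>u. (u i)\<^sup>2) = moment n 2 i"
  proof -
    have "ennreal (integral\<^sup>L (cond_law n) (\<lambda>u. (u i)\<^sup>2)) = (\<integral>\<^sup>+u. ennreal ((u i)\<^sup>2) \<partial>cond_law n)"
      by (rule nn_integral_eq_integral[symmetric]) (use int2 ae in auto)
    also have "\<dots> = (\<integral>\<^sup>+u. ennreal (exp (2 * ln (u i))) \<partial>cond_law n)"
      by (rule nn_integral_cong_AE) (use ae in \<open>auto simp: exp_double\<close>)
    also have "\<dots> = ennreal (moment n 2 i)"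
      by (rule moment_integral[OF i]) simp
    finally have eq: "ennreal (integral\<^sup>L (cond_law n) (\<lambda>u. (u i)\<^sup>2)) = ennreal (moment n 2 i)" .
    have "0 \<le> integral\<^sup>L (cond_law n) (\<lambda>u. (u i)\<^sup>2)"
      using ae by (intro integral_nonneg_AE) auto
    then show ?thesis
      by (rule ennreal_inj[THEN iffD1, OF _ m eq]) simp
  qed
  have eq: "(u i - y)\<^sup>2 = (u i)\<^sup>2 - 2 * y * u i + y\<^sup>2" for u :: "nat \<Rightarrow> real"
    by (simp add: power2_diff mult.commute)
  have int3: "integrable (cond_law n) (\<lambda>u. (u i - y)\<^sup>2)"
    unfolding eq using int1 int2 by auto
  have 3: "integral\<^sup>L (cond_law n) (\<lambda>u. (u i - y)\<^sup>2) = moment n 2 i - 2 * y * moment n 1 i + y\<^sup>2"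
    unfolding eq using int1 int2 prob_space by (simp add: 1 2)
  show "(\<integral>\<^sup>+u. ennreal ((u i - y)\<^sup>2) \<partial>cond_law n) = ennreal (moment n 2 i - 2 * y * moment n 1 i + y\<^sup>2)"
    unfolding 3[symmetric] by (rule nn_integral_eq_integral[OF int3]) simp
  show "0 \<le> moment n 2 i - 2 * y * moment n 1 i + y\<^sup>2"
    unfolding 3[symmetric] by simp
qed

text \<open>Indices left of the middle are reflected to \<open>n - i\<close>, which has the same
  moments. The lower bound on the first and the upper bound on the second moment then squeeze the
  mean square deviation.\<close>

lemma second_moment_limit:
  assumes i: "(\<lambda>n. real (i n) / real n) \<longlonglongrightarrow> t" and t: "0 < t" "t < 1" "t \<noteq> 1/2"
  defines "y \<equiv> exp (- limit_shape t)"
  shows "(\<lambda>n. moment n 2 (i n) - 2 * y * moment n 1 (i n) + y\<^sup>2) \<longlonglongrightarrow> 0"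
proof -
  have ev_i: "\<forall>\<^sub>F n in sequentially. i n \<le> n"
    using order_tendstoD(2)[OF i t(2)] eventually_gt_at_top[of 0]
    by eventually_elim (simp add: divide_less_eq)
  have "\<exists>L U. L \<longlonglongrightarrow> y \<and> U \<longlonglongrightarrow> y\<^sup>2 \<and> (\<forall>\<^sub>F n in sequentially. L n \<le> moment n 1 (i n) \<and> moment n 2 (i n) \<le> U n)"
  proof (cases "t > 1/2")
    case True
    from moment_bounds_limit[OF i this t(2)] obtain L U where "L \<longlonglongrightarrow> exp (- limit_shape t)"
      "U \<longlonglongrightarrow> exp (- limit_shape t)^2" "\<forall>\<^sub>F n in sequentially. L n \<le> moment n 1 (i n) \<and> moment n 2 (i n) \<le> U n" .
    then show ?thesis unfolding y_def by blast
  next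
    case False
    define i' where "i' = (\<lambda>n. n - i n)"
    have "(\<lambda>n. 1 - real (i n) / real n) \<longlonglongrightarrow> 1 - t" by (intro tendsto_intros i)
    moreover have "\<forall>\<^sub>F n in sequentially. 1 - real (i n) / real n = real (i' n) / real n"
      using ev_i eventually_gt_at_top[of 0] by eventually_elim (simp add: i'_def of_nat_diff diff_divide_distrib)
    ultimately have "(\<lambda>n. real (i' n) / real n) \<longlonglongrightarrow> 1 - t" by (rule Lim_transform_eventually)
    then obtain L U where LU: "L \<longlonglongrightarrow> exp (- limit_shape (1 - t))" "U \<longlonglongrightarrow> exp (- limit_shape (1 - t))^2"
       and ev: "\<forall>\<^sub>F n in sequentially. L n \<le> moment n 1 (i' n) \<and> moment n 2 (i' n) \<le> U n"
      by (rule moment_bounds_limit) (use False t in auto)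
    have "\<forall>\<^sub>F n in sequentially. L n \<le> moment n 1 (i n) \<and> moment n 2 (i n) \<le> U n"
      using ev ev_i by eventually_elim (simp add: i'_def moment_rev)
    then show ?thesis using LU unfolding y_def limit_shape_rev by blast
  qed
  then obtain L U where L: "L \<longlonglongrightarrow> y" and U: "U \<longlonglongrightarrow> y\<^sup>2"
    and LU: "\<forall>\<^sub>F n in sequentially. L n \<le> moment n 1 (i n) \<and> moment n 2 (i n) \<le> U n" by blast
  have "(\<lambda>n. U n - 2 * y * L n + y\<^sup>2) \<longlonglongrightarrow> y\<^sup>2 - 2 * y * y + y\<^sup>2"
    by (intro tendsto_intros L U)
  then have lim: "(\<lambda>n. U n - 2 * y * L n + y\<^sup>2) \<longlonglongrightarrow> 0"
    by (simp add: power2_eq_square)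
  show ?thesis
  proof (rule tendsto_sandwich[OF _ _ tendsto_const lim])
    show "\<forall>\<^sub>F n in sequentially. 0 \<le> moment n 2 (i n) - 2 * y * moment n 1 (i n) + y\<^sup>2"
      using ev_i by eventually_elim (rule cond_law_second_moment(2))
    show "\<forall>\<^sub>F n in sequentially. moment n 2 (i n) - 2 * y * moment n 1 (i n) + y\<^sup>2 \<le> U n - 2 * y * L n + y\<^sup>2"
      using LU
    proof eventually_elim
      case (elim n)
      then have "2 * y * L n \<le> 2 * y * moment n 1 (i n)" by (intro mult_left_mono) (auto simp: y_def)
      then show ?case using elim by linarith
    qed
  qed
qed

text \<open>Chebyshev's inequality for \<open>u (i n)\<close> about
  \<open>exp (- limit_shape t)\<close>, transferred to the logarithm by continuity of
  \<open>ln\<close> at this positive point.\<close>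

lemma cond_law_ln_limit:
  assumes i: "(\<lambda>n. real (i n) / real n) \<longlonglongrightarrow> t" and t: "0 < t" "t < 1" "t \<noteq> 1/2" and e: "e > 0"
  shows "(\<lambda>n. measure (cond_law n) {u \<in> space (cond_law n). \<not> \<bar>ln (u (i n)) + limit_shape t\<bar> < e}) \<longlonglongrightarrow> 0"
proof -
  define y where "y = exp (- limit_shape t)"
  have "isCont ln y" unfolding y_def by (rule isCont_ln) simp
  then obtain d where d: "d > 0" "\<And>x. \<bar>x - y\<bar> < d \<Longrightarrow> \<bar>ln x - ln y\<bar> < e"
    using e unfolding continuous_at_eps_delta dist_real_def by (metis abs_minus_commute)
  let ?Q = "\<lambda>n. moment n 2 (i n) - 2 * y * moment n 1 (i n) + y\<^sup>2"
  have ev_i: "\<forall>\<^sub>F n in sequentially. i n \<le> n"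
    using order_tendstoD(2)[OF i t(2)] eventually_gt_at_top[of 0]
    by eventually_elim (simp add: divide_less_eq)
  have "(\<lambda>n. 1 / d\<^sup>2 * ?Q n) \<longlonglongrightarrow> 1 / d\<^sup>2 * 0"
    unfolding y_def by (intro tendsto_mult tendsto_const second_moment_limit i t)
  then have lim: "(\<lambda>n. 1 / d\<^sup>2 * ?Q n) \<longlonglongrightarrow> 0" by simp
  show ?thesis
  proof (rule tendsto_sandwich[OF _ _ tendsto_const lim])
    show "\<forall>\<^sub>F n in sequentially. measure (cond_law n) {u \<in> space (cond_law n). \<not> \<bar>ln (u (i n)) + limit_shape t\<bar> < e} \<le> 1 / d\<^sup>2 * ?Q n"
      using ev_i
    proof eventually_elim
      case (elim n)
      let ?A = "{u \<in> space (cond_law n). \<not> \<bar>ln (u (i n)) + limit_shape t\<bar> < e}"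
      have m: "(\<lambda>u. u (i n)) \<in> borel_measurable (cond_law n)"
        using measurable_iid_component[OF elim] by simp
      have A: "?A \<in> sets (cond_law n)"
        by (intro sets.sets_Collect_neg borel_measurable_less borel_measurable_abs borel_measurable_add borel_measurable_const
           borel_measurable_ln m)
      have "emeasure (cond_law n) ?A = (\<integral>\<^sup>+u. indicator ?A u \<partial>cond_law n)"
        using A by simp
      also have "\<dots> \<le> (\<integral>\<^sup>+u. ennreal (1 / d\<^sup>2) * ennreal ((u (i n) - y)\<^sup>2) \<partial>cond_law n)"
      proof (rule nn_integral_mono)
        fix u
        show "indicator ?A u \<le> ennreal (1 / d\<^sup>2) * ennreal ((u (i n) - y)\<^sup>2)"
        proof (cases "u \<in> ?A")
          case True
          then have "d \<le> \<bar>u (i n) - y\<bar>" using d(2)[of "u (i n)"] by (intro leI notI) (auto simp: y_def)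
          then have "d\<^sup>2 \<le> (u (i n) - y)\<^sup>2" using d(1) by (metis power2_abs power_mono less_imp_le)
          then have "1 \<le> 1 / d\<^sup>2 * (u (i n) - y)\<^sup>2" using d(1) by (simp add: field_simps)
          then have "ennreal 1 \<le> ennreal (1 / d\<^sup>2 * (u (i n) - y)\<^sup>2)" by (rule ennreal_leI)
          then show ?thesis using True by (simp add: ennreal_mult'[symmetric])
        qed simp
      qed
      also have "\<dots> = ennreal (1 / d\<^sup>2) * (\<integral>\<^sup>+u. ennreal ((u (i n) - y)\<^sup>2) \<partial>cond_law n)"
        by (intro nn_integral_cmult measurable_compose[OF _ measurable_ennreal] borel_measurable_power borel_measurable_diff m borel_measurable_const)
      also have "\<dots> = ennreal (1 / d\<^sup>2 * ?Q n)"
        using cond_law_second_moment[OF elim, of y] d(1) by (simp add: ennreal_mult'[symmetric])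
      finally show ?case
        using cond_law_second_moment(2)[OF elim, of y] d(1)
        unfolding measure_def by (intro enn2real_leI) auto
    qed
  qed simp
qed

section \<open>Curvature gaps and anticoncentration\<close>

text \<open>\<open>l\<close> times the second-difference stencil centred at
  \<open>i\<close>.\<close>

definition curvature :: "nat \<Rightarrow> real \<Rightarrow> nat \<Rightarrow> real" where
  "curvature i l k = ((if k = i - 1 then l else 0) + (if k = i then - 2 * l else 0)) + (if k = i + 1 then l else 0)"

lemma rateR_plus: "rateR n (\<lambda>k. f k + g k) p = rateR n f p + rateR n g p"
  by (simp add: rateR_def sum.distrib[symmetric] algebra_simps)

lemma rateL_plus: "rateL (\<lambda>k. f k + g k) p = rateL f p + rateL g p"
  by (simp add: rateL_def sum.distrib[symmetric] algebra_simps)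

text \<open>Rates are twofold partial sums and thus invert the second difference, so a single rate
  survives; \<open>rateL_curvature\<close> is the same from the other side.\<close>

lemma rateR_curvature:
  assumes "0 < i" "i < n"
  shows "rateR n (curvature i l) p = (if p = i + 1 then l else 0)"
proof -
  have "rateR n (curvature i l) p = rateR n (\<lambda>k. if k = i - 1 then l else 0) p
      + rateR n (\<lambda>k. if k = i then - 2 * l else 0) p + rateR n (\<lambda>k. if k = i + 1 then l else 0) p"
    unfolding curvature_def by (simp only: rateR_plus)
  also have "\<dots> = (if p = i + 1 then l else 0)"
  proof -
    consider "p > i + 1" | "p = i + 1" | "p = i" | "p \<le> i - 1" by linarith
    then show ?thesis
      using assms unfolding rateR_single by cases (auto simp: of_nat_diff algebra_simps)
  qed
  finally show ?thesis .
qed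

lemma rateL_curvature:
  assumes "0 < i"
  shows "rateL (curvature i l) p = (if p = i - 1 then l else 0)"
proof -
  have "rateL (curvature i l) p = rateL (\<lambda>k. if k = i - 1 then l else 0) p
      + rateL (\<lambda>k. if k = i then - 2 * l else 0) p + rateL (\<lambda>k. if k = i + 1 then l else 0) p"
    unfolding curvature_def by (simp only: rateL_plus)
  also have "\<dots> = (if p = i - 1 then l else 0)"
  proof -
    consider "p < i - 1" | "p = i - 1" | "p = i" | "p \<ge> i + 1" by linarith
    then show ?thesis
      using assms unfolding rateL_single by cases (auto simp: of_nat_diff algebra_simps)
  qed
  finally show ?thesis .
qed

lemma sum_curvature:
  fixes f :: "nat \<Rightarrow> real"
  assumes "0 < i" "i < n"
  shows "(\<Sum>k\<le>n. curvature i l k * f k) = l * (f (i - 1) + f (i + 1) - 2 * f i)"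
proof -
  have "(\<Sum>k\<le>n. curvature i l k * f k) = (\<Sum>k\<le>n. if k = i - 1 then l * f k else 0)
     + (\<Sum>k\<le>n. if k = i then - 2 * l * f k else 0) + (\<Sum>k\<le>n. if k = i + 1 then l * f k else 0)"
    unfolding sum.distrib[symmetric] curvature_def by (rule sum.cong) (auto simp: algebra_simps)
  then show ?thesis using assms by (simp add: algebra_simps)
qed

text \<open>A Laplace transform of the curvature gap, that is of minus the second difference. In
  every sector at least one rate is raised by \<open>l\<close>: the right one at
  \<open>i + 1\<close> if the maximum is at or left of \<open>i\<close>, the left one at
  \<open>i - 1\<close> otherwise. Both are at most \<open>n^2\<close>.\<close>

lemma curvature_moment:
  assumes i: "0 < i" "i < n" and l: "l \<ge> 0"
  shows "(\<integral>\<^sup>+u. ennreal (exp (l * (ln (u (i - 1)) + ln (u (i + 1)) - 2 * ln (u i)))) \<partial>cond_law n)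
     \<le> ennreal ((real n)\<^sup>2 / ((real n)\<^sup>2 + l))"
proof -
  have sum0: "(\<Sum>k\<le>n. curvature i l k) = 0"
    using sum_curvature[OF i, of l "\<lambda>_. 1"] by simp
  have "(\<integral>\<^sup>+u. ennreal (exp (l * (ln (u (i - 1)) + ln (u (i + 1)) - 2 * ln (u i)))) \<partial>cond_law n)
     = (\<integral>\<^sup>+u. ennreal (exp (\<Sum>k\<le>n. curvature i l k * ln (u k))) \<partial>cond_law n)"
    using sum_curvature[OF i, of l] by simp
  also have "\<dots> = ennreal ((\<Sum>j\<le>n. sector_weight n (\<lambda>k. 1 + curvature i l k) j) / total_weight n)"
  proof (rule cond_law_integral)
    show "0 < (\<Sum>k\<le>n. 1 + curvature i l k)" by (simp add: sum.distrib sum0)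
    show "0 < rateR n (\<lambda>k. 1 + curvature i l k) p" if "p \<le> n" for p
      using l rateR_1_pos[OF that] by (simp add: rateR_add rateR_curvature[OF i] add_pos_nonneg)
    show "0 < rateL (\<lambda>k. 1 + curvature i l k) p" for p
      using l rateL_1_pos[of p] by (simp add: rateL_add rateL_curvature[OF i(1)] add_pos_nonneg)
  qed
  also have "(\<Sum>j\<le>n. sector_weight n (\<lambda>k. 1 + curvature i l k) j) \<le> (real n)\<^sup>2 / ((real n)\<^sup>2 + l) * total_weight n"
    unfolding sector_weight_eq[of n "\<lambda>k. 1 + curvature i l k"] total_weight_def sum_distrib_left
  proof (rule sum_mono)
    fix j assume "j \<in> {..n}"
    then have j: "j \<le> n" by simp
    have mono: "x / (x + l) \<le> (real n)\<^sup>2 / ((real n)\<^sup>2 + l)" if "0 < x" "x \<le> (real n)\<^sup>2" for x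
    proof -
      have "x * l \<le> (real n)\<^sup>2 * l" using that l by (intro mult_right_mono) auto
      then show ?thesis using that l i by (simp add: divide_simps) (auto simp: algebra_simps add_nonneg_eq_0_iff)
    qed
    have "weight_ratio n (\<lambda>k. 1 + curvature i l k) j \<le> (real n)\<^sup>2 / ((real n)\<^sup>2 + l)"
    proof (cases "j \<le> i")
      case True
      have "weight_ratio n (\<lambda>k. 1 + curvature i l k) j \<le> rateR n (\<lambda>_. 1) (i + 1) / rateR n (\<lambda>k. 1 + curvature i l k) (i + 1)"
        using True i l j by (intro weight_ratio_bounds(3)) (auto simp: sum0 rateR_curvature rateL_curvature)
      also have "\<dots> = rateR n (\<lambda>_. 1) (i + 1) / (rateR n (\<lambda>_. 1) (i + 1) + l)"
        using i by (simp add: rateR_add rateR_curvature)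
      also have "\<dots> \<le> (real n)\<^sup>2 / ((real n)\<^sup>2 + l)"
      proof (rule mono)
        show "0 < rateR n (\<lambda>_. 1) (i + 1)" using i by (intro rateR_1_pos) auto
        have "rateR n (\<lambda>_. 1) (i + 1) = (real n - real i) * (real n - real i + 1) / 2"
          using i by (simp add: rateR_1)
        also have "\<dots> \<le> real n * (real n + 1) / 2"
          using i by (intro divide_right_mono mult_mono) auto
        also have "\<dots> \<le> (real n)\<^sup>2" using i by (simp add: power2_eq_square field_simps)
        finally show "rateR n (\<lambda>_. 1) (i + 1) \<le> (real n)\<^sup>2" .
      qed
      finally show ?thesis .
    next
      case False
      have "weight_ratio n (\<lambda>k. 1 + curvature i l k) j \<le> rateL (\<lambda>_. 1) (i - 1) / rateL (\<lambda>k. 1 + curvature i l k) (i - 1)"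
        using False i l j by (intro weight_ratio_bounds(4)[where n = n]) (auto simp: sum0 rateR_curvature rateL_curvature)
      also have "\<dots> = rateL (\<lambda>_. 1) (i - 1) / (rateL (\<lambda>_. 1) (i - 1) + l)"
        using i by (simp add: rateL_add rateL_curvature)
      also have "\<dots> \<le> (real n)\<^sup>2 / ((real n)\<^sup>2 + l)"
      proof (rule mono)
        show "0 < rateL (\<lambda>_. 1) (i - 1)" by (rule rateL_1_pos)
        have "rateL (\<lambda>_. 1) (i - 1) = real i * (real i + 1) / 2"
          using i by (simp add: rateL_1 of_nat_diff)
        also have "\<dots> \<le> real n * (real n + 1) / 2"
          using i by (intro divide_right_mono mult_mono) auto
        also have "\<dots> \<le> (real n)\<^sup>2" using i by (simp add: power2_eq_square field_simps)
        finally show "rateL (\<lambda>_. 1) (i - 1) \<le> (real n)\<^sup>2" .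
      qed
      finally show ?thesis .
    qed
    then have "argmax_weight n j * weight_ratio n (\<lambda>k. 1 + curvature i l k) j \<le> argmax_weight n j * ((real n)\<^sup>2 / ((real n)\<^sup>2 + l))"
      using argmax_weight_pos[of n j] by (intro mult_left_mono) auto
    then show "argmax_weight n j * weight_ratio n (\<lambda>k. 1 + curvature i l k) j \<le> (real n)\<^sup>2 / ((real n)\<^sup>2 + l) * argmax_weight n j"
      by (simp only: mult.commute)
  qed
  finally show ?thesis
    using total_weight_pos[of n] by (simp add: ennreal_leI divide_le_eq divide_right_mono pos_divide_le_eq)
qed

text \<open>Markov's inequality with \<open>l = n^3\<close>: outside an event of probability at most
  \<open>2 / n\<close> the curvature gap is at least \<open>ln 2 / n^3\<close>. This is rewritten as
  the room left to \<open>u i\<close> above the geometric mean of its neighbours.\<close>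

lemma gap_prob:
  assumes i: "0 < i" "i < n"
  shows "measure (cond_law n) {u \<in> space (cond_law n). \<not> (u i / (8 * real n ^ 3) \<le> u i - sqrt (u (i - 1) * u (i + 1)))} \<le> 2 / n"
proof -
  let ?A = "{u \<in> space (cond_law n). \<not> (u i / (8 * real n ^ 3) \<le> u i - sqrt (u (i - 1) * u (i + 1)))}"
  let ?g = "\<lambda>u::nat \<Rightarrow> real. exp (real n ^ 3 * (ln (u (i - 1)) + ln (u (i + 1)) - 2 * ln (u i)))"
  have n: "real n \<ge> 1" using i by simp
  have m: "(\<lambda>u. u k) \<in> borel_measurable (cond_law n)" if "k \<le> n" for k
    using measurable_iid_component[OF that] by simp
  have m1: "(\<lambda>u. u (i - 1)) \<in> borel_measurable (cond_law n)" and m2: "(\<lambda>u. u (i + 1)) \<in> borel_measurable (cond_law n)"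
    and m3: "(\<lambda>u. u i) \<in> borel_measurable (cond_law n)"
    using i by (auto intro!: m simp del: sets_cond_law space_cond_law)
  have sq: "(\<lambda>u. sqrt (u (i - 1) * u (i + 1))) \<in> borel_measurable (cond_law n)"
    using m1 m2 by measurable
  have A: "?A \<in> sets (cond_law n)"
    by (intro sets.sets_Collect_neg borel_measurable_le borel_measurable_diff borel_measurable_divide sq m3 borel_measurable_const)
  have g: "(\<lambda>u. ennreal (?g u)) \<in> borel_measurable (cond_law n)"
    using m1 m2 m3 by measurable
  have "emeasure (cond_law n) ?A = (\<integral>\<^sup>+u. indicator ?A u \<partial>cond_law n)"
    using A by simp
  also have "\<dots> \<le> (\<integral>\<^sup>+u. ennreal 2 * ennreal (?g u) \<partial>cond_law n)"
  proof (rule nn_integral_mono_AE, use AE_cond_law[of n] in eventually_elim)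
    fix u :: "nat \<Rightarrow> real" assume u: "u \<in> log_concave_event n \<and> (\<forall>i\<le>n. 0 < u i \<and> u i < 1)"
    let ?x = "ln (u (i - 1)) + ln (u (i + 1)) - 2 * ln (u i)"
    have pos: "0 < u (i - 1)" "0 < u (i + 1)" "0 < u i" using u i by auto
    show "indicator ?A u \<le> ennreal 2 * ennreal (?g u)"
    proof (cases "u \<in> ?A")
      case True
      have "?g u \<ge> 1 / 2"
      proof (rule ccontr)
        assume "\<not> 1 / 2 \<le> ?g u"
        then have "?g u < exp (- ln 2)" by (simp add: exp_minus)
        then have x: "real n ^ 3 * ?x < - ln 2" by (simp only: exp_less_cancel_iff)
        have n3: "real n ^ 3 \<ge> 1" using n by simp
        \<comment> \<open>The geometric mean is \<open>u i * exp (?x / 2)\<close>, and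
          \<open>?x\<close> is below \<open>- 1 / (2 * n^3)\<close> as
          \<open>ln 2 \<ge> 1/2\<close>; halving gives the \<open>4\<close>. The estimate
          \<open>exp (- t) \<le> 1 - t / 2\<close> then yields the \<open>8\<close> of the
          statement.\<close>
        define t where "t = 1 / (4 * real n ^ 3)"
        have "1 \<le> 4 * real n ^ 3" using n3 by linarith
        then have t: "0 < t" "t \<le> 1" using i by (auto simp: t_def divide_le_eq_1)
        have "real n ^ 3 * ?x \<le> - (1 / 2)" using x ln2_ge_two_thirds by linarith
        moreover have n0: "real n ^ 3 > 0" using n3 by linarith
        ultimately have "?x \<le> - (1 / 2) / real n ^ 3"
          by (simp only: pos_le_divide_eq[OF n0] mult.commute[of ?x "real n ^ 3"])
        then have xt: "?x / 2 \<le> - t" by (simp add: t_def)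
        have "sqrt (u (i - 1) * u (i + 1)) = u i * exp (?x / 2)"
        proof -
          have "u i * exp (?x / 2) = exp (ln (u i) + ?x / 2)" using pos by (simp add: exp_add)
          also have "\<dots> = exp ((ln (u (i - 1)) + ln (u (i + 1))) / 2)" by (simp add: field_simps)
          also have "\<dots> = sqrt (exp (ln (u (i - 1)) + ln (u (i + 1))))"
            by (rule real_sqrt_unique[symmetric]) (auto simp: exp_double[symmetric])
          also have "\<dots> = sqrt (u (i - 1) * u (i + 1))" using pos by (simp add: exp_add)
          finally show ?thesis ..
        qed
        also have "\<dots> \<le> u i * exp (- t)" using pos xt by (intro mult_left_mono) auto
        also have "exp (- t) \<le> 1 - t / 2"
        proof -
          have "1 + t \<le> exp t" by (rule exp_ge_add_one_self)
          then have "exp (- t) \<le> 1 / (1 + t)" using t by (simp add: exp_minus field_simps)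
          also have "\<dots> \<le> 1 - t / 2"
          proof -
            have "t * t \<le> t" using t mult_left_le[of t t] by simp
            then show ?thesis using t by (simp add: field_simps)
          qed
          finally show ?thesis .
        qed
        also have "u i * (1 - t / 2) = u i - u i / (8 * real n ^ 3)"
          by (simp add: t_def algebra_simps)
        finally have "sqrt (u (i - 1) * u (i + 1)) \<le> u i - u i / (8 * real n ^ 3)"
          using pos by (simp add: mult_left_mono)
        then show False using True by auto
      qed
      then have "ennreal 1 \<le> ennreal (2 * ?g u)" by (intro ennreal_leI) simp
      then show ?thesis using True by (simp add: ennreal_mult)
    qed simp
  qed
  also have "\<dots> = ennreal 2 * (\<integral>\<^sup>+u. ennreal (?g u) \<partial>cond_law n)"
    by (rule nn_integral_cmult[OF g])
  also have "\<dots> \<le> ennreal 2 * ennreal ((real n)\<^sup>2 / ((real n)\<^sup>2 + real n ^ 3))"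
    using i by (intro mult_left_mono curvature_moment) auto
  also have "\<dots> = ennreal (2 * ((real n)\<^sup>2 / ((real n)\<^sup>2 + real n ^ 3)))"
    by (simp only: ennreal_mult'[symmetric] zero_le_numeral)
  also have "\<dots> \<le> ennreal (2 / n)"
  proof (rule ennreal_leI)
    have "(real n)\<^sup>2 / ((real n)\<^sup>2 + real n ^ 3) \<le> (real n)\<^sup>2 / real n ^ 3"
      using n by (intro divide_left_mono) (auto intro!: mult_pos_pos add_pos_pos)
    also have "\<dots> = 1 / n" using n by (simp add: power2_eq_square power3_eq_cube)
    finally show "2 * ((real n)\<^sup>2 / ((real n)\<^sup>2 + real n ^ 3)) \<le> 2 / real n" by simp
  qed
  finally show ?thesis unfolding measure_def by (intro enn2real_leI) auto
qed

text \<open>Both powers are close to \<open>- a\<close> in the relative sense, so their quotient is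
  at most \<open>1 + 4 * \<eta> \<le> (1 + 4 * \<eta>) ^ n\<close>. Taking \<open>n\<close>-th roots
  compares \<open>y\<close> with \<open>y'\<close> and loses nothing as \<open>n\<close>
  grows.\<close>

lemma power_near_opposite:
  fixes a :: complex and y y' :: real
  assumes n: "1 \<le> n" and eta: "0 < \<eta>" "\<eta> \<le> 1/2" and y: "0 < y" "y < 1" and y': "0 < y'" "y' < 1"
    and c: "cmod (a + of_real (y ^ n)) < \<eta> * y ^ n" and c': "cmod (a + of_real (y' ^ n)) < \<eta> * y' ^ n"
  shows "y - y' \<le> 4 * \<eta>"
proof -
  have "y ^ n - y' ^ n \<le> cmod (of_real (y ^ n) - of_real (y' ^ n) :: complex)"
    by (metis abs_ge_self norm_of_real of_real_diff)
  also have "\<dots> = cmod ((a + of_real (y ^ n)) - (a + of_real (y' ^ n)))" by simp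
  also have "\<dots> \<le> cmod (a + of_real (y ^ n)) + cmod (a + of_real (y' ^ n))" by (rule norm_triangle_ineq4)
  also have "\<dots> \<le> \<eta> * y ^ n + \<eta> * y' ^ n" using c c' by simp
  finally have 1: "(1 - \<eta>) * y ^ n \<le> (1 + \<eta>) * y' ^ n" by (simp add: algebra_simps)
  have "1 + \<eta> \<le> (1 - \<eta>) * (1 + 4 * \<eta>)"
  proof -
    have "\<eta> * \<eta> \<le> \<eta> * (1/2)" using eta by (intro mult_left_mono) auto
    then show ?thesis by (simp add: algebra_simps)
  qed
  then have "(1 + \<eta>) * y' ^ n \<le> (1 - \<eta>) * (1 + 4 * \<eta>) * y' ^ n"
    using y' by (intro mult_right_mono) auto
  with 1 have "(1 - \<eta>) * y ^ n \<le> (1 - \<eta>) * ((1 + 4 * \<eta>) * y' ^ n)" by simp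
  then have "y ^ n \<le> (1 + 4 * \<eta>) * y' ^ n" using eta by (subst (asm) mult_le_cancel_left_pos) auto
  also have "\<dots> \<le> (1 + 4 * \<eta>) ^ n * y' ^ n"
    using n eta y' self_le_power[of "1 + 4 * \<eta>" n] by (intro mult_right_mono) auto
  also have "\<dots> = ((1 + 4 * \<eta>) * y') ^ n" by (simp add: power_mult_distrib)
  finally have "y \<le> (1 + 4 * \<eta>) * y'"
    using n eta y' by (subst (asm) power_mono_iff) (auto simp: y less_imp_le[OF y(1)])
  then have "y - y' \<le> 4 * \<eta> * y'" by (simp add: algebra_simps)
  also have "\<dots> \<le> 4 * \<eta> * 1" using eta y' by (intro mult_left_mono) auto
  finally show ?thesis by simp
qed

text \<open>\<open>\<delta>\<close> bounds from below the length of the interval through which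
  \<open>u i\<close> can be lowered, with the other coordinates fixed, before the constraint at
  \<open>i\<close> fails.\<close>

definition anticonc_event :: "nat \<Rightarrow> complex \<Rightarrow> nat \<Rightarrow> real \<Rightarrow> real \<Rightarrow> (nat \<Rightarrow> real) set" where
  "anticonc_event n z i \<eta> \<delta> = {u \<in> space (cond_law n). (\<forall>k\<in>{..n}. 0 < u k \<and> u k < 1) \<and>
     cmod (\<Sum>k\<le>n. of_real (u k ^ n) * z ^ k) < \<eta> * u i ^ n * cmod z ^ i \<and> \<delta> \<le> u i - sqrt (u (i - 1) * u (i + 1))}"

lemma sets_anticonc_event:
  assumes i: "0 < i" "i < n"
  shows "anticonc_event n z i \<eta> \<delta> \<in> sets (cond_law n)"
proof -
  have m: "(\<lambda>u. u k) \<in> borel_measurable (cond_law n)" if "k \<le> n" for k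
    using measurable_iid_component[OF that] by simp
  have sq: "(\<lambda>u. sqrt (u (i - 1) * u (i + 1))) \<in> borel_measurable (cond_law n)"
    by (intro measurable_compose[OF _ borel_measurable_sqrt] borel_measurable_times m) (use i in linarith)+
  have P: "(\<lambda>u. \<Sum>k\<le>n. of_real (u k ^ n) * z ^ k :: complex) \<in> borel_measurable (cond_law n)"
    by (intro borel_measurable_sum borel_measurable_times borel_measurable_const measurable_compose[OF _ borel_measurable_of_real] borel_measurable_power m) auto
  have Pn: "(\<lambda>u. cmod (\<Sum>k\<le>n. of_real (u k ^ n) * z ^ k)) \<in> borel_measurable (cond_law n)"
    by (rule measurable_compose[OF P borel_measurable_norm])
  show ?thesis
    unfolding anticonc_event_def using i
    by (intro sets.sets_Collect_conj sets.sets_Collect_finite_All borel_measurable_le borel_measurable_less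
        borel_measurable_times borel_measurable_power borel_measurable_diff sq m Pn borel_measurable_const) auto
qed

text \<open>Lowering coordinate \<open>i\<close> relaxes the constraints centred at its neighbours,
  so only the one centred at \<open>i\<close> restricts the range.\<close>

lemma log_concave_slice:
  assumes x: "x(i := y0) \<in> log_concave_event n" and pos: "\<forall>k\<le>n. 0 < (x(i := y0)) k"
    and i: "0 < i" "i < n" and y: "sqrt (x (i - 1) * x (i + 1)) \<le> y" "y \<le> y0"
  shows "x(i := y) \<in> log_concave_event n"
proof -
  let ?v = "x(i := y0)" and ?w = "x(i := y)"
  have sp: "?w \<in> space (iid_uniform n)"
    using x i by (auto simp: log_concave_event_def iid_uniform_def space_PiM PiE_def extensional_def)
  have le: "i - 1 \<le> n" "i - 1 \<noteq> i" "i + 1 \<le> n" using i by auto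
  have nb: "0 < x (i - 1)" "0 < x (i + 1)"
    using pos[rule_format, OF le(1)] pos[rule_format, OF le(3)] le(2) by auto
  have lc: "?v (k - 1) * ?v (k + 1) \<le> (?v k)\<^sup>2" if "1 \<le> k" "k < n" for k
    using x that by (auto simp: log_concave_event_def simp del: fun_upd_apply)
  have "?w (k - 1) * ?w (k + 1) \<le> (?w k)\<^sup>2" if k: "1 \<le> k" "k < n" for k
  proof -
    consider "k = i" | "k = i + 1" | "k + 1 = i" | "k \<noteq> i" "k - 1 \<noteq> i" "k + 1 \<noteq> i" by linarith
    then show ?thesis
    proof cases
      case 1
      have "sqrt (x (i - 1) * x (i + 1)) ^ 2 \<le> y\<^sup>2"
        using y(1) nb by (intro power_mono) auto
      then show ?thesis
        using 1 i nb le by simp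
    next
      case 2
      have "y * x (k + 1) \<le> y0 * x (k + 1)"
        using y(2) pos[rule_format, of "k + 1"] 2 k i by (intro mult_right_mono) auto
      then show ?thesis using lc[OF k] 2 i by simp
    next
      case 3
      have "k - 1 \<le> n" "k - 1 \<noteq> i" using 3 k by auto
      then have "x (k - 1) * y \<le> x (k - 1) * y0"
        using y(2) pos[rule_format, of "k - 1"] 3 k i by (intro mult_left_mono) auto
      then show ?thesis using lc[OF k] 3 k by auto
    next
      case 4
      then show ?thesis using lc[OF k] by simp
    qed
  qed
  then show ?thesis using sp by (auto simp: log_concave_event_def simp del: fun_upd_apply)
qed

lemma emeasure_unif01_Icc:
  assumes "0 \<le> a" "a \<le> b" "b < 1"
  shows "ennreal (b - a) \<le> emeasure unif01 {a..b}"
proof -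
  have "emeasure unif01 {a..b} = emeasure lborel ({0<..<1} \<inter> {a..b})"
    by (subst emeasure_uniform_measure) (auto simp: divide_ennreal_def)
  moreover have "emeasure lborel {a<..b} \<le> emeasure lborel ({0<..<1} \<inter> {a..b})"
    using assms by (intro emeasure_mono) auto
  ultimately show ?thesis using assms by simp
qed

lemma emeasure_unif01_Icc_le:
  assumes "a \<le> b"
  shows "emeasure unif01 {a..b} \<le> ennreal (b - a)"
proof -
  have "emeasure unif01 {a..b} = emeasure lborel ({0<..<1} \<inter> {a..b})"
    by (subst emeasure_uniform_measure) (auto simp: divide_ennreal_def)
  also have "\<dots> \<le> emeasure lborel {a..b}"
    by (intro emeasure_mono) auto
  finally show ?thesis using assms by simp
qed

text \<open>Fibre by fibre in coordinate \<open>i\<close>: all bad values lie within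
  \<open>4 * \<eta>\<close> of any one bad value, while the log-concave fibre contains an interval
  of length at least \<open>\<delta>\<close> ending at that value. The ratio of the lengths survives
  integration over the other coordinates.\<close>

lemma anticonc:
  assumes i: "0 < i" "i < n" and z: "z \<noteq> 0" and eta: "0 < \<eta>" "\<eta> \<le> 1/2" and d: "\<delta> > 0"
  shows "measure (cond_law n) (anticonc_event n z i \<eta> \<delta>) \<le> 8 * \<eta> / \<delta>"
proof -
  let ?I = "{..n} - {i}" and ?L = "log_concave_event n"
  let ?E = "anticonc_event n z i \<eta> \<delta> \<inter> ?L"
  have E_sets: "?E \<in> sets (iid_uniform n)"
    using sets_anticonc_event[OF i, of z \<eta> \<delta>] sets_log_concave_event by auto
  have ins: "{..n} = insert i ?I" using i by auto
  have Ei: "iid_uniform n = PiM (insert i ?I) (\<lambda>_. unif01)"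
    unfolding iid_uniform_def ins[symmetric] ..
  have slice: "(\<integral>\<^sup>+u. indicator A u \<partial>iid_uniform n) = (\<integral>\<^sup>+x. \<integral>\<^sup>+y. indicator A (x(i := y)) \<partial>unif01 \<partial>PiM ?I (\<lambda>_. unif01))"
    if "A \<in> sets (iid_uniform n)" for A
    unfolding Ei by (rule unif01.product_nn_integral_insert) (use that in \<open>auto simp: Ei\<close>)
  have meas: "(\<lambda>x. \<integral>\<^sup>+y. indicator ?L (x(i := y)) \<partial>unif01) \<in> borel_measurable (PiM ?I (\<lambda>_. unif01))"
  proof (rule sigma_finite_measure.borel_measurable_nn_integral)
    show "sigma_finite_measure unif01" by (rule unif01.sigma_finite_measures)
    have "(\<lambda>(x, y). x(i := y)) \<in> measurable (PiM ?I (\<lambda>_. unif01) \<Otimes>\<^sub>M unif01) (PiM (insert i ?I) (\<lambda>_. unif01))"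
      by (rule measurable_add_dim)
    then have "(\<lambda>p. indicator ?L ((\<lambda>(x, y). x(i := y)) p) :: ennreal) \<in> borel_measurable (PiM ?I (\<lambda>_. unif01) \<Otimes>\<^sub>M unif01)"
      by (rule measurable_compose) (use sets_log_concave_event[of n] in \<open>simp add: Ei\<close>)
    then show "(\<lambda>(x, y). indicator ?L (x(i := y)) :: ennreal) \<in> borel_measurable (PiM ?I (\<lambda>_. unif01) \<Otimes>\<^sub>M unif01)"
      by (simp add: case_prod_beta')
  qed
  have inner: "(\<integral>\<^sup>+y. indicator ?E (x(i := y)) \<partial>unif01) \<le> ennreal (8 * \<eta> / \<delta>) * (\<integral>\<^sup>+y. indicator ?L (x(i := y)) \<partial>unif01)" for x
  proof (cases "\<exists>y. x(i := y) \<in> ?E")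
    case False
    then show ?thesis by simp
  next
    case True
    then obtain y0 where y0: "x(i := y0) \<in> ?E" by blast
    let ?s = "sqrt (x (i - 1) * x (i + 1))"
    \<comment> \<open>After division by \<open>z ^ i\<close> the polynomial is
      \<open>a + y ^ n\<close>, with \<open>a\<close> independent of the varied coordinate
      \<open>y\<close>.\<close>
    define a where "a = (\<Sum>k\<in>?I. of_real (x k ^ n) * z ^ k) / z ^ i"
    have mem: "0 < y \<and> y < 1 \<and> cmod (a + of_real (y ^ n)) < \<eta> * y ^ n \<and> \<delta> \<le> y - ?s"
      if "x(i := y) \<in> ?E" for y
    proof -
      have "(\<Sum>k\<le>n. of_real ((x(i := y)) k ^ n) * z ^ k) = of_real (y ^ n) * z ^ i + (\<Sum>k\<in>?I. of_real ((x(i := y)) k ^ n) * z ^ k)"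
        using i by (subst sum.remove[of _ i]) auto
      also have "(\<Sum>k\<in>?I. of_real ((x(i := y)) k ^ n) * z ^ k) = a * z ^ i"
      proof -
        have "(\<Sum>k\<in>?I. of_real ((x(i := y)) k ^ n) * z ^ k) = (\<Sum>k\<in>?I. of_real (x k ^ n) * z ^ k)"
          by (rule sum.cong) auto
        then show ?thesis unfolding a_def using z by simp
      qed
      finally have "(\<Sum>k\<le>n. of_real ((x(i := y)) k ^ n) * z ^ k) = (a + of_real (y ^ n)) * z ^ i"
        by (simp add: algebra_simps)
      moreover have "cmod (\<Sum>k\<le>n. of_real ((x(i := y)) k ^ n) * z ^ k) < \<eta> * y ^ n * cmod z ^ i"
        using that by (auto simp: anticonc_event_def)
      ultimately have "cmod (a + of_real (y ^ n)) * cmod z ^ i < \<eta> * y ^ n * cmod z ^ i"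
        by (simp add: norm_mult norm_power)
      then have "cmod (a + of_real (y ^ n)) < \<eta> * y ^ n"
        using z by (subst (asm) mult_less_cancel_right_pos) auto
      moreover have "i - Suc 0 \<noteq> i" using i by simp
      then have "0 < y \<and> y < 1" "\<delta> \<le> y - ?s"
        using that i by (auto simp: anticonc_event_def dest: bspec[of _ _ i])
      ultimately show ?thesis by blast
    qed
    have "(\<integral>\<^sup>+y. indicator ?E (x(i := y)) \<partial>unif01) \<le> (\<integral>\<^sup>+y. indicator {y0 - 4 * \<eta>..y0 + 4 * \<eta>} y \<partial>unif01)"
    proof (rule nn_integral_mono)
      fix y
      show "(indicator ?E (x(i := y)) :: ennreal) \<le> indicator {y0 - 4 * \<eta>..y0 + 4 * \<eta>} y"
      proof (cases "x(i := y) \<in> ?E")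
        case True
        have "y - y0 \<le> 4 * \<eta>" "y0 - y \<le> 4 * \<eta>"
          using mem[OF True] mem[OF y0] i eta by (auto intro!: power_near_opposite[of n \<eta> _ _ a])
        then show ?thesis using True by simp
      qed simp
    qed
    also have "\<dots> = emeasure unif01 {y0 - 4 * \<eta>..y0 + 4 * \<eta>}"
      by (rule nn_integral_indicator) simp
    also have "\<dots> \<le> ennreal ((y0 + 4 * \<eta>) - (y0 - 4 * \<eta>))"
      using eta by (intro emeasure_unif01_Icc_le) auto
    also have "\<dots> \<le> ennreal (8 * \<eta> / \<delta> * (y0 - ?s))"
    proof (rule ennreal_leI)
      have "8 * \<eta> / \<delta> * \<delta> \<le> 8 * \<eta> / \<delta> * (y0 - ?s)"
        using mem[OF y0] d eta by (intro mult_left_mono) auto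
      then show "y0 + 4 * \<eta> - (y0 - 4 * \<eta>) \<le> 8 * \<eta> / \<delta> * (y0 - ?s)" using d by simp
    qed
    also have "\<dots> = ennreal (8 * \<eta> / \<delta>) * ennreal (y0 - ?s)"
      using d eta by (intro ennreal_mult') auto
    also have "ennreal (y0 - ?s) \<le> emeasure unif01 {?s..y0}"
    proof (rule emeasure_unif01_Icc)
      have pos: "0 < (x(i := y0)) (i - 1)" "0 < (x(i := y0)) (i + 1)"
        using y0 i by (auto simp: anticonc_event_def simp del: fun_upd_apply)
      moreover have "i - 1 \<noteq> i" using i by simp
      ultimately show "0 \<le> ?s" using i by simp
    qed (use mem[OF y0] d in auto)
    also have "\<dots> = (\<integral>\<^sup>+y. indicator {?s..y0} y \<partial>unif01)"
      by (rule nn_integral_indicator[symmetric]) simp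
    also have "\<dots> \<le> (\<integral>\<^sup>+y. indicator ?L (x(i := y)) \<partial>unif01)"
    proof (rule nn_integral_mono)
      fix y
      show "(indicator {?s..y0} y :: ennreal) \<le> indicator ?L (x(i := y))"
      proof (cases "y \<in> {?s..y0}")
        case True
        have "x(i := y) \<in> ?L"
          using y0 True i by (intro log_concave_slice[of x i y0 n y]) (auto simp: anticonc_event_def simp del: fun_upd_apply)
        then show ?thesis using True by simp
      qed simp
    qed
    finally show ?thesis by (simp add: mult_left_mono del: fun_upd_apply)
  qed
  have "emeasure (iid_uniform n) ?E = (\<integral>\<^sup>+u. indicator ?E u \<partial>iid_uniform n)"
    using E_sets by simp
  also have "\<dots> = (\<integral>\<^sup>+x. \<integral>\<^sup>+y. indicator ?E (x(i := y)) \<partial>unif01 \<partial>PiM ?I (\<lambda>_. unif01))"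
    by (rule slice[OF E_sets])
  also have "\<dots> \<le> (\<integral>\<^sup>+x. ennreal (8 * \<eta> / \<delta>) * (\<integral>\<^sup>+y. indicator ?L (x(i := y)) \<partial>unif01) \<partial>PiM ?I (\<lambda>_. unif01))"
    by (intro nn_integral_mono inner)
  also have "\<dots> = ennreal (8 * \<eta> / \<delta>) * (\<integral>\<^sup>+x. (\<integral>\<^sup>+y. indicator ?L (x(i := y)) \<partial>unif01) \<partial>PiM ?I (\<lambda>_. unif01))"
    by (rule nn_integral_cmult[OF meas])
  also have "\<dots> = ennreal (8 * \<eta> / \<delta>) * (\<integral>\<^sup>+u. indicator ?L u \<partial>iid_uniform n)"
    by (simp only: slice[OF sets_log_concave_event])
  also have "\<dots> = ennreal (8 * \<eta> / \<delta>) * ennreal (total_weight n)"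
    by (simp add: emeasure_log_concave_event)
  also have "\<dots> = ennreal (8 * \<eta> / \<delta> * total_weight n)"
    by (rule ennreal_mult''[symmetric]) (use total_weight_pos[of n] in simp)
  finally have le: "emeasure (iid_uniform n) ?E \<le> ennreal (8 * \<eta> / \<delta> * total_weight n)" .
  have "emeasure (cond_law n) (anticonc_event n z i \<eta> \<delta>) = emeasure (iid_uniform n) ?E / ennreal (total_weight n)"
    unfolding cond_law_def using sets_anticonc_event[OF i, of z \<eta> \<delta>]
    by (subst emeasure_uniform_measure) (auto simp: emeasure_log_concave_event Int_commute)
  also have "\<dots> \<le> ennreal (8 * \<eta> / \<delta> * total_weight n) / ennreal (total_weight n)"
    by (rule divide_right_mono_ennreal[OF le])
  also have "\<dots> = ennreal (8 * \<eta> / \<delta>)"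
    using total_weight_pos[of n] d eta by (subst divide_ennreal) auto
  finally show ?thesis
    unfolding measure_def using d eta by (intro enn2real_leI) auto
qed

section \<open>Logarithmic means and the limit measure\<close>

text \<open>The integrand is the real part of \<open>Ln (1 + q * w)\<close>, holomorphic on the
  closed unit disc, so its circle mean is the value \<open>0\<close> at the centre.\<close>

lemma circle_mean_ln_unit:
  assumes q: "cmod q < 1"
  shows "((\<lambda>x. ln (cmod (1 + q * cis (2 * pi * x)))) has_integral 0) {0..1}"
proof -
  let ?f = "\<lambda>w. Ln (1 + q * w)"
  have re: "0 < Re (1 + q * w)" if "cmod w \<le> 1" for w
  proof -
    have "cmod (q * w) \<le> cmod q * 1" unfolding norm_mult using that by (intro mult_left_mono) auto
    then have "\<bar>Re (q * w)\<bar> < 1" using abs_Re_le_cmod[of "q * w"] q by linarith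
    then show ?thesis by simp
  qed
  have "?f holomorphic_on cball 0 1"
  proof (intro holomorphic_intros)
    fix w :: complex assume "w \<in> cball 0 1"
    then show "1 + q * w \<notin> \<real>\<^sub>\<le>\<^sub>0" using re[of w] by (auto simp: complex_nonpos_Reals_iff)
  qed
  then have "((\<lambda>u. ?f u / (u - 0)) has_contour_integral 2 * complex_of_real pi * \<i> * ?f 0) (circlepath 0 1)"
    by (rule Cauchy_integral_circlepath_simple) simp
  then have "((\<lambda>x. ?f (circlepath 0 1 x) / (circlepath 0 1 x - 0) * vector_derivative (circlepath 0 1) (at x)) has_integral 0) {0..1}"
    by (simp add: has_contour_integral)
  moreover have "circlepath 0 1 x = cis (2 * pi * x)" for x
    by (simp add: circlepath_def part_circlepath_def cis_conv_exp linepath_def mult_ac scaleR_conv_of_real)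
  moreover have "vector_derivative (circlepath 0 1) (at x) = 2 * pi * \<i> * cis (2 * pi * x)" for x
    by (simp add: vector_derivative_circlepath cis_conv_exp mult_ac)
  ultimately have "((\<lambda>x. ?f (cis (2 * pi * x)) * (2 * pi * \<i>)) has_integral 0) {0..1}"
    by (simp add: mult_ac)
  then have "((\<lambda>x. ?f (cis (2 * pi * x)) * (2 * pi * \<i>) * (1 / (2 * pi * \<i>))) has_integral 0 * (1 / (2 * pi * \<i>))) {0..1}"
    by (rule has_integral_mult_left)
  then have "((\<lambda>x. ?f (cis (2 * pi * x))) has_integral 0) {0..1}" by simp
  from has_integral_linear[OF this bounded_linear_Re]
  have "((\<lambda>x. Re (?f (cis (2 * pi * x)))) has_integral 0) {0..1}" by (simp add: o_def)
  moreover have "Re (?f (cis (2 * pi * x))) = ln (cmod (1 + q * cis (2 * pi * x)))" for x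
  proof -
    have r: "0 < Re (1 + q * cis (2 * pi * x))" by (rule re) simp
    have "1 + q * cis (2 * pi * x) \<noteq> 0"
    proof
      assume "1 + q * cis (2 * pi * x) = 0"
      from r[unfolded this] show False by simp
    qed
    then show ?thesis by (rule Re_Ln)
  qed
  ultimately show ?thesis by simp
qed

text \<open>Jensen's formula for a single root: the dominant modulus is factored out and the
  remaining factor has mean \<open>0\<close>. Equal moduli would put a singularity on the
  circle.\<close>

lemma circle_mean_ln:
  assumes "cmod z \<noteq> cmod a"
  shows "((\<lambda>x. ln (cmod (z + a * cis (2 * pi * x)))) has_integral ln (max (cmod a) (cmod z))) {0..1}"
proof -
  have add_const: "((\<lambda>x. ln R + f x) has_integral ln R) {0..1}"
    if "(f has_integral 0) {0..1}" for f :: "real \<Rightarrow> real" and R :: real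
    using has_integral_add[OF has_integral_const_real[of "ln R" 0 1] that] by simp
  consider "cmod a < cmod z" | "cmod z < cmod a" using assms by linarith
  then show ?thesis
  proof cases
    case 1
    then have z: "z \<noteq> 0" by auto
    have q: "cmod (a / z) < 1" using 1 z by (simp add: norm_divide)
    have ne: "1 + a / z * cis (2 * pi * x) \<noteq> 0" for x
    proof
      assume "1 + a / z * cis (2 * pi * x) = 0"
      then have "a / z * cis (2 * pi * x) = - 1" by (simp add: eq_neg_iff_add_eq_0 add.commute)
      then have "cmod (a / z) * cmod (cis (2 * pi * x)) = 1" unfolding norm_mult[symmetric] by simp
      then show False using q by simp
    qed
    have "ln (cmod (z + a * cis (2 * pi * x))) = ln (cmod z) + ln (cmod (1 + a / z * cis (2 * pi * x)))" for x
    proof -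
      have "z + a * cis (2 * pi * x) = z * (1 + a / z * cis (2 * pi * x))" using z by (simp add: field_simps)
      then have eq: "cmod (z + a * cis (2 * pi * x)) = cmod z * cmod (1 + a / z * cis (2 * pi * x))"
        by (simp only: norm_mult)
      show ?thesis unfolding eq
        by (rule ln_mult_pos) (use z ne[of x] in \<open>simp_all only: zero_less_norm_iff not_False_eq_True\<close>)
    qed
    then show ?thesis using add_const[OF circle_mean_ln_unit[OF q], of "cmod z"] 1 by simp
  next
    case 2
    then have a: "a \<noteq> 0" by auto
    \<comment> \<open>On the unit circle \<open>w * cnj w = 1\<close>, so \<open>z + a * w\<close>
      is \<open>a * w\<close> times the conjugate of \<open>1 + cnj (z / a) * w\<close>, which
      brings the small quotient into the required form.\<close>
    have q: "cmod (cnj (z / a)) < 1" using 2 a by (simp add: norm_divide)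
    have ne: "1 + cnj (z / a) * cis (2 * pi * x) \<noteq> 0" for x
    proof
      assume "1 + cnj (z / a) * cis (2 * pi * x) = 0"
      then have "cnj (z / a) * cis (2 * pi * x) = - 1" by (simp add: eq_neg_iff_add_eq_0 add.commute)
      then have "cmod (cnj (z / a)) * cmod (cis (2 * pi * x)) = 1" unfolding norm_mult[symmetric] by simp
      then show False using q by simp
    qed
    have "ln (cmod (z + a * cis (2 * pi * x))) = ln (cmod a) + ln (cmod (1 + cnj (z / a) * cis (2 * pi * x)))" for x
    proof -
      have c: "cis (2 * pi * x) * cnj (cis (2 * pi * x)) = 1" by (simp add: cis_cnj cis_mult)
      have "z + a * cis (2 * pi * x) = a * cis (2 * pi * x) * cnj (1 + cnj (z / a) * cis (2 * pi * x))"
      proof -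
        have "a * cis (2 * pi * x) * cnj (1 + cnj (z / a) * cis (2 * pi * x))
          = a * cis (2 * pi * x) + a * (z / a) * (cis (2 * pi * x) * cnj (cis (2 * pi * x)))"
          by (simp add: algebra_simps)
        then show ?thesis unfolding c using a by simp
      qed
      then have eq: "cmod (z + a * cis (2 * pi * x)) = cmod a * cmod (1 + cnj (z / a) * cis (2 * pi * x))"
        by (simp only: norm_mult complex_mod_cnj norm_cis mult_1_right)
      show ?thesis unfolding eq
        by (rule ln_mult_pos) (use a ne[of x] in \<open>simp_all only: zero_less_norm_iff not_False_eq_True\<close>)
    qed
    then show ?thesis using add_const[OF circle_mean_ln_unit[OF q], of "cmod a"] 2 by simp
  qed
qed

lemma continuous_cis_2pi: "continuous_on A (\<lambda>x. cis (2 * pi * x))"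
  by (intro continuous_intros)

lemma measurable_cis_2pi [measurable]: "(\<lambda>x. cis (2 * pi * x)) \<in> borel_measurable borel"
  by (intro borel_measurable_continuous_onI continuous_cis_2pi)

lemma nn_integral_unif01_has_integral:
  fixes g :: "real \<Rightarrow> real"
  assumes "g \<in> borel_measurable borel" "\<And>x. 0 \<le> g x" "(g has_integral I) {0..1}"
  shows "(\<integral>\<^sup>+x. ennreal (g x) \<partial>unif01) = ennreal I"
proof -
  have "(\<integral>\<^sup>+x. ennreal (g x) \<partial>unif01) = (\<integral>\<^sup>+x. ennreal (g x) * indicator {0<..<1} x \<partial>lborel)"
    using assms(1) by (intro nn_integral_unif01) measurable
  also have "\<dots> = (\<integral>\<^sup>+x. ennreal (g x * indicator {0<..<1} x) \<partial>lborel)"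
    by (intro nn_integral_cong) (auto simp: indicator_def)
  also have "\<dots> = ennreal I"
  proof (rule nn_integral_has_integral_lborel)
    have "(g has_integral I) {0<..<1}" using assms(3) by (simp add: has_integral_Icc_iff_Ioo)
    then have "((\<lambda>x. if x \<in> {0<..<1} then g x else 0) has_integral I) UNIV"
      by (simp only: has_integral_restrict_UNIV)
    then show "((\<lambda>x. g x * indicator {0<..<1} x) has_integral I) UNIV"
      by (rule has_integral_eq[rotated]) auto
    show "(\<lambda>x. g x * indicator {0<..<1} x) \<in> borel_measurable borel"
      using assms(1) by (intro borel_measurable_times borel_measurable_indicator) auto
  qed (use assms in auto)
  finally show ?thesis .
qed

text \<open>Subtracting the logarithm from an upper bound \<open>C\<close> makes the integrand
  nonnegative, so that integrals can be exchanged later without integrability conditions.\<close>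

lemma circle_nn_integral_ln:
  assumes za: "cmod z \<noteq> cmod a" and C: "ln (cmod z + cmod a) \<le> C"
  shows "(\<integral>\<^sup>+x. ennreal (C - ln (cmod (z + a * cis (2 * pi * x)))) \<partial>unif01) = ennreal (C - ln (max (cmod a) (cmod z)))"
proof (rule nn_integral_unif01_has_integral)
  show "(\<lambda>x. C - ln (cmod (z + a * cis (2 * pi * x)))) \<in> borel_measurable borel" by measurable
  show "0 \<le> C - ln (cmod (z + a * cis (2 * pi * x)))" for x
  proof -
    have "z + a * cis (2 * pi * x) \<noteq> 0"
    proof
      assume "z + a * cis (2 * pi * x) = 0"
      then have "z = - (a * cis (2 * pi * x))" by (simp add: eq_neg_iff_add_eq_0)
      then have "cmod z = cmod a" by (simp add: norm_mult)
      then show False using za by simp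
    qed
    moreover have "cmod (z + a * cis (2 * pi * x)) \<le> cmod z + cmod a"
      by (rule order_trans[OF norm_triangle_ineq]) (simp add: norm_mult)
    ultimately have "ln (cmod (z + a * cis (2 * pi * x))) \<le> ln (cmod z + cmod a)"
      by (intro ln_mono) auto
    then show ?thesis using C by simp
  qed
  show "((\<lambda>x. C - ln (cmod (z + a * cis (2 * pi * x)))) has_integral C - ln (max (cmod a) (cmod z))) {0..1}"
    using has_integral_diff[OF has_integral_const_real[of C 0 1] circle_mean_ln[OF za]] by simp
qed

section \<open>Planar Lebesgue measure under rotations and in polar form\<close>

lemma nn_integral_lborel_translate:
  fixes f :: "'a::euclidean_space \<Rightarrow> ennreal"
  assumes [measurable]: "f \<in> borel_measurable borel"
  shows "(\<integral>\<^sup>+x. f (c + x) \<partial>lborel) = (\<integral>\<^sup>+x. f x \<partial>lborel)"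
proof -
  have "(\<integral>\<^sup>+x. f x \<partial>lborel) = (\<integral>\<^sup>+x. f x \<partial>distr lborel borel ((+) c))"
    by (simp only: lborel_distr_plus)
  also have "\<dots> = (\<integral>\<^sup>+x. f (c + x) \<partial>lborel)"
    by (rule nn_integral_distr) auto
  finally show ?thesis ..
qed

text \<open>The rotated measure of \<open>E\<close> is multiplied by the area of the unit disc. Two
  exchanges of integrals and two translations turn this product into the Lebesgue measure of
  \<open>E\<close> times the same area, because the disc is rotation invariant; the positive finite
  area cancels.\<close>

lemma lborel_distr_rotate:
  fixes c :: complex
  assumes c: "cmod c = 1"
  shows "distr lborel borel ((*) c) = lborel"
proof (rule measure_eqI)
  fix E :: "complex set" assume "E \<in> sets (distr lborel borel ((*) c))"
  then have E [measurable]: "E \<in> sets borel" by simp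
  have c0: "c \<noteq> 0" using c by auto
  let ?B = "{x. cmod x < 1}"
  have B: "?B \<in> sets borel" by measurable
  let ?\<beta> = "emeasure lborel ?B"
  have "?B = ball 0 1" by auto
  then have \<beta>: "?\<beta> = ennreal pi" by (simp add: emeasure_ball unit_ball_vol_2)
  have iE: "(\<lambda>p::complex\<times>complex. indicator E (f p) :: ennreal) \<in> borel_measurable (borel \<Otimes>\<^sub>M borel)"
    if "f \<in> borel_measurable (borel \<Otimes>\<^sub>M borel)" for f using that by measurable
  have swap: "(\<integral>\<^sup>+x. \<integral>\<^sup>+y. g x y \<partial>lborel \<partial>lborel) = (\<integral>\<^sup>+y. \<integral>\<^sup>+x. g x y \<partial>lborel \<partial>lborel)"
    if "case_prod g \<in> borel_measurable (borel \<Otimes>\<^sub>M borel)" for g :: "complex \<Rightarrow> complex \<Rightarrow> ennreal"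
    using that by (intro lborel_pair.Fubini'[symmetric]) (simp cong: measurable_cong_sets sets_pair_measure_cong)
  have "emeasure (distr lborel borel ((*) c)) E * ?\<beta> = (\<integral>\<^sup>+t. indicator E (c * t) \<partial>lborel) * ?\<beta>"
  proof -
    have "emeasure (distr lborel borel ((*) c)) E = (\<integral>\<^sup>+t. indicator E t \<partial>distr lborel borel ((*) c))"
      by simp
    also have "\<dots> = (\<integral>\<^sup>+t. indicator E (c * t) \<partial>lborel)" by (rule nn_integral_distr) auto
    finally show ?thesis by simp
  qed
  also have "\<dots> = (\<integral>\<^sup>+t. indicator E (c * t) * ?\<beta> \<partial>lborel)"
    by (rule nn_integral_multc[symmetric]) measurable
  also have "\<dots> = (\<integral>\<^sup>+t. \<integral>\<^sup>+y. indicator E (c * t) * indicator ?B (y - c * t) \<partial>lborel \<partial>lborel)"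
  proof (rule nn_integral_cong)
    fix t
    have "?\<beta> = (\<integral>\<^sup>+y. indicator ?B y \<partial>lborel)" by simp
    also have "\<dots> = (\<integral>\<^sup>+y. indicator ?B (- (c * t) + y) \<partial>lborel)"
      by (rule nn_integral_lborel_translate[symmetric]) measurable
    finally have "?\<beta> = (\<integral>\<^sup>+y. indicator ?B (y - c * t) \<partial>lborel)" by simp
    then show "indicator E (c * t) * ?\<beta> = (\<integral>\<^sup>+y. indicator E (c * t) * indicator ?B (y - c * t) \<partial>lborel)"
      by (simp add: nn_integral_cmult)
  qed
  also have "\<dots> = (\<integral>\<^sup>+y. \<integral>\<^sup>+t. indicator E (c * t) * indicator ?B (y - c * t) \<partial>lborel \<partial>lborel)"
    by (rule swap) measurable
  also have "\<dots> = (\<integral>\<^sup>+y. \<integral>\<^sup>+t. indicator E (y + c * t) * indicator ?B (- (c * t)) \<partial>lborel \<partial>lborel)"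
  proof (rule nn_integral_cong)
    fix y
    have "(\<integral>\<^sup>+t. indicator E (c * t) * indicator ?B (y - c * t) \<partial>lborel)
       = (\<integral>\<^sup>+t. indicator E (c * (y / c + t)) * indicator ?B (y - c * (y / c + t)) \<partial>lborel)"
      by (rule nn_integral_lborel_translate[symmetric]) measurable
    then show "(\<integral>\<^sup>+t. indicator E (c * t) * indicator ?B (y - c * t) \<partial>lborel)
       = (\<integral>\<^sup>+t. indicator E (y + c * t) * indicator ?B (- (c * t)) \<partial>lborel)"
      using c0 by (simp add: distrib_left)
  qed
  also have "\<dots> = (\<integral>\<^sup>+t. \<integral>\<^sup>+y. indicator E (y + c * t) * indicator ?B (- (c * t)) \<partial>lborel \<partial>lborel)"
    by (rule swap) measurable
  also have "\<dots> = (\<integral>\<^sup>+t. emeasure lborel E * indicator ?B t \<partial>lborel)"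
  proof (rule nn_integral_cong)
    fix t
    have bt: "indicator ?B (- (c * t)) = (indicator ?B t :: ennreal)"
      using c by (simp add: indicator_def norm_mult)
    have "(\<integral>\<^sup>+y. indicator E (y + c * t) * indicator ?B (- (c * t)) \<partial>lborel)
      = (\<integral>\<^sup>+y. indicator E (c * t + y) \<partial>lborel) * indicator ?B (- (c * t))"
      by (subst nn_integral_multc[symmetric]) (auto simp: add.commute)
    also have "(\<integral>\<^sup>+y. indicator E (c * t + y) \<partial>lborel) = (\<integral>\<^sup>+y. indicator E y \<partial>lborel)"
      by (rule nn_integral_lborel_translate) measurable
    also have "(\<integral>\<^sup>+y. indicator E y \<partial>lborel) * indicator ?B (- (c * t)) = emeasure lborel E * indicator ?B t"
      by (simp add: bt)
    finally show "(\<integral>\<^sup>+y. indicator E (y + c * t) * indicator ?B (- (c * t)) \<partial>lborel) = emeasure lborel E * indicator ?B t" .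
  qed
  also have "\<dots> = emeasure lborel E * ?\<beta>"
    by (subst nn_integral_cmult) auto
  finally show "emeasure (distr lborel borel ((*) c)) E = emeasure lborel E"
    unfolding \<beta> by (simp add: ennreal_mult_cancel_left mult.commute[of _ "ennreal pi"])
qed simp

text \<open>Half-lines generate the Borel sets, and on them the left side is the area of a
  disc.\<close>

lemma lborel_distr_cmod: "distr lborel borel cmod = density lborel (\<lambda>r. ennreal (2 * pi * r) * indicator {0..} r)"
proof (rule measure_eqI_generator_eq)
  let ?M = "distr lborel borel cmod" and ?N = "density lborel (\<lambda>r. ennreal (2 * pi * r) * indicator {0..} r)"
  show "Int_stable (range atMost :: real set set)"
    by (auto simp: Int_stable_def)
  show "sets ?M = sigma_sets UNIV (range atMost)" "sets ?N = sigma_sets UNIV (range atMost)"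
    by (simp_all add: borel_eq_atMost)
  have M: "emeasure ?M {..a} = ennreal (pi * a\<^sup>2 * of_bool (0 \<le> a))" for a
  proof -
    have "emeasure ?M {..a} = emeasure lborel (cball (0::complex) a)"
      by (subst emeasure_distr) (auto intro!: arg_cong[of _ _ "emeasure lborel"] simp: vimage_def)
    then show ?thesis by (cases "0 \<le> a") (auto simp: emeasure_cball unit_ball_vol_2)
  qed
  have N: "emeasure ?N {..a} = ennreal (pi * a\<^sup>2 * of_bool (0 \<le> a))" for a
  proof -
    have "emeasure ?N {..a} = (\<integral>\<^sup>+r. ennreal (2 * pi * r) * indicator {0..} r * indicator {..a} r \<partial>lborel)"
      by (rule emeasure_density) auto
    also have "\<dots> = (\<integral>\<^sup>+r. ennreal (2 * pi * r) * indicator {0..a} r \<partial>lborel)"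
      by (intro nn_integral_cong) (auto simp: indicator_def)
    also have "\<dots> = ennreal (pi * a\<^sup>2 * of_bool (0 \<le> a))"
    proof (cases "0 \<le> a")
      case True
      have "(\<integral>\<^sup>+r. ennreal (2 * pi * r) * indicator {0..a} r \<partial>lborel) = ennreal (pi * a\<^sup>2 - pi * 0\<^sup>2)"
        by (rule nn_integral_FTC_Icc) (use True in \<open>auto intro!: derivative_eq_intros\<close>)
      then show ?thesis using True by simp
    qed simp
    finally show ?thesis .
  qed
  show "emeasure ?M X = emeasure ?N X" if "X \<in> range atMost" for X
    using that M N by auto
  show "range (\<lambda>i::nat. {..real i}) \<subseteq> range atMost" by auto
  show "(\<Union>i::nat. {..real i}) = UNIV" by (auto simp: real_arch_simple)
  show "emeasure ?M {..real i} \<noteq> \<infinity>" for i :: nat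
    unfolding M by simp
qed simp

section \<open>Radial law and potential of the limit measure\<close>

definition radial_density :: "real \<Rightarrow> real" where
  "radial_density r = 2 / (r * (4 + \<bar>ln r\<bar>)\<^sup>2)"

lemma measurable_radial_density [measurable]: "radial_density \<in> borel_measurable borel"
  unfolding radial_density_def by measurable

lemma radial_density_nonneg: "0 \<le> r \<Longrightarrow> 0 \<le> radial_density r"
  by (simp add: radial_density_def)

lemma sets_limit_measure [measurable_cong, simp]: "sets limit_measure = sets borel"
  by (simp add: limit_measure_def)

lemma space_limit_measure [simp]: "space limit_measure = UNIV"
  by (simp add: limit_measure_def)

lemma nn_integral_limit_radial:
  assumes g [measurable]: "g \<in> borel_measurable borel"
  shows "(\<integral>\<^sup>+z. g (cmod z) \<partial>limit_measure) = (\<integral>\<^sup>+r. ennreal (radial_density r) * indicator {0<..} r * g r \<partial>lborel)"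
proof -
  let ?F = "\<lambda>r. ennreal (1 / (pi * r\<^sup>2 * (4 + \<bar>ln r\<bar>)\<^sup>2))"
  have "(\<integral>\<^sup>+z. g (cmod z) \<partial>limit_measure) = (\<integral>\<^sup>+z. ?F (cmod z) * g (cmod z) \<partial>lborel)"
    unfolding limit_measure_def by (rule nn_integral_density) measurable
  also have "\<dots> = (\<integral>\<^sup>+r. ?F r * g r \<partial>distr lborel borel cmod)"
    by (rule nn_integral_distr[symmetric]) measurable
  also have "\<dots> = (\<integral>\<^sup>+r. (ennreal (2 * pi * r) * indicator {0..} r) * (?F r * g r) \<partial>lborel)"
    unfolding lborel_distr_cmod by (rule nn_integral_density) measurable
  also have "\<dots> = (\<integral>\<^sup>+r. ennreal (radial_density r) * indicator {0<..} r * g r \<partial>lborel)"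
  proof (rule nn_integral_cong)
    fix r :: real
    show "(ennreal (2 * pi * r) * indicator {0..} r) * (?F r * g r) = ennreal (radial_density r) * indicator {0<..} r * g r"
    proof (cases "r > 0")
      case True
      have "4 + \<bar>ln r\<bar> \<noteq> 0" by linarith
      then have "2 * pi * r * (1 / (pi * r\<^sup>2 * (4 + \<bar>ln r\<bar>)\<^sup>2)) = radial_density r"
        using True by (simp add: radial_density_def power2_eq_square)
      moreover have "ennreal (2 * pi * r) * ?F r = ennreal (2 * pi * r * (1 / (pi * r\<^sup>2 * (4 + \<bar>ln r\<bar>)\<^sup>2)))"
        by (rule ennreal_mult'[symmetric]) (use True in simp)
      ultimately have "ennreal (2 * pi * r) * ?F r = ennreal (radial_density r)" by simp
      then show ?thesis using True by (simp add: mult.assoc[symmetric])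
    next
      case False
      then show ?thesis by (cases "r = 0") auto
    qed
  qed
  finally show ?thesis .
qed

lemma abs_ln_plus_4_neq [simp]: "4 + \<bar>ln (r::real)\<bar> \<noteq> 0"
  by linarith

text \<open>The antiderivative \<open>2 / (4 - ln r)\<close> is the distribution function of the
  modulus inside the unit disc; its value at \<open>b\<close> is
  \<open>tilt_point (ln b)\<close>.\<close>

lemma radial_mass_below:
  assumes b: "0 < b" "b \<le> 1"
  shows "(\<integral>\<^sup>+r. ennreal (radial_density r) * indicator {0<..<b} r \<partial>lborel) = ennreal (2 / (4 - ln b))"
proof -
  let ?F = "\<lambda>r::real. 2 / (4 - ln r)"
  let ?f = "\<lambda>r. 2 / (r * (4 - ln r)\<^sup>2)"
  have lb: "ln r < 4" if "0 < r" "r < b" for r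
  proof -
    have "ln r < ln 1" using that b by (subst ln_less_cancel_iff) auto
    then show ?thesis by simp
  qed
  have D: "DERIV ?F r :> ?f r" if "0 < r" "r < b" for r
    using that lb[OF that] by (auto intro!: derivative_eq_intros simp: power2_eq_square field_simps)
  have ln0: "filterlim ln at_bot (at_right (0::real))" by (rule ln_at_0)
  have A: "(?F \<longlongrightarrow> 0) (at_right 0)" by real_asymp
  have B: "(?F \<longlongrightarrow> 2 / (4 - ln b)) (at_left b)"
  proof -
    have "isCont ?F b" using b by (auto intro!: continuous_intros)
       (metis ln_le_zero_iff not_numeral_le_zero)
    then show ?thesis by (simp add: isCont_def filterlim_at_split)
  qed
  have si: "set_integrable lborel (einterval 0 b) ?f" "(LBINT x=0..b. ?f x) = 2 / (4 - ln b) - 0"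
  proof -
    have "\<And>x. ereal 0 < ereal x \<Longrightarrow> ereal x < ereal b \<Longrightarrow> isCont ?f x"
      using lb by (auto intro!: continuous_intros) fastforce
    moreover have "AE x in lborel. ereal 0 < ereal x \<longrightarrow> ereal x < ereal b \<longrightarrow> 0 \<le> ?f x" by auto
    moreover have "((?F \<circ> real_of_ereal) \<longlongrightarrow> 0) (at_right (ereal 0))"
      using A by (simp add: ereal_tendsto_simps1)
    moreover have "((?F \<circ> real_of_ereal) \<longlongrightarrow> 2 / (4 - ln b)) (at_left (ereal b))"
      using B by (simp add: ereal_tendsto_simps1)
    ultimately show "set_integrable lborel (einterval 0 b) ?f" "(LBINT x=0..b. ?f x) = 2 / (4 - ln b) - 0"
      using interval_integral_FTC_nonneg[of "ereal 0" "ereal b" ?F ?f 0 "2 / (4 - ln b)"] D b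
      by (auto simp: zero_ereal_def)
  qed
  have eq: "einterval 0 b = {0<..<b}" by (auto simp: einterval_def zero_ereal_def)
  have "(LBINT x=0..b. ?f x) = (LINT x:{0<..<b}|lborel. ?f x)"
    using b by (simp add: interval_lebesgue_integral_def eq less_imp_le)
  then have int: "integrable lborel (\<lambda>x. indicator {0<..<b} x * ?f x)"
     "(LINT x|lborel. indicator {0<..<b} x * ?f x) = 2 / (4 - ln b)"
    using si by (simp_all add: eq set_integrable_def set_lebesgue_integral_def)
  have "(\<integral>\<^sup>+r. ennreal (radial_density r) * indicator {0<..<b} r \<partial>lborel) = (\<integral>\<^sup>+r. ennreal (indicator {0<..<b} r * ?f r) \<partial>lborel)"
  proof (rule nn_integral_cong)
    fix r :: real
    have "\<bar>ln r\<bar> = - ln r" if "0 < r" "r < b" using that b by simp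
    then show "ennreal (radial_density r) * indicator {0<..<b} r = ennreal (indicator {0<..<b} r * ?f r)"
      by (auto simp: indicator_def radial_density_def)
  qed
  also have "\<dots> = ennreal (2 / (4 - ln b))"
    unfolding int(2)[symmetric]
    by (rule nn_integral_eq_integral[OF int(1)]) (auto simp: indicator_def)
  finally show ?thesis .
qed

lemma radial_mass_above:
  assumes a: "1 \<le> a"
  shows "(\<integral>\<^sup>+r. ennreal (radial_density r) * indicator {a..} r \<partial>lborel) = ennreal (2 / (4 + ln a))"
proof -
  have "(\<integral>\<^sup>+r. ennreal (radial_density r) * indicator {a..} r \<partial>lborel) = ennreal (0 - (- 2 / (4 + ln a)))"
  proof (rule nn_integral_FTC_atLeast)
    fix x assume x: "a \<le> x"
    then have ln: "0 \<le> ln x" using a by simp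
    then have "ln x + 4 \<noteq> 0" by linarith
    show "((\<lambda>r. - 2 / (4 + ln r)) has_real_derivative radial_density x) (at x)"
      using x a ln \<open>ln x + 4 \<noteq> 0\<close> by (auto intro!: derivative_eq_intros simp: radial_density_def power2_eq_square field_simps)
    show "0 \<le> radial_density x" using x a by (intro radial_density_nonneg) auto
  next
    show "((\<lambda>r::real. - 2 / (4 + ln r)) \<longlongrightarrow> 0) at_top" by real_asymp
  qed measurable
  then show ?thesis by simp
qed

lemma limit_measure_outside:
  assumes "1 \<le> a"
  shows "emeasure limit_measure {z. a \<le> cmod z} = ennreal (2 / (4 + ln a))"
proof -
  have "emeasure limit_measure {z. a \<le> cmod z} = (\<integral>\<^sup>+z. indicator {z. a \<le> cmod z} z \<partial>limit_measure)"
    by (rule nn_integral_indicator[symmetric]) (unfold sets_limit_measure, measurable)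
  also have "\<dots> = (\<integral>\<^sup>+z. indicator {a..} (cmod z) \<partial>limit_measure)"
    by (intro nn_integral_cong) (auto simp: indicator_def)
  also have "\<dots> = (\<integral>\<^sup>+r. ennreal (radial_density r) * indicator {0<..} r * indicator {a..} r \<partial>lborel)"
    by (rule nn_integral_limit_radial) measurable
  also have "\<dots> = (\<integral>\<^sup>+r. ennreal (radial_density r) * indicator {a..} r \<partial>lborel)"
    using assms by (intro nn_integral_cong) (auto simp: indicator_def)
  finally show ?thesis using radial_mass_above[OF assms] by simp
qed

lemma limit_measure_inside:
  assumes "0 < b" "b \<le> 1"
  shows "emeasure limit_measure {z. cmod z < b} = ennreal (2 / (4 - ln b))"
proof -
  have "emeasure limit_measure {z. cmod z < b} = (\<integral>\<^sup>+z. indicator {z. cmod z < b} z \<partial>limit_measure)"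
    by (rule nn_integral_indicator[symmetric]) (unfold sets_limit_measure, measurable)
  also have "\<dots> = (\<integral>\<^sup>+z. indicator {..<b} (cmod z) \<partial>limit_measure)"
    by (intro nn_integral_cong) (auto simp: indicator_def)
  also have "\<dots> = (\<integral>\<^sup>+r. ennreal (radial_density r) * indicator {0<..} r * indicator {..<b} r \<partial>lborel)"
    by (rule nn_integral_limit_radial) measurable
  also have "\<dots> = (\<integral>\<^sup>+r. ennreal (radial_density r) * indicator {0<..<b} r \<partial>lborel)"
    using assms by (intro nn_integral_cong) (auto simp: indicator_def)
  finally show ?thesis using radial_mass_below[OF assms] by simp
qed

lemma prob_space_limit_measure: "prob_space limit_measure"
proof
  have "UNIV = {z. cmod z < 1} \<union> {z. 1 \<le> cmod z}" by auto
  then have "emeasure limit_measure UNIV = emeasure limit_measure {z. cmod z < 1} + emeasure limit_measure {z. 1 \<le> cmod z}"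
    by (subst plus_emeasure) auto
  also have "\<dots> = ennreal (1/2) + ennreal (1/2)"
    by (simp add: limit_measure_inside limit_measure_outside)
  also have "\<dots> = ennreal (1/2 + 1/2)" by (rule ennreal_plus[symmetric]) auto
  finally show "emeasure limit_measure (space limit_measure) = 1" by simp
qed

lemma AE_limit_measureI: "AE z in lborel. P z \<Longrightarrow> AE z in limit_measure. P z"
  unfolding limit_measure_def by (subst AE_density) auto

lemma AE_lborel_sphere: "AE z in lborel. dist c z \<noteq> r"
  for c :: "'a::euclidean_space"
proof -
  have "sphere c r \<in> null_sets lborel"
    using negligible_sphere[of c r] by (simp add: negligible_iff_null_sets null_sets_completion_iff)
  then have "AE z in lborel. z \<notin> sphere c r" by (rule AE_not_in)
  then show ?thesis by auto
qed

lemma nn_integral_limit_rotate: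
  assumes c: "cmod c = 1" and g [measurable]: "g \<in> borel_measurable borel"
  shows "(\<integral>\<^sup>+z. g (c * z) \<partial>limit_measure) = (\<integral>\<^sup>+z. g z \<partial>limit_measure)"
proof -
  let ?f = "\<lambda>z. ennreal (1 / (pi * (cmod z)\<^sup>2 * (4 + \<bar>ln (cmod z)\<bar>)\<^sup>2))"
  have "(\<integral>\<^sup>+z. g z \<partial>limit_measure) = (\<integral>\<^sup>+z. ?f z * g z \<partial>lborel)"
    unfolding limit_measure_def by (rule nn_integral_density) measurable
  also have "\<dots> = (\<integral>\<^sup>+z. ?f z * g z \<partial>distr lborel borel ((*) c))"
    by (simp only: lborel_distr_rotate[OF c])
  also have "\<dots> = (\<integral>\<^sup>+z. ?f (c * z) * g (c * z) \<partial>lborel)"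
    by (rule nn_integral_distr) measurable
  also have "\<dots> = (\<integral>\<^sup>+z. ?f z * g (c * z) \<partial>lborel)"
    using c by (simp add: norm_mult)
  also have "\<dots> = (\<integral>\<^sup>+z. g (c * z) \<partial>limit_measure)"
    unfolding limit_measure_def by (rule nn_integral_density[symmetric]) measurable
  finally show ?thesis ..
qed

text \<open>For \<open>v \<noteq> 0\<close>, the mean of \<open>ln |v - z| - ln (max 1 |z|)\<close>
  under the limit measure. The second term is what makes this finite, since \<open>ln |z|\<close> is
  not integrable at infinity.\<close>

definition log_potential :: "complex \<Rightarrow> real" where
  "log_potential v = max (ln (cmod v)) 0 - 2 * ln ((4 + \<bar>ln (cmod v)\<bar>) / 4)"

lemma measurable_log_potential [measurable]: "log_potential \<in> borel_measurable borel"
  unfolding log_potential_def by measurable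

text \<open>Moduli below \<open>1\<close> have mass \<open>1/2\<close> and give the constant
  \<open>ln b\<close>; between \<open>1\<close> and \<open>b\<close> an explicit antiderivative
  applies; beyond \<open>b\<close> the integrand vanishes.\<close>

lemma radial_potential_ge_1:
  assumes b: "1 \<le> b"
  shows "(\<integral>\<^sup>+r. ennreal (radial_density r) * indicator {0<..} r * ennreal (ln (max b r) - ln (max 1 r)) \<partial>lborel)
    = ennreal (ln b - 2 * ln ((4 + ln b) / 4))"
proof -
  have lb: "0 \<le> ln b" using b by simp
  let ?G = "\<lambda>r. - (ln b + 4) * (2 / (4 + ln r)) - 2 * ln (4 + ln r)"
  have Icc: "(\<integral>\<^sup>+r. ennreal ((ln b - ln r) * radial_density r) * indicator {1..b} r \<partial>lborel) = ennreal (?G b - ?G 1)"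
  proof (rule nn_integral_FTC_Icc)
    fix x assume x: "x \<in> {1..b}"
    then have lx: "0 \<le> ln x" "ln x \<le> ln b" "ln x + 4 \<noteq> 0" by (auto simp: add_nonneg_eq_0_iff)
    have "4 + ln x > 0" using lx by linarith
    have alg: "- (B + 4) * (- (2 * (1 / x)) / ((4 + L) * (4 + L))) - 2 * ((1 / x) / (4 + L)) = (B - L) * (2 / (x * (4 + L)\<^sup>2))"
      if "4 + L > 0" "x > 0" for B L x :: real
      using that by (simp add: divide_simps power2_eq_square)
    have "(?G has_real_derivative - (ln b + 4) * (- (2 * (1 / x)) / ((4 + ln x) * (4 + ln x))) - 2 * ((1 / x) / (4 + ln x))) (at x)"
      using x \<open>4 + ln x > 0\<close> by (auto intro!: derivative_eq_intros simp: divide_inverse)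
    then show "(?G has_real_derivative (ln b - ln x) * radial_density x) (at x)"
      unfolding radial_density_def using alg[of "ln x" x "ln b"] x lx by simp
    show "0 \<le> (ln b - ln x) * radial_density x"
      using x lx by (intro mult_nonneg_nonneg radial_density_nonneg) auto
  qed (use b in auto)
  have "(\<integral>\<^sup>+r. ennreal (radial_density r) * indicator {0<..} r * ennreal (ln (max b r) - ln (max 1 r)) \<partial>lborel)
    = (\<integral>\<^sup>+r. ennreal (ln b) * (ennreal (radial_density r) * indicator {0<..<1} r)
         + ennreal ((ln b - ln r) * radial_density r) * indicator {1..b} r \<partial>lborel)"
  proof (rule nn_integral_cong)
    fix r :: real
    consider "r \<le> 0" | "0 < r" "r < 1" | "1 \<le> r" "r \<le> b" | "1 \<le> r" "b < r" by linarith
    then show "ennreal (radial_density r) * indicator {0<..} r * ennreal (ln (max b r) - ln (max 1 r))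
       = ennreal (ln b) * (ennreal (radial_density r) * indicator {0<..<1} r)
         + ennreal ((ln b - ln r) * radial_density r) * indicator {1..b} r"
    proof cases
      case 2 then show ?thesis using b by (simp add: mult.commute)
    next
      case 3 then show ?thesis by (simp add: ennreal_mult mult.commute radial_density_nonneg max_def)
    qed (use b in \<open>auto simp: max_def\<close>)
  qed
  also have "\<dots> = (\<integral>\<^sup>+r. ennreal (ln b) * (ennreal (radial_density r) * indicator {0<..<1} r) \<partial>lborel)
      + (\<integral>\<^sup>+r. ennreal ((ln b - ln r) * radial_density r) * indicator {1..b} r \<partial>lborel)"
    by (rule nn_integral_add) measurable
  also have "(\<integral>\<^sup>+r. ennreal (ln b) * (ennreal (radial_density r) * indicator {0<..<1} r) \<partial>lborel) = ennreal (ln b) * ennreal (1/2)"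
    using radial_mass_below[of 1] by (subst nn_integral_cmult) auto
  also have "\<dots> = ennreal (ln b * (1/2))" by (rule ennreal_mult'[symmetric, OF lb])
  also note Icc
  also have "ennreal (ln b * (1/2)) + ennreal (?G b - ?G 1) = ennreal (ln b * (1/2) + (?G b - ?G 1))"
  proof (rule ennreal_plus[symmetric])
    have "1 + ln b / 4 > 0" using lb by linarith
    have le: "ln (1 + ln b / 4) \<le> ln b / 4" using lb by (intro ln_add_one_self_le_self) auto
    have 1: "ln (4 + ln b) = ln 4 + ln (1 + ln b / 4)"
      using lb by (subst ln_mult_pos[symmetric]) (auto simp: algebra_simps)
    have 2: "- (ln b + 4) * (2 / (4 + ln b)) = - 2"
      using lb by (simp add: field_simps add_nonneg_eq_0_iff)
    have 3: "- (ln b + 4) * (2 / (4 + ln 1)) - 2 * ln (4 + ln 1) = - (ln b + 4) / 2 - 2 * ln (4::real)" by simp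
    have alg: "0 \<le> - 2 - 2 * (a + X) - (- (B + 4) / 2 - 2 * a)" if "X \<le> B / 4" for a B X :: real
    proof -
      have "- (B + 4) / 2 = - (B / 2) - 2" by (simp add: field_simps)
      then have "- 2 - 2 * (a + X) - (- (B + 4) / 2 - 2 * a) = - 2 - 2 * (a + X) - (- (B / 2) - 2 - 2 * a)" by (simp only:)
      also have "\<dots> = B / 2 - 2 * X" by (simp add: algebra_simps)
      finally have "- 2 - 2 * (a + X) - (- (B + 4) / 2 - 2 * a) = B / 2 - 2 * X" .
      then show ?thesis using that by linarith
    qed
    show "0 \<le> ?G b - ?G 1" unfolding 2 3 1 by (rule alg[OF le])
  qed (use lb in auto)
  also have "ln b * (1/2) + (?G b - ?G 1) = ln b - 2 * ln ((4 + ln b) / 4)"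
  proof -
    have 2: "- (ln b + 4) * (2 / (4 + ln b)) = - 2"
      using lb by (simp add: field_simps add_nonneg_eq_0_iff)
    have 3: "- (ln b + 4) * (2 / (4 + ln 1)) - 2 * ln (4 + ln 1) = - (ln b + 4) / 2 - 2 * ln (4::real)" by simp
    have 4: "- (ln b + 4) / 2 = - (ln b / 2) - 2" by (simp add: field_simps)
    have 5: "ln ((4 + ln b) / 4) = ln (4 + ln b) - ln 4" using lb by (subst ln_divide_pos) auto
    show ?thesis unfolding 2 3 4 5 by (simp add: algebra_simps)
  qed
  finally show ?thesis .
qed

text \<open>The counterpart inside the unit disc, with the two logarithms exchanged to keep the
  integrand nonnegative.\<close>

lemma radial_potential_le_1:
  assumes b: "0 < b" "b < 1"
  shows "(\<integral>\<^sup>+r. ennreal (radial_density r) * indicator {0<..} r * ennreal (ln (max 1 r) - ln (max b r)) \<partial>lborel)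
    = ennreal (2 * ln ((4 - ln b) / 4))"
proof -
  have lb: "ln b < 0" using b by simp
  let ?G = "\<lambda>r. - 2 * ln (4 - ln r) - 8 / (4 - ln r)"
  have Icc: "(\<integral>\<^sup>+r. ennreal (- ln r * radial_density r) * indicator {b..1} r \<partial>lborel) = ennreal (?G 1 - ?G b)"
  proof (rule nn_integral_FTC_Icc)
    fix x assume x: "x \<in> {b..1}"
    then have x0: "0 < x" using b by auto
    then have lx: "ln x \<le> 0" using x by simp
    then have "4 - ln x > 0" by linarith
    have alg: "- 2 * (- (1 / x) / (4 - L)) - 8 * ((1 / x) / ((4 - L) * (4 - L))) = - L * (2 / (x * (4 - L)\<^sup>2))"
      if "4 - L > 0" "x > 0" for L x :: real
      using that by (simp add: divide_simps power2_eq_square)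
    have "(?G has_real_derivative - 2 * (- (1 / x) / (4 - ln x)) - 8 * ((1 / x) / ((4 - ln x) * (4 - ln x)))) (at x)"
      using x0 \<open>4 - ln x > 0\<close> by (auto intro!: derivative_eq_intros simp: divide_inverse)
    then show "(?G has_real_derivative - ln x * radial_density x) (at x)"
      unfolding radial_density_def using alg[of "ln x" x] x0 lx by simp
    show "0 \<le> - ln x * radial_density x"
      using x0 lx by (intro mult_nonneg_nonneg radial_density_nonneg) auto
  qed (use b in auto)
  have "(\<integral>\<^sup>+r. ennreal (radial_density r) * indicator {0<..} r * ennreal (ln (max 1 r) - ln (max b r)) \<partial>lborel)
    = (\<integral>\<^sup>+r. ennreal (- ln b) * (ennreal (radial_density r) * indicator {0<..<b} r)
         + ennreal (- ln r * radial_density r) * indicator {b..1} r \<partial>lborel)"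
  proof (rule nn_integral_cong)
    fix r :: real
    consider "r \<le> 0" | "0 < r" "r < b" | "b \<le> r" "r \<le> 1" | "1 < r" by linarith
    then show "ennreal (radial_density r) * indicator {0<..} r * ennreal (ln (max 1 r) - ln (max b r))
       = ennreal (- ln b) * (ennreal (radial_density r) * indicator {0<..<b} r)
         + ennreal (- ln r * radial_density r) * indicator {b..1} r"
    proof cases
      case 2 then show ?thesis using b by (simp add: mult.commute max_def)
    next
      case 3
      then have "0 \<le> - ln r" "0 \<le> radial_density r" "0 < r" using b by (auto intro: radial_density_nonneg)
      then have "ennreal (- ln r * radial_density r) = ennreal (- ln r) * ennreal (radial_density r)"
        by (intro ennreal_mult)
      then show ?thesis using 3 b by (cases "r = b") (simp_all add: mult.commute max_def)
    qed (use b in \<open>auto simp: max_def\<close>)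
  qed
  also have "\<dots> = (\<integral>\<^sup>+r. ennreal (- ln b) * (ennreal (radial_density r) * indicator {0<..<b} r) \<partial>lborel)
      + (\<integral>\<^sup>+r. ennreal (- ln r * radial_density r) * indicator {b..1} r \<partial>lborel)"
    by (rule nn_integral_add) measurable
  also have "(\<integral>\<^sup>+r. ennreal (- ln b) * (ennreal (radial_density r) * indicator {0<..<b} r) \<partial>lborel) = ennreal (- ln b) * ennreal (2 / (4 - ln b))"
    using radial_mass_below[of b] b by (subst nn_integral_cmult) auto
  also have "\<dots> = ennreal (- ln b * (2 / (4 - ln b)))" by (rule ennreal_mult'[symmetric]) (use lb in simp)
  also note Icc
  also have "ennreal (- ln b * (2 / (4 - ln b))) + ennreal (?G 1 - ?G b) = ennreal (- ln b * (2 / (4 - ln b)) + (?G 1 - ?G b))"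
  proof (rule ennreal_plus[symmetric])
    show "0 \<le> - ln b * (2 / (4 - ln b))" using lb by (intro mult_nonneg_nonneg divide_nonneg_pos) auto
    define q where "q = 4 / (4 - ln b)"
    have q: "0 < q" using lb by (simp add: q_def)
    have "ln q \<le> q - 1" using q by (rule ln_le_minus_one)
    moreover have "ln q = ln 4 - ln (4 - ln b)" unfolding q_def using lb by (subst ln_divide_pos) auto
    moreover have "8 / (4 - ln b) = 2 * q" by (simp add: q_def)
    ultimately show "0 \<le> ?G 1 - ?G b" by simp
  qed
  also have "- ln b * (2 / (4 - ln b)) + (?G 1 - ?G b) = 2 * ln ((4 - ln b) / 4)"
  proof -
    have "- ln b * (2 / (4 - ln b)) = 2 - 8 / (4 - ln b)"
      using lb by (simp add: field_simps)
    moreover have "ln ((4 - ln b) / 4) = ln (4 - ln b) - ln 4" using lb by (subst ln_divide_pos) auto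
    ultimately show ?thesis by simp
  qed
  finally show ?thesis .
qed

text \<open>The difference of the logarithms has one sign for \<open>cmod v \<ge> 1\<close> and the
  other for \<open>cmod v < 1\<close>; adding \<open>C\<close> puts both cases into one nonnegative
  form.\<close>

lemma limit_radial_potential:
  assumes v: "v \<noteq> 0" and C: "ln (1 + cmod v) \<le> C"
  shows "(\<integral>\<^sup>+z. ennreal (C + ln (max 1 (cmod z)) - ln (max (cmod v) (cmod z))) \<partial>limit_measure) = ennreal (C - log_potential v)"
proof -
  interpret prob_space limit_measure by (rule prob_space_limit_measure)
  let ?b = "cmod v"
  have b: "0 < ?b" using v by simp
  have "0 \<le> ln (1 + ?b)" by (rule ln_ge_zero) simp
  then have C0: "0 \<le> C" using C by linarith
  have bC: "ln ?b \<le> C"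
  proof -
    have "ln ?b \<le> ln (1 + ?b)" using b by (subst ln_le_cancel_iff) (auto intro: add_pos_nonneg)
    then show ?thesis using C by simp
  qed
  have const: "(\<integral>\<^sup>+z. ennreal C \<partial>limit_measure) = ennreal C" using emeasure_space_1 by simp
  show ?thesis
  proof (cases "1 \<le> ?b")
    case True
    let ?h = "\<lambda>z. ln (max ?b (cmod z)) - ln (max 1 (cmod z))"
    have lb: "0 \<le> ln ?b" using True by simp
    have h: "0 \<le> ?h z \<and> ?h z \<le> C" for z
    proof
      have "ln (max 1 (cmod z)) \<le> ln (max ?b (cmod z))" using True by (intro ln_mono) auto
      then show "0 \<le> ?h z" by simp
      have "?b * 1 \<le> ?b * max 1 (cmod z)" by (intro mult_left_mono) auto
      moreover have "1 * cmod z \<le> ?b * max 1 (cmod z)" using True by (intro mult_mono) auto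
      ultimately have "max ?b (cmod z) \<le> ?b * max 1 (cmod z)" by simp
      then have "ln (max ?b (cmod z)) \<le> ln (?b * max 1 (cmod z))"
        using b by (intro ln_mono) (auto simp: less_max_iff_disj)
      also have "\<dots> = ln ?b + ln (max 1 (cmod z))" using b by (intro ln_mult_pos) auto
      finally show "?h z \<le> C" using bC by linarith
    qed
    have "(\<integral>\<^sup>+z. ennreal (?h z) \<partial>limit_measure) = ennreal (ln ?b - 2 * ln ((4 + ln ?b) / 4))"
      using nn_integral_limit_radial[of "\<lambda>r. ennreal (ln (max ?b r) - ln (max 1 r))"] radial_potential_ge_1[OF True] by simp
    also have "ln ?b - 2 * ln ((4 + ln ?b) / 4) = log_potential v"
      using lb by (simp add: log_potential_def)
    finally have 1: "(\<integral>\<^sup>+z. ennreal (?h z) \<partial>limit_measure) = ennreal (log_potential v)" .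
    have pot: "0 \<le> log_potential v"
    proof -
      have "ln (1 + ln ?b / 4) \<le> ln ?b / 4" using lb by (intro ln_add_one_self_le_self) auto
      then show ?thesis using lb by (simp add: log_potential_def add_divide_distrib)
    qed
    have "ennreal C = (\<integral>\<^sup>+z. ennreal C \<partial>limit_measure)" by (rule const[symmetric])
    also have "\<dots> = (\<integral>\<^sup>+z. ennreal (C - ?h z) + ennreal (?h z) \<partial>limit_measure)"
    proof (rule nn_integral_cong)
      fix z
      have "ennreal (C - ?h z) + ennreal (?h z) = ennreal ((C - ?h z) + ?h z)"
        using h[of z] by (intro ennreal_plus[symmetric]) auto
      then show "ennreal C = ennreal (C - ?h z) + ennreal (?h z)" by simp
    qed
    also have "\<dots> = (\<integral>\<^sup>+z. ennreal (C - ?h z) \<partial>limit_measure) + (\<integral>\<^sup>+z. ennreal (?h z) \<partial>limit_measure)"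
      by (rule nn_integral_add) measurable
    finally have "(\<integral>\<^sup>+z. ennreal (C - ?h z) \<partial>limit_measure) = ennreal C - ennreal (log_potential v)"
      unfolding 1 by simp
    also have "\<dots> = ennreal (C - log_potential v)" using pot by (rule ennreal_minus)
    finally show ?thesis by (simp add: algebra_simps)
  next
    case False
    let ?h = "\<lambda>z. ln (max 1 (cmod z)) - ln (max ?b (cmod z))"
    have lb: "ln ?b < 0" using False b by simp
    have h: "0 \<le> ?h z" for z
    proof -
      have "ln (max ?b (cmod z)) \<le> ln (max 1 (cmod z))" using b False by (subst ln_le_cancel_iff) (auto simp: less_max_iff_disj)
      then show ?thesis by simp
    qed
    have "(\<integral>\<^sup>+z. ennreal (?h z) \<partial>limit_measure) = ennreal (2 * ln ((4 - ln ?b) / 4))"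
      using nn_integral_limit_radial[of "\<lambda>r. ennreal (ln (max 1 r) - ln (max ?b r))"] radial_potential_le_1[of ?b] b False by simp
    also have "2 * ln ((4 - ln ?b) / 4) = - log_potential v"
      using lb by (simp add: log_potential_def)
    finally have 1: "(\<integral>\<^sup>+z. ennreal (?h z) \<partial>limit_measure) = ennreal (- log_potential v)" .
    have pot: "0 \<le> - log_potential v"
    proof -
      have "0 \<le> ln ((4 - ln ?b) / 4)" using lb by (intro ln_ge_zero) auto
      then show ?thesis using lb by (simp add: log_potential_def)
    qed
    have "(\<integral>\<^sup>+z. ennreal (C + ?h z) \<partial>limit_measure) = (\<integral>\<^sup>+z. ennreal C + ennreal (?h z) \<partial>limit_measure)"
      using h C0 by (intro nn_integral_cong) simp
    also have "\<dots> = (\<integral>\<^sup>+z. ennreal C \<partial>limit_measure) + (\<integral>\<^sup>+z. ennreal (?h z) \<partial>limit_measure)"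
      by (rule nn_integral_add) measurable
    also have "\<dots> = ennreal (C + - log_potential v)"
      unfolding 1 const by (rule ennreal_plus[symmetric, OF C0 pot])
    finally show ?thesis by (simp add: algebra_simps)
  qed
qed

lemma prob_space_nn_integral_const: "prob_space M \<Longrightarrow> (\<integral>\<^sup>+x. c \<partial>M) = c"
  using prob_space.emeasure_space_1[of M] by simp

lemma pair_sigma_finite_limit: "pair_sigma_finite limit_measure unif01"
  by (simp add: pair_sigma_finite_def prob_space_imp_sigma_finite prob_space_limit_measure prob_space_unif01)

lemma AE_limit_dist: "AE z in limit_measure. cmod (c - z) \<noteq> r"
  using AE_limit_measureI[OF AE_lborel_sphere[of c r]] by (simp add: dist_norm)

text \<open>Rotation invariance allows averaging over the argument of \<open>z\<close>. By Jensen's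
  formula \<open>ln |v - z|\<close> becomes \<open>ln (max |v| |z|)\<close>, and only the radial
  integral remains.\<close>

lemma limit_potential:
  assumes v: "v \<noteq> 0" and C: "ln (1 + cmod v) \<le> C"
  shows "(\<integral>\<^sup>+z. ennreal (C + ln (max 1 (cmod z)) - ln (cmod (v - z))) \<partial>limit_measure) = ennreal (C - log_potential v)"
proof -
  define g where "g = (\<lambda>z. ennreal (C + ln (max 1 (cmod z)) - ln (cmod (v - z))))"
  have g [measurable]: "g \<in> borel_measurable borel" unfolding g_def by measurable
  have "(\<integral>\<^sup>+z. g z \<partial>limit_measure) = (\<integral>\<^sup>+x. (\<integral>\<^sup>+z. g (cis (2 * pi * x) * z) \<partial>limit_measure) \<partial>unif01)"
    by (simp add: nn_integral_limit_rotate prob_space_nn_integral_const[OF prob_space_unif01])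
  also have "\<dots> = (\<integral>\<^sup>+z. (\<integral>\<^sup>+x. g (cis (2 * pi * x) * z) \<partial>unif01) \<partial>limit_measure)"
    by (rule pair_sigma_finite.Fubini'[OF pair_sigma_finite_limit]) measurable
  also have "\<dots> = (\<integral>\<^sup>+z. ennreal (C + ln (max 1 (cmod z)) - ln (max (cmod v) (cmod z))) \<partial>limit_measure)"
  proof (rule nn_integral_cong_AE, use AE_limit_dist[of 0 "cmod v"] in eventually_elim)
    fix z assume "cmod (0 - z) \<noteq> cmod v"
    then have z: "cmod v \<noteq> cmod (- z)" by simp
    have "ln (cmod v + cmod z) \<le> ln ((1 + cmod v) * max 1 (cmod z))"
    proof (rule ln_mono)
      show "0 < cmod v + cmod z" using v by (simp add: add_pos_nonneg)
      have "cmod v * 1 \<le> cmod v * max 1 (cmod z)" by (intro mult_left_mono) auto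
      then show "cmod v + cmod z \<le> (1 + cmod v) * max 1 (cmod z)"
        by (simp add: distrib_right max_def split: if_splits)
    qed
    also have "\<dots> = ln (1 + cmod v) + ln (max 1 (cmod z))"
      by (rule ln_mult_pos) (auto intro: add_pos_nonneg)
    finally have "ln (cmod v + cmod (- z)) \<le> C + ln (max 1 (cmod z))" using C by simp
    from circle_nn_integral_ln[OF z this]
    have "(\<integral>\<^sup>+x. ennreal (C + ln (max 1 (cmod z)) - ln (cmod (v - z * cis (2 * pi * x)))) \<partial>unif01)
       = ennreal (C + ln (max 1 (cmod z)) - ln (max (cmod v) (cmod z)))"
      by (simp add: max.commute)
    moreover have "g (cis (2 * pi * x) * z) = ennreal (C + ln (max 1 (cmod z)) - ln (cmod (v - z * cis (2 * pi * x))))" for x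
      by (simp add: g_def norm_mult mult.commute)
    ultimately show "(\<integral>\<^sup>+x. g (cis (2 * pi * x) * z) \<partial>unif01)
       = ennreal (C + ln (max 1 (cmod z)) - ln (max (cmod v) (cmod z)))" by simp
  qed
  also have "\<dots> = ennreal (C - log_potential v)"
    by (rule limit_radial_potential[OF v C])
  finally show ?thesis by (simp add: g_def)
qed

section \<open>Circle means of the limit potential\<close>

lemma cmod_add_cis:
  assumes "0 < t"
  shows "cmod (w + of_real t * cis x) \<le> cmod w + t" "cmod w - t \<le> cmod (w + of_real t * cis x)"
proof -
  have t: "cmod (of_real t * cis x) = t" using assms by (simp add: norm_mult)
  show "cmod (w + of_real t * cis x) \<le> cmod w + t"
    using norm_triangle_ineq[of w "of_real t * cis x"] t by simp
  show "cmod w - t \<le> cmod (w + of_real t * cis x)"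
    using norm_diff_ineq[of w "of_real t * cis x"] t by simp
qed

text \<open>The circle mean and the integral over the limit measure are exchanged. As
  \<open>t < cmod w\<close>, the circle avoids \<open>0\<close>, where \<open>log_potential\<close>
  takes a default value although the potential is infinite there.\<close>

lemma circle_mean_log_potential:
  assumes t: "0 < t" "t < cmod w" and C: "ln (1 + cmod w + t) \<le> C"
  shows "(\<integral>\<^sup>+x. ennreal (C - log_potential (w + of_real t * cis (2 * pi * x))) \<partial>unif01)
     = (\<integral>\<^sup>+z. ennreal (C + ln (max 1 (cmod z)) - ln (max t (cmod (w - z)))) \<partial>limit_measure)"
proof -
  define g where "g = (\<lambda>z x. ennreal (C + ln (max 1 (cmod z)) - ln (cmod ((w + of_real t * cis (2 * pi * x)) - z))))"
  have "(\<integral>\<^sup>+x. ennreal (C - log_potential (w + of_real t * cis (2 * pi * x))) \<partial>unif01)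
      = (\<integral>\<^sup>+x. (\<integral>\<^sup>+z. g z x \<partial>limit_measure) \<partial>unif01)"
  proof (rule nn_integral_cong)
    fix x :: real
    let ?v = "w + of_real t * cis (2 * pi * x)"
    have "?v \<noteq> 0" using cmod_add_cis(2)[OF t(1), of w "2 * pi * x"] t by auto
    moreover have "ln (1 + cmod ?v) \<le> ln (1 + cmod w + t)"
      using cmod_add_cis(1)[OF t(1), of w "2 * pi * x"] by (intro ln_mono) (auto intro: add_pos_nonneg)
    ultimately show "ennreal (C - log_potential ?v) = (\<integral>\<^sup>+z. g z x \<partial>limit_measure)"
      unfolding g_def using C by (intro limit_potential[symmetric]) auto
  qed
  also have "\<dots> = (\<integral>\<^sup>+z. (\<integral>\<^sup>+x. g z x \<partial>unif01) \<partial>limit_measure)"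
    unfolding g_def by (rule pair_sigma_finite.Fubini'[OF pair_sigma_finite_limit]) measurable
  also have "\<dots> = (\<integral>\<^sup>+z. ennreal (C + ln (max 1 (cmod z)) - ln (max t (cmod (w - z)))) \<partial>limit_measure)"
  proof (rule nn_integral_cong_AE, use AE_limit_dist[of w t] in eventually_elim)
    fix z assume "cmod (w - z) \<noteq> t"
    then have z: "cmod (w - z) \<noteq> cmod (of_real t)" using t by simp
    have "ln (cmod (w - z) + t) \<le> ln ((1 + cmod w + t) * max 1 (cmod z))"
    proof (rule ln_mono)
      show "0 < cmod (w - z) + t" using t by (simp add: add_nonneg_pos)
      have "cmod (w - z) + t \<le> (cmod w + t) * 1 + cmod z" using norm_triangle_ineq4[of w z] by simp
      also have "\<dots> \<le> (cmod w + t) * max 1 (cmod z) + max 1 (cmod z)"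
        using t by (intro add_mono mult_left_mono) auto
      finally show "cmod (w - z) + t \<le> (1 + cmod w + t) * max 1 (cmod z)" by (simp add: algebra_simps)
    qed
    also have "\<dots> = ln (1 + cmod w + t) + ln (max 1 (cmod z))"
      using t by (intro ln_mult_pos) (auto intro: add_pos_nonneg)
    finally have "ln (cmod (w - z) + cmod (of_real t)) \<le> C + ln (max 1 (cmod z))" using C t by simp
    from circle_nn_integral_ln[OF z this] show "(\<integral>\<^sup>+x. g z x \<partial>unif01) = ennreal (C + ln (max 1 (cmod z)) - ln (max t (cmod (w - z))))"
      using t by (simp add: g_def add_diff_eq diff_add_eq add.commute)
  qed
  finally show ?thesis .
qed

definition log_kernel :: "real \<Rightarrow> real \<Rightarrow> complex \<Rightarrow> real" where
  "log_kernel r s z = ln (max s (cmod z)) - ln (max r (cmod z))"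

lemma measurable_log_kernel [measurable]: "log_kernel r s \<in> borel_measurable borel"
  unfolding log_kernel_def by measurable

lemma log_kernel_nonneg: "0 < r \<Longrightarrow> r \<le> s \<Longrightarrow> 0 \<le> log_kernel r s z"
proof -
  assume "0 < r" "r \<le> s"
  then have "ln (max r (cmod z)) \<le> ln (max s (cmod z))" by (intro ln_mono) auto
  then show ?thesis by (simp add: log_kernel_def)
qed

lemma integrable_unif01_bounded:
  fixes g :: "real \<Rightarrow> real"
  assumes "g \<in> borel_measurable borel" "\<And>x. \<bar>g x\<bar> \<le> B"
  shows "integrable unif01 g"
proof -
  interpret prob_space unif01 by (rule prob_space_unif01)
  show ?thesis using assms by (intro integrable_const_bound[of _ B]) auto
qed

lemma integrable_log_potential_circle:
  assumes t: "0 < t" "t < cmod w"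
  shows "integrable unif01 (\<lambda>x. log_potential (w + of_real t * cis (2 * pi * x)))"
proof (rule integrable_unif01_bounded)
  fix x :: real
  let ?v = "w + of_real t * cis (2 * pi * x)"
  define l where "l = ln (cmod ?v)"
  have "ln (cmod w - t) \<le> l" "l \<le> ln (cmod w + t)"
    using cmod_add_cis[OF t(1), of w "2 * pi * x"] t unfolding l_def by (auto intro!: ln_mono)
  then have l: "\<bar>l\<bar> \<le> \<bar>ln (cmod w - t)\<bar> + \<bar>ln (cmod w + t)\<bar>" by linarith
  define X where "X = ln (1 + \<bar>l\<bar> / 4)"
  have "0 \<le> X" by (simp add: X_def)
  moreover have "X \<le> \<bar>l\<bar> / 4" unfolding X_def by (rule ln_add_one_self_le_self) simp
  moreover have "log_potential ?v = max l 0 - 2 * X"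
    by (simp add: log_potential_def l_def X_def add_divide_distrib)
  ultimately have "\<bar>log_potential ?v\<bar> \<le> 2 * \<bar>l\<bar>" by (auto simp: max_def abs_if split: if_splits)
  then show "\<bar>log_potential ?v\<bar> \<le> 2 * (\<bar>ln (cmod w - t)\<bar> + \<bar>ln (cmod w + t)\<bar>)"
    by (rule order_trans[OF _ mult_left_mono[OF l]]) auto
qed measurable

lemma nn_integral_diff_const:
  assumes g: "integrable M g" and M: "prob_space M" and C: "\<And>x. x \<in> space M \<Longrightarrow> g x \<le> C"
  shows "(\<integral>\<^sup>+x. ennreal (C - g x) \<partial>M) = ennreal (C - integral\<^sup>L M g)" "integral\<^sup>L M g \<le> C"
proof -
  interpret prob_space M by (rule M)
  have 1: "integral\<^sup>L M (\<lambda>x. C - g x) = C - integral\<^sup>L M g"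
    using g prob_space by simp
  have "(\<integral>\<^sup>+x. ennreal (C - g x) \<partial>M) = ennreal (integral\<^sup>L M (\<lambda>x. C - g x))"
    using g C by (intro nn_integral_eq_integral AE_I2) auto
  then show "(\<integral>\<^sup>+x. ennreal (C - g x) \<partial>M) = ennreal (C - integral\<^sup>L M g)" unfolding 1 .
  have "0 \<le> integral\<^sup>L M (\<lambda>x. C - g x)" using C by (intro integral_nonneg_AE AE_I2) auto
  then show "integral\<^sup>L M g \<le> C" unfolding 1 by simp
qed

lemma log_potential_le:
  assumes "v \<noteq> 0"
  shows "log_potential v \<le> ln (1 + cmod v)"
proof -
  have "ln (cmod v) \<le> ln (1 + cmod v)" "0 \<le> ln (1 + cmod v)"
    using assms by (auto intro!: ln_mono)
  moreover have "0 \<le> ln ((4 + \<bar>ln (cmod v)\<bar>) / 4)" by (intro ln_ge_zero) auto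
  ultimately show ?thesis unfolding log_potential_def by linarith
qed

text \<open>The limit measure seen through the kernel is a difference of circle means of its
  potential; the auxiliary \<open>C\<close> and the renormalising term cancel in that
  difference.\<close>

theorem log_kernel_limit_measure:
  assumes rs: "0 < r" "r < s" "s < cmod w"
  defines "a \<equiv> \<lambda>t. LINT x|unif01. log_potential (w + of_real t * cis (2 * pi * x))"
  shows "(\<integral>\<^sup>+z. ennreal (log_kernel r s (w - z)) \<partial>limit_measure) = ennreal (a s - a r)" and "a r \<le> a s"
proof -
  define C where "C = ln (1 + cmod w + s)"
  have C: "ln (1 + cmod w + t) \<le> C" if "0 < t" "t \<le> s" for t
    unfolding C_def using that norm_ge_zero[of w] by (intro ln_mono; linarith)
  have bound: "log_potential (w + of_real t * cis (2 * pi * x)) \<le> C" if "0 < t" "t \<le> s" for t x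
  proof -
    let ?v = "w + of_real t * cis (2 * pi * x)"
    have "?v \<noteq> 0" using cmod_add_cis(2)[OF that(1), of w "2 * pi * x"] that rs by auto
    then have "log_potential ?v \<le> ln (1 + cmod ?v)" by (rule log_potential_le)
    also have "\<dots> \<le> ln (1 + cmod w + t)"
      using cmod_add_cis(1)[OF that(1), of w "2 * pi * x"] by (intro ln_mono) (auto intro: add_pos_nonneg)
    finally show ?thesis using C[OF that] by simp
  qed
  have mean: "ennreal (C - a t) = (\<integral>\<^sup>+z. ennreal (C + ln (max 1 (cmod z)) - ln (max t (cmod (w - z)))) \<partial>limit_measure)"
     "a t \<le> C" if t: "0 < t" "t \<le> s" for t
  proof -
    have tw: "t < cmod w" using t rs by simp
    note d = nn_integral_diff_const[OF integrable_log_potential_circle[OF t(1) tw] prob_space_unif01 bound[OF t]]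
    show "a t \<le> C" unfolding a_def by (rule d(2))
    show "ennreal (C - a t) = (\<integral>\<^sup>+z. ennreal (C + ln (max 1 (cmod z)) - ln (max t (cmod (w - z)))) \<partial>limit_measure)"
      unfolding a_def d(1)[symmetric] by (rule circle_mean_log_potential[OF t(1) tw C[OF t]])
  qed
  have "ennreal (C - a r) = (\<integral>\<^sup>+z. ennreal (C + ln (max 1 (cmod z)) - ln (max s (cmod (w - z)))) + ennreal (log_kernel r s (w - z)) \<partial>limit_measure)"
    unfolding mean(1)[OF rs(1) less_imp_le[OF rs(2)]]
  proof (rule nn_integral_cong)
    fix z
    have "ln (max s (cmod (w - z))) \<le> ln ((1 + cmod w + s) * max 1 (cmod z))"
    proof (rule ln_mono)
      show "0 < max s (cmod (w - z))" using rs by (simp add: less_max_iff_disj)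
      have "max s (cmod (w - z)) \<le> (cmod w + s) * 1 + cmod z" using norm_triangle_ineq4[of w z] rs by simp
      also have "\<dots> \<le> (cmod w + s) * max 1 (cmod z) + max 1 (cmod z)"
        using rs by (intro add_mono mult_left_mono) auto
      finally show "max s (cmod (w - z)) \<le> (1 + cmod w + s) * max 1 (cmod z)" by (simp add: algebra_simps)
    qed
    also have "\<dots> = C + ln (max 1 (cmod z))"
      unfolding C_def using rs by (intro ln_mult_pos) (auto intro: add_pos_nonneg)
    finally have "0 \<le> C + ln (max 1 (cmod z)) - ln (max s (cmod (w - z)))" by simp
    then show "ennreal (C + ln (max 1 (cmod z)) - ln (max r (cmod (w - z)))) =
       ennreal (C + ln (max 1 (cmod z)) - ln (max s (cmod (w - z)))) + ennreal (log_kernel r s (w - z))"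
      using log_kernel_nonneg[of r s "w - z"] rs
      by (subst ennreal_plus[symmetric]) (auto simp: log_kernel_def algebra_simps)
  qed
  also have "\<dots> = (\<integral>\<^sup>+z. ennreal (C + ln (max 1 (cmod z)) - ln (max s (cmod (w - z)))) \<partial>limit_measure)
      + (\<integral>\<^sup>+z. ennreal (log_kernel r s (w - z)) \<partial>limit_measure)"
    by (rule nn_integral_add) measurable
  also have "(\<integral>\<^sup>+z. ennreal (C + ln (max 1 (cmod z)) - ln (max s (cmod (w - z)))) \<partial>limit_measure) = ennreal (C - a s)"
    using rs by (intro mean(1)[symmetric]) auto
  finally have eq: "ennreal (C - a r) = ennreal (C - a s) + (\<integral>\<^sup>+z. ennreal (log_kernel r s (w - z)) \<partial>limit_measure)" .
  have as: "0 \<le> C - a s" and ar: "0 \<le> C - a r" using mean(2)[of s] mean(2)[of r] rs by auto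
  have "ennreal (C - a s) \<le> ennreal (C - a r)" unfolding eq by simp
  then show le: "a r \<le> a s" using ar as by (simp add: ennreal_le_iff)
  have "ennreal (C - a s) + (\<integral>\<^sup>+z. ennreal (log_kernel r s (w - z)) \<partial>limit_measure) = ennreal (C - a s) + ennreal (a s - a r)"
    unfolding eq[symmetric] using as le by (subst ennreal_plus[symmetric]) auto
  then show "(\<integral>\<^sup>+z. ennreal (log_kernel r s (w - z)) \<partial>limit_measure) = ennreal (a s - a r)"
    by simp
qed

section \<open>From potentials to root measures\<close>

lemma order_linear_factor: "order z [:- a, 1:] = (if z = a then 1 else 0)" for a :: complex
proof (cases "z = a")
  case True
  then show ?thesis using order_power_n_n[of a 1] by simp
next
  case False
  then show ?thesis by (simp add: order_0I)
qed

lemma prod_linear_neq_0: "(\<Prod>m<n. [:- \<zeta> m, 1:]) \<noteq> (0 :: complex poly)" for n :: nat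
  by (simp add: prod_zero_iff)

lemma order_prod_linear: "order z (\<Prod>m<n. [:- \<zeta> m, 1:]) = card {m. m < n \<and> \<zeta> m = z}" for z :: complex and n :: nat
proof (induction n)
  case (Suc n)
  have "order z (\<Prod>m<Suc n. [:- \<zeta> m, 1:]) = order z (\<Prod>m<n. [:- \<zeta> m, 1:]) + order z [:- \<zeta> n, 1:]"
    using prod_linear_neq_0[of \<zeta> "Suc n"] unfolding prod.lessThan_Suc by (rule order_mult)
  also have "\<dots> = card {m. m < n \<and> \<zeta> m = z} + (if z = \<zeta> n then 1 else 0)"
    by (simp add: Suc.IH order_linear_factor)
  also have "\<dots> = card {m. m < Suc n \<and> \<zeta> m = z}"
  proof (cases "z = \<zeta> n")
    case True
    then have "{m. m < Suc n \<and> \<zeta> m = z} = insert n {m. m < n \<and> \<zeta> m = z}" by (auto simp: less_Suc_eq)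
    then show ?thesis using True by simp
  next
    case False
    then have "{m. m < Suc n \<and> \<zeta> m = z} = {m. m < n \<and> \<zeta> m = z}" by (auto simp: less_Suc_eq)
    then show ?thesis using False by simp
  qed
  finally show ?case .
qed simp

lemma degree_prod_linear: "degree (\<Prod>m<n. [:- \<zeta> m, 1:] :: complex poly) = n" for n :: nat
proof (induction n)
  case (Suc n)
  have "degree (\<Prod>m<Suc n. [:- \<zeta> m, 1:] :: complex poly) = degree (\<Prod>m<n. [:- \<zeta> m, 1:]) + degree [:- \<zeta> n, 1:]"
    unfolding prod.lessThan_Suc using prod_linear_neq_0[of \<zeta> n] by (intro degree_mult_eq) auto
  then show ?case using Suc by simp
qed simp

lemma poly_factorization:
  fixes p :: "complex poly"
  assumes "p \<noteq> 0"
  obtains \<zeta> where "p = smult (lead_coeff p) (\<Prod>m<degree p. [:- \<zeta> m, 1:])"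
proof -
  obtain A where A: "size A = degree p" "p = smult (lead_coeff p) (\<Prod>x\<in>#A. [:- x, 1:])"
    using alg_closed_imp_factorization[OF assms] by blast
  obtain xs where xs: "mset xs = A" using ex_mset by blast
  have "(\<Prod>x\<in>#A. [:- x, 1:]) = prod_list (map (\<lambda>x. [:- x, 1:]) xs)"
    unfolding xs[symmetric] by (simp add: prod_mset_prod_list[symmetric])
  also have "\<dots> = (\<Prod>m<degree p. [:- (xs ! m), 1:])"
  proof -
    have "length xs = degree p" using A(1) xs by auto
    then show ?thesis by (simp add: prod.list_conv_set_nth lessThan_atLeast0)
  qed
  finally have "p = smult (lead_coeff p) (\<Prod>m<degree p. [:- (xs ! m), 1:])" using A(2) by simp
  then show thesis by (rule that)
qed

text \<open>Turns point masses weighted by multiplicity into a count of indices, so that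
  multiplicities need no attention afterwards.\<close>

lemma measure_root_measure:
  fixes p :: "complex poly" and n :: nat
  assumes n: "1 \<le> n" and l: "l \<noteq> 0" and p: "p = smult l (\<Prod>m<n. [:- \<zeta> m, 1:])" and A: "A \<in> sets borel"
  shows "emeasure (root_measure p) A = ennreal (card {m. m < n \<and> \<zeta> m \<in> A} / n)"
    and "measure (root_measure p) A = card {m. m < n \<and> \<zeta> m \<in> A} / n"
proof -
  have deg: "degree p = n" unfolding p using l by (simp add: degree_prod_linear)
  have ord: "order z p = card {m. m < n \<and> \<zeta> m = z}" for z
    unfolding p using l by (simp add: order_smult order_prod_linear)
  let ?R = "{z. poly p z = 0}" and ?f = "\<lambda>z. ennreal (real (order z p) / real (degree p))"
  have R: "?R = \<zeta> ` {..<n}" unfolding p using l by (auto simp: poly_prod prod_zero_iff)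
  then have fin: "finite ?R" by simp
  have "emeasure (root_measure p) A = emeasure (point_measure ?R ?f) ((\<lambda>z. z) -` A \<inter> space (point_measure ?R ?f))"
    unfolding root_measure_def using A by (intro emeasure_distr) (auto simp: measurable_def space_point_measure sets_point_measure)
  also have "\<dots> = emeasure (point_measure ?R ?f) (A \<inter> ?R)"
    by (simp add: space_point_measure)
  also have "\<dots> = (\<Sum>z\<in>A \<inter> ?R. ?f z)"
    using fin by (intro emeasure_point_measure_finite) auto
  also have "\<dots> = ennreal (\<Sum>z\<in>A \<inter> ?R. real (card {m. m < n \<and> \<zeta> m = z}) / real n)"
    unfolding deg ord by (rule sum_ennreal) simp
  also have "(\<Sum>z\<in>A \<inter> ?R. real (card {m. m < n \<and> \<zeta> m = z}) / real n) = real (\<Sum>z\<in>A \<inter> ?R. card {m. m < n \<and> \<zeta> m = z}) / real n"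
    by (simp add: sum_divide_distrib)
  also have "(\<Sum>z\<in>A \<inter> ?R. card {m. m < n \<and> \<zeta> m = z}) = card (\<Union>z\<in>A \<inter> ?R. {m. m < n \<and> \<zeta> m = z})"
    using fin by (intro card_UN_disjoint[symmetric]) auto
  also have "(\<Union>z\<in>A \<inter> ?R. {m. m < n \<and> \<zeta> m = z}) = {m. m < n \<and> \<zeta> m \<in> A}"
    unfolding R by auto
  finally show 1: "emeasure (root_measure p) A = ennreal (card {m. m < n \<and> \<zeta> m \<in> A} / n)" .
  show "measure (root_measure p) A = card {m. m < n \<and> \<zeta> m \<in> A} / n"
    unfolding measure_def 1 by simp
qed

lemma open_neighbourhood: "open (\<Union>x\<in>A. ball x e)"
  by (intro open_UN ballI open_ball)

text \<open>For probability measures one of the two inequalities implies the other: it is applied to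
  the complement of the neighbourhood of \<open>A\<close>, whose own neighbourhood misses
  \<open>A\<close>.\<close>

lemma levy_prokhorov_le:
  fixes M N :: "'a::metric_space measure"
  assumes M: "prob_space M" "sets M = sets borel" and N: "prob_space N" "sets N = sets borel" and e: "0 < e"
    and le: "\<And>A. A \<in> sets borel \<Longrightarrow> measure M A \<le> measure N (\<Union>x\<in>A. ball x e) + e"
  shows "levy_prokhorov M N \<le> e"
proof -
  interpret M: prob_space M by (rule M)
  interpret N: prob_space N by (rule N)
  have rev: "measure N A \<le> measure M (\<Union>x\<in>A. ball x e) + e" if A: "A \<in> sets borel" for A
  proof -
    let ?O = "\<Union>x\<in>A. ball x e" and ?B = "- (\<Union>x\<in>A. ball x e)"
    have O: "?O \<in> sets borel" using open_neighbourhood by (rule borel_open)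
    have sp: "space M = UNIV" "space N = UNIV" using sets_eq_imp_space_eq[OF M(2)] sets_eq_imp_space_eq[OF N(2)] by auto
    have B: "?B \<in> sets borel" by (rule borel_comp[OF O])
    have "(\<Union>x\<in>?B. ball x e) \<subseteq> - A" by auto (metis dist_commute)
    then have "measure N (\<Union>x\<in>?B. ball x e) \<le> measure N (- A)"
      using A N(2) by (intro N.finite_measure_mono) auto
    also have "measure N (- A) = 1 - measure N A"
      using N.prob_compl[of A] A N(2) sp by (simp add: Compl_eq_Diff_UNIV)
    finally have "measure M ?B \<le> 1 - measure N A + e" using le[OF B] by linarith
    moreover have "measure M ?B = 1 - measure M ?O"
      using M.prob_compl[of ?O] O M(2) sp by (simp add: Compl_eq_Diff_UNIV)
    ultimately show ?thesis by linarith
  qed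
  show ?thesis unfolding levy_prokhorov_def
  proof (rule cInf_lower)
    show "e \<in> {e. 0 < e \<and> (\<forall>A\<in>sets borel. measure M A \<le> measure N (\<Union>x\<in>A. ball x e) + e \<and> measure N A \<le> measure M (\<Union>x\<in>A. ball x e) + e)}"
      using e le rev by auto
    show "bdd_below {e. 0 < e \<and> (\<forall>A\<in>sets borel. measure M A \<le> measure N (\<Union>x\<in>A. ball x e) + e \<and> measure N A \<le> measure M (\<Union>x\<in>A. ball x e) + e)}"
      by (rule bdd_belowI[of _ 0]) auto
  qed
qed

section \<open>Comparing roots and limit measure through potentials\<close>

lemma circle_integral_ln:
  assumes za: "cmod z \<noteq> cmod a"
  shows "integrable unif01 (\<lambda>x. ln (cmod (z + a * cis (2 * pi * x))))"
    and "(LINT x|unif01. ln (cmod (z + a * cis (2 * pi * x)))) = ln (max (cmod a) (cmod z))"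
proof -
  interpret prob_space unif01 by (rule prob_space_unif01)
  let ?f = "\<lambda>x. ln (cmod (z + a * cis (2 * pi * x)))"
  define C where "C = ln (cmod z + cmod a)"
  have f: "?f x \<le> C" for x
  proof -
    have "z + a * cis (2 * pi * x) \<noteq> 0"
    proof
      assume "z + a * cis (2 * pi * x) = 0"
      then have "z = - (a * cis (2 * pi * x))" by (simp add: eq_neg_iff_add_eq_0)
      then have "cmod z = cmod a" by (simp add: norm_mult)
      then show False using za by simp
    qed
    moreover have "cmod (z + a * cis (2 * pi * x)) \<le> cmod z + cmod a"
      by (rule order_trans[OF norm_triangle_ineq]) (simp add: norm_mult)
    ultimately show ?thesis unfolding C_def by (intro ln_mono) auto
  qed
  have m: "ln (max (cmod a) (cmod z)) \<le> C"
    unfolding C_def using za by (intro ln_mono) (auto simp: less_max_iff_disj)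
  have nn: "(\<integral>\<^sup>+x. ennreal (C - ?f x) \<partial>unif01) = ennreal (C - ln (max (cmod a) (cmod z)))"
    by (rule circle_nn_integral_ln[OF za]) (simp add: C_def)
  have int: "integrable unif01 (\<lambda>x. C - ?f x)"
    by (rule integrableI_nn_integral_finite[OF _ _ nn]) (use f in \<open>auto simp: measurable_If\<close>)
  have "integrable unif01 (\<lambda>x. C - (C - ?f x))" by (rule Bochner_Integration.integrable_diff[OF integrable_const int])
  moreover have "(\<lambda>x. C - (C - ?f x)) = ?f" by auto
  ultimately show i: "integrable unif01 ?f" by (simp only:)
  have "ennreal (integral\<^sup>L unif01 (\<lambda>x. C - ?f x)) = ennreal (C - ln (max (cmod a) (cmod z)))"
    unfolding nn[symmetric] using int f by (intro nn_integral_eq_integral[symmetric]) auto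
  moreover have "0 \<le> integral\<^sup>L unif01 (\<lambda>x. C - ?f x)" using f by (intro integral_nonneg_AE) auto
  ultimately have "integral\<^sup>L unif01 (\<lambda>x. C - ?f x) = C - ln (max (cmod a) (cmod z))"
    using m by (simp only: ennreal_inj diff_ge_0_iff_ge)
  moreover have "integral\<^sup>L unif01 (\<lambda>x. C - ?f x) = C - integral\<^sup>L unif01 ?f"
    using i prob_space by simp
  ultimately show "integral\<^sup>L unif01 ?f = ln (max (cmod a) (cmod z))" by simp
qed

locale factored_poly =
  fixes n :: nat and l :: complex and \<zeta> :: "nat \<Rightarrow> complex"
  assumes n: "1 \<le> n" and l: "l \<noteq> 0"
begin

definition U :: "complex \<Rightarrow> real" where
  "U v = ln (cmod (l * (\<Prod>m<n. v - \<zeta> m))) / n"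

definition D :: "complex \<Rightarrow> real" where
  "D v = U v - log_potential v"

definition kernel_mean :: "real \<Rightarrow> real \<Rightarrow> complex \<Rightarrow> real" where
  "kernel_mean r s w = (\<Sum>m<n. log_kernel r s (w - \<zeta> m)) / n"

lemma measurable_U [measurable]: "U \<in> borel_measurable borel"
  unfolding U_def by measurable

lemma measurable_D [measurable]: "D \<in> borel_measurable borel"
  unfolding D_def by measurable

lemma measurable_kernel_mean [measurable]: "kernel_mean r s \<in> borel_measurable borel"
  unfolding kernel_mean_def by measurable

lemma U_circle:
  assumes t: "0 < t" and off: "\<And>m. m < n \<Longrightarrow> cmod (w - \<zeta> m) \<noteq> t"
  shows "integrable unif01 (\<lambda>x. U (w + of_real t * cis (2 * pi * x)))"
    and "(LINT x|unif01. U (w + of_real t * cis (2 * pi * x))) = (ln (cmod l) + (\<Sum>m<n. ln (max t (cmod (w - \<zeta> m))))) / n"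
proof -
  interpret prob_space unif01 by (rule prob_space_unif01)
  let ?f = "\<lambda>m x. ln (cmod ((w - \<zeta> m) + of_real t * cis (2 * pi * x)))"
  have off': "cmod (w - \<zeta> m) \<noteq> cmod (of_real t)" if "m < n" for m using off[OF that] t by simp
  have eq: "U (w + of_real t * cis (2 * pi * x)) = (ln (cmod l) + (\<Sum>m<n. ?f m x)) / n" for x
  proof -
    have ne: "w - \<zeta> m + of_real t * cis (2 * pi * x) \<noteq> 0" if "m < n" for m
    proof
      assume "w - \<zeta> m + of_real t * cis (2 * pi * x) = 0"
      then have "w - \<zeta> m = - (of_real t * cis (2 * pi * x))" by (simp only: eq_neg_iff_add_eq_0)
      then have "cmod (w - \<zeta> m) = cmod (of_real t * cis (2 * pi * x))" by (simp only: norm_minus_cancel)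
      then show False using off'[OF that] by (simp add: norm_mult)
    qed
    have "cmod (l * (\<Prod>m<n. w + of_real t * cis (2 * pi * x) - \<zeta> m)) = cmod l * (\<Prod>m<n. cmod (w - \<zeta> m + of_real t * cis (2 * pi * x)))"
      by (simp add: norm_mult prod_norm[symmetric] diff_add_eq)
    moreover have "ln (cmod l * (\<Prod>m<n. cmod (w - \<zeta> m + of_real t * cis (2 * pi * x))))
       = ln (cmod l) + ln (\<Prod>m<n. cmod (w - \<zeta> m + of_real t * cis (2 * pi * x)))"
      using l ne by (intro ln_mult_pos prod_pos) auto
    moreover have "ln (\<Prod>m<n. cmod (w - \<zeta> m + of_real t * cis (2 * pi * x))) = (\<Sum>m<n. ?f m x)"
      using ne by (intro ln_prod) auto
    ultimately show ?thesis by (simp only: U_def)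
  qed
  have int: "integrable unif01 (?f m)" if "m < n" for m
    by (rule circle_integral_ln(1)[OF off'[OF that]])
  have int': "integrable unif01 (\<lambda>x. \<Sum>m<n. ?f m x)"
    using int by (intro Bochner_Integration.integrable_sum) auto
  show "integrable unif01 (\<lambda>x. U (w + of_real t * cis (2 * pi * x)))"
    unfolding eq by (intro Bochner_Integration.integrable_divide Bochner_Integration.integrable_add integrable_const int')
  have "(LINT x|unif01. (\<Sum>m<n. ?f m x)) = (\<Sum>m<n. (LINT x|unif01. ?f m x))"
    using int by (intro Bochner_Integration.integral_sum) auto
  also have "\<dots> = (\<Sum>m<n. ln (max t (cmod (w - \<zeta> m))))"
    using t by (intro sum.cong) (auto simp: circle_integral_ln(2)[OF off'])
  finally show "(LINT x|unif01. U (w + of_real t * cis (2 * pi * x))) = (ln (cmod l) + (\<Sum>m<n. ln (max t (cmod (w - \<zeta> m))))) / n"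
    unfolding eq using int' prob_space by simp
qed

definition circle_error :: "real \<Rightarrow> complex \<Rightarrow> ennreal" where
  "circle_error t w = (\<integral>\<^sup>+x. ennreal \<bar>D (w + of_real t * cis (2 * pi * x))\<bar> \<partial>unif01)"

text \<open>The term \<open>ln (cmod l)\<close> cancels between the circle means at the radii
  \<open>s\<close> and \<open>r\<close>. The kernel means of the roots and of the limit measure then
  differ exactly by a difference of two circle means of \<open>D\<close>.\<close>

lemma kernel_mean_compare:
  assumes rs: "0 < r" "r < s" "s < cmod w" and off: "\<And>m. m < n \<Longrightarrow> cmod (w - \<zeta> m) \<noteq> r \<and> cmod (w - \<zeta> m) \<noteq> s"
  defines "K \<equiv> \<integral>\<^sup>+z. ennreal (log_kernel r s (w - z)) \<partial>limit_measure"
  shows "ennreal (kernel_mean r s w) \<le> K + (circle_error s w + circle_error r w)"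
    and "K \<le> ennreal (kernel_mean r s w) + (circle_error s w + circle_error r w)"
proof -
  let ?p = "\<lambda>t. LINT x|unif01. log_potential (w + of_real t * cis (2 * pi * x))"
  let ?d = "\<lambda>t. LINT x|unif01. D (w + of_real t * cis (2 * pi * x))"
  have K: "K = ennreal (?p s - ?p r)" "?p r \<le> ?p s"
    unfolding K_def using log_kernel_limit_measure[OF rs] by auto
  have d: "?d t = (ln (cmod l) + (\<Sum>m<n. ln (max t (cmod (w - \<zeta> m))))) / n - ?p t"
     and di: "integrable unif01 (\<lambda>x. D (w + of_real t * cis (2 * pi * x)))"
     if t: "t = r \<or> t = s" for t
  proof -
    have t': "0 < t" "t < cmod w" using t rs by auto
    have o: "cmod (w - \<zeta> m) \<noteq> t" if "m < n" for m using off[OF that] t by auto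
    note u = U_circle[OF t'(1) o] and p = integrable_log_potential_circle[OF t']
    have "?d t = (LINT x|unif01. U (w + of_real t * cis (2 * pi * x))) - ?p t"
      unfolding D_def by (rule Bochner_Integration.integral_diff[OF u(1) p])
    then show "?d t = (ln (cmod l) + (\<Sum>m<n. ln (max t (cmod (w - \<zeta> m))))) / n - ?p t"
      using u(2) by simp
    show "integrable unif01 (\<lambda>x. D (w + of_real t * cis (2 * pi * x)))"
      unfolding D_def by (rule Bochner_Integration.integrable_diff[OF u(1) p])
  qed
  have err: "ennreal \<bar>?d t\<bar> \<le> circle_error t w" if "t = r \<or> t = s" for t
    unfolding circle_error_def using integral_norm_bound_ennreal[OF di[OF that]] by simp
  have km: "kernel_mean r s w = (?p s - ?p r) + (?d s - ?d r)"
    unfolding d[OF disjI1[OF refl]] d[OF disjI2[OF refl]] kernel_mean_def log_kernel_def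
    by (simp add: sum_subtractf diff_divide_distrib add_divide_distrib)
  have e: "ennreal \<bar>?d s\<bar> + ennreal \<bar>?d r\<bar> \<le> circle_error s w + circle_error r w"
    by (intro add_mono err) auto
  have "ennreal (kernel_mean r s w) \<le> ennreal ((?p s - ?p r) + (\<bar>?d s\<bar> + \<bar>?d r\<bar>))"
    unfolding km by (intro ennreal_leI) linarith
  also have "\<dots> = K + (ennreal \<bar>?d s\<bar> + ennreal \<bar>?d r\<bar>)"
    unfolding K(1) using K(2) by simp
  also have "\<dots> \<le> K + (circle_error s w + circle_error r w)"
    using e by (rule add_left_mono)
  finally show "ennreal (kernel_mean r s w) \<le> K + (circle_error s w + circle_error r w)" .
  have km0: "0 \<le> kernel_mean r s w"
    unfolding kernel_mean_def using rs log_kernel_nonneg[of r s] by (intro divide_nonneg_nonneg sum_nonneg) auto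
  have "K \<le> ennreal (kernel_mean r s w + (\<bar>?d s\<bar> + \<bar>?d r\<bar>))"
    unfolding K(1) km by (intro ennreal_leI) linarith
  also have "\<dots> = ennreal (kernel_mean r s w) + (ennreal \<bar>?d s\<bar> + ennreal \<bar>?d r\<bar>)"
    using km0 by simp
  also have "\<dots> \<le> ennreal (kernel_mean r s w) + (circle_error s w + circle_error r w)"
    using e by (rule add_left_mono)
  finally show "K \<le> ennreal (kernel_mean r s w) + (circle_error s w + circle_error r w)" .
qed

lemma measurable_circle_error [measurable]: "circle_error t \<in> borel_measurable borel"
proof -
  have "(\<lambda>(w, x). ennreal \<bar>D (w + of_real t * cis (2 * pi * x))\<bar>) \<in> borel_measurable (borel \<Otimes>\<^sub>M unif01)"
    by measurable
  then show ?thesis unfolding circle_error_def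
    by (rule sigma_finite_measure.borel_measurable_nn_integral[OF prob_space_imp_sigma_finite[OF prob_space_unif01]])
qed

text \<open>For each direction the shift by \<open>t\<close> preserves Lebesgue measure, so
  averaging over circles does not increase the L1 norm of \<open>D\<close>; it only enlarges the
  domain from \<open>Q\<close> to \<open>A\<close>.\<close>

lemma circle_error_integral:
  assumes Q [measurable]: "Q \<in> sets borel" and A [measurable]: "A \<in> sets borel"
    and QA: "\<And>w x. w \<in> Q \<Longrightarrow> w + of_real t * cis x \<in> A"
  shows "(\<integral>\<^sup>+w. indicator Q w * circle_error t w \<partial>lborel) \<le> (\<integral>\<^sup>+v. indicator A v * ennreal \<bar>D v\<bar> \<partial>lborel)"
proof -
  have ps: "pair_sigma_finite unif01 (lborel :: complex measure)"
    by (simp add: pair_sigma_finite_def prob_space_imp_sigma_finite prob_space_unif01 sigma_finite_lborel)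
  have "(\<integral>\<^sup>+w. indicator Q w * circle_error t w \<partial>lborel)
    = (\<integral>\<^sup>+w. (\<integral>\<^sup>+x. indicator Q w * ennreal \<bar>D (w + of_real t * cis (2 * pi * x))\<bar> \<partial>unif01) \<partial>lborel)"
    unfolding circle_error_def by (intro nn_integral_cong nn_integral_cmult[symmetric]) measurable
  also have "\<dots> = (\<integral>\<^sup>+x. (\<integral>\<^sup>+w. indicator Q w * ennreal \<bar>D (w + of_real t * cis (2 * pi * x))\<bar> \<partial>lborel) \<partial>unif01)"
    by (rule pair_sigma_finite.Fubini'[OF ps]) measurable
  also have "\<dots> \<le> (\<integral>\<^sup>+x. (\<integral>\<^sup>+v. indicator A v * ennreal \<bar>D v\<bar> \<partial>lborel) \<partial>unif01)"
  proof (rule nn_integral_mono)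
    fix x
    let ?c = "of_real t * cis (2 * pi * x)"
    have "(\<integral>\<^sup>+w. indicator Q w * ennreal \<bar>D (w + ?c)\<bar> \<partial>lborel) \<le> (\<integral>\<^sup>+w. indicator A (?c + w) * ennreal \<bar>D (?c + w)\<bar> \<partial>lborel)"
    proof (rule nn_integral_mono)
      fix w
      show "indicator Q w * ennreal \<bar>D (w + ?c)\<bar> \<le> indicator A (?c + w) * ennreal \<bar>D (?c + w)\<bar>"
        using QA[of w "2 * pi * x"] by (cases "w \<in> Q") (simp_all add: add.commute)
    qed
    also have "\<dots> = (\<integral>\<^sup>+v. indicator A v * ennreal \<bar>D v\<bar> \<partial>lborel)"
      by (rule nn_integral_lborel_translate) measurable
    finally show "(\<integral>\<^sup>+w. indicator Q w * ennreal \<bar>D (w + ?c)\<bar> \<partial>lborel) \<le> (\<integral>\<^sup>+v. indicator A v * ennreal \<bar>D v\<bar> \<partial>lborel)" .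
  qed
  also have "\<dots> = (\<integral>\<^sup>+v. indicator A v * ennreal \<bar>D v\<bar> \<partial>lborel)"
    by (rule prob_space_nn_integral_const[OF prob_space_unif01])
  finally show ?thesis .
qed

end

section \<open>Smoothed indicators of planar sets\<close>

definition kernel_mass :: "real \<Rightarrow> real \<Rightarrow> complex set \<Rightarrow> complex \<Rightarrow> ennreal" where
  "kernel_mass r s Q z = (\<integral>\<^sup>+w. indicator Q w * ennreal (log_kernel r s (w - z)) \<partial>lborel)"

lemma measurable_kernel_mass [measurable]:
  assumes [measurable]: "Q \<in> sets borel"
  shows "kernel_mass r s Q \<in> borel_measurable borel"
proof -
  have "(\<lambda>(z, w). indicator Q w * ennreal (log_kernel r s (w - z))) \<in> borel_measurable (borel \<Otimes>\<^sub>M lborel)"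
    by measurable
  then show ?thesis unfolding kernel_mass_def
    by (rule sigma_finite_measure.borel_measurable_nn_integral[OF sigma_finite_lborel])
qed

context factored_poly
begin

text \<open>The pointwise comparison integrated over centres \<open>w \<in> Q\<close>. Centres for
  which a root lies on one of the two circles form a null set; the error enters once for each
  radius.\<close>

lemma kernel_mass_compare:
  assumes rs: "0 < r" "r < s" and Q [measurable]: "Q \<in> sets borel" and A [measurable]: "A \<in> sets borel"
    and Qs: "\<And>w. w \<in> Q \<Longrightarrow> s < cmod w"
    and QA: "\<And>w t x. w \<in> Q \<Longrightarrow> 0 < t \<Longrightarrow> t \<le> s \<Longrightarrow> w + of_real t * cis x \<in> A"
  defines "err \<equiv> \<integral>\<^sup>+v. indicator A v * ennreal \<bar>D v\<bar> \<partial>lborel"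
  shows "ennreal (1 / n) * (\<Sum>m<n. kernel_mass r s Q (\<zeta> m)) \<le> (\<integral>\<^sup>+z. kernel_mass r s Q z \<partial>limit_measure) + (err + err)"
    and "(\<integral>\<^sup>+z. kernel_mass r s Q z \<partial>limit_measure) \<le> ennreal (1 / n) * (\<Sum>m<n. kernel_mass r s Q (\<zeta> m)) + (err + err)"
proof -
  have knn: "0 \<le> log_kernel r s z" for z using rs by (intro log_kernel_nonneg) auto
  let ?K = "\<lambda>w. \<integral>\<^sup>+z. ennreal (log_kernel r s (w - z)) \<partial>limit_measure"
  have ps: "pair_sigma_finite limit_measure (lborel :: complex measure)"
    by (simp add: pair_sigma_finite_def prob_space_imp_sigma_finite prob_space_limit_measure sigma_finite_lborel)
  have mK [measurable]: "?K \<in> borel_measurable borel"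
    by (rule sigma_finite_measure.borel_measurable_nn_integral[OF prob_space_imp_sigma_finite[OF prob_space_limit_measure]]) measurable
  have 1: "(\<integral>\<^sup>+w. indicator Q w * ennreal (kernel_mean r s w) \<partial>lborel) = ennreal (1 / n) * (\<Sum>m<n. kernel_mass r s Q (\<zeta> m))"
  proof -
    have "indicator Q w * ennreal (kernel_mean r s w) = (\<Sum>m<n. ennreal (1 / n) * (indicator Q w * ennreal (log_kernel r s (w - \<zeta> m))))" for w
    proof -
      have "ennreal (kernel_mean r s w) = ennreal (1 / n) * ennreal (\<Sum>m<n. log_kernel r s (w - \<zeta> m))"
        unfolding kernel_mean_def by (subst ennreal_mult'[symmetric]) auto
      also have "ennreal (\<Sum>m<n. log_kernel r s (w - \<zeta> m)) = (\<Sum>m<n. ennreal (log_kernel r s (w - \<zeta> m)))"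
        by (rule sum_ennreal[symmetric]) (rule knn)
      finally show ?thesis by (simp add: sum_distrib_left mult_ac)
    qed
    then have "(\<integral>\<^sup>+w. indicator Q w * ennreal (kernel_mean r s w) \<partial>lborel)
       = (\<integral>\<^sup>+w. (\<Sum>m<n. ennreal (1 / n) * (indicator Q w * ennreal (log_kernel r s (w - \<zeta> m)))) \<partial>lborel)" by simp
    also have "\<dots> = (\<Sum>m<n. \<integral>\<^sup>+w. ennreal (1 / n) * (indicator Q w * ennreal (log_kernel r s (w - \<zeta> m))) \<partial>lborel)"
      by (rule nn_integral_sum) measurable
    also have "\<dots> = (\<Sum>m<n. ennreal (1 / n) * kernel_mass r s Q (\<zeta> m))"
      unfolding kernel_mass_def by (intro sum.cong refl nn_integral_cmult) measurable
    finally show ?thesis by (simp add: sum_distrib_left)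
  qed
  have 2: "(\<integral>\<^sup>+w. indicator Q w * ?K w \<partial>lborel) = (\<integral>\<^sup>+z. kernel_mass r s Q z \<partial>limit_measure)"
  proof -
    have "(\<integral>\<^sup>+w. indicator Q w * ?K w \<partial>lborel) = (\<integral>\<^sup>+w. (\<integral>\<^sup>+z. indicator Q w * ennreal (log_kernel r s (w - z)) \<partial>limit_measure) \<partial>lborel)"
      by (intro nn_integral_cong nn_integral_cmult[symmetric]) measurable
    also have "\<dots> = (\<integral>\<^sup>+z. (\<integral>\<^sup>+w. indicator Q w * ennreal (log_kernel r s (w - z)) \<partial>lborel) \<partial>limit_measure)"
      by (rule pair_sigma_finite.Fubini'[OF ps]) measurable
    finally show ?thesis by (simp add: kernel_mass_def)
  qed
  have e: "(\<integral>\<^sup>+w. indicator Q w * circle_error t w \<partial>lborel) \<le> err" if "0 < t" "t \<le> s" for t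
    unfolding err_def using QA that by (intro circle_error_integral Q A) auto
  have ee: "(\<integral>\<^sup>+w. indicator Q w * (circle_error s w + circle_error r w) \<partial>lborel) \<le> err + err"
  proof -
    have "(\<integral>\<^sup>+w. indicator Q w * (circle_error s w + circle_error r w) \<partial>lborel)
      = (\<integral>\<^sup>+w. indicator Q w * circle_error s w + indicator Q w * circle_error r w \<partial>lborel)"
      by (simp add: distrib_left)
    also have "\<dots> = (\<integral>\<^sup>+w. indicator Q w * circle_error s w \<partial>lborel) + (\<integral>\<^sup>+w. indicator Q w * circle_error r w \<partial>lborel)"
      by (rule nn_integral_add) measurable
    also have "\<dots> \<le> err + err" using rs by (intro add_mono e) auto
    finally show ?thesis .
  qed
  have ae: "AE w in lborel. \<forall>m\<in>{..<n}. dist (\<zeta> m) w \<noteq> r \<and> dist (\<zeta> m) w \<noteq> s"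
    by (intro AE_finite_allI AE_conjI AE_lborel_sphere) auto
  have "(\<integral>\<^sup>+w. indicator Q w * ennreal (kernel_mean r s w) \<partial>lborel)
    \<le> (\<integral>\<^sup>+w. indicator Q w * ?K w + indicator Q w * (circle_error s w + circle_error r w) \<partial>lborel)"
  proof (rule nn_integral_mono_AE, use ae in eventually_elim)
    fix w assume w: "\<forall>m\<in>{..<n}. dist (\<zeta> m) w \<noteq> r \<and> dist (\<zeta> m) w \<noteq> s"
    show "indicator Q w * ennreal (kernel_mean r s w) \<le> indicator Q w * ?K w + indicator Q w * (circle_error s w + circle_error r w)"
    proof (cases "w \<in> Q")
      case True
      have "ennreal (kernel_mean r s w) \<le> ?K w + (circle_error s w + circle_error r w)"
        using w by (intro kernel_mean_compare(1) rs Qs True) (auto simp: dist_norm norm_minus_commute)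
      then show ?thesis using True by simp
    qed simp
  qed
  also have "\<dots> = (\<integral>\<^sup>+w. indicator Q w * ?K w \<partial>lborel) + (\<integral>\<^sup>+w. indicator Q w * (circle_error s w + circle_error r w) \<partial>lborel)"
    by (rule nn_integral_add) measurable
  also have "\<dots> \<le> (\<integral>\<^sup>+w. indicator Q w * ?K w \<partial>lborel) + (err + err)" using ee by (rule add_left_mono)
  finally show "ennreal (1 / n) * (\<Sum>m<n. kernel_mass r s Q (\<zeta> m)) \<le> (\<integral>\<^sup>+z. kernel_mass r s Q z \<partial>limit_measure) + (err + err)"
    unfolding 1 2 .
  have "(\<integral>\<^sup>+w. indicator Q w * ?K w \<partial>lborel)
    \<le> (\<integral>\<^sup>+w. indicator Q w * ennreal (kernel_mean r s w) + indicator Q w * (circle_error s w + circle_error r w) \<partial>lborel)"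
  proof (rule nn_integral_mono_AE, use ae in eventually_elim)
    fix w assume w: "\<forall>m\<in>{..<n}. dist (\<zeta> m) w \<noteq> r \<and> dist (\<zeta> m) w \<noteq> s"
    show "indicator Q w * ?K w \<le> indicator Q w * ennreal (kernel_mean r s w) + indicator Q w * (circle_error s w + circle_error r w)"
    proof (cases "w \<in> Q")
      case True
      have "?K w \<le> ennreal (kernel_mean r s w) + (circle_error s w + circle_error r w)"
        using w by (intro kernel_mean_compare(2) rs Qs True) (auto simp: dist_norm norm_minus_commute)
      then show ?thesis using True by simp
    qed simp
  qed
  also have "\<dots> = (\<integral>\<^sup>+w. indicator Q w * ennreal (kernel_mean r s w) \<partial>lborel) + (\<integral>\<^sup>+w. indicator Q w * (circle_error s w + circle_error r w) \<partial>lborel)"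
    by (rule nn_integral_add) measurable
  also have "\<dots> \<le> (\<integral>\<^sup>+w. indicator Q w * ennreal (kernel_mean r s w) \<partial>lborel) + (err + err)" using ee by (rule add_left_mono)
  finally show "(\<integral>\<^sup>+z. kernel_mass r s Q z \<partial>limit_measure) \<le> ennreal (1 / n) * (\<Sum>m<n. kernel_mass r s Q (\<zeta> m)) + (err + err)"
    unfolding 1 2 .
qed

end

text \<open>\<open>\<kappa>\<close> is the integral of the kernel over the plane. It is finite
  because the kernel is bounded and supported in the disc of radius \<open>s\<close>, and positive
  because the kernel equals \<open>ln s - ln r\<close> on the disc of radius
  \<open>r\<close>.\<close>

lemma kernel_mass_values:
  assumes rs: "0 < r" "r < s"
  obtains \<kappa> :: real where "\<kappa> > 0"
    "\<And>Q z. kernel_mass r s Q z \<le> ennreal \<kappa>"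
    "\<And>Q z. ball z s \<subseteq> Q \<Longrightarrow> kernel_mass r s Q z = ennreal \<kappa>"
    "\<And>Q z. ball z s \<inter> Q = {} \<Longrightarrow> kernel_mass r s Q z = 0"
proof -
  define I where "I = (\<integral>\<^sup>+w. ennreal (log_kernel r s w) \<partial>lborel)"
  have k0: "log_kernel r s w = 0" if "s \<le> cmod w" for w using that rs by (simp add: log_kernel_def max_def)
  have ln: "ln r < ln s" using rs by (subst ln_less_cancel_iff) auto
  have kle: "log_kernel r s w \<le> ln s - ln r" for w
  proof (cases "s \<le> cmod w")
    case False
    have "ln r \<le> ln (max r (cmod w))" using rs by (intro ln_mono) auto
    then show ?thesis using False by (simp add: log_kernel_def max_def)
  qed (use k0 ln in auto)
  have "I \<le> (\<integral>\<^sup>+w. ennreal (ln s - ln r) * indicator (ball 0 s) w \<partial>(lborel :: complex measure))"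
    unfolding I_def
  proof (rule nn_integral_mono)
    fix w :: complex
    show "ennreal (log_kernel r s w) \<le> ennreal (ln s - ln r) * indicator (ball 0 s) w"
      using kle[of w] k0[of w] by (cases "cmod w < s") (auto intro: ennreal_leI)
  qed
  also have "\<dots> = ennreal (ln s - ln r) * emeasure lborel (ball (0::complex) s)"
    by (rule nn_integral_cmult_indicator) simp
  also have "\<dots> = ennreal (ln s - ln r) * ennreal (pi * s\<^sup>2)"
    using rs by (simp add: emeasure_ball unit_ball_vol_2)
  also have "\<dots> < \<infinity>" by (simp add: ennreal_mult_less_top)
  finally have fin: "I < \<infinity>" .
  have "0 < ennreal (ln s - ln r) * ennreal (pi * r\<^sup>2)"
    using ln rs by (simp add: ennreal_zero_less_mult_iff)
  also have "\<dots> = ennreal (ln s - ln r) * emeasure lborel (ball (0::complex) r)"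
    using rs by (simp add: emeasure_ball unit_ball_vol_2)
  also have "\<dots> = (\<integral>\<^sup>+w. ennreal (ln s - ln r) * indicator (ball 0 r) w \<partial>(lborel :: complex measure))"
    by (rule nn_integral_cmult_indicator[symmetric]) simp
  also have "\<dots> \<le> I" unfolding I_def
  proof (rule nn_integral_mono)
    fix w :: complex
    show "ennreal (ln s - ln r) * indicator (ball 0 r) w \<le> ennreal (log_kernel r s w)"
      using rs by (cases "cmod w < r") (auto simp: log_kernel_def max_def)
  qed
  finally have pos: "0 < I" .
  have I: "I = ennreal (enn2real I)" using fin by simp
  have tr: "(\<integral>\<^sup>+w. ennreal (log_kernel r s (w - z)) \<partial>lborel) = I" for z
    unfolding I_def using nn_integral_lborel_translate[of "\<lambda>w. ennreal (log_kernel r s w)" "- z"] by simp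
  show thesis
  proof
    show "0 < enn2real I" using pos fin by (simp add: enn2real_positive_iff)
    show "kernel_mass r s Q z \<le> ennreal (enn2real I)" for Q z
      unfolding I[symmetric] unfolding tr[of z, symmetric] kernel_mass_def
      by (intro nn_integral_mono) (auto simp: indicator_def)
    show "kernel_mass r s Q z = ennreal (enn2real I)" if "ball z s \<subseteq> Q" for Q z
      unfolding I[symmetric] unfolding tr[of z, symmetric] kernel_mass_def
    proof (rule nn_integral_cong)
      fix w
      show "indicator Q w * ennreal (log_kernel r s (w - z)) = ennreal (log_kernel r s (w - z))"
      proof (cases "w \<in> Q")
        case False
        then have "w \<notin> ball z s" using that by auto
        then have "s \<le> cmod (w - z)" by (simp add: dist_norm norm_minus_commute not_less)
        then show ?thesis using k0 by simp
      qed simp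
    qed
    show "kernel_mass r s Q z = 0" if "ball z s \<inter> Q = {}" for Q z
    proof -
      have k: "indicator Q w * ennreal (log_kernel r s (w - z)) = 0" for w
      proof (cases "w \<in> Q")
        case True
        then have "w \<notin> ball z s" using that by auto
        then have "s \<le> cmod (w - z)" by (simp add: dist_norm norm_minus_commute not_less)
        then show ?thesis using k0 by simp
      qed simp
      have "kernel_mass r s Q z = (\<integral>\<^sup>+w. 0 \<partial>(lborel :: complex measure))"
        unfolding kernel_mass_def by (rule nn_integral_cong) (rule k)
      then show ?thesis by simp
    qed
  qed
qed

definition annulus :: "real \<Rightarrow> real \<Rightarrow> complex set" where
  "annulus a b = {z. a \<le> cmod z \<and> cmod z \<le> b}"

lemma sets_annulus [measurable]: "annulus a b \<in> sets borel"
  unfolding annulus_def by measurable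

lemma annulus_ball:
  assumes "z \<in> annulus (a + e) (b - e)" "dist z w \<le> e"
  shows "w \<in> annulus a b"
proof -
  have "\<bar>cmod z - cmod w\<bar> \<le> dist z w" unfolding dist_norm by (rule norm_triangle_ineq3)
  then show ?thesis using assms by (auto simp: annulus_def)
qed

text \<open>Potentials are compared on an annulus only, so a smoothed neighbourhood of
  \<open>B\<close> accounts just for the roots inside. The roots outside are counted by the reverse
  comparison for an annulus: most roots are inside because most of the limit mass is. Each
  comparison costs \<open>2 * \<delta> / \<kappa>\<close>.\<close>

lemma (in factored_poly) root_measure_bound:
  assumes rs: "0 < r" "r < s" and a: "0 < a" and kp: "\<kappa> > 0"
    and k1: "\<And>Q z. kernel_mass r s Q z \<le> ennreal \<kappa>"
    and k2: "\<And>Q z. ball z s \<subseteq> Q \<Longrightarrow> kernel_mass r s Q z = ennreal \<kappa>"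
    and k3: "\<And>Q z. ball z s \<inter> Q = {} \<Longrightarrow> kernel_mass r s Q z = 0"
    and err: "(\<integral>\<^sup>+v. indicator (annulus a b) v * ennreal \<bar>D v\<bar> \<partial>lborel) \<le> ennreal \<delta>" and d: "0 \<le> \<delta>"
    and p: "p = smult l (\<Prod>m<n. [:- \<zeta> m, 1:])" and B: "B \<in> sets borel"
  shows "measure (root_measure p) B \<le> measure limit_measure (\<Union>x\<in>B. ball x (2 * s))
     + (4 * \<delta> / \<kappa> + (1 - measure limit_measure (annulus (a + 4 * s) (b - 4 * s))))"
proof -
  interpret L: prob_space limit_measure by (rule prob_space_limit_measure)
  define cnt where "cnt = (\<lambda>S. real (card {m. m < n \<and> \<zeta> m \<in> S}))"
  \<comment> \<open>Each smoothing and each passage to an \<open>s\<close>-neighbourhood uses up one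
    step of this shrinking family.\<close>
  let ?R = "\<lambda>k. annulus (a + k * s) (b - k * s)"
  have shift: "w \<in> ?R k" if "z \<in> ?R (k + 1)" "dist z w < s" for z w k
  proof (rule annulus_ball)
    show "z \<in> annulus (a + k * s + s) (b - k * s - s)" using that(1) by (simp add: algebra_simps)
    show "dist z w \<le> s" using that(2) by simp
  qed
  let ?err = "\<integral>\<^sup>+v. indicator (annulus a b) v * ennreal \<bar>D v\<bar> \<partial>lborel"
  have err2: "?err + ?err \<le> ennreal (2 * \<delta>)"
  proof -
    have "?err + ?err \<le> ennreal \<delta> + ennreal \<delta>" by (intro add_mono err)
    also have "\<dots> = ennreal (2 * \<delta>)" using d by (simp flip: ennreal_plus)
    finally show ?thesis .
  qed
  have cmp: "ennreal (1 / n) * (\<Sum>m<n. kernel_mass r s Q (\<zeta> m)) \<le> (\<integral>\<^sup>+z. kernel_mass r s Q z \<partial>limit_measure) + ennreal (2 * \<delta>)"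
      "(\<integral>\<^sup>+z. kernel_mass r s Q z \<partial>limit_measure) \<le> ennreal (1 / n) * (\<Sum>m<n. kernel_mass r s Q (\<zeta> m)) + ennreal (2 * \<delta>)"
    if Q: "Q \<in> sets borel" "Q \<subseteq> ?R 1" for Q
  proof -
    have 1: "s < cmod w" if "w \<in> Q" for w using that Q(2) a by (auto simp: annulus_def)
    have 2: "w + of_real t * cis x \<in> annulus a b" if "w \<in> Q" "0 < t" "t \<le> s" for w t x
    proof (rule annulus_ball)
      show "w \<in> annulus (a + s) (b - s)" using that Q(2) by auto
      show "dist w (w + of_real t * cis x) \<le> s" using that by (simp add: dist_norm norm_mult)
    qed
    show "ennreal (1 / n) * (\<Sum>m<n. kernel_mass r s Q (\<zeta> m)) \<le> (\<integral>\<^sup>+z. kernel_mass r s Q z \<partial>limit_measure) + ennreal (2 * \<delta>)"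
      by (rule order_trans[OF kernel_mass_compare(1)[OF rs Q(1) sets_annulus 1 2] add_left_mono[OF err2]])
    show "(\<integral>\<^sup>+z. kernel_mass r s Q z \<partial>limit_measure) \<le> ennreal (1 / n) * (\<Sum>m<n. kernel_mass r s Q (\<zeta> m)) + ennreal (2 * \<delta>)"
      by (rule order_trans[OF kernel_mass_compare(2)[OF rs Q(1) sets_annulus 1 2] add_left_mono[OF err2]])
  qed
  have count: "ennreal (1 / n) * (\<Sum>m<n. ennreal \<kappa> * indicator S (\<zeta> m)) = ennreal (cnt S / n * \<kappa>)" for S
  proof -
    have "(\<Sum>m<n. ennreal \<kappa> * indicator S (\<zeta> m)) = (\<Sum>m<n. if \<zeta> m \<in> S then ennreal \<kappa> else 0)"
      by (rule sum.cong) auto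
    also have "\<dots> = (\<Sum>m\<in>{m\<in>{..<n}. \<zeta> m \<in> S}. ennreal \<kappa>)"
      by (rule sum.inter_filter[symmetric]) simp
    also have "\<dots> = of_nat (card {m\<in>{..<n}. \<zeta> m \<in> S}) * ennreal \<kappa>" by simp
    also have "\<dots> = ennreal (cnt S * \<kappa>)"
      using kp by (simp add: cnt_def ennreal_mult ennreal_of_nat_eq_real_of_nat)
    finally show ?thesis using kp by (simp add: ennreal_mult'[symmetric] cnt_def)
  qed
  have lim: "(\<integral>\<^sup>+z. ennreal \<kappa> * indicator S z \<partial>limit_measure) = ennreal (\<kappa> * measure limit_measure S)" if "S \<in> sets borel" for S
    using that kp by (subst nn_integral_cmult_indicator) (auto simp: L.emeasure_eq_measure ennreal_mult)
  let ?N1 = "\<Union>x\<in>B. ball x s" and ?N2 = "\<Union>x\<in>B. ball x (2 * s)"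
  have N: "?N1 \<in> sets borel" "?N2 \<in> sets borel"
    by (intro borel_open open_neighbourhood)+
  \<comment> \<open>The test set is the \<open>s\<close>-neighbourhood of \<open>B\<close> within
    \<open>?R 1\<close>: its smoothed indicator is full on \<open>B \<inter> ?R 2\<close> and
    vanishes off the \<open>2 * s\<close>-neighbourhood of \<open>B\<close>.\<close>
  have "cnt (B \<inter> ?R 2) / n * \<kappa> \<le> \<kappa> * measure limit_measure ?N2 + 2 * \<delta>"
  proof -
    let ?Q = "?N1 \<inter> ?R 1"
    have "ennreal (cnt (B \<inter> ?R 2) / n * \<kappa>) \<le> ennreal (1 / n) * (\<Sum>m<n. kernel_mass r s ?Q (\<zeta> m))"
      unfolding count[symmetric]
    proof (intro mult_left_mono sum_mono)
      fix m
      show "ennreal \<kappa> * indicator (B \<inter> ?R 2) (\<zeta> m) \<le> kernel_mass r s ?Q (\<zeta> m)"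
      proof (cases "\<zeta> m \<in> B \<inter> ?R 2")
        case True
        have "w \<in> ?R 1" if "dist (\<zeta> m) w < s" for w
          using True that shift[of "\<zeta> m" 1 w] by simp
        then have "ball (\<zeta> m) s \<subseteq> ?Q" using True by auto
        then show ?thesis using k2 True by simp
      qed simp
    qed simp
    also have "\<dots> \<le> (\<integral>\<^sup>+z. kernel_mass r s ?Q z \<partial>limit_measure) + ennreal (2 * \<delta>)"
      using N by (intro cmp(1)) auto
    also have "(\<integral>\<^sup>+z. kernel_mass r s ?Q z \<partial>limit_measure) \<le> (\<integral>\<^sup>+z. ennreal \<kappa> * indicator ?N2 z \<partial>limit_measure)"
    proof (rule nn_integral_mono)
      fix z
      show "kernel_mass r s ?Q z \<le> ennreal \<kappa> * indicator ?N2 z"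
      proof (cases "z \<in> ?N2")
        case True
        then show ?thesis using k1 by simp
      next
        case False
        have "ball z s \<inter> ?Q = {}"
        proof (rule ccontr)
          assume "ball z s \<inter> ?Q \<noteq> {}"
          then obtain w x where "dist z w < s" "x \<in> B" "dist x w < s" by auto
          then have "dist x z < 2 * s" using dist_triangle[of x z w] by (simp add: dist_commute)
          then show False using False \<open>x \<in> B\<close> by auto
        qed
        then show ?thesis using k3 by simp
      qed
    qed
    also have "\<dots> = ennreal (\<kappa> * measure limit_measure ?N2)" by (rule lim[OF N(2)])
    also have "\<dots> + ennreal (2 * \<delta>) = ennreal (\<kappa> * measure limit_measure ?N2 + 2 * \<delta>)"
      using kp d by (intro ennreal_plus[symmetric]) auto
    finally have "ennreal (cnt (B \<inter> ?R 2) / n * \<kappa>) \<le> ennreal (\<kappa> * measure limit_measure ?N2 + 2 * \<delta>)"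
      by (simp only: add_right_mono)
    then show ?thesis using kp d by (subst (asm) ennreal_le_iff) auto
  qed
  then have 1: "cnt (B \<inter> ?R 2) / n \<le> measure limit_measure ?N2 + 2 * \<delta> / \<kappa>"
    using kp by (simp add: field_simps)
  \<comment> \<open>Reverse comparison with test set \<open>?R 3\<close>, whose smoothed indicator
    is full on \<open>?R 4\<close> and vanishes off \<open>?R 2\<close>.\<close>
  have "\<kappa> * measure limit_measure (?R 4) \<le> cnt (?R 2) / n * \<kappa> + 2 * \<delta>"
  proof -
    let ?Q = "?R 3"
    have "ennreal (\<kappa> * measure limit_measure (?R 4)) \<le> (\<integral>\<^sup>+z. kernel_mass r s ?Q z \<partial>limit_measure)"
      unfolding lim[OF sets_annulus, symmetric]
    proof (rule nn_integral_mono)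
      fix z
      show "ennreal \<kappa> * indicator (?R 4) z \<le> kernel_mass r s ?Q z"
      proof (cases "z \<in> ?R 4")
        case True
        have "w \<in> ?R 3" if "dist z w < s" for w
          using True that shift[of z 3 w] by simp
        then have "ball z s \<subseteq> ?Q" by auto
        then show ?thesis using k2 True by simp
      qed simp
    qed
    also have "\<dots> \<le> ennreal (1 / n) * (\<Sum>m<n. kernel_mass r s ?Q (\<zeta> m)) + ennreal (2 * \<delta>)"
      using rs by (intro cmp(2)) (auto simp: annulus_def)
    also have "ennreal (1 / n) * (\<Sum>m<n. kernel_mass r s ?Q (\<zeta> m)) \<le> ennreal (1 / n) * (\<Sum>m<n. ennreal \<kappa> * indicator (?R 2) (\<zeta> m))"
    proof (intro mult_left_mono sum_mono)
      fix m
      show "kernel_mass r s ?Q (\<zeta> m) \<le> ennreal \<kappa> * indicator (?R 2) (\<zeta> m)"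
      proof (cases "\<zeta> m \<in> ?R 2")
        case True
        then show ?thesis using k1 by simp
      next
        case False
        have "\<zeta> m \<in> ?R 2" if "dist (\<zeta> m) w < s" "w \<in> ?R 3" for w
          using that shift[of w 2 "\<zeta> m"] by (simp add: dist_commute)
        then have "ball (\<zeta> m) s \<inter> ?Q = {}" using False by auto
        then show ?thesis using k3 by simp
      qed
    qed simp
    also have "\<dots> = ennreal (cnt (?R 2) / n * \<kappa>)" by (rule count)
    also have "\<dots> + ennreal (2 * \<delta>) = ennreal (cnt (?R 2) / n * \<kappa> + 2 * \<delta>)"
      using kp d by (intro ennreal_plus[symmetric]) (auto simp: cnt_def)
    finally have "ennreal (\<kappa> * measure limit_measure (?R 4)) \<le> ennreal (cnt (?R 2) / n * \<kappa> + 2 * \<delta>)"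
      by (simp only: add_right_mono)
    then show ?thesis using kp d by (subst (asm) ennreal_le_iff) (auto simp: cnt_def)
  qed
  then have 2: "measure limit_measure (?R 4) \<le> cnt (?R 2) / n + 2 * \<delta> / \<kappa>"
    using kp by (simp add: field_simps)
  \<comment> \<open>Inclusion-exclusion: the roots in \<open>B\<close> outside \<open>?R 2\<close>
    are among the few roots outside \<open>?R 2\<close>.\<close>
  have "cnt B + cnt (?R 2) \<le> cnt (B \<inter> ?R 2) + n"
  proof -
    have "card {m. m < n \<and> \<zeta> m \<in> B} + card {m. m < n \<and> \<zeta> m \<in> ?R 2}
       = card ({m. m < n \<and> \<zeta> m \<in> B} \<union> {m. m < n \<and> \<zeta> m \<in> ?R 2}) + card ({m. m < n \<and> \<zeta> m \<in> B} \<inter> {m. m < n \<and> \<zeta> m \<in> ?R 2})"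
      by (rule card_Un_Int) auto
    also have "{m. m < n \<and> \<zeta> m \<in> B} \<inter> {m. m < n \<and> \<zeta> m \<in> ?R 2} = {m. m < n \<and> \<zeta> m \<in> B \<inter> ?R 2}" by auto
    also have "card ({m. m < n \<and> \<zeta> m \<in> B} \<union> {m. m < n \<and> \<zeta> m \<in> ?R 2}) \<le> card {..<n}"
      by (rule card_mono) auto
    finally show ?thesis unfolding cnt_def of_nat_add[symmetric] of_nat_le_iff by simp
  qed
  then have "(cnt B + cnt (?R 2)) / n \<le> (cnt (B \<inter> ?R 2) + n) / n"
    by (rule divide_right_mono) simp
  then have "cnt B / n \<le> cnt (B \<inter> ?R 2) / n + 1 - cnt (?R 2) / n"
    using n by (simp add: add_divide_distrib)
  moreover have "measure (root_measure p) B = cnt B / n"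
    unfolding cnt_def by (rule measure_root_measure(2)[OF n l p B])
  ultimately show ?thesis using 1 2 by simp
qed

section \<open>Measurability of the distance\<close>

lemma neighbourhood_mono:
  assumes "prob_space N" "sets N = sets borel" "A \<subseteq> B" "open B"
  shows "measure N A \<le> measure N B"
proof -
  interpret N: prob_space N by (rule assms)
  show ?thesis using assms by (intro N.finite_measure_mono) auto
qed

lemma neighbourhood_add: "(\<Union>x\<in>(\<Union>x\<in>A. ball x e). ball x d) \<subseteq> (\<Union>x\<in>A. ball x (e + d))"
  for A :: "'a::metric_space set"
proof
  fix y assume "y \<in> (\<Union>x\<in>(\<Union>x\<in>A. ball x e). ball x d)"
  then obtain a x where "a \<in> A" "dist a x < e" "dist x y < d" by auto
  moreover have "dist a y \<le> dist a x + dist x y" by (rule dist_triangle)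
  ultimately show "y \<in> (\<Union>x\<in>A. ball x (e + d))" by force
qed

text \<open>A triangle inequality for two measures related by moving mass through distances below
  \<open>d\<close>, with no additive loss. It yields continuity of the distance in the
  roots.\<close>

lemma levy_prokhorov_perturb:
  fixes M M' N :: "'a::metric_space measure"
  assumes N: "prob_space N" "sets N = sets borel" and M: "prob_space M" "sets M = sets borel"
    and M': "prob_space M'" "sets M' = sets borel" and d: "0 < d"
    and le: "\<And>A. A \<in> sets borel \<Longrightarrow> measure M' A \<le> measure M (\<Union>x\<in>A. ball x d)"
      "\<And>A. A \<in> sets borel \<Longrightarrow> measure M A \<le> measure M' (\<Union>x\<in>A. ball x d)"
  shows "levy_prokhorov M' N \<le> levy_prokhorov M N + d"
proof -
  define S where "S = (\<lambda>M. {e. 0 < e \<and> (\<forall>A\<in>sets borel.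
            measure M A \<le> measure N (\<Union>x\<in>A. ball x e) + e \<and>
            measure N A \<le> measure M (\<Union>x\<in>A. ball x e) + e)})"
  have LP: "levy_prokhorov M N = Inf (S M)" for M by (simp add: levy_prokhorov_def S_def)
  have one: "1 \<in> S M"
  proof -
    have "measure M A \<le> 1" "measure N A \<le> 1" for A
      using prob_space.prob_le_1[OF M(1)] prob_space.prob_le_1[OF N(1)] by auto
    then show ?thesis unfolding S_def by (auto intro: order_trans add_increasing)
  qed
  have bdd: "bdd_below (S M')" unfolding S_def by (rule bdd_belowI[of _ 0]) auto
  have "Inf (S M') - d \<le> Inf (S M)"
  proof (rule cInf_greatest)
    show "S M \<noteq> {}" using one by auto
    fix e assume e: "e \<in> S M"
    then have e0: "0 < e" by (simp add: S_def)
    note spec = e[unfolded S_def mem_Collect_eq, THEN conjunct2]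
    have "e + d \<in> S M'"
      unfolding S_def
    proof (intro CollectI conjI ballI)
      show "0 < e + d" using e0 d by simp
      fix A :: "'a set" assume A: "A \<in> sets borel"
      let ?N = "\<lambda>A e. \<Union>x\<in>A. ball x e"
      have b: "?N A e' \<in> sets borel" for e' by (rule borel_open[OF open_neighbourhood])
      have "measure M' A \<le> measure M (?N A d)" by (rule le(1)[OF A])
      also have "\<dots> \<le> measure N (?N (?N A d) e) + e" by (rule spec[rule_format, OF b, THEN conjunct1])
      also have "measure N (?N (?N A d) e) \<le> measure N (?N A (e + d))"
        by (rule neighbourhood_mono[OF N _ open_neighbourhood]) (use neighbourhood_add[where A = A and e = d and d = e] in \<open>simp add: add.commute\<close>)
      finally show "measure M' A \<le> measure N (?N A (e + d)) + (e + d)" using d by simp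
      have "measure N A \<le> measure M (?N A e) + e" by (rule spec[rule_format, OF A, THEN conjunct2])
      also have "measure M (?N A e) \<le> measure M' (?N (?N A e) d)" by (rule le(2)[OF b])
      also have "\<dots> \<le> measure M' (?N A (e + d))"
        by (rule neighbourhood_mono[OF M' neighbourhood_add open_neighbourhood])
      finally show "measure N A \<le> measure M' (?N A (e + d)) + (e + d)" using d by simp
    qed
    then have "Inf (S M') \<le> e + d" using bdd by (rule cInf_lower)
    then show "Inf (S M') - d \<le> e" by simp
  qed
  then show ?thesis unfolding LP by simp
qed

lemma levy_prokhorov_le_1:
  fixes M N :: "'a::metric_space measure"
  assumes "prob_space M" "sets M = sets borel" "prob_space N" "sets N = sets borel"
  shows "levy_prokhorov M N \<le> 1"
proof (rule levy_prokhorov_le[OF assms])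
  show "measure M A \<le> measure N (\<Union>x\<in>A. ball x 1) + 1" for A
    using prob_space.prob_le_1[OF assms(1), of A] by (simp add: add_increasing)
qed simp

lemma sets_root_measure [simp]: "sets (root_measure p) = sets borel"
  by (simp add: root_measure_def)

section \<open>Polynomials parametrised by leading coefficient and roots\<close>

definition linear_product :: "nat \<Rightarrow> (nat \<Rightarrow> complex) \<Rightarrow> complex poly" where
  "linear_product k z = smult (z 0) (\<Prod>m<k. [:- z (Suc m), 1:])"

lemma prob_space_root_measure:
  assumes "1 \<le> k" "z 0 \<noteq> 0"
  shows "prob_space (root_measure (linear_product k z))"
proof
  have "emeasure (root_measure (linear_product k z)) UNIV = ennreal (real k / real k)"
    using measure_root_measure(1)[OF assms linear_product_def[of k z], of UNIV] by simp
  then show "emeasure (root_measure (linear_product k z)) (space (root_measure (linear_product k z))) = 1"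
    using assms by (simp add: root_measure_def)
qed

definition root_distance :: "nat \<Rightarrow> (nat \<Rightarrow> complex) \<Rightarrow> real" where
  "root_distance k z = levy_prokhorov (root_measure (linear_product k z)) limit_measure"

lemma root_distance_perturb:
  assumes k: "1 \<le> k" and z: "z 0 \<noteq> 0" "z' 0 \<noteq> 0" and d: "0 < d"
    and close: "\<And>m. m < k \<Longrightarrow> dist (z (Suc m)) (z' (Suc m)) < d"
  shows "root_distance k z' \<le> root_distance k z + d"
proof -
  have le: "measure (root_measure (linear_product k z)) A \<le> measure (root_measure (linear_product k z')) (\<Union>x\<in>A. ball x d)"
    if A: "A \<in> sets borel" and z: "z 0 \<noteq> 0" "z' 0 \<noteq> 0" and close: "\<And>m. m < k \<Longrightarrow> dist (z (Suc m)) (z' (Suc m)) < d" for A z z'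
  proof -
    have "card {m. m < k \<and> z (Suc m) \<in> A} \<le> card {m. m < k \<and> z' (Suc m) \<in> (\<Union>x\<in>A. ball x d)}"
      using close by (intro card_mono) auto
    then show ?thesis
      unfolding measure_root_measure(2)[OF k z(1) linear_product_def[of k z] A]
        measure_root_measure(2)[OF k z(2) linear_product_def[of k z'] borel_open[OF open_neighbourhood]]
      by (simp add: divide_right_mono)
  qed
  show ?thesis unfolding root_distance_def
    using k z d close
    by (intro levy_prokhorov_perturb prob_space_limit_measure prob_space_root_measure le) (auto simp: dist_commute)
qed

text \<open>All coordinates are bounded, also those beyond the degree, so that the box is compact in
  the full product; the second condition keeps the leading coefficient away from
  \<open>0\<close>.\<close>

definition parameter_box :: "nat \<Rightarrow> (nat \<Rightarrow> complex) set" where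
  "parameter_box R = {z. (\<forall>i. z i \<in> cball 0 (real R)) \<and> 1 \<le> real R * cmod (z 0)}"

lemma compact_parameter_box: "compact (parameter_box R)"
proof -
  have "compactin (product_topology (\<lambda>_. euclidean) UNIV) (PiE UNIV (\<lambda>_::nat. cball (0::complex) (real R)))"
    unfolding compactin_PiE by simp
  then have c: "compact (PiE UNIV (\<lambda>_::nat. cball (0::complex) (real R)))"
    by (simp add: euclidean_product_topology)
  have "closed {z :: nat \<Rightarrow> complex. 1 \<le> real R * cmod (z 0)}"
    by (intro closed_Collect_le continuous_intros continuous_on_product_coordinates)
  with c have "compact (PiE UNIV (\<lambda>_::nat. cball (0::complex) (real R)) \<inter> {z. 1 \<le> real R * cmod (z 0)})"
    by (rule compact_Int_closed)
  moreover have "PiE UNIV (\<lambda>_::nat. cball (0::complex) (real R)) \<inter> {z. 1 \<le> real R * cmod (z 0)} = parameter_box R"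
    by (auto simp: parameter_box_def)
  ultimately show ?thesis by simp
qed

lemma continuous_on_root_distance:
  assumes k: "1 \<le> k"
  shows "continuous_on (parameter_box R) (root_distance k)"
  unfolding continuous_on_def
proof (intro ballI tendstoI)
  fix z and e :: real assume z: "z \<in> parameter_box R" and e: "0 < e"
  have nz: "w 0 \<noteq> 0" if "w \<in> parameter_box R" for w using that by (auto simp: parameter_box_def)
  have "\<forall>\<^sub>F w in at z within parameter_box R. \<forall>m\<in>{..<k}. dist (w (Suc m)) (z (Suc m)) < e / 2"
  proof (rule eventually_ball_finite)
    show "\<forall>m\<in>{..<k}. \<forall>\<^sub>F w in at z within parameter_box R. dist (w (Suc m)) (z (Suc m)) < e / 2"
    proof
      fix m
      have "continuous_on (parameter_box R) (\<lambda>w. w (Suc m))"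
        by (rule continuous_on_subset[OF continuous_on_product_coordinates]) simp
      then have "((\<lambda>w. w (Suc m)) \<longlongrightarrow> z (Suc m)) (at z within parameter_box R)"
        using z by (simp add: continuous_on_def)
      then show "\<forall>\<^sub>F w in at z within parameter_box R. dist (w (Suc m)) (z (Suc m)) < e / 2"
        by (rule tendstoD) (use e in simp)
    qed
  qed simp
  moreover have "\<forall>\<^sub>F w in at z within parameter_box R. w \<in> parameter_box R"
    by (simp add: eventually_at_filter)
  ultimately show "\<forall>\<^sub>F w in at z within parameter_box R. dist (root_distance k w) (root_distance k z) < e"
  proof eventually_elim
    case (elim w)
    have "root_distance k w \<le> root_distance k z + e / 2"
      using elim e k nz z by (intro root_distance_perturb) (auto simp: dist_commute)
    moreover have "root_distance k z \<le> root_distance k w + e / 2"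
      using elim e k nz z by (intro root_distance_perturb) auto
    ultimately show ?case using e by (auto simp: dist_real_def)
  qed
qed

lemma continuous_on_coeff_linear_product:
  "continuous_on UNIV (\<lambda>z. coeff (linear_product k z) i)"
proof -
  have "continuous_on UNIV (\<lambda>z :: nat \<Rightarrow> complex. coeff (\<Prod>m<k. [:- z (Suc m), 1:]) i)"
  proof (induction k arbitrary: i)
    case 0
    show ?case by simp
  next
    case (Suc k)
    have eq: "coeff (\<Prod>m<Suc k. [:- z (Suc m), 1:]) i
       = (if i = 0 then 0 else coeff (\<Prod>m<k. [:- z (Suc m), 1:]) (i - 1)) - z (Suc k) * coeff (\<Prod>m<k. [:- z (Suc m), 1:]) i"
      for z :: "nat \<Rightarrow> complex"
      by (cases i) (simp_all add: mult_pCons_right)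
    show ?case unfolding eq
      by (cases "i = 0") (auto intro!: continuous_intros Suc continuous_on_product_coordinates)
  qed
  then show ?thesis
    by (auto simp: linear_product_def intro!: continuous_intros continuous_on_product_coordinates)
qed

text \<open>The map from roots to coefficients is continuous, unlike any labelling in the other
  direction. A sublevel set of the distance is compact within a box, so its image is compact, hence
  closed.\<close>

lemma borel_coefficients:
  assumes k: "1 \<le> k"
  shows "(\<lambda>z. coeff (linear_product k z)) ` {z \<in> parameter_box R. root_distance k z \<le> e} \<in> sets borel"
proof -
  have "closed (parameter_box R)" using compact_parameter_box by (rule compact_imp_closed)
  then have "closed (parameter_box R \<inter> root_distance k -` {..e})"
    by (intro continuous_closed_preimage continuous_on_root_distance k) auto
  then have "compact (parameter_box R \<inter> (parameter_box R \<inter> root_distance k -` {..e}))"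
    by (rule compact_Int_closed[OF compact_parameter_box])
  moreover have "parameter_box R \<inter> (parameter_box R \<inter> root_distance k -` {..e}) = {z \<in> parameter_box R. root_distance k z \<le> e}"
    by auto
  moreover have "continuous_on UNIV (\<lambda>z. coeff (linear_product k z))"
    by (intro continuous_on_coordinatewise_then_product continuous_on_coeff_linear_product)
  ultimately have "compact ((\<lambda>z. coeff (linear_product k z)) ` {z \<in> parameter_box R. root_distance k z \<le> e})"
    by (metis compact_continuous_image continuous_on_subset subset_UNIV)
  then have "closed ((\<lambda>z. coeff (linear_product k z)) ` {z \<in> parameter_box R. root_distance k z \<le> e})"
    by (rule compact_imp_closed)
  then show ?thesis by (rule borel_closed)
qed

lemma coeff_coeff_poly: "coeff (coeff_poly n c) i = (if i \<le> n then complex_of_real (c i) else 0)"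
  unfolding coeff_poly_def by (simp add: coeff_sum sum.delta' if_distrib cong: if_cong)

lemma measurable_coeff_coeff_poly:
  "(\<lambda>c. coeff (coeff_poly n c)) \<in> measurable (PiM {..n} (\<lambda>_. borel)) borel"
proof (rule measurable_coordinatewise_then_product)
  fix i
  show "(\<lambda>c. coeff (coeff_poly n c) i) \<in> borel_measurable (PiM {..n} (\<lambda>_. borel))"
    by (cases "i \<le> n") (simp_all add: coeff_coeff_poly)
qed

definition coeff_distance :: "nat \<Rightarrow> (nat \<Rightarrow> real) \<Rightarrow> real" where
  "coeff_distance n c = levy_prokhorov (root_measure (coeff_poly n c)) limit_measure"

text \<open>Every polynomial of degree \<open>k \<ge> 1\<close> has its parameters in some box, so a
  countable union over \<open>R\<close> exhausts the sublevel set.\<close>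

lemma coeff_distance_iff:
  assumes k: "1 \<le> k"
  shows "degree (coeff_poly n c) = k \<and> coeff_distance n c \<le> e \<longleftrightarrow>
    coeff (coeff_poly n c) \<in> (\<Union>R. (\<lambda>z. coeff (linear_product k z)) ` {z \<in> parameter_box R. root_distance k z \<le> e})"
proof
  assume "coeff (coeff_poly n c) \<in> (\<Union>R. (\<lambda>z. coeff (linear_product k z)) ` {z \<in> parameter_box R. root_distance k z \<le> e})"
  then obtain R z where z: "coeff (coeff_poly n c) = coeff (linear_product k z)" "z \<in> parameter_box R" "root_distance k z \<le> e"
    by auto
  then have "coeff_poly n c = linear_product k z" by (simp add: poly_eq_iff)
  moreover have "z 0 \<noteq> 0" using z(2) by (auto simp: parameter_box_def)
  ultimately show "degree (coeff_poly n c) = k \<and> coeff_distance n c \<le> e"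
    using z(3) by (simp add: coeff_distance_def root_distance_def) (simp add: linear_product_def degree_prod_linear)
next
  assume h: "degree (coeff_poly n c) = k \<and> coeff_distance n c \<le> e"
  define p where "p = coeff_poly n c"
  have p0: "p \<noteq> 0" using h k by (auto simp: p_def)
  obtain \<zeta> where \<zeta>: "p = smult (lead_coeff p) (\<Prod>m<degree p. [:- \<zeta> m, 1:])" by (rule poly_factorization[OF p0])
  \<comment> \<open>The surplus coordinates are set to \<open>0\<close> to stay within a
    box.\<close>
  define z where "z = (\<lambda>i. case i of 0 \<Rightarrow> lead_coeff p | Suc m \<Rightarrow> if m < k then \<zeta> m else 0)"
  have pz: "p = linear_product k z"
    using \<zeta> h by (simp add: linear_product_def z_def p_def)
  have z0: "z 0 \<noteq> 0" using p0 by (simp add: z_def)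
  obtain R where R: "(\<Sum>i\<le>k. cmod (z i)) + 1 / cmod (z 0) \<le> real R" using real_arch_simple by blast
  have "z i \<in> cball 0 (real R)" for i
  proof (cases "i \<le> k")
    case True
    have "cmod (z i) \<le> (\<Sum>i\<le>k. cmod (z i))" using True by (intro member_le_sum) auto
    moreover have "0 \<le> 1 / cmod (z 0)" by simp
    ultimately have "cmod (z i) \<le> real R" using R by linarith
    then show ?thesis by simp
  next
    case False
    then show ?thesis by (cases i) (auto simp: z_def)
  qed
  moreover have "1 \<le> real R * cmod (z 0)"
  proof -
    have "0 \<le> (\<Sum>i\<le>k. cmod (z i))" by (intro sum_nonneg) auto
    then have "1 / cmod (z 0) \<le> real R" using R by linarith
    then show ?thesis using z0 by (simp add: field_simps)
  qed
  ultimately have "z \<in> parameter_box R" by (simp add: parameter_box_def)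
  moreover have "root_distance k z \<le> e" using h pz by (simp add: root_distance_def coeff_distance_def p_def)
  ultimately show "coeff (coeff_poly n c) \<in> (\<Union>R. (\<lambda>z. coeff (linear_product k z)) ` {z \<in> parameter_box R. root_distance k z \<le> e})"
    using pz unfolding p_def by auto
qed

lemma measure_root_measure_degree_0:
  assumes "degree p = 0" "A \<in> sets borel"
  shows "measure (root_measure p) A = 0"
proof -
  have "emeasure (root_measure p) A = emeasure (point_measure {z. poly p z = 0} (\<lambda>z. 0)) ((\<lambda>z. z) -` A \<inter> space (point_measure {z. poly p z = 0} (\<lambda>z. 0)))"
    unfolding root_measure_def using assms
    by (subst emeasure_distr) (auto simp: measurable_def space_point_measure sets_point_measure)
  also have "\<dots> = 0"
    unfolding point_measure_def by (subst emeasure_density) auto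
  finally show ?thesis by (simp add: measure_def)
qed

lemma coeff_distance_degree_0:
  assumes "degree (coeff_poly n c) = 0"
  shows "coeff_distance n c = levy_prokhorov (root_measure 0) limit_measure"
proof -
  have eq: "measure (root_measure (coeff_poly n c)) A = measure (root_measure 0) A" if "A \<in> sets borel" for A
    using measure_root_measure_degree_0[OF assms that] measure_root_measure_degree_0[of 0, OF _ that] by simp
  have "measure (root_measure (coeff_poly n c)) (\<Union>x\<in>A. ball x e) = measure (root_measure 0) (\<Union>x\<in>A. ball x e)" for A e
    by (rule eq[OF borel_open[OF open_neighbourhood]])
  then show ?thesis
    unfolding coeff_distance_def levy_prokhorov_def by (simp add: eq cong: ball_cong conj_cong)
qed

text \<open>Coefficient vectors may have a vanishing leading entry, so sublevel sets are split by
  the actual degree. Constant polynomials form one further piece, on which the distance is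
  constant.\<close>

theorem measurable_coeff_distance: "coeff_distance n \<in> borel_measurable (PiM {..n} (\<lambda>_. borel))"
proof -
  let ?M = "PiM {..n} (\<lambda>_. borel) :: (nat \<Rightarrow> real) measure"
  let ?S = "\<lambda>k e. {c \<in> space ?M. degree (coeff_poly n c) = k \<and> coeff_distance n c \<le> e}"
  have S: "?S k e \<in> sets ?M" if k: "1 \<le> k" for k e
  proof -
    have "?S k e = (\<lambda>c. coeff (coeff_poly n c)) -` (\<Union>R. (\<lambda>z. coeff (linear_product k z)) ` {z \<in> parameter_box R. root_distance k z \<le> e}) \<inter> space ?M"
      using coeff_distance_iff[OF k, of n _ e] by blast
    also have "\<dots> \<in> sets ?M"
      by (rule measurable_sets[OF measurable_coeff_coeff_poly]) (intro sets.countable_UN image_subsetI borel_coefficients[OF k])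
    finally show ?thesis .
  qed
  have deg: "degree (coeff_poly n c) \<le> n" for c
    by (rule degree_le) (simp add: coeff_coeff_poly)
  have le1: "coeff_distance n c \<le> 1" if d: "1 \<le> degree (coeff_poly n c)" for c
  proof -
    let ?p = "coeff_poly n c"
    have p0: "?p \<noteq> 0" using d by auto
    obtain \<zeta> where \<zeta>: "?p = smult (lead_coeff ?p) (\<Prod>m<degree ?p. [:- \<zeta> m, 1:])" by (rule poly_factorization[OF p0])
    have "prob_space (root_measure ?p)"
    proof
      have "emeasure (root_measure ?p) UNIV = ennreal (real (degree ?p) / real (degree ?p))"
        using measure_root_measure(1)[OF d _ \<zeta>, of UNIV] p0 by simp
      then show "emeasure (root_measure ?p) (space (root_measure ?p)) = 1"
        using d by (simp add: root_measure_def)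
    qed
    then show ?thesis
      unfolding coeff_distance_def by (intro levy_prokhorov_le_1 prob_space_limit_measure) auto
  qed
  show ?thesis
  proof (rule borel_measurable_iff_le[THEN iffD2], rule allI)
    fix e
    \<comment> \<open>In positive degree the distance is at most \<open>1\<close>, so the sublevel
      sets at level \<open>1\<close> exhaust the positive degrees, and their complement is the
      degree-\<open>0\<close> part.\<close>
    define S0 where "S0 = space ?M - (\<Union>k\<in>{1..n}. ?S k 1)"
    have S0: "S0 \<in> sets ?M" unfolding S0_def using S by (intro sets.Diff sets.finite_UN) auto
    have S0_iff: "c \<in> S0 \<longleftrightarrow> c \<in> space ?M \<and> degree (coeff_poly n c) = 0" for c
    proof -
      have "degree (coeff_poly n c) = 0 \<longleftrightarrow> \<not> (\<exists>k\<in>{1..n}. degree (coeff_poly n c) = k \<and> coeff_distance n c \<le> 1)"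
        using deg[of c] le1[of c] by (cases "degree (coeff_poly n c) = 0") auto
      then show ?thesis by (auto simp: S0_def)
    qed
    have "{c \<in> space ?M. coeff_distance n c \<le> e} = (\<Union>k\<in>{1..n}. ?S k e) \<union> (if levy_prokhorov (root_measure 0) limit_measure \<le> e then S0 else {})"
    proof (rule set_eqI)
      fix c
      show "c \<in> {c \<in> space ?M. coeff_distance n c \<le> e} \<longleftrightarrow> c \<in> (\<Union>k\<in>{1..n}. ?S k e) \<union> (if levy_prokhorov (root_measure 0) limit_measure \<le> e then S0 else {})"
        using deg[of c] coeff_distance_degree_0[of n c] S0_iff[of c] by (cases "degree (coeff_poly n c) = 0") auto
    qed
    also have "\<dots> \<in> sets ?M" using S S0 by (intro sets.Un sets.finite_UN) auto
    finally show "{c \<in> space ?M. coeff_distance n c \<le> e} \<in> sets ?M" .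
  qed
qed

section \<open>Concave profiles and tilts\<close>

lemma concave_increments:
  fixes y :: "nat \<Rightarrow> real"
  assumes conc: "\<And>i. 0 < i \<Longrightarrow> i < n \<Longrightarrow> y (i - 1) + y (Suc i) \<le> 2 * y i"
    and le: "k \<le> m" "m < n"
  shows "y (Suc m) - y m \<le> y (Suc k) - y k"
  using le
proof (induction m rule: dec_induct)
  case (step m)
  have "y (Suc m - 1) + y (Suc (Suc m)) \<le> 2 * y (Suc m)" using step by (intro conc) auto
  then show ?case using step by simp
qed simp

text \<open>Both chords are compared with the single increment just before \<open>j\<close>.\<close>

lemma concave_chord:
  fixes y :: "nat \<Rightarrow> real"
  assumes conc: "\<And>i. 0 < i \<Longrightarrow> i < n \<Longrightarrow> y (i - 1) + y (Suc i) \<le> 2 * y i"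
    and le: "i < j" "j \<le> k" "k \<le> n"
  shows "(y k - y j) * (real j - real i) \<le> (y j - y i) * (real k - real j)"
proof -
  define d where "d = y (Suc (j - 1)) - y (j - 1)"
  have inc: "y (Suc m) - y m \<le> y (Suc k) - y k" if "k \<le> m" "m < n" for k m
    by (rule concave_increments[of n y, OF _ that]) (fact conc)
  have up: "y k' - y j \<le> (real k' - real j) * d" if "j \<le> k'" "k' \<le> n" for k'
    using that
  proof (induction k' rule: dec_induct)
    case (step m)
    have "y (Suc m) - y m \<le> d" unfolding d_def using step le by (intro inc) auto
    then show ?case using step by (simp add: algebra_simps)
  qed simp
  have down: "(real j - real i') * d \<le> y j - y i'" if "i' \<le> j" for i'
    using that
  proof (induction i' rule: inc_induct)
    case (step m)
    have "d \<le> y (Suc m) - y m" unfolding d_def using step le by (intro inc) auto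
    then show ?case using step by (simp add: algebra_simps)
  qed simp
  have "(y k - y j) * (real j - real i) \<le> (real k - real j) * d * (real j - real i)"
    using up[of k] le by (intro mult_right_mono) auto
  also have "\<dots> = (real k - real j) * ((real j - real i) * d)" by simp
  also have "\<dots> \<le> (real k - real j) * (y j - y i)"
    using down[of i] le by (intro mult_left_mono) auto
  finally show ?thesis by (simp add: mult.commute)
qed

text \<open>Chords from \<open>j\<close> to the right are no steeper than the chord from
  \<open>i\<close> to \<open>j\<close>, and chords from the left into \<open>j\<close> are at least
  as steep as the one from \<open>j\<close> to \<open>l\<close>. Horizontal distances in units of
  \<open>n\<close> are at most \<open>1\<close>, so a slope error \<open>e\<close> costs at most
  \<open>e\<close> in value.\<close>

lemma concave_tilted_max:
  fixes y :: "nat \<Rightarrow> real" and i j k l n :: nat and e \<rho> :: real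
  assumes conc: "\<And>i. 0 < i \<Longrightarrow> i < n \<Longrightarrow> y (i - 1) + y (Suc i) \<le> 2 * y i"
    and le: "i < j" "j < l" "l \<le> n" and k: "k \<le> n" and e: "0 \<le> e"
    and left: "\<rho> + (y j - y i) / ((real j - real i) / n) \<le> e"
    and right: "- e \<le> \<rho> + (y l - y j) / ((real l - real j) / n)"
  shows "y k + real k * \<rho> / real n \<le> y j + real j * \<rho> / real n + e"
proof (cases "j \<le> k")
  case True
  have n: "real n > 0" using le by simp
  have pos: "real j - real i > 0" using le by simp
  have "(y k - y j) \<le> (y j - y i) * (real k - real j) / (real j - real i)"
    using concave_chord[OF conc le(1) True k] pos by (simp add: pos_le_divide_eq)
  moreover have "(real k - real j) / n * (\<rho> + (y j - y i) / ((real j - real i) / n))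
      = (real k - real j) * \<rho> / n + (y j - y i) * (real k - real j) / (real j - real i)"
    using n pos by (simp add: distrib_left)
  ultimately have "y k - y j + (real k - real j) * \<rho> / n \<le> (real k - real j) / n * (\<rho> + (y j - y i) / ((real j - real i) / n))"
    by linarith
  also have "\<dots> \<le> (real k - real j) / n * e" using left True n by (intro mult_left_mono) auto
  also have "\<dots> \<le> 1 * e" using e n k True by (intro mult_right_mono) auto
  finally show ?thesis unfolding left_diff_distrib diff_divide_distrib by linarith
next
  case False
  then have kj: "k < j" by simp
  have n: "real n > 0" using le by simp
  have pos: "real l - real j > 0" "real j - real k > 0" using le kj by auto
  have "(y l - y j) * (real j - real k) \<le> (y j - y k) * (real l - real j)"
    using concave_chord[OF conc kj] le by simp
  then have "(y l - y j) * (real j - real k) / (real l - real j) \<le> y j - y k"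
    using pos by (simp add: pos_divide_le_eq)
  moreover have "(real j - real k) / n * (\<rho> + (y l - y j) / ((real l - real j) / n))
      = (real j - real k) * \<rho> / n + (y l - y j) * (real j - real k) / (real l - real j)"
    using n pos by (simp add: distrib_left)
  ultimately have "(real j - real k) / n * (\<rho> + (y l - y j) / ((real l - real j) / n)) \<le> y j - y k + (real j - real k) * \<rho> / n"
    by linarith
  moreover have "(real j - real k) / n * (- e) \<le> (real j - real k) / n * (\<rho> + (y l - y j) / ((real l - real j) / n))"
    using right n kj by (intro mult_left_mono) auto
  moreover have "- e \<le> (real j - real k) / n * (- e)"
  proof -
    have "(real j - real k) / n * e \<le> 1 * e" using e n kj le by (intro mult_right_mono) auto
    then show ?thesis by simp
  qed
  ultimately have "- e \<le> y j - y k + (real j - real k) * \<rho> / n" by linarith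
  then show ?thesis unfolding left_diff_distrib diff_divide_distrib by linarith
qed

section \<open>Legendre duality between limit shape and potential\<close>

definition potential_profile :: "real \<Rightarrow> real" where
  "potential_profile \<rho> = max \<rho> 0 - 2 * ln ((4 + \<bar>\<rho>\<bar>) / 4)"

lemma log_potential_profile: "log_potential v = potential_profile (ln (cmod v))"
  by (simp add: log_potential_def potential_profile_def)

text \<open>The point where the slope of the limit shape is \<open>\<rho>\<close>, so that
  \<open>t * \<rho> - limit_shape t\<close> is stationary there; also the limit mass of the disc of
  radius \<open>exp \<rho>\<close>.\<close>

definition tilt_point :: "real \<Rightarrow> real" where
  "tilt_point \<rho> = (if 0 < \<rho> then 1 - 2 / (4 + \<rho>) else 2 / (4 - \<rho>))"

lemma tilt_point_bounds:
  assumes "\<rho> \<noteq> 0"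
  shows "0 < tilt_point \<rho>" "tilt_point \<rho> < 1" "tilt_point \<rho> \<noteq> 1/2" "0 < \<rho> \<longleftrightarrow> 1/2 < tilt_point \<rho>"
  using assms by (auto simp: tilt_point_def field_simps)

lemma limit_shape_tilt_point:
  assumes "\<rho> \<noteq> 0"
  shows "limit_shape (tilt_point \<rho>) = tilt_point \<rho> * \<rho> - potential_profile \<rho>"
proof (cases "0 < \<rho>")
  case True
  have "limit_shape (tilt_point \<rho>) = - 2 * ln (2 * (1 - tilt_point \<rho>)) - 4 * tilt_point \<rho> + 2"
    using tilt_point_bounds(4)[OF assms] True by (simp add: limit_shape_def)
  also have "2 * (1 - tilt_point \<rho>) = inverse ((4 + \<rho>) / 4)" using True by (simp add: tilt_point_def)
  also have "ln (inverse ((4 + \<rho>) / 4)) = - ln ((4 + \<rho>) / 4)" by (rule ln_inverse)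
  finally show ?thesis using True
    by (simp add: tilt_point_def potential_profile_def) (simp add: field_simps)
next
  case False
  then have neg: "\<rho> < 0" using assms by simp
  have "limit_shape (tilt_point \<rho>) = - 2 * ln (2 * tilt_point \<rho>) + 4 * tilt_point \<rho> - 2"
    using tilt_point_bounds(3,4)[OF assms] False by (simp add: limit_shape_def)
  also have "2 * tilt_point \<rho> = inverse ((4 - \<rho>) / 4)" using neg by (simp add: tilt_point_def)
  also have "ln (inverse ((4 - \<rho>) / 4)) = - ln ((4 - \<rho>) / 4)" by (rule ln_inverse)
  finally show ?thesis using neg
    by (simp add: tilt_point_def potential_profile_def) (simp add: field_simps)
qed

lemma limit_shape_derivative:
  assumes "\<rho> \<noteq> 0"
  shows "(limit_shape has_real_derivative \<rho>) (at (tilt_point \<rho>))"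
proof (cases "0 < \<rho>")
  case True
  let ?t = "tilt_point \<rho>"
  have t: "1/2 < ?t" "?t < 1" using tilt_point_bounds[OF assms] True by auto
  have "((\<lambda>t. - 2 * ln (2 * (1 - t)) - 4 * t + 2) has_real_derivative 2 / (1 - t) - 4) (at t)"
    if "t < 1" for t :: real
    using that by (auto intro!: derivative_eq_intros) (simp add: field_simps)?
  from this[OF t(2)]
  have "((\<lambda>t. - 2 * ln (2 * (1 - t)) - 4 * t + 2) has_real_derivative 2 / (1 - ?t) - 4) (at ?t)" .
  moreover have "2 / (1 - ?t) - 4 = \<rho>"
  proof -
    have "2 / (1 - ?t) = 4 + \<rho>" using True by (simp add: tilt_point_def field_simps)
    then show ?thesis by simp
  qed
  ultimately have "((\<lambda>t. - 2 * ln (2 * (1 - t)) - 4 * t + 2) has_real_derivative \<rho>) (at ?t)" by simp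
  moreover have "eventually (\<lambda>t. limit_shape t = - 2 * ln (2 * (1 - t)) - 4 * t + 2) (nhds ?t)"
    using eventually_nhds_in_open[of "{1/2<..}" ?t] t
    by (auto elim!: eventually_mono simp: limit_shape_def)
  ultimately show ?thesis by (subst DERIV_cong_ev[OF refl _ refl])
next
  case False
  let ?t = "tilt_point \<rho>"
  have neg: "\<rho> < 0" using False assms by simp
  have t: "0 < ?t" "?t < 1/2" using tilt_point_bounds[OF assms] False by auto
  have "((\<lambda>t. - 2 * ln (2 * t) + 4 * t - 2) has_real_derivative - 2 / t + 4) (at t)"
    if "0 < t" for t :: real
    using that by (auto intro!: derivative_eq_intros) (simp add: field_simps)?
  from this[OF t(1)]
  have "((\<lambda>t. - 2 * ln (2 * t) + 4 * t - 2) has_real_derivative - 2 / ?t + 4) (at ?t)" .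
  moreover have "- 2 / ?t + 4 = \<rho>"
  proof -
    have "2 / ?t = 4 - \<rho>" using neg by (simp add: tilt_point_def field_simps)
    then show ?thesis by simp
  qed
  ultimately have "((\<lambda>t. - 2 * ln (2 * t) + 4 * t - 2) has_real_derivative \<rho>) (at ?t)" by simp
  moreover have "eventually (\<lambda>t. limit_shape t = - 2 * ln (2 * t) + 4 * t - 2) (nhds ?t)"
    using eventually_nhds_in_open[of "{..<1/2}" ?t] t
    by (auto elim!: eventually_mono simp: limit_shape_def)
  ultimately show ?thesis by (subst DERIV_cong_ev[OF refl _ refl])
qed

text \<open>Differentiability at the tilt point gives chords on both sides with slopes close to
  \<open>\<rho>\<close>. Their end points are kept off \<open>1/2\<close>, where convergence to the
  limit shape has not been established.\<close>

lemma limit_shape_chords: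
  assumes \<rho>: "\<rho> \<noteq> 0" and e: "0 < e"
  obtains t1 t2 where "0 < t1" "t1 < tilt_point \<rho>" "tilt_point \<rho> < t2" "t2 < 1" "t1 \<noteq> 1/2" "t2 \<noteq> 1/2"
    "\<rho> - e < (limit_shape (tilt_point \<rho>) - limit_shape t1) / (tilt_point \<rho> - t1)"
    "(limit_shape t2 - limit_shape (tilt_point \<rho>)) / (t2 - tilt_point \<rho>) < \<rho> + e"
proof -
  let ?t = "tilt_point \<rho>"
  have lim: "((\<lambda>s. (limit_shape s - limit_shape ?t) / (s - ?t)) \<longlongrightarrow> \<rho>) (at ?t)"
    using limit_shape_derivative[OF \<rho>] by (simp add: has_field_derivative_iff)
  have ev: "\<forall>\<^sub>F s in at ?t. \<bar>(limit_shape s - limit_shape ?t) / (s - ?t) - \<rho>\<bar> < e \<and> 0 < s \<and> s < 1 \<and> s \<noteq> 1/2"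
  proof (intro eventually_conj)
    show "\<forall>\<^sub>F s in at ?t. \<bar>(limit_shape s - limit_shape ?t) / (s - ?t) - \<rho>\<bar> < e"
      using tendstoD[OF lim e] by (simp add: dist_real_def)
    have "\<forall>\<^sub>F s in at ?t. s \<in> {0<..<1} - {1/2}"
      using tilt_point_bounds[OF \<rho>] by (intro eventually_at_in_open') auto
    then show "\<forall>\<^sub>F s in at ?t. 0 < s" "\<forall>\<^sub>F s in at ?t. s < 1" "\<forall>\<^sub>F s in at ?t. s \<noteq> 1/2"
      by (auto elim: eventually_mono)
  qed
  have "\<forall>\<^sub>F s in at_left ?t. \<bar>(limit_shape s - limit_shape ?t) / (s - ?t) - \<rho>\<bar> < e \<and> 0 < s \<and> s < 1 \<and> s \<noteq> 1/2"
     "\<forall>\<^sub>F s in at_right ?t. \<bar>(limit_shape s - limit_shape ?t) / (s - ?t) - \<rho>\<bar> < e \<and> 0 < s \<and> s < 1 \<and> s \<noteq> 1/2"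
    using ev unfolding eventually_at_split by auto
  then have "\<forall>\<^sub>F s in at_left ?t. (\<bar>(limit_shape s - limit_shape ?t) / (s - ?t) - \<rho>\<bar> < e \<and> 0 < s \<and> s < 1 \<and> s \<noteq> 1/2) \<and> s < ?t"
      "\<forall>\<^sub>F s in at_right ?t. (\<bar>(limit_shape s - limit_shape ?t) / (s - ?t) - \<rho>\<bar> < e \<and> 0 < s \<and> s < 1 \<and> s \<noteq> 1/2) \<and> ?t < s"
    by (auto intro: eventually_conj simp: eventually_at_filter)
  from eventually_happens'[OF trivial_limit_at_left_real this(1)] eventually_happens'[OF trivial_limit_at_right_real this(2)]
  obtain t1 t2 where
    t1: "\<bar>(limit_shape t1 - limit_shape ?t) / (t1 - ?t) - \<rho>\<bar> < e" "0 < t1" "t1 \<noteq> 1/2" "t1 < ?t" and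
    t2: "\<bar>(limit_shape t2 - limit_shape ?t) / (t2 - ?t) - \<rho>\<bar> < e" "t2 < 1" "t2 \<noteq> 1/2" "?t < t2"
    by blast
  show thesis
  proof
    have "(limit_shape t1 - limit_shape ?t) / (t1 - ?t) = (limit_shape ?t - limit_shape t1) / (?t - t1)"
      by (metis minus_diff_eq minus_divide_divide)
    then show "\<rho> - e < (limit_shape ?t - limit_shape t1) / (?t - t1)" using t1(1) by linarith
    show "(limit_shape t2 - limit_shape ?t) / (t2 - ?t) < \<rho> + e" using t2(1) by linarith
  qed (use t1 t2 in auto)
qed

section \<open>Control of all tilted values from finitely many nodes\<close>

definition node :: "real \<Rightarrow> nat \<Rightarrow> nat" where
  "node t n = nat \<lfloor>t * real n\<rfloor>"

lemma node_limit:
  assumes "0 \<le> t"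
  shows "(\<lambda>n. real (node t n) / real n) \<longlonglongrightarrow> t"
proof (rule nat_floor_ratio_limit)
  have "\<forall>\<^sub>F n in sequentially. t = t * real n / real n"
    using eventually_gt_at_top[of 0] by eventually_elim simp
  then show "(\<lambda>n. t * real n / real n) \<longlonglongrightarrow> t" by (rule Lim_transform_eventually[OF tendsto_const])
  show "\<forall>\<^sub>F n in sequentially. 0 \<le> t * real n" using assms by simp
  show "\<bar>real (node t n) - t * real n\<bar> \<le> 1" if "0 \<le> t * real n" for n
  proof -
    have "real (node t n) = of_int \<lfloor>t * real n\<rfloor>" using that by (simp add: node_def)
    then show ?thesis by linarith
  qed
qed

definition near_shape :: "real \<Rightarrow> real \<Rightarrow> nat \<Rightarrow> (nat \<Rightarrow> real) \<Rightarrow> bool" where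
  "near_shape t e n u \<longleftrightarrow> \<bar>ln (u (node t n)) + limit_shape t\<bar> < e"

lemma near_shape_prob:
  assumes "0 < t" "t < 1" "t \<noteq> 1/2" "0 < e"
  shows "(\<lambda>n. measure (cond_law n) {u \<in> space (cond_law n). \<not> near_shape t e n u}) \<longlonglongrightarrow> 0"
  unfolding near_shape_def using assms by (intro cond_law_ln_limit node_limit) auto

lemma node_less:
  assumes "0 \<le> s" "s < t"
  shows "\<forall>\<^sub>F n in sequentially. node s n < node t n"
proof -
  define m where "m = (s + t) / 2"
  have m: "s < m" "m < t" using assms by (auto simp: m_def)
  have t: "0 \<le> t" using assms by simp
  show ?thesis
    using order_tendstoD(2)[OF node_limit[OF assms(1)] m(1)] order_tendstoD(1)[OF node_limit[OF t] m(2)] eventually_gt_at_top[of 0]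
  proof eventually_elim
    case (elim n)
    then have "real (node s n) / real n < real (node t n) / real n" by linarith
    then show ?case using elim by (simp add: divide_less_cancel)
  qed
qed

text \<open>The bound on all tilted values follows from closeness to the limit shape at three nodes only,
  since a concave sequence lies below the extensions of its chords.\<close>

lemma tilted_bounds:
  fixes \<rho> e :: real
  assumes \<rho>: "\<rho> \<noteq> 0" and e: "0 < e"
  obtains t1 t2 \<eta> where "0 < t1" "t1 < 1" "t1 \<noteq> 1/2" "0 < t2" "t2 < 1" "t2 \<noteq> 1/2" "0 < \<eta>"
    "\<forall>\<^sub>F n in sequentially. \<forall>u. (\<forall>i. 0 < i \<and> i < n \<longrightarrow> ln (u (i - 1)) + ln (u (Suc i)) \<le> 2 * ln (u i)) \<longrightarrow>
       near_shape t1 \<eta> n u \<longrightarrow> near_shape (tilt_point \<rho>) \<eta> n u \<longrightarrow> near_shape t2 \<eta> n u \<longrightarrow>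
       (\<forall>k\<le>n. ln (u k) + real k * \<rho> / real n \<le> potential_profile \<rho> + e) \<and>
       potential_profile \<rho> - e \<le> ln (u (node (tilt_point \<rho>) n)) + real (node (tilt_point \<rho>) n) * \<rho> / real n \<and>
       0 < node (tilt_point \<rho>) n \<and> node (tilt_point \<rho>) n < n"
proof -
  let ?t = "tilt_point \<rho>"
  note tb = tilt_point_bounds[OF \<rho>]
  obtain t1 t2 where t: "0 < t1" "t1 < ?t" "?t < t2" "t2 < 1" "t1 \<noteq> 1/2" "t2 \<noteq> 1/2"
    and c1: "\<rho> - e / 4 < (limit_shape ?t - limit_shape t1) / (?t - t1)"
    and c2: "(limit_shape t2 - limit_shape ?t) / (t2 - ?t) < \<rho> + e / 4"
    using limit_shape_chords[OF \<rho>, of "e / 4"] e by auto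
  \<comment> \<open>Errors \<open>\<eta>\<close> at both ends of a chord change its slope by at most
    \<open>e / 8\<close>, and the value at the middle node by at most \<open>e / 8\<close>. Together
    with the slack \<open>e / 4\<close> of the chords the slope error stays below
    \<open>e / 2\<close>.\<close>
  define \<eta> where "\<eta> = min (e / 8) (min ((?t - t1) * e / 16) ((t2 - ?t) * e / 16))"
  have \<eta>: "0 < \<eta>" "\<eta> \<le> e / 8" "\<eta> \<le> (?t - t1) * e / 16" "\<eta> \<le> (t2 - ?t) * e / 16"
    using t e by (auto simp: \<eta>_def)
  let ?i = "node t1" and ?j = "node ?t" and ?l = "node t2"
  have lim_j: "(\<lambda>n. real (?j n) / real n) \<longlonglongrightarrow> ?t" using tb by (intro node_limit) auto
  have lim_i: "(\<lambda>n. real (?i n) / real n) \<longlonglongrightarrow> t1" using t by (intro node_limit) auto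
  have lim_l: "(\<lambda>n. real (?l n) / real n) \<longlonglongrightarrow> t2" using t tb by (intro node_limit) auto
  have L1: "(\<lambda>n. \<rho> + (- (limit_shape ?t - limit_shape t1) + 2 * \<eta>) / (real (?j n) / n - real (?i n) / n))
     \<longlonglongrightarrow> \<rho> + (- (limit_shape ?t - limit_shape t1) + 2 * \<eta>) / (?t - t1)"
    using t by (intro tendsto_intros lim_i lim_j) auto
  have "\<rho> + (- (limit_shape ?t - limit_shape t1) + 2 * \<eta>) / (?t - t1) < e / 2"
  proof -
    have "2 * \<eta> / (?t - t1) \<le> e / 8" using \<eta>(3) t by (simp add: pos_divide_le_eq mult.commute)
    then show ?thesis using c1 e by (simp add: add_divide_distrib diff_divide_distrib)
  qed
  note ev1 = order_tendstoD(2)[OF L1 this]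
  have L2: "(\<lambda>n. \<rho> + (- (limit_shape t2 - limit_shape ?t) - 2 * \<eta>) / (real (?l n) / n - real (?j n) / n))
     \<longlonglongrightarrow> \<rho> + (- (limit_shape t2 - limit_shape ?t) - 2 * \<eta>) / (t2 - ?t)"
    using t by (intro tendsto_intros lim_l lim_j) auto
  have "- (e / 2) < \<rho> + (- (limit_shape t2 - limit_shape ?t) - 2 * \<eta>) / (t2 - ?t)"
  proof -
    have "2 * \<eta> / (t2 - ?t) \<le> e / 8" using \<eta>(4) t by (simp add: pos_divide_le_eq mult.commute)
    then show ?thesis using c2 e by (simp add: add_divide_distrib diff_divide_distrib)
  qed
  note ev2 = order_tendstoD(1)[OF L2 this]
  have L3: "(\<lambda>n. real (?j n) / n * \<rho>) \<longlonglongrightarrow> ?t * \<rho>" by (intro tendsto_intros lim_j)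
  have ev3: "\<forall>\<^sub>F n in sequentially. \<bar>real (?j n) / n * \<rho> - ?t * \<rho>\<bar> < e / 8"
    using tendstoD[OF L3, of "e / 8"] e by (simp add: dist_real_def)
  have ev4: "\<forall>\<^sub>F n in sequentially. ?i n < ?j n" using t by (intro node_less) auto
  have ev5: "\<forall>\<^sub>F n in sequentially. ?j n < ?l n" using t tb by (intro node_less) auto
  have ev6: "\<forall>\<^sub>F n in sequentially. ?l n < n"
    using order_tendstoD(2)[OF lim_l t(4)] eventually_gt_at_top[of 0]
    by eventually_elim (simp add: divide_less_eq)
  show thesis
  proof
    show "\<forall>\<^sub>F n in sequentially. \<forall>u. (\<forall>i. 0 < i \<and> i < n \<longrightarrow> ln (u (i - 1)) + ln (u (Suc i)) \<le> 2 * ln (u i)) \<longrightarrow>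
       near_shape t1 \<eta> n u \<longrightarrow> near_shape ?t \<eta> n u \<longrightarrow> near_shape t2 \<eta> n u \<longrightarrow>
       (\<forall>k\<le>n. ln (u k) + real k * \<rho> / real n \<le> potential_profile \<rho> + e) \<and>
       potential_profile \<rho> - e \<le> ln (u (?j n)) + real (?j n) * \<rho> / real n \<and> 0 < ?j n \<and> ?j n < n"
      using ev1 ev2 ev3 ev4 ev5 ev6
    proof eventually_elim
      case (elim n)
      show ?case
      proof (intro allI impI)
        fix u
        assume conc: "\<forall>i. 0 < i \<and> i < n \<longrightarrow> ln (u (i - 1)) + ln (u (Suc i)) \<le> 2 * ln (u i)"
          and near: "near_shape t1 \<eta> n u" "near_shape ?t \<eta> n u" "near_shape t2 \<eta> n u"
        let ?y = "\<lambda>k. ln (u k)"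
        have n: "real n > 0" using elim by simp
        have y: "\<bar>?y (?i n) + limit_shape t1\<bar> < \<eta>" "\<bar>?y (?j n) + limit_shape ?t\<bar> < \<eta>" "\<bar>?y (?l n) + limit_shape t2\<bar> < \<eta>"
          using near by (auto simp: near_shape_def)
        have pos: "0 < real (?j n) / n - real (?i n) / n" "0 < real (?l n) / n - real (?j n) / n"
          using elim n by (auto simp: divide_strict_right_mono)
        have "(?y (?j n) - ?y (?i n)) / (real (?j n) / n - real (?i n) / n) \<le> (- (limit_shape ?t - limit_shape t1) + 2 * \<eta>) / (real (?j n) / n - real (?i n) / n)"
          using y pos by (intro divide_right_mono) auto
        then have left: "\<rho> + (?y (?j n) - ?y (?i n)) / ((real (?j n) - real (?i n)) / n) \<le> e / 2"
          using elim(1) unfolding diff_divide_distrib[of "real (?j n)"] by linarith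
        have "(- (limit_shape t2 - limit_shape ?t) - 2 * \<eta>) / (real (?l n) / n - real (?j n) / n) \<le> (?y (?l n) - ?y (?j n)) / (real (?l n) / n - real (?j n) / n)"
          using y pos by (intro divide_right_mono) auto
        then have right: "- (e / 2) \<le> \<rho> + (?y (?l n) - ?y (?j n)) / ((real (?l n) - real (?j n)) / n)"
          using elim(2) unfolding diff_divide_distrib[of "real (?l n)"] by linarith
        have pp: "potential_profile \<rho> = ?t * \<rho> - limit_shape ?t" using limit_shape_tilt_point[OF \<rho>] by simp
        have j: "\<bar>real (?j n) * \<rho> / n - ?t * \<rho>\<bar> < e / 8" using elim(3) by simp
        have "?y k + real k * \<rho> / real n \<le> potential_profile \<rho> + e" if k: "k \<le> n" for k
        proof -
          have "?y k + real k * \<rho> / real n \<le> ?y (?j n) + real (?j n) * \<rho> / real n + e / 2"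
            using conc elim k e left right by (intro concave_tilted_max[of n ?y "?i n" "?j n" "?l n"]) auto
          then show ?thesis using y(2) j \<eta>(2) unfolding pp by linarith
        qed
        moreover have "potential_profile \<rho> - e \<le> ?y (?j n) + real (?j n) * \<rho> / real n"
          using y(2) j \<eta>(2) e unfolding pp by linarith
        ultimately show "(\<forall>k\<le>n. ?y k + real k * \<rho> / real n \<le> potential_profile \<rho> + e) \<and>
          potential_profile \<rho> - e \<le> ?y (?j n) + real (?j n) * \<rho> / real n \<and> 0 < ?j n \<and> ?j n < n"
          using elim by auto
      qed
    qed
  qed (use t tb \<eta>(1) in auto)
qed

section \<open>Convergence of the potentials\<close>

definition sample_poly :: "nat \<Rightarrow> (nat \<Rightarrow> real) \<Rightarrow> complex \<Rightarrow> complex" where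
  "sample_poly n u v = (\<Sum>k\<le>n. of_real (u k ^ n) * v ^ k)"

text \<open>How far the polynomial falls below its \<open>i\<close>-th term on the scale of
  potentials. At a root the quotient is \<open>0\<close> and \<open>ln 0 = 0\<close>, so the loss is
  \<open>0\<close> there; the roots are a null set in \<open>v\<close>.\<close>

definition term_loss :: "nat \<Rightarrow> nat \<Rightarrow> (nat \<Rightarrow> real) \<Rightarrow> complex \<Rightarrow> real" where
  "term_loss n i u v = max 0 (ln (u i ^ n * cmod v ^ i / cmod (sample_poly n u v))) / n"

text \<open>The lower bound \<open>\<kappa>\<close> turns the relative gap into an absolute one of
  order \<open>\<kappa> / n^3\<close>.\<close>

definition good_term :: "nat \<Rightarrow> real \<Rightarrow> nat \<Rightarrow> (nat \<Rightarrow> real) \<Rightarrow> bool" where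
  "good_term n \<kappa> i u \<longleftrightarrow> \<kappa> \<le> u i \<and> u i / (8 * real n ^ 3) \<le> u i - sqrt (u (i - 1) * u (i + 1))"

text \<open>A layer-cake bound. A logarithmic loss up to \<open>sqrt n\<close> is negligible after
  division by \<open>n\<close>; every further unit is charged to an anticoncentration event, and
  these have geometrically decreasing bounds. The threshold makes \<open>exp (- sqrt n)\<close> beat
  the polynomial factor coming from the gap.\<close>

lemma term_loss_integral:
  assumes i: "0 < i" "i < n" and v: "v \<noteq> 0" and \<kappa>: "0 < \<kappa>"
  shows "(\<integral>\<^sup>+u. indicator {u. good_term n \<kappa> i u} u * ennreal (term_loss n i u v) \<partial>cond_law n)
     \<le> ennreal (1 / sqrt n + 128 * (real n)\<^sup>2 * exp (- sqrt n) / \<kappa>)"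
proof -
  interpret prob_space "cond_law n" by (rule prob_space_cond_law)
  define \<delta> where "\<delta> = \<kappa> / (8 * real n ^ 3)"
  define \<eta> where "\<eta> = (\<lambda>j::nat. exp (- (sqrt n + real j)))"
  define E where "E = (\<lambda>j. anticonc_event n v i (\<eta> j) \<delta>)"
  have n: "real n \<ge> 1" using i by simp
  have n0: "real n > 0" using n by linarith
  have d: "\<delta> > 0" using \<kappa> n0 by (simp add: \<delta>_def)
  have sq: "1 \<le> sqrt n" using n by simp
  have \<eta>: "0 < \<eta> j" "\<eta> j \<le> 1/2" for j
  proof -
    have "\<eta> j \<le> exp (- 1)" unfolding \<eta>_def by (subst exp_le_cancel_iff) (use sq in linarith)
    also have "\<dots> \<le> 1/2" using exp_ge_add_one_self[of 1] by (simp add: exp_minus divide_simps)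
    finally show "\<eta> j \<le> 1/2" .
  qed (simp add: \<eta>_def)
  have E_sets: "E j \<in> sets (cond_law n)" for j unfolding E_def by (rule sets_anticonc_event[OF i])
  \<comment> \<open>\<open>8 * \<eta> j / \<delta>\<close> is
    \<open>64 * n^3 * \<eta> j / \<kappa>\<close>; one factor \<open>n\<close> is split off to
    cancel the division by \<open>n\<close> in the loss.\<close>
  define c where "c = 64 * (real n)\<^sup>2 * exp (- sqrt n) / \<kappa>"
  have c0: "0 \<le> c" using \<kappa> by (simp add: c_def)
  have E_prob: "emeasure (cond_law n) (E j) \<le> ennreal (real n * (c * exp (- 1) ^ j))" for j
  proof -
    have "measure (cond_law n) (E j) \<le> 8 * \<eta> j / \<delta>"
      unfolding E_def using i v \<eta> d by (intro anticonc) auto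
    also have "8 * \<eta> j / \<delta> = real n * (c * exp (- 1) ^ j)"
    proof -
      have "\<eta> j = exp (- sqrt n) * exp (- 1) ^ j"
        by (simp add: \<eta>_def exp_add exp_of_nat_mult[symmetric] mult.commute flip: exp_add)
      then show ?thesis using n0 \<kappa> by (simp add: \<delta>_def c_def power2_eq_square power3_eq_cube)
    qed
    finally show ?thesis unfolding emeasure_eq_measure by (rule ennreal_leI)
  qed
  have pw: "indicator {u. good_term n \<kappa> i u} u * ennreal (term_loss n i u v)
      \<le> ennreal (1 / sqrt n) + (\<Sum>j. ennreal (1 / n) * indicator (E j) u)"
    if u: "u \<in> space (cond_law n)" "\<forall>k\<le>n. 0 < u k \<and> u k < 1" for u
  proof (cases "good_term n \<kappa> i u")
    case False
    then show ?thesis by simp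
  next
    case True
    let ?P = "cmod (sample_poly n u v)" and ?T = "u i ^ n * cmod v ^ i"
    define x where "x = ln (?T / ?P)"
    have T: "?T > 0" using u i v by simp
    have sn: "sqrt n / n = 1 / sqrt n" using n0 by (simp add: real_div_sqrt divide_simps)
    show ?thesis
    proof (cases "x \<le> sqrt n")
      case le: True
      have "term_loss n i u v \<le> sqrt n / n"
        unfolding term_loss_def x_def[symmetric] using le n0 by (intro divide_right_mono) auto
      then have "ennreal (term_loss n i u v) \<le> ennreal (1 / sqrt n)" unfolding sn by (rule ennreal_leI)
      then show ?thesis using True by (simp add: add_increasing2)
    next
      case False
      then have x: "sqrt n < x" by simp
      have x0: "0 < x" using x sq by linarith
      have P: "?P > 0"
      proof (rule ccontr)
        assume "\<not> ?P > 0"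
        then have "?P = 0" by simp
        then have "x = 0" unfolding x_def by (simp only: div_by_0 ln_0)
        then show False using x0 by simp
      qed
      \<comment> \<open>The number of events \<open>E j\<close> that hold when the logarithmic loss
        is \<open>x\<close>: all those with \<open>j\<close> below the excess over
        \<open>sqrt n\<close>.\<close>
      define N where "N = nat \<lceil>x - sqrt n\<rceil>"
      have N: "x - sqrt n \<le> real N" unfolding N_def by linarith
      have mem: "u \<in> E j" if "j < N" for j
      proof -
        have "real j < x - sqrt n" using that unfolding N_def by linarith
        then have "exp (sqrt n + real j) < exp x" by simp
        also have "exp x = ?T / ?P" unfolding x_def using T P by simp
        finally have "exp (sqrt n + real j) * ?P < ?T" using P by (simp add: pos_less_divide_eq)
        then have "\<eta> j * (exp (sqrt n + real j) * ?P) < \<eta> j * ?T"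
          by (rule mult_strict_left_mono[OF _ \<eta>(1)])
        moreover have "\<eta> j * exp (sqrt n + real j) = 1"
          unfolding \<eta>_def by (simp flip: exp_add)
        ultimately have "?P < \<eta> j * ?T" by (simp only: mult.assoc[symmetric] mult_1_left)
        moreover have "\<delta> \<le> u i - sqrt (u (i - 1) * u (i + 1))"
        proof -
          have "\<delta> \<le> u i / (8 * real n ^ 3)"
            unfolding \<delta>_def using True n0 by (intro divide_right_mono) (auto simp: good_term_def)
          then show ?thesis using True by (auto simp: good_term_def)
        qed
        ultimately show ?thesis
          using u unfolding E_def anticonc_event_def sample_poly_def by (auto simp: mult.assoc)
      qed
      have "term_loss n i u v = x / n" unfolding term_loss_def x_def[symmetric] using x0 by simp
      also have "\<dots> \<le> (sqrt n + real N) / n" using N n0 by (intro divide_right_mono) auto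
      also have "\<dots> = 1 / sqrt n + real N / n" by (simp only: add_divide_distrib sn)
      finally have "ennreal (term_loss n i u v) \<le> ennreal (1 / sqrt n + real N / n)" by (rule ennreal_leI)
      also have "\<dots> = ennreal (1 / sqrt n) + ennreal (real N / n)" by (rule ennreal_plus) auto
      also have "ennreal (real N / n) = (\<Sum>j<N. ennreal (1 / n) * indicator (E j) u)"
      proof -
        have "(\<Sum>j<N. ennreal (1 / n) * indicator (E j) u) = (\<Sum>j<N. ennreal (1 / n))"
          using mem by (intro sum.cong) auto
        also have "\<dots> = ennreal (\<Sum>j<N. 1 / n)" by (rule sum_ennreal) simp
        finally show ?thesis by simp
      qed
      also have "\<dots> \<le> (\<Sum>j. ennreal (1 / n) * indicator (E j) u)"
        by (rule sum_le_suminf) (auto intro: summableI)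
      finally have "ennreal (term_loss n i u v) \<le> ennreal (1 / sqrt n) + (\<Sum>j. ennreal (1 / n) * indicator (E j) u)"
        by (simp add: add_left_mono)
      then show ?thesis using True by simp
    qed
  qed
  have "(\<integral>\<^sup>+u. indicator {u. good_term n \<kappa> i u} u * ennreal (term_loss n i u v) \<partial>cond_law n)
     \<le> (\<integral>\<^sup>+u. ennreal (1 / sqrt n) + (\<Sum>j. ennreal (1 / n) * indicator (E j) u) \<partial>cond_law n)"
    by (rule nn_integral_mono_AE, use AE_cond_law[of n] AE_space in eventually_elim) (rule pw; blast)
  also have "\<dots> = (\<integral>\<^sup>+u. ennreal (1 / sqrt n) \<partial>cond_law n) + (\<integral>\<^sup>+u. (\<Sum>j. ennreal (1 / n) * indicator (E j) u) \<partial>cond_law n)"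
    using E_sets by (intro nn_integral_add borel_measurable_suminf_order borel_measurable_times_ennreal borel_measurable_const borel_measurable_indicator)
  also have "(\<integral>\<^sup>+u. ennreal (1 / sqrt n) \<partial>cond_law n) = ennreal (1 / sqrt n)"
    using emeasure_space_1 by simp
  also have "(\<integral>\<^sup>+u. (\<Sum>j. ennreal (1 / n) * indicator (E j) u) \<partial>cond_law n) = (\<Sum>j. \<integral>\<^sup>+u. ennreal (1 / n) * indicator (E j) u \<partial>cond_law n)"
    using E_sets by (intro nn_integral_suminf borel_measurable_times_ennreal borel_measurable_const borel_measurable_indicator)
  also have "\<dots> = (\<Sum>j. ennreal (1 / n) * emeasure (cond_law n) (E j))"
    using E_sets by (simp only: nn_integral_cmult_indicator)
  also have "\<dots> \<le> (\<Sum>j. ennreal (c * exp (- 1) ^ j))"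
  proof (intro suminf_le summableI)
    fix j
    have "ennreal (1 / n) * emeasure (cond_law n) (E j) \<le> ennreal (1 / n) * ennreal (real n * (c * exp (- 1) ^ j))"
      by (intro mult_left_mono E_prob) simp
    also have "\<dots> = ennreal (1 / n * (real n * (c * exp (- 1) ^ j)))" by (rule ennreal_mult'[symmetric]) simp
    also have "1 / n * (real n * (c * exp (- 1) ^ j)) = c * exp (- 1) ^ j" using n0 by simp
    finally show "ennreal (1 / n) * emeasure (cond_law n) (E j) \<le> ennreal (c * exp (- 1) ^ j)" .
  qed
  also have "(\<Sum>j. ennreal (c * exp (- 1) ^ j)) = ennreal (c * (1 / (1 - exp (- 1))))"
    using c0 by (intro suminf_ennreal_eq sums_mult geometric_sums) auto
  also have "\<dots> \<le> ennreal (c * 2)"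
  proof (intro ennreal_leI mult_left_mono c0)
    have "exp (- 1) \<le> (1/2 :: real)" using exp_ge_add_one_self[of 1] by (simp add: exp_minus divide_simps)
    then show "1 / (1 - exp (- 1)) \<le> (2 :: real)" by (simp add: divide_simps)
  qed
  also have "ennreal (1 / sqrt n) + ennreal (c * 2) = ennreal (1 / sqrt n + c * 2)"
    using c0 by (intro ennreal_plus[symmetric]) auto
  finally show ?thesis by (simp add: c_def add_left_mono algebra_simps)
qed

section \<open>From the potential error to the Levy-Prokhorov distance\<close>

definition sample_coeffs :: "nat \<Rightarrow> (nat \<Rightarrow> real) \<Rightarrow> nat \<Rightarrow> real" where
  "sample_coeffs n u = (\<lambda>i\<in>{..n}. u i ^ n)"

lemma poly_sample: "poly (coeff_poly n (sample_coeffs n u)) v = sample_poly n u v"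
  unfolding coeff_poly_def sample_poly_def sample_coeffs_def poly_sum
  by (rule sum.cong) (auto simp: poly_monom)

lemma sample_degree:
  assumes "0 < u n"
  shows "degree (coeff_poly n (sample_coeffs n u)) = n" "coeff_poly n (sample_coeffs n u) \<noteq> 0"
proof -
  have c: "coeff (coeff_poly n (sample_coeffs n u)) n \<noteq> 0"
    using assms by (simp add: coeff_coeff_poly sample_coeffs_def)
  then show "coeff_poly n (sample_coeffs n u) \<noteq> 0" by auto
  have "degree (coeff_poly n (sample_coeffs n u)) \<le> n" by (rule degree_le) (simp add: coeff_coeff_poly)
  then show "degree (coeff_poly n (sample_coeffs n u)) = n" using le_degree[OF c] by simp
qed

definition potential_error :: "nat \<Rightarrow> (nat \<Rightarrow> real) \<Rightarrow> complex \<Rightarrow> real" where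
  "potential_error n u v = \<bar>ln (cmod (sample_poly n u v)) / n - log_potential v\<bar>"

definition shape_error :: "nat \<Rightarrow> real \<Rightarrow> real \<Rightarrow> (nat \<Rightarrow> real) \<Rightarrow> ennreal" where
  "shape_error n a b u = (\<integral>\<^sup>+v. indicator (annulus a b) v * ennreal (potential_error n u v) \<partial>lborel)"

lemma limit_measure_annulus:
  assumes "1 \<le> A"
  shows "1 - measure limit_measure (annulus (1 / A) A) \<le> 4 / (4 + ln A)"
proof -
  interpret prob_space limit_measure by (rule prob_space_limit_measure)
  have m: "{z. cmod z < 1 / A} \<in> sets limit_measure" "{z. A \<le> cmod z} \<in> sets limit_measure"
    by (unfold sets_limit_measure, measurable)
  have "space limit_measure - annulus (1 / A) A \<subseteq> {z. cmod z < 1 / A} \<union> {z. A \<le> cmod z}"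
    by (auto simp: annulus_def)
  then have "measure limit_measure (space limit_measure - annulus (1 / A) A) \<le> measure limit_measure ({z. cmod z < 1 / A} \<union> {z. A \<le> cmod z})"
    using m by (intro finite_measure_mono sets.Un)
  also have "\<dots> \<le> measure limit_measure {z. cmod z < 1 / A} + measure limit_measure {z. A \<le> cmod z}"
    using m by (rule measure_Un_le)
  also have "measure limit_measure {z. cmod z < 1 / A} = 2 / (4 + ln A)"
    unfolding measure_def using assms by (subst limit_measure_inside) (auto simp: ln_divide_pos)
  also have "measure limit_measure {z. A \<le> cmod z} = 2 / (4 + ln A)"
    unfolding measure_def using assms by (subst limit_measure_outside) auto
  finally show ?thesis using prob_compl[of "annulus (1 / A) A"] by simp
qed

text \<open>The radii of the kernel, and with them \<open>\<kappa>\<close>, depend on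
  \<open>\<epsilon>\<close> only, so the tolerance \<open>\<delta>\<close> is uniform in
  \<open>n\<close> and in the sample.\<close>

lemma coeff_distance_le_of_shape_error:
  assumes \<epsilon>: "0 < \<epsilon>"
  obtains a \<delta> b where "0 < a" "0 < \<delta>"
    "\<And>n u. 1 \<le> n \<Longrightarrow> 0 < u n \<Longrightarrow> shape_error n a b u \<le> ennreal \<delta> \<Longrightarrow> coeff_distance n (sample_coeffs n u) \<le> \<epsilon>"
proof -
  \<comment> \<open>Makes the mass outside the annulus, at most \<open>4 / (4 + ln A)\<close>, no
    larger than \<open>\<epsilon> / 2\<close>.\<close>
  define A where "A = exp (8 / \<epsilon>)"
  have A: "1 \<le> A" using \<epsilon> by (simp add: A_def)
  have "4 / (4 + ln A) \<le> \<epsilon> / 2"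
    using \<epsilon> by (simp add: A_def divide_simps)
  then have tail: "1 - measure limit_measure (annulus (1 / A) A) \<le> \<epsilon> / 2"
    using limit_measure_annulus[OF A] by linarith
  \<comment> \<open>\<open>2 * s \<le> \<epsilon>\<close> fits the neighbourhood of
    \<open>B\<close>, and \<open>4 * s < 1 / A\<close> keeps the enlarged annulus off the
    origin.\<close>
  define s where "s = min (\<epsilon> / 2) (1 / (8 * A))"
  have s: "0 < s" "2 * s \<le> \<epsilon>" "s \<le> 1 / (8 * A)" using \<epsilon> A by (auto simp: s_def)
  have s4: "4 * s < 1 / A"
  proof -
    have "4 * (1 / (8 * A)) < 1 / A" using A by (simp add: field_simps)
    then show ?thesis using s(3) by linarith
  qed
  have rs: "0 < s / 2" "s / 2 < s" using s by auto
  obtain \<kappa> where kp: "\<kappa> > 0" and k1: "\<And>Q z. kernel_mass (s / 2) s Q z \<le> ennreal \<kappa>"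
    and k2: "\<And>Q z. ball z s \<subseteq> Q \<Longrightarrow> kernel_mass (s / 2) s Q z = ennreal \<kappa>"
    and k3: "\<And>Q z. ball z s \<inter> Q = {} \<Longrightarrow> kernel_mass (s / 2) s Q z = 0"
    using kernel_mass_values[OF rs] by blast
  define a where "a = 1 / A - 4 * s"
  define b where "b = A + 4 * s"
  \<comment> \<open>Two comparisons then cost
    \<open>4 * \<delta> / \<kappa> = \<epsilon> / 2\<close> in total.\<close>
  define \<delta> where "\<delta> = \<kappa> * \<epsilon> / 8"
  show thesis
  proof
    show a: "0 < a" using s4 by (simp add: a_def)
    show d: "0 < \<delta>" using kp \<epsilon> by (simp add: \<delta>_def)
    fix n :: nat and u assume n: "1 \<le> n" and un: "0 < u n" and err: "shape_error n a b u \<le> ennreal \<delta>"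
    define p where "p = coeff_poly n (sample_coeffs n u)"
    have p: "degree p = n" "p \<noteq> 0" unfolding p_def
      by (rule sample_degree(1)[where u = u and n = n, OF un], rule sample_degree(2)[where u = u and n = n, OF un])
    obtain \<zeta> where "p = smult (lead_coeff p) (\<Prod>m<degree p. [:- \<zeta> m, 1:])" by (rule poly_factorization[OF p(2)])
    then have \<zeta>: "p = smult (lead_coeff p) (\<Prod>m<n. [:- \<zeta> m, 1:])" unfolding p(1) .
    interpret F: factored_poly n "lead_coeff p" \<zeta>
      by unfold_locales (use n p in auto)
    have "sample_poly n u v = lead_coeff p * (\<Prod>m<n. v - \<zeta> m)" for v
    proof -
      have "poly p v = poly (smult (lead_coeff p) (\<Prod>m<n. [:- \<zeta> m, 1:])) v" using \<zeta> by simp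
      then show ?thesis unfolding p_def[symmetric] poly_sample[symmetric] by (simp add: poly_prod p_def)
    qed
    then have "\<bar>F.D v\<bar> = potential_error n u v" for v
      by (simp add: F.D_def F.U_def potential_error_def)
    then have err': "(\<integral>\<^sup>+v. indicator (annulus a b) v * ennreal \<bar>F.D v\<bar> \<partial>lborel) \<le> ennreal \<delta>"
      using err by (simp add: shape_error_def)
    have "levy_prokhorov (root_measure p) limit_measure \<le> \<epsilon>"
    proof (rule levy_prokhorov_le)
      show "prob_space (root_measure p)"
      proof
        have "emeasure (root_measure p) UNIV = ennreal (real n / real n)"
          using measure_root_measure(1)[OF n F.l \<zeta>, of UNIV] by simp
        then show "emeasure (root_measure p) (space (root_measure p)) = 1"
          using n by (simp add: root_measure_def)
      qed
      fix B :: "complex set" assume B: "B \<in> sets borel"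
      have "measure (root_measure p) B \<le> measure limit_measure (\<Union>x\<in>B. ball x (2 * s))
         + (4 * \<delta> / \<kappa> + (1 - measure limit_measure (annulus (a + 4 * s) (b - 4 * s))))"
        by (rule F.root_measure_bound[OF rs a kp k1 k2 k3 err' less_imp_le[OF d] \<zeta> B])
      also have "annulus (a + 4 * s) (b - 4 * s) = annulus (1 / A) A" by (simp add: a_def b_def)
      also have "measure limit_measure (\<Union>x\<in>B. ball x (2 * s)) \<le> measure limit_measure (\<Union>x\<in>B. ball x \<epsilon>)"
        using s by (intro neighbourhood_mono prob_space_limit_measure open_neighbourhood) fastforce+
      also have "4 * \<delta> / \<kappa> = \<epsilon> / 2" using kp by (simp add: \<delta>_def)
      finally show "measure (root_measure p) B \<le> measure limit_measure (\<Union>x\<in>B. ball x \<epsilon>) + \<epsilon>"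
        using tail by simp
    qed (use \<epsilon> prob_space_limit_measure in auto)
    then show "coeff_distance n (sample_coeffs n u) \<le> \<epsilon>" by (simp add: coeff_distance_def p_def)
  qed
qed

text \<open>The positive part contributes the constant \<open>1\<close> and the logarithm
  \<open>2 * (1/4)\<close>, which \<open>2\<close> covers.\<close>

lemma potential_profile_lipschitz: "\<bar>potential_profile x - potential_profile y\<bar> \<le> 2 * \<bar>x - y\<bar>"
proof -
  have one: "ln ((4 + \<bar>x\<bar>) / 4) - ln ((4 + \<bar>y\<bar>) / 4) \<le> \<bar>x - y\<bar> / 4" for x y :: real
  proof -
    have "ln ((4 + \<bar>x\<bar>) / 4) - ln ((4 + \<bar>y\<bar>) / 4) = ln ((4 + \<bar>x\<bar>) / (4 + \<bar>y\<bar>))"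
      by (simp add: ln_divide_pos add_pos_nonneg)
    also have "\<dots> \<le> (4 + \<bar>x\<bar>) / (4 + \<bar>y\<bar>) - 1"
      by (intro ln_le_minus_one divide_pos_pos add_pos_nonneg) auto
    also have "\<dots> = (\<bar>x\<bar> - \<bar>y\<bar>) / (4 + \<bar>y\<bar>)" by (simp add: diff_divide_distrib[symmetric] divide_simps add_nonneg_eq_0_iff)
    also have "\<dots> \<le> \<bar>x - y\<bar> / (4 + \<bar>y\<bar>)" by (intro divide_right_mono) auto
    also have "\<dots> \<le> \<bar>x - y\<bar> / 4" by (intro divide_left_mono) auto
    finally show ?thesis .
  qed
  have "\<bar>max x 0 - max y 0\<bar> \<le> \<bar>x - y\<bar>" by (auto simp: max_def)
  moreover have "\<bar>ln ((4 + \<bar>x\<bar>) / 4) - ln ((4 + \<bar>y\<bar>) / 4)\<bar> \<le> \<bar>x - y\<bar> / 4"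
  proof (rule abs_leI)
    show "- (ln ((4 + \<bar>x\<bar>) / 4) - ln ((4 + \<bar>y\<bar>) / 4)) \<le> \<bar>x - y\<bar> / 4"
      using one[of y x] by (simp only: minus_diff_eq abs_minus_commute[of y x])
  qed (rule one)
  moreover have "\<bar>(m - 2 * l) - (m' - 2 * l')\<bar> \<le> 2 * d" if "\<bar>m - m'\<bar> \<le> d" "\<bar>l - l'\<bar> \<le> d / 4" for m m' l l' d :: real
  proof -
    have "(m - 2 * l) - (m' - 2 * l') = (m - m') - 2 * (l - l')" by simp
    then have "\<bar>(m - 2 * l) - (m' - 2 * l')\<bar> \<le> \<bar>m - m'\<bar> + \<bar>2 * (l - l')\<bar>" by (simp only: abs_triangle_ineq4)
    also have "\<bar>2 * (l - l')\<bar> = 2 * \<bar>l - l'\<bar>" by (simp only: abs_mult abs_numeral)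
    also have "\<bar>m - m'\<bar> + 2 * \<bar>l - l'\<bar> \<le> d + 2 * (d / 4)" by (intro add_mono mult_left_mono that) simp
    also have "\<dots> \<le> 2 * d" using order_trans[OF abs_ge_zero that(1)] by simp
    finally show ?thesis .
  qed
  ultimately show ?thesis unfolding potential_profile_def by blast
qed

text \<open>From above, \<open>n + 1\<close> terms are each bounded by the largest; from below, the
  \<open>i\<close>-th term less its loss is used. The \<open>5 * e\<close> consists of
  \<open>e\<close> for the shape, \<open>e\<close> for changing the tilt in the terms,
  \<open>2 * e\<close> for changing it in the profile, and \<open>e\<close> for the number of
  terms.\<close>

lemma potential_error_bound:
  assumes n: "1 \<le> n" and u: "\<forall>k\<le>n. 0 < u k" and v: "v \<noteq> 0" and P: "sample_poly n u v \<noteq> 0"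
    and upper: "\<forall>k\<le>n. ln (u k) + real k * \<rho> / real n \<le> potential_profile \<rho> + e"
    and lower: "potential_profile \<rho> - e \<le> ln (u i) + real i * \<rho> / real n" and i: "i \<le> n"
    and near: "\<bar>ln (cmod v) - \<rho>\<bar> \<le> e" and big: "ln (real n + 1) / n \<le> e"
  shows "potential_error n u v \<le> 5 * e + term_loss n i u v"
proof -
  let ?\<sigma> = "ln (cmod v)"
  have n0: "real n > 0" using n by simp
  have tilt: "\<bar>real k * ?\<sigma> / n - real k * \<rho> / n\<bar> \<le> e" if "k \<le> n" for k
  proof -
    have "real k * ?\<sigma> / n - real k * \<rho> / n = real k / n * (?\<sigma> - \<rho>)" by (simp add: algebra_simps diff_divide_distrib)
    then have "\<bar>real k * ?\<sigma> / n - real k * \<rho> / n\<bar> = real k / n * \<bar>?\<sigma> - \<rho>\<bar>" by (simp add: abs_mult)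
    also have "\<dots> \<le> 1 * e" using that n0 near by (intro mult_mono) auto
    finally show ?thesis by simp
  qed
  have "\<bar>potential_profile ?\<sigma> - potential_profile \<rho>\<bar> \<le> 2 * e"
    by (rule order_trans[OF potential_profile_lipschitz mult_left_mono[OF near]]) simp
  note lip = abs_le_D1[OF this] abs_le_D2[OF this]
  have term_eq: "u k ^ n * cmod v ^ k = exp (n * (ln (u k) + real k * ?\<sigma> / n))" if "k \<le> n" for k
  proof -
    have "n * (ln (u k) + real k * ?\<sigma> / n) = n * ln (u k) + k * ?\<sigma>" using n0 by (simp add: distrib_left)
    then show ?thesis using u that v by (simp add: exp_add exp_of_nat_mult)
  qed
  define M where "M = potential_profile \<rho> + 2 * e"
  have "cmod (sample_poly n u v) \<le> (\<Sum>k\<le>n. cmod (of_real (u k ^ n) * v ^ k))"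
    unfolding sample_poly_def by (rule norm_sum)
  also have "\<dots> \<le> (\<Sum>k\<le>n. exp (n * M))"
  proof (rule sum_mono)
    fix k assume "k \<in> {..n}"
    then have k: "k \<le> n" by simp
    have "cmod (of_real (u k ^ n) * v ^ k) = u k ^ n * cmod v ^ k"
      using less_imp_le[OF u[rule_format, OF k]] by (simp add: norm_mult norm_power)
    also have "\<dots> \<le> exp (n * M)"
    proof -
      have "ln (u k) + real k * ?\<sigma> / n \<le> M"
        using upper[rule_format, OF k] abs_le_D1[OF tilt[OF k]] unfolding M_def by linarith
      then show ?thesis unfolding term_eq[OF k] using n0 by simp
    qed
    finally show "cmod (of_real (u k ^ n) * v ^ k) \<le> exp (n * M)" .
  qed
  also have "\<dots> = (real n + 1) * exp (n * M)" by simp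
  finally have "ln (cmod (sample_poly n u v)) \<le> ln ((real n + 1) * exp (n * M))"
    using P by (intro ln_mono) auto
  also have "\<dots> = ln (real n + 1) + n * M" by (subst ln_mult_pos) auto
  finally have "ln (cmod (sample_poly n u v)) / n \<le> (ln (real n + 1) + n * M) / n"
    using n0 by (intro divide_right_mono) auto
  also have "\<dots> = ln (real n + 1) / n + M" using n0 by (simp add: add_divide_distrib)
  finally have up: "ln (cmod (sample_poly n u v)) / n \<le> potential_profile ?\<sigma> + 5 * e"
    using big lip unfolding M_def by linarith
  have T: "u i ^ n * cmod v ^ i > 0" using u i v by simp
  have "ln (u i ^ n * cmod v ^ i / cmod (sample_poly n u v)) = n * (ln (u i) + real i * ?\<sigma> / n) - ln (cmod (sample_poly n u v))"
    using T P by (subst ln_divide_pos) (auto simp: term_eq[OF i])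
  then have "n * (ln (u i) + real i * ?\<sigma> / n) - ln (cmod (sample_poly n u v)) \<le> max 0 (ln (u i ^ n * cmod v ^ i / cmod (sample_poly n u v)))"
    by simp
  then have "(n * (ln (u i) + real i * ?\<sigma> / n) - ln (cmod (sample_poly n u v))) / n \<le> term_loss n i u v"
    unfolding term_loss_def using n0 by (intro divide_right_mono) auto
  then have "ln (u i) + real i * ?\<sigma> / n - ln (cmod (sample_poly n u v)) / n \<le> term_loss n i u v"
    using n0 by (simp add: diff_divide_distrib)
  then have low: "potential_profile ?\<sigma> - 4 * e - term_loss n i u v \<le> ln (cmod (sample_poly n u v)) / n"
    using lower abs_le_D2[OF tilt[OF i]] lip by linarith
  have "0 \<le> e" using near by linarith
  moreover have "0 \<le> term_loss n i u v" by (simp add: term_loss_def)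
  ultimately show ?thesis using up low unfolding potential_error_def log_potential_profile by (intro abs_leI) linarith+
qed

lemma measurable_component_fst:
  assumes "k \<le> n"
  shows "(\<lambda>p. fst p k) \<in> borel_measurable (cond_law n \<Otimes>\<^sub>M lborel)"
  by (rule measurable_compose[OF measurable_fst]) (use measurable_iid_component[OF assms] in simp)

lemma measurable_sample_poly:
  "(\<lambda>p. sample_poly n (fst p) (snd p)) \<in> borel_measurable (cond_law n \<Otimes>\<^sub>M lborel)"
proof -
  have "(\<lambda>p. snd p ^ k) \<in> borel_measurable (cond_law n \<Otimes>\<^sub>M (lborel :: complex measure))" for k
    by measurable
  then show ?thesis unfolding sample_poly_def
    by (intro borel_measurable_sum borel_measurable_times measurable_compose[OF _ borel_measurable_of_real]
        borel_measurable_power measurable_component_fst) auto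
qed

lemma measurable_potential_error:
  "(\<lambda>p. potential_error n (fst p) (snd p)) \<in> borel_measurable (cond_law n \<Otimes>\<^sub>M lborel)"
proof -
  note [measurable] = measurable_sample_poly
  show ?thesis unfolding potential_error_def by measurable
qed

lemma measurable_term_loss:
  assumes "i \<le> n"
  shows "(\<lambda>p. term_loss n i (fst p) (snd p)) \<in> borel_measurable (cond_law n \<Otimes>\<^sub>M lborel)"
proof -
  note [measurable] = measurable_sample_poly measurable_component_fst[OF assms]
  show ?thesis unfolding term_loss_def by measurable
qed

lemma measurable_shape_error: "shape_error n a b \<in> borel_measurable (cond_law n)"
proof -
  note [measurable] = measurable_potential_error
  have "(\<lambda>(u, v). indicator (annulus a b) v * ennreal (potential_error n u v)) \<in> borel_measurable (cond_law n \<Otimes>\<^sub>M lborel)"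
    unfolding case_prod_beta' by measurable
  then show ?thesis unfolding shape_error_def
    by (rule sigma_finite_measure.borel_measurable_nn_integral[OF sigma_finite_lborel])
qed

lemma sets_good_term:
  assumes "0 < i" "i < n"
  shows "{u \<in> space (cond_law n). good_term n \<kappa> i u} \<in> sets (cond_law n)"
proof -
  have m: "(\<lambda>u. u k) \<in> borel_measurable (cond_law n)" if "k \<le> n" for k
    using measurable_iid_component[OF that] by simp
  have m1: "(\<lambda>u. u (i - 1)) \<in> borel_measurable (cond_law n)" and m2: "(\<lambda>u. u (i + 1)) \<in> borel_measurable (cond_law n)"
    and m3: "(\<lambda>u. u i) \<in> borel_measurable (cond_law n)"
    using assms by (auto intro!: m simp del: sets_cond_law space_cond_law)
  have sq: "(\<lambda>u. sqrt (u (i - 1) * u (i + 1))) \<in> borel_measurable (cond_law n)"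
    using m1 m2 by measurable
  show ?thesis unfolding good_term_def
    by (intro sets.sets_Collect_conj borel_measurable_le borel_measurable_diff borel_measurable_divide sq m3 borel_measurable_const)
qed

text \<open>The indicator is built in because anticoncentration controls the mean loss only over
  samples with a good \<open>i\<close>-th term.\<close>

definition total_loss :: "nat \<Rightarrow> real \<Rightarrow> real \<Rightarrow> real \<Rightarrow> nat \<Rightarrow> (nat \<Rightarrow> real) \<Rightarrow> ennreal" where
  "total_loss n a b \<kappa> i u = indicator {u. good_term n \<kappa> i u} u *
     (\<integral>\<^sup>+v. indicator (annulus a b) v * ennreal (term_loss n i u v) \<partial>lborel)"

text \<open>The bound for a fixed \<open>v \<noteq> 0\<close> does not depend on \<open>v\<close>,
  so exchanging the integrals yields it times the area; \<open>0 < a\<close> excludes the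
  origin.\<close>

lemma total_loss_integral:
  assumes i: "0 < i" "i < n" and \<kappa>: "0 < \<kappa>" and a: "0 < a"
  shows "total_loss n a b \<kappa> i \<in> borel_measurable (cond_law n)"
    and "(\<integral>\<^sup>+u. total_loss n a b \<kappa> i u \<partial>cond_law n)
      \<le> ennreal (1 / sqrt n + 128 * (real n)\<^sup>2 * exp (- sqrt n) / \<kappa>) * emeasure lborel (annulus a b)"
proof -
  let ?M = "cond_law n" and ?G = "{u \<in> space (cond_law n). good_term n \<kappa> i u}"
  let ?c = "ennreal (1 / sqrt n + 128 * (real n)\<^sup>2 * exp (- sqrt n) / \<kappa>)"
  have i': "i \<le> n" using i by simp
  note [measurable] = measurable_term_loss[OF i'] sets_good_term[OF i, of \<kappa>]
  have ps: "pair_sigma_finite ?M (lborel :: complex measure)"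
    by (simp add: pair_sigma_finite_def prob_space_imp_sigma_finite prob_space_cond_law sigma_finite_lborel)
  have m0: "(\<lambda>(u, v). indicator (annulus a b) v * ennreal (term_loss n i u v)) \<in> borel_measurable (?M \<Otimes>\<^sub>M lborel)"
    unfolding case_prod_beta' by measurable
  have inner: "(\<lambda>u. \<integral>\<^sup>+v. indicator (annulus a b) v * ennreal (term_loss n i u v) \<partial>lborel) \<in> borel_measurable ?M"
    by (rule sigma_finite_measure.borel_measurable_nn_integral[OF sigma_finite_lborel m0])
  have ind: "indicator {u. good_term n \<kappa> i u} u = (indicator ?G u :: ennreal)" if "u \<in> space ?M" for u
    using that by (simp add: indicator_def)
  have "(\<lambda>u. indicator ?G u * (\<integral>\<^sup>+v. indicator (annulus a b) v * ennreal (term_loss n i u v) \<partial>lborel)) \<in> borel_measurable ?M"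
    using inner by (intro borel_measurable_times_ennreal borel_measurable_indicator sets_good_term i)
  then show "total_loss n a b \<kappa> i \<in> borel_measurable ?M"
    unfolding total_loss_def by (subst measurable_cong[OF arg_cong2[of _ _ _ _ "(*)", OF ind refl]])
  have m1: "(\<lambda>(u, v). indicator ?G u * (indicator (annulus a b) v * ennreal (term_loss n i u v))) \<in> borel_measurable (?M \<Otimes>\<^sub>M lborel)"
    unfolding case_prod_beta' by measurable
  have msec: "(\<lambda>v. indicator (annulus a b) v * ennreal (term_loss n i u v)) \<in> borel_measurable lborel" if "u \<in> space ?M" for u
    using measurable_Pair2[OF m0 that] by simp
  have usec: "(\<lambda>u. indicator ?G u * ennreal (term_loss n i u v)) \<in> borel_measurable ?M" for v
  proof -
    have "(\<lambda>u. term_loss n i u v) \<in> borel_measurable ?M"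
      using measurable_Pair1[OF measurable_term_loss[OF i'], of v] by simp
    then show ?thesis
      by (intro borel_measurable_times_ennreal borel_measurable_indicator sets_good_term i measurable_compose[OF _ measurable_ennreal])
  qed
  have "(\<integral>\<^sup>+u. total_loss n a b \<kappa> i u \<partial>?M)
      = (\<integral>\<^sup>+u. (\<integral>\<^sup>+v. indicator ?G u * (indicator (annulus a b) v * ennreal (term_loss n i u v)) \<partial>lborel) \<partial>?M)"
  proof (rule nn_integral_cong)
    fix u assume u: "u \<in> space ?M"
    show "total_loss n a b \<kappa> i u = (\<integral>\<^sup>+v. indicator ?G u * (indicator (annulus a b) v * ennreal (term_loss n i u v)) \<partial>lborel)"
      unfolding total_loss_def ind[OF u] by (rule nn_integral_cmult[OF msec[OF u], symmetric])
  qed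
  also have "\<dots> = (\<integral>\<^sup>+v. (\<integral>\<^sup>+u. indicator ?G u * (indicator (annulus a b) v * ennreal (term_loss n i u v)) \<partial>?M) \<partial>lborel)"
    by (rule pair_sigma_finite.Fubini'[OF ps m1, symmetric])
  also have "\<dots> \<le> (\<integral>\<^sup>+v. ?c * indicator (annulus a b) v \<partial>lborel)"
  proof (rule nn_integral_mono)
    fix v :: complex
    show "(\<integral>\<^sup>+u. indicator ?G u * (indicator (annulus a b) v * ennreal (term_loss n i u v)) \<partial>?M) \<le> ?c * indicator (annulus a b) v"
    proof (cases "v \<in> annulus a b")
      case True
      then have v: "v \<noteq> 0" using a by (auto simp: annulus_def)
      have "(\<integral>\<^sup>+u. indicator ?G u * (indicator (annulus a b) v * ennreal (term_loss n i u v)) \<partial>?M)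
        = (\<integral>\<^sup>+u. indicator {u. good_term n \<kappa> i u} u * ennreal (term_loss n i u v) \<partial>?M)"
        using True by (intro nn_integral_cong) (simp add: ind)
      also have "\<dots> \<le> ?c" by (rule term_loss_integral[OF i v \<kappa>])
      finally show ?thesis using True by simp
    qed simp
  qed
  also have "\<dots> = ?c * emeasure lborel (annulus a b)"
    by (rule nn_integral_cmult_indicator) simp
  finally show "(\<integral>\<^sup>+u. total_loss n a b \<kappa> i u \<partial>?M) \<le> ?c * emeasure lborel (annulus a b)" .
qed

lemma AE_sample_poly_nonzero:
  assumes "0 < u n"
  shows "AE v in lborel. sample_poly n u v \<noteq> 0"
proof -
  have "finite {v. poly (coeff_poly n (sample_coeffs n u)) v = 0}"
    using sample_degree(2)[where u = u and n = n, OF assms] by (rule poly_roots_finite)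
  then have "{v. sample_poly n u v = 0} \<in> null_sets lborel"
    unfolding poly_sample by (rule finite_imp_null_set_lborel)
  then show ?thesis by (rule AE_I') auto
qed

lemma emeasure_annulus_finite: "emeasure lborel (annulus a b) < \<infinity>"
proof -
  have "emeasure lborel (annulus a b) \<le> emeasure lborel (cball (0::complex) \<bar>b\<bar>)"
    by (intro emeasure_mono) (auto simp: annulus_def)
  also have "\<dots> < \<infinity>" by (simp add: emeasure_cball)
  finally show ?thesis .
qed

lemma measurable_cond_law_component: "k \<le> n \<Longrightarrow> (\<lambda>u. u k) \<in> borel_measurable (cond_law n)"
  using measurable_iid_component by simp

lemma node_le: "t < 1 \<Longrightarrow> node t n \<le> n"
proof -
  assume "t < 1"
  then have "t * real n \<le> 1 * real n" by (intro mult_right_mono) auto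
  then have "\<lfloor>t * real n\<rfloor> \<le> int n" by linarith
  then show ?thesis by (simp add: node_def)
qed

lemma node_interior:
  assumes "0 < t" "t < 1"
  shows "\<forall>\<^sub>F n in sequentially. 0 < node t n \<and> node t n < n"
proof -
  have "\<forall>\<^sub>F n in sequentially. node 0 n < node t n" using assms by (intro node_less) auto
  moreover have "\<forall>\<^sub>F n in sequentially. (0::nat) < n" by (rule eventually_gt_at_top)
  ultimately show ?thesis
  proof eventually_elim
    fix n :: nat assume n: "0 < n" and "node 0 n < node t n"
    moreover have "\<lfloor>t * real n\<rfloor> < int n"
    proof -
      have "t * real n < 1 * real n" using assms n by (intro mult_strict_right_mono) auto
      then show ?thesis by linarith
    qed
    ultimately show "0 < node t n \<and> node t n < n" by (simp add: node_def nat_less_iff)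
  qed
qed

lemma sets_not_near_shape:
  assumes "t < 1"
  shows "{u \<in> space (cond_law n). \<not> near_shape t e n u} \<in> sets (cond_law n)"
proof -
  have "(\<lambda>u. ln (u (node t n))) \<in> borel_measurable (cond_law n)"
    by (rule borel_measurable_ln[OF measurable_cond_law_component[OF node_le[OF assms]]])
  then show ?thesis unfolding near_shape_def
    by (intro sets.sets_Collect_neg borel_measurable_less borel_measurable_abs borel_measurable_add borel_measurable_const)
qed

lemma sets_gap:
  assumes "0 < i" "i < n"
  shows "{u \<in> space (cond_law n). \<not> (u i / (8 * real n ^ 3) \<le> u i - sqrt (u (i - 1) * u (i + 1)))} \<in> sets (cond_law n)"
proof -
  have m1: "(\<lambda>u. u (i - 1)) \<in> borel_measurable (cond_law n)" and m2: "(\<lambda>u. u (i + 1)) \<in> borel_measurable (cond_law n)"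
    and m3: "(\<lambda>u. u i) \<in> borel_measurable (cond_law n)"
    using assms by (auto intro!: measurable_cond_law_component simp del: sets_cond_law space_cond_law)
  have sq: "(\<lambda>u. sqrt (u (i - 1) * u (i + 1))) \<in> borel_measurable (cond_law n)"
    using m1 m2 by measurable
  show ?thesis
    by (intro sets.sets_Collect_neg borel_measurable_le borel_measurable_diff borel_measurable_divide sq m3 borel_measurable_const)
qed

section \<open>Uniform control on an annulus through a finite grid of tilts\<close>

definition regular_at :: "nat \<Rightarrow> real \<Rightarrow> real \<Rightarrow> real \<Rightarrow> nat \<Rightarrow> (nat \<Rightarrow> real) \<Rightarrow> bool" where
  "regular_at n \<rho> e \<kappa> i u \<longleftrightarrow> good_term n \<kappa> i u \<and>
     (\<forall>k\<le>n. ln (u k) + real k * \<rho> / real n \<le> potential_profile \<rho> + e) \<and>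
     potential_profile \<rho> - e \<le> ln (u i) + real i * \<rho> / real n"

text \<open>Bundles the data belonging to one tilt (lower bound, term index, sets of vanishing
  probability) so that they can be chosen for all grid points together.\<close>

definition exceptional :: "real \<Rightarrow> real \<Rightarrow> real \<Rightarrow> (nat \<Rightarrow> nat) \<Rightarrow> (nat \<Rightarrow> (nat \<Rightarrow> real) set) \<Rightarrow> bool" where
  "exceptional \<rho> e \<kappa> i B \<longleftrightarrow> 0 < \<kappa> \<and> (\<lambda>n. measure (cond_law n) (B n)) \<longlonglongrightarrow> 0 \<and>
     (\<forall>\<^sub>F n in sequentially. B n \<in> sets (cond_law n) \<and> 0 < i n \<and> i n < n \<and>
       (\<forall>u \<in> log_concave_event n - B n. (\<forall>k\<le>n. 0 < u k \<and> u k < 1) \<longrightarrow> regular_at n \<rho> e \<kappa> (i n) u))"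

text \<open>The exceptional set collects the failures of closeness at the three nodes and of the
  curvature gap at the middle one; the chosen term is the one at the middle node.\<close>

lemma exceptional_exists:
  assumes \<rho>: "\<rho> \<noteq> 0" and e: "0 < e"
  shows "\<exists>\<kappa> i B. exceptional \<rho> e \<kappa> i B"
proof -
  let ?t = "tilt_point \<rho>"
  note tb = tilt_point_bounds[OF \<rho>]
  obtain t1 t2 \<eta> where t: "0 < t1" "t1 < 1" "t1 \<noteq> 1/2" "0 < t2" "t2 < 1" "t2 \<noteq> 1/2" and \<eta>: "0 < \<eta>"
    and ev: "\<forall>\<^sub>F n in sequentially. \<forall>u. (\<forall>i. 0 < i \<and> i < n \<longrightarrow> ln (u (i - 1)) + ln (u (Suc i)) \<le> 2 * ln (u i)) \<longrightarrow>
       near_shape t1 \<eta> n u \<longrightarrow> near_shape ?t \<eta> n u \<longrightarrow> near_shape t2 \<eta> n u \<longrightarrow>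
       (\<forall>k\<le>n. ln (u k) + real k * \<rho> / real n \<le> potential_profile \<rho> + e) \<and>
       potential_profile \<rho> - e \<le> ln (u (node ?t n)) + real (node ?t n) * \<rho> / real n \<and>
       0 < node ?t n \<and> node ?t n < n"
    using tilted_bounds[OF \<rho> e] by blast
  define F where "F = (\<lambda>s n. {u \<in> space (cond_law n). \<not> near_shape s \<eta> n u})"
  define G where "G = (\<lambda>n. {u \<in> space (cond_law n).
      \<not> (u (node ?t n) / (8 * real n ^ 3) \<le> u (node ?t n) - sqrt (u (node ?t n - 1) * u (node ?t n + 1)))})"
  define B where "B = (\<lambda>n. ((F t1 n \<union> F ?t n) \<union> F t2 n) \<union> G n)"
  \<comment> \<open>The lower bound on the coordinate at the middle node that closeness there
    implies.\<close>
  define \<kappa> where "\<kappa> = exp (- limit_shape ?t - \<eta>)"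
  have Fs: "F s n \<in> sets (cond_law n)" if "s < 1" for s n
    unfolding F_def by (rule sets_not_near_shape[OF that])
  have Gs: "G n \<in> sets (cond_law n)" "measure (cond_law n) (G n) \<le> 2 / n" if "0 < node ?t n \<and> node ?t n < n" for n
    unfolding G_def by (rule sets_gap gap_prob; use that in blast)+
  have le: "measure (cond_law n) (B n) \<le> measure (cond_law n) (F t1 n) + measure (cond_law n) (F ?t n) + measure (cond_law n) (F t2 n) + 2 / n"
    if "0 < node ?t n \<and> node ?t n < n" for n
  proof -
    interpret prob_space "cond_law n" by (rule prob_space_cond_law)
    note s = Fs[OF t(2)] Fs[OF tb(2)] Fs[OF t(5)] Gs(1)[OF that]
    have "measure (cond_law n) (B n) \<le> measure (cond_law n) ((F t1 n \<union> F ?t n) \<union> F t2 n) + measure (cond_law n) (G n)"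
      unfolding B_def using s by (intro measure_Un_le sets.Un)
    moreover have "measure (cond_law n) ((F t1 n \<union> F ?t n) \<union> F t2 n) \<le> measure (cond_law n) (F t1 n \<union> F ?t n) + measure (cond_law n) (F t2 n)"
      using s by (intro measure_Un_le sets.Un)
    moreover have "measure (cond_law n) (F t1 n \<union> F ?t n) \<le> measure (cond_law n) (F t1 n) + measure (cond_law n) (F ?t n)"
      using s by (intro measure_Un_le)
    ultimately show ?thesis using Gs(2)[OF that] by linarith
  qed
  have inner: "\<forall>\<^sub>F n in sequentially. 0 < node ?t n \<and> node ?t n < n" using tb by (intro node_interior) auto
  have lim: "(\<lambda>n. measure (cond_law n) (B n)) \<longlonglongrightarrow> 0"
  proof (rule tendsto_sandwich[OF always_eventually _ tendsto_const])
    show "\<forall>\<^sub>F n in sequentially. measure (cond_law n) (B n) \<le> measure (cond_law n) (F t1 n) + measure (cond_law n) (F ?t n) + measure (cond_law n) (F t2 n) + 2 / real n"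
      using inner by eventually_elim (rule le)
    have "(\<lambda>n. measure (cond_law n) (F t1 n) + measure (cond_law n) (F ?t n) + measure (cond_law n) (F t2 n) + 2 / real n) \<longlonglongrightarrow> 0 + 0 + 0 + 0"
      unfolding F_def using t tb \<eta> by (intro tendsto_add near_shape_prob lim_const_over_n) auto
    then show "(\<lambda>n. measure (cond_law n) (F t1 n) + measure (cond_law n) (F ?t n) + measure (cond_law n) (F t2 n) + 2 / real n) \<longlonglongrightarrow> 0"
      by simp
  qed simp
  have "exceptional \<rho> e \<kappa> (node ?t) B"
    unfolding exceptional_def
  proof (intro conjI lim)
    show "0 < \<kappa>" by (simp add: \<kappa>_def)
    show "\<forall>\<^sub>F n in sequentially. B n \<in> sets (cond_law n) \<and> 0 < node ?t n \<and> node ?t n < n \<and>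
       (\<forall>u \<in> log_concave_event n - B n. (\<forall>k\<le>n. 0 < u k \<and> u k < 1) \<longrightarrow> regular_at n \<rho> e \<kappa> (node ?t n) u)"
      using inner ev
    proof (eventually_elim, intro conjI ballI impI)
      fix n assume i: "0 < node ?t n \<and> node ?t n < n"
      show "B n \<in> sets (cond_law n)" unfolding B_def using Fs[OF t(2)] Fs[OF tb(2)] Fs[OF t(5)] Gs(1)[OF i] by (intro sets.Un)
      show "0 < node ?t n" "node ?t n < n" using i by auto
      fix u assume ev: "\<forall>u. (\<forall>i. 0 < i \<and> i < n \<longrightarrow> ln (u (i - 1)) + ln (u (Suc i)) \<le> 2 * ln (u i)) \<longrightarrow>
         near_shape t1 \<eta> n u \<longrightarrow> near_shape ?t \<eta> n u \<longrightarrow> near_shape t2 \<eta> n u \<longrightarrow>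
         (\<forall>k\<le>n. ln (u k) + real k * \<rho> / real n \<le> potential_profile \<rho> + e) \<and>
         potential_profile \<rho> - e \<le> ln (u (node ?t n)) + real (node ?t n) * \<rho> / real n \<and>
         0 < node ?t n \<and> node ?t n < n"
        and u: "u \<in> log_concave_event n - B n" and pos: "\<forall>k\<le>n. 0 < u k \<and> u k < 1"
      have sp: "u \<in> space (iid_uniform n)" using u by (simp add: log_concave_event_def)
      have conc: "\<forall>i. 0 < i \<and> i < n \<longrightarrow> ln (u (i - 1)) + ln (u (Suc i)) \<le> 2 * ln (u i)"
        using u log_concave_event_iff[OF sp pos] by blast
      have near: "near_shape t1 \<eta> n u" "near_shape ?t \<eta> n u" "near_shape t2 \<eta> n u"
        using u sp by (auto simp: B_def F_def)
      have gap: "u (node ?t n) / (8 * real n ^ 3) \<le> u (node ?t n) - sqrt (u (node ?t n - 1) * u (node ?t n + 1))"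
        using u sp by (simp add: B_def G_def)
      have "- (ln (u (node ?t n)) + limit_shape ?t) < \<eta>"
        using near(2) unfolding near_shape_def by (rule le_less_trans[OF abs_ge_minus_self])
      then have "- limit_shape ?t - \<eta> \<le> ln (u (node ?t n))" by linarith
      then have "\<kappa> \<le> exp (ln (u (node ?t n)))" unfolding \<kappa>_def by (subst exp_le_cancel_iff)
      then have "\<kappa> \<le> u (node ?t n)" using pos i by simp
      then show "regular_at n \<rho> e \<kappa> (node ?t n) u"
        using ev[rule_format, OF conc[rule_format] near] gap unfolding regular_at_def good_term_def by blast
    qed
  qed
  then show ?thesis by blast
qed

text \<open>Half-integer multiples of \<open>e\<close> avoid the excluded tilt
  \<open>0\<close>.\<close>

lemma log_grid:
  fixes e l r :: real
  assumes e: "0 < e"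
  obtains \<Gamma> where "finite \<Gamma>" "0 \<notin> \<Gamma>" "\<And>x. l \<le> x \<Longrightarrow> x \<le> r \<Longrightarrow> \<exists>\<rho>\<in>\<Gamma>. \<bar>x - \<rho>\<bar> \<le> e"
proof
  let ?\<Gamma> = "(\<lambda>j::int. e * (of_int j + 1/2)) ` {\<lfloor>l / e\<rfloor>..\<lfloor>r / e\<rfloor>}"
  show "finite ?\<Gamma>" by simp
  show "0 \<notin> ?\<Gamma>"
  proof
    assume "0 \<in> ?\<Gamma>"
    then obtain j :: int where "e * (of_int j + 1/2) = 0" by auto
    then have "2 * real_of_int j = -1" using e by simp
    then have "2 * j = -1" by linarith
    then show False by presburger
  qed
  fix x assume x: "l \<le> x" "x \<le> r"
  let ?j = "\<lfloor>x / e\<rfloor>"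
  have "?j \<in> {\<lfloor>l / e\<rfloor>..\<lfloor>r / e\<rfloor>}"
    using x e by (auto intro!: floor_mono divide_right_mono)
  moreover have "\<bar>x - e * (of_int ?j + 1/2)\<bar> \<le> e"
  proof -
    have "x - e * (of_int ?j + 1/2) = e * (x / e - of_int ?j - 1/2)" using e by (simp add: algebra_simps)
    then have "\<bar>x - e * (of_int ?j + 1/2)\<bar> = e * \<bar>x / e - of_int ?j - 1/2\<bar>" using e by (simp add: abs_mult)
    also have "\<dots> \<le> e * 1"
    proof (intro mult_left_mono abs_leI)
      show "x / e - of_int ?j - 1/2 \<le> 1" "- (x / e - of_int ?j - 1/2) \<le> 1" by linarith+
    qed (use e in simp)
    finally show ?thesis by simp
  qed
  ultimately show "\<exists>\<rho>\<in>?\<Gamma>. \<bar>x - \<rho>\<bar> \<le> e" by blast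
qed

text \<open>Each \<open>v\<close> is served by a grid tilt near \<open>ln (cmod v)\<close>. Adding
  the losses of all grid tilts makes a measurable choice among them unnecessary.\<close>

lemma shape_error_bound:
  assumes n: "1 \<le> n" and u: "u \<in> space (cond_law n)" "\<forall>k\<le>n. 0 < u k" and a: "0 < a" and e: "0 \<le> e"
    and \<Gamma>: "finite \<Gamma>" "\<And>x. ln a \<le> x \<Longrightarrow> x \<le> ln b \<Longrightarrow> \<exists>\<rho>\<in>\<Gamma>. \<bar>x - \<rho>\<bar> \<le> e"
    and i: "\<And>\<rho>. \<rho> \<in> \<Gamma> \<Longrightarrow> i \<rho> \<le> n" and reg: "\<And>\<rho>. \<rho> \<in> \<Gamma> \<Longrightarrow> regular_at n \<rho> e (\<kappa> \<rho>) (i \<rho>) u"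
    and big: "ln (real n + 1) / n \<le> e"
  shows "shape_error n a b u \<le> ennreal (5 * e) * emeasure lborel (annulus a b) + (\<Sum>\<rho>\<in>\<Gamma>. total_loss n a b (\<kappa> \<rho>) (i \<rho>) u)"
proof -
  let ?I = "\<lambda>v. indicator (annulus a b) v :: ennreal"
  have m: "(\<lambda>v. ?I v * ennreal (term_loss n (i \<rho>) u v)) \<in> borel_measurable lborel" if "\<rho> \<in> \<Gamma>" for \<rho>
  proof -
    have "(\<lambda>v. term_loss n (i \<rho>) u v) \<in> borel_measurable lborel"
      using measurable_Pair2[OF measurable_term_loss[OF i[OF that]] u(1)] by simp
    then show ?thesis
      by (intro borel_measurable_times_ennreal borel_measurable_indicator measurable_compose[OF _ measurable_ennreal]) auto
  qed
  have "shape_error n a b u \<le> (\<integral>\<^sup>+v. ennreal (5 * e) * ?I v + (\<Sum>\<rho>\<in>\<Gamma>. ?I v * ennreal (term_loss n (i \<rho>) u v)) \<partial>lborel)"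
    unfolding shape_error_def
  proof (rule nn_integral_mono_AE, use AE_sample_poly_nonzero[where u = u and n = n, OF u(2)[rule_format, OF order_refl]] in eventually_elim)
    fix v assume P: "sample_poly n u v \<noteq> 0"
    show "?I v * ennreal (potential_error n u v) \<le> ennreal (5 * e) * ?I v + (\<Sum>\<rho>\<in>\<Gamma>. ?I v * ennreal (term_loss n (i \<rho>) u v))"
    proof (cases "v \<in> annulus a b")
      case True
      then have v: "v \<noteq> 0" "ln a \<le> ln (cmod v)" "ln (cmod v) \<le> ln b"
        using a by (auto simp: annulus_def intro!: ln_mono)
      obtain \<rho> where \<rho>: "\<rho> \<in> \<Gamma>" "\<bar>ln (cmod v) - \<rho>\<bar> \<le> e" using \<Gamma>(2)[OF v(2,3)] by blast
      have "potential_error n u v \<le> 5 * e + term_loss n (i \<rho>) u v"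
        using reg[OF \<rho>(1)] unfolding regular_at_def
        by (intro potential_error_bound[OF n u(2) v(1) P _ _ i[OF \<rho>(1)] \<rho>(2) big]) blast+
      then have "ennreal (potential_error n u v) \<le> ennreal (5 * e + term_loss n (i \<rho>) u v)" by (rule ennreal_leI)
      also have "\<dots> = ennreal (5 * e) + ennreal (term_loss n (i \<rho>) u v)"
        using e by (intro ennreal_plus) (auto simp: term_loss_def)
      also have "ennreal (term_loss n (i \<rho>) u v) \<le> (\<Sum>\<rho>\<in>\<Gamma>. ennreal (term_loss n (i \<rho>) u v))"
        using \<Gamma>(1) \<rho>(1) by (intro member_le_sum) auto
      finally show ?thesis using True by (simp add: add_left_mono)
    qed simp
  qed
  also have "\<dots> = (\<integral>\<^sup>+v. ennreal (5 * e) * ?I v \<partial>lborel) + (\<integral>\<^sup>+v. (\<Sum>\<rho>\<in>\<Gamma>. ?I v * ennreal (term_loss n (i \<rho>) u v)) \<partial>lborel)"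
  proof (rule nn_integral_add)
    show "(\<lambda>v. ennreal (5 * e) * ?I v) \<in> borel_measurable lborel" by measurable
    show "(\<lambda>v. \<Sum>\<rho>\<in>\<Gamma>. ?I v * ennreal (term_loss n (i \<rho>) u v)) \<in> borel_measurable lborel"
      by (rule borel_measurable_sum) (rule m)
  qed
  also have "(\<integral>\<^sup>+v. ennreal (5 * e) * ?I v \<partial>lborel) = ennreal (5 * e) * emeasure lborel (annulus a b)"
    by (rule nn_integral_cmult_indicator) simp
  also have "(\<integral>\<^sup>+v. (\<Sum>\<rho>\<in>\<Gamma>. ?I v * ennreal (term_loss n (i \<rho>) u v)) \<partial>lborel) = (\<Sum>\<rho>\<in>\<Gamma>. \<integral>\<^sup>+v. ?I v * ennreal (term_loss n (i \<rho>) u v) \<partial>lborel)"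
    by (rule nn_integral_sum[OF m])
  also have "\<dots> = (\<Sum>\<rho>\<in>\<Gamma>. total_loss n a b (\<kappa> \<rho>) (i \<rho>) u)"
    using reg by (intro sum.cong) (auto simp: total_loss_def regular_at_def)
  finally show ?thesis .
qed

text \<open>The error has a deterministic part of order \<open>e\<close>, made small in advance. The
  rest is either an exceptional sample for one of finitely many tilts or a large summed loss,
  excluded by Markov's inequality.\<close>

lemma shape_error_prob:
  assumes a: "0 < a" and \<delta>: "0 < \<delta>"
  shows "(\<lambda>n. measure (cond_law n) {u \<in> space (cond_law n). \<not> shape_error n a b u \<le> ennreal \<delta>}) \<longlonglongrightarrow> 0"
proof -
  define \<alpha> where "\<alpha> = enn2real (emeasure lborel (annulus a b))"
  have \<alpha>: "emeasure lborel (annulus a b) = ennreal \<alpha>" "0 \<le> \<alpha>"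
    using emeasure_annulus_finite[of a b] by (auto simp: \<alpha>_def less_top)
  \<comment> \<open>Keeps the deterministic part \<open>5 * e * \<alpha>\<close> below half of
    \<open>\<delta>\<close>; the \<open>+ 1\<close> allows for an annulus of area
    \<open>0\<close>.\<close>
  define e where "e = \<delta> / (20 * (\<alpha> + 1))"
  have e: "0 < e" using \<delta> \<alpha> by (simp add: e_def)
  have e\<alpha>: "5 * e * \<alpha> \<le> \<delta> / 2"
  proof -
    have "5 * e * \<alpha> = \<delta> / 4 * (\<alpha> / (\<alpha> + 1))" using \<alpha>(2) by (simp add: e_def divide_simps add_nonneg_eq_0_iff)
    also have "\<dots> \<le> \<delta> / 4 * 1" using \<delta> \<alpha> by (intro mult_left_mono) (auto simp: divide_le_eq_1)
    finally show ?thesis using \<delta> by simp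
  qed
  obtain \<Gamma> where \<Gamma>: "finite \<Gamma>" "0 \<notin> \<Gamma>" "\<And>x. ln a \<le> x \<Longrightarrow> x \<le> ln b \<Longrightarrow> \<exists>\<rho>\<in>\<Gamma>. \<bar>x - \<rho>\<bar> \<le> e"
    using log_grid[OF e, of "ln a" "ln b"] by blast
  have "\<forall>\<rho>\<in>\<Gamma>. \<exists>\<kappa> i B. exceptional \<rho> e \<kappa> i B"
    using \<Gamma>(2) exceptional_exists[OF _ e] by metis
  then obtain \<kappa> where "\<forall>\<rho>\<in>\<Gamma>. \<exists>i B. exceptional \<rho> e (\<kappa> \<rho>) i B"
    using bchoice[of \<Gamma> "\<lambda>\<rho> \<kappa>. \<exists>i B. exceptional \<rho> e \<kappa> i B"] by blast
  then obtain i where "\<forall>\<rho>\<in>\<Gamma>. \<exists>B. exceptional \<rho> e (\<kappa> \<rho>) (i \<rho>) B"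
    using bchoice[of \<Gamma> "\<lambda>\<rho> i. \<exists>B. exceptional \<rho> e (\<kappa> \<rho>) i B"] by blast
  then obtain B where ex: "\<forall>\<rho>\<in>\<Gamma>. exceptional \<rho> e (\<kappa> \<rho>) (i \<rho>) (B \<rho>)"
    using bchoice[of \<Gamma> "\<lambda>\<rho> B. exceptional \<rho> e (\<kappa> \<rho>) (i \<rho>) B"] by blast
  have \<kappa>: "0 < \<kappa> \<rho>" if "\<rho> \<in> \<Gamma>" for \<rho> using ex that unfolding exceptional_def by blast
  have Blim: "(\<lambda>n. measure (cond_law n) (B \<rho> n)) \<longlonglongrightarrow> 0" if "\<rho> \<in> \<Gamma>" for \<rho>
    using ex that unfolding exceptional_def by blast
  have ev: "\<forall>\<^sub>F n in sequentially. \<forall>\<rho>\<in>\<Gamma>. B \<rho> n \<in> sets (cond_law n) \<and> 0 < i \<rho> n \<and> i \<rho> n < n \<and>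
       (\<forall>u \<in> log_concave_event n - B \<rho> n. (\<forall>k\<le>n. 0 < u k \<and> u k < 1) \<longrightarrow> regular_at n \<rho> e (\<kappa> \<rho>) (i \<rho> n) u)"
    using ex \<Gamma>(1) unfolding exceptional_def by (intro eventually_ball_finite) blast+
  define err where "err = (\<lambda>\<rho> n. 1 / sqrt (real n) + 128 * (real n)\<^sup>2 * exp (- sqrt (real n)) / \<kappa> \<rho>)"
  have err0: "0 \<le> err \<rho> n" if "\<rho> \<in> \<Gamma>" for \<rho> n using \<kappa>[OF that] by (simp add: err_def)
  have err_lim: "err \<rho> \<longlonglongrightarrow> 0" if "\<rho> \<in> \<Gamma>" for \<rho>
  proof -
    have "(\<lambda>n::nat. 1 / sqrt (real n)) \<longlonglongrightarrow> 0" by real_asymp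
    moreover have "(\<lambda>n::nat. 128 * (real n)\<^sup>2 * exp (- sqrt (real n))) \<longlonglongrightarrow> 0" by real_asymp
    ultimately have "err \<rho> \<longlonglongrightarrow> 0 + 0 / \<kappa> \<rho>" unfolding err_def
      using \<kappa>[OF that] by (intro tendsto_add tendsto_divide tendsto_const) auto
    then show ?thesis by simp
  qed
  let ?Z = "\<lambda>n. {u \<in> space (cond_law n). \<not> shape_error n a b u \<le> ennreal \<delta>}"
  let ?R = "\<lambda>n. (\<Sum>\<rho>\<in>\<Gamma>. measure (cond_law n) (B \<rho> n)) + 2 / \<delta> * \<alpha> * (\<Sum>\<rho>\<in>\<Gamma>. err \<rho> n)"
  have "\<forall>\<^sub>F n::nat in sequentially. ln (real n + 1) / n < e"
    by (rule order_tendstoD(2)[OF _ e]) real_asymp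
  with ev have "\<forall>\<^sub>F n in sequentially. measure (cond_law n) (?Z n) \<le> ?R n"
    using eventually_ge_at_top[of 1]
  proof eventually_elim
    fix n :: nat
    assume n: "1 \<le> n" and big: "ln (real n + 1) / n < e"
      and h: "\<forall>\<rho>\<in>\<Gamma>. B \<rho> n \<in> sets (cond_law n) \<and> 0 < i \<rho> n \<and> i \<rho> n < n \<and>
       (\<forall>u \<in> log_concave_event n - B \<rho> n. (\<forall>k\<le>n. 0 < u k \<and> u k < 1) \<longrightarrow> regular_at n \<rho> e (\<kappa> \<rho>) (i \<rho> n) u)"
    interpret prob_space "cond_law n" by (rule prob_space_cond_law)
    define T where "T = (\<lambda>u. \<Sum>\<rho>\<in>\<Gamma>. total_loss n a b (\<kappa> \<rho>) (i \<rho> n) u)"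
    have loss: "total_loss n a b (\<kappa> \<rho>) (i \<rho> n) \<in> borel_measurable (cond_law n)"
      "(\<integral>\<^sup>+u. total_loss n a b (\<kappa> \<rho>) (i \<rho> n) u \<partial>cond_law n) \<le> ennreal (err \<rho> n) * ennreal \<alpha>" if "\<rho> \<in> \<Gamma>" for \<rho>
    proof -
      have i: "0 < i \<rho> n" "i \<rho> n < n" using h that by blast+
      show "total_loss n a b (\<kappa> \<rho>) (i \<rho> n) \<in> borel_measurable (cond_law n)"
        by (rule total_loss_integral(1)[OF i \<kappa>[OF that] a])
      show "(\<integral>\<^sup>+u. total_loss n a b (\<kappa> \<rho>) (i \<rho> n) u \<partial>cond_law n) \<le> ennreal (err \<rho> n) * ennreal \<alpha>"
        unfolding \<alpha>(1)[symmetric] err_def by (rule total_loss_integral(2)[OF i \<kappa>[OF that] a])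
    qed
    have Tm: "T \<in> borel_measurable (cond_law n)"
      unfolding T_def by (rule borel_measurable_sum) (rule loss)
    \<comment> \<open>The event that the summed loss is at least \<open>\<delta> / 2\<close>, scaled
      as Markov's inequality expects it.\<close>
    define C where "C = {u \<in> space (cond_law n). 1 \<le> ennreal (2 / \<delta>) * T u}"
    have Cm: "C \<in> sets (cond_law n)" unfolding C_def
      using Tm by (intro borel_measurable_le borel_measurable_times_ennreal borel_measurable_const)
    have C_prob: "measure (cond_law n) C \<le> 2 / \<delta> * \<alpha> * (\<Sum>\<rho>\<in>\<Gamma>. err \<rho> n)"
    proof -
      have "(\<lambda>u. T u * indicator (space (cond_law n)) u) \<in> borel_measurable (cond_law n)"
        using Tm by (intro borel_measurable_times_ennreal borel_measurable_indicator sets.top)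
      then have "emeasure (cond_law n) C \<le> ennreal (2 / \<delta>) * (\<integral>\<^sup>+u. T u * indicator (space (cond_law n)) u \<partial>cond_law n)"
        unfolding C_def by (rule nn_integral_Markov_inequality[OF _ sets.top])
      also have "(\<integral>\<^sup>+u. T u * indicator (space (cond_law n)) u \<partial>cond_law n) = (\<integral>\<^sup>+u. T u \<partial>cond_law n)"
        by (rule nn_integral_cong) simp
      also have "\<dots> = (\<Sum>\<rho>\<in>\<Gamma>. \<integral>\<^sup>+u. total_loss n a b (\<kappa> \<rho>) (i \<rho> n) u \<partial>cond_law n)"
        unfolding T_def by (rule nn_integral_sum) (rule loss)
      also have "\<dots> \<le> (\<Sum>\<rho>\<in>\<Gamma>. ennreal (err \<rho> n) * ennreal \<alpha>)" by (rule sum_mono) (rule loss)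
      also have "\<dots> = ennreal (\<Sum>\<rho>\<in>\<Gamma>. err \<rho> n * \<alpha>)"
        using err0 \<alpha> by (subst sum_ennreal[symmetric]) (auto simp: ennreal_mult intro!: sum.cong)
      also have "ennreal (2 / \<delta>) * \<dots> = ennreal (2 / \<delta> * (\<Sum>\<rho>\<in>\<Gamma>. err \<rho> n * \<alpha>))"
        using \<delta> err0 \<alpha> by (intro ennreal_mult[symmetric] sum_nonneg) auto
      also have "2 / \<delta> * (\<Sum>\<rho>\<in>\<Gamma>. err \<rho> n * \<alpha>) = 2 / \<delta> * \<alpha> * (\<Sum>\<rho>\<in>\<Gamma>. err \<rho> n)"
        by (simp add: sum_distrib_left sum_distrib_right sum_divide_distrib mult_ac)
      finally have "emeasure (cond_law n) C \<le> ennreal (2 / \<delta> * \<alpha> * (\<Sum>\<rho>\<in>\<Gamma>. err \<rho> n))" by (simp add: mult_left_mono)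
      moreover have "0 \<le> 2 / \<delta> * \<alpha> * (\<Sum>\<rho>\<in>\<Gamma>. err \<rho> n)"
        using \<delta> \<alpha> err0 by (intro mult_nonneg_nonneg sum_nonneg) auto
      ultimately show ?thesis unfolding emeasure_eq_measure by (simp only: ennreal_le_iff)
    qed
    have U: "(\<Union>\<rho>\<in>\<Gamma>. B \<rho> n) \<in> sets (cond_law n)" using h \<Gamma>(1) by (intro sets.finite_UN) auto
    have key: "u \<in> (\<Union>\<rho>\<in>\<Gamma>. B \<rho> n) \<union> C"
      if u: "u \<in> log_concave_event n \<and> (\<forall>i\<le>n. 0 < u i \<and> u i < 1)" and Z: "u \<in> ?Z n" for u
    proof (rule ccontr)
      assume nin: "u \<notin> (\<Union>\<rho>\<in>\<Gamma>. B \<rho> n) \<union> C"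
      have sp: "u \<in> space (cond_law n)" using Z by blast
      have reg: "regular_at n \<rho> e (\<kappa> \<rho>) (i \<rho> n) u" if "\<rho> \<in> \<Gamma>" for \<rho>
        using h that u nin by blast
      have "shape_error n a b u \<le> ennreal (5 * e) * ennreal \<alpha> + T u"
        unfolding T_def \<alpha>(1)[symmetric]
      proof (rule shape_error_bound[OF n sp _ a less_imp_le[OF e] \<Gamma>(1) \<Gamma>(3) _ reg less_imp_le[OF big]])
        show "\<forall>k\<le>n. 0 < u k" using u by blast
        show "i \<rho> n \<le> n" if "\<rho> \<in> \<Gamma>" for \<rho> using h that by (simp add: less_imp_le)
      qed
      also have "ennreal (5 * e) * ennreal \<alpha> = ennreal (5 * e * \<alpha>)" using e \<alpha> by (intro ennreal_mult[symmetric]) auto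
      also have "\<dots> \<le> ennreal (\<delta> / 2)" by (rule ennreal_leI[OF e\<alpha>])
      also have "T u \<le> ennreal (\<delta> / 2)"
      proof -
        have "ennreal (2 / \<delta>) * T u \<le> 1" using nin sp by (auto simp: C_def)
        then have "ennreal (\<delta> / 2) * (ennreal (2 / \<delta>) * T u) \<le> ennreal (\<delta> / 2) * 1" by (rule mult_left_mono) simp
        moreover have "ennreal (\<delta> / 2) * ennreal (2 / \<delta>) = 1" using \<delta> by (simp flip: ennreal_mult)
        ultimately show ?thesis by (simp add: mult.assoc[symmetric])
      qed
      also have "ennreal (\<delta> / 2) + ennreal (\<delta> / 2) = ennreal \<delta>" using \<delta> by (simp flip: ennreal_plus)
      finally show False using Z by (simp add: add_mono)
    qed
    have "AE u in cond_law n. u \<in> ?Z n \<longrightarrow> u \<in> (\<Union>\<rho>\<in>\<Gamma>. B \<rho> n) \<union> C"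
      using AE_cond_law[of n] by eventually_elim (rule impI, rule key)
    then have "measure (cond_law n) (?Z n) \<le> measure (cond_law n) ((\<Union>\<rho>\<in>\<Gamma>. B \<rho> n) \<union> C)"
      using U Cm by (intro finite_measure_mono_AE sets.Un)
    also have "\<dots> \<le> measure (cond_law n) (\<Union>\<rho>\<in>\<Gamma>. B \<rho> n) + measure (cond_law n) C"
      using U Cm by (rule measure_Un_le)
    also have "measure (cond_law n) (\<Union>\<rho>\<in>\<Gamma>. B \<rho> n) \<le> (\<Sum>\<rho>\<in>\<Gamma>. measure (cond_law n) (B \<rho> n))"
      using h \<Gamma>(1) by (intro measure_UNION_le) auto
    finally show "measure (cond_law n) (?Z n) \<le> ?R n" using C_prob by linarith
  qed
  note le = this
  have "?R \<longlonglongrightarrow> (\<Sum>\<rho>\<in>\<Gamma>. 0) + 2 / \<delta> * \<alpha> * (\<Sum>\<rho>\<in>\<Gamma>. 0)"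
    by (intro tendsto_add tendsto_mult tendsto_const tendsto_sum Blim err_lim)
  then have lim: "?R \<longlonglongrightarrow> 0" by (simp only: sum.neutral_const mult_zero_right add_0_right)
  show ?thesis
  proof (rule tendsto_sandwich[OF always_eventually le tendsto_const lim])
    show "\<forall>n. 0 \<le> measure (cond_law n) (?Z n)" by (intro allI measure_nonneg)
  qed
qed

section \<open>Convergence in probability and transfer to an arbitrary realisation\<close>

lemma coeff_distance_prob:
  assumes "0 < \<epsilon>"
  shows "(\<lambda>n. measure (cond_law n) {u \<in> space (cond_law n). \<epsilon> < coeff_distance n (sample_coeffs n u)}) \<longlonglongrightarrow> 0"
proof -
  obtain a \<delta> b where ab: "0 < a" "0 < \<delta>"
    and le: "\<And>n u. 1 \<le> n \<Longrightarrow> 0 < u n \<Longrightarrow> shape_error n a b u \<le> ennreal \<delta> \<Longrightarrow> coeff_distance n (sample_coeffs n u) \<le> \<epsilon>"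
    by (rule coeff_distance_le_of_shape_error[OF assms]) blast
  show ?thesis
  proof (rule tendsto_sandwich[OF always_eventually _ tendsto_const shape_error_prob[OF ab, of b]])
    show "\<forall>\<^sub>F n in sequentially. measure (cond_law n) {u \<in> space (cond_law n). \<epsilon> < coeff_distance n (sample_coeffs n u)}
       \<le> measure (cond_law n) {u \<in> space (cond_law n). \<not> shape_error n a b u \<le> ennreal \<delta>}"
      using eventually_ge_at_top[of 1]
    proof eventually_elim
      fix n :: nat assume n: "1 \<le> n"
      interpret prob_space "cond_law n" by (rule prob_space_cond_law)
      show "measure (cond_law n) {u \<in> space (cond_law n). \<epsilon> < coeff_distance n (sample_coeffs n u)}
       \<le> measure (cond_law n) {u \<in> space (cond_law n). \<not> shape_error n a b u \<le> ennreal \<delta>}"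
      proof (rule finite_measure_mono_AE)
        show "AE u in cond_law n. u \<in> {u \<in> space (cond_law n). \<epsilon> < coeff_distance n (sample_coeffs n u)} \<longrightarrow>
            u \<in> {u \<in> space (cond_law n). \<not> shape_error n a b u \<le> ennreal \<delta>}"
          using AE_cond_law[of n]
        proof eventually_elim
          fix u assume "u \<in> log_concave_event n \<and> (\<forall>i\<le>n. 0 < u i \<and> u i < 1)"
          then have "0 < u n" by simp
          then show "u \<in> {u \<in> space (cond_law n). \<epsilon> < coeff_distance n (sample_coeffs n u)} \<longrightarrow>
            u \<in> {u \<in> space (cond_law n). \<not> shape_error n a b u \<le> ennreal \<delta>}"
            using le[OF n] by (metis (mono_tags, lifting) mem_Collect_eq not_less)
        qed
        show "{u \<in> space (cond_law n). \<not> shape_error n a b u \<le> ennreal \<delta>} \<in> sets (cond_law n)"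
          by (intro sets.sets_Collect_neg borel_measurable_le measurable_shape_error borel_measurable_const)
      qed
    qed
  qed simp
qed

theorem theorem2:
  fixes M :: "nat \<Rightarrow> 'a measure"
    and b :: "nat \<Rightarrow> nat \<Rightarrow> 'a \<Rightarrow> real"
  assumes "\<And>n. 1 \<le> n \<Longrightarrow> prob_space (M n)"
    and "\<And>n i. 1 \<le> n \<Longrightarrow> i \<le> n \<Longrightarrow> b n i \<in> borel_measurable (M n)"
    and "\<And>n. 1 \<le> n \<Longrightarrow>
           distr (M n) (PiM {..n} (\<lambda>_. borel)) (\<lambda>\<omega>. \<lambda>i\<in>{..n}. b n i \<omega>) = beta_model n"
  defines "d \<equiv> \<lambda>n \<omega>. levy_prokhorov (root_measure (coeff_poly n (\<lambda>i. b n i \<omega>))) limit_measure"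
  shows "(\<forall>n\<ge>1. d n \<in> borel_measurable (M n)) \<and>
         (\<forall>\<epsilon>>0. (\<lambda>n. \<P>(\<omega> in M n. d n \<omega> > \<epsilon>)) \<longlonglongrightarrow> 0)"
proof (intro conjI allI impI)
  let ?B = "\<lambda>n \<omega>. \<lambda>i\<in>{..n}. b n i \<omega>" and ?N = "\<lambda>n. PiM {..n} (\<lambda>_. borel) :: (nat \<Rightarrow> real) measure"
  \<comment> \<open>Only the coefficients up to \<open>n\<close> enter the polynomial, so it is a
    function of the restricted vector, whose law is prescribed.\<close>
  have d: "d n = (\<lambda>\<omega>. coeff_distance n (?B n \<omega>))" for n
  proof
    fix \<omega>
    have "coeff_poly n (\<lambda>i. b n i \<omega>) = coeff_poly n (?B n \<omega>)"
      by (rule poly_eqI) (simp add: coeff_coeff_poly)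
    then show "d n \<omega> = coeff_distance n (?B n \<omega>)" by (simp add: d_def coeff_distance_def)
  qed
  have Bm: "?B n \<in> measurable (M n) (?N n)" if "1 \<le> n" for n
    using assms(2)[OF that] by (intro measurable_restrict) auto
  show "d n \<in> borel_measurable (M n)" if "1 \<le> n" for n
    unfolding d by (rule measurable_compose[OF Bm[OF that] measurable_coeff_distance])
  fix \<epsilon> :: real assume \<epsilon>: "0 < \<epsilon>"
  have "\<P>(\<omega> in M n. d n \<omega> > \<epsilon>) = measure (cond_law n) {u \<in> space (cond_law n). \<epsilon> < coeff_distance n (sample_coeffs n u)}"
    if n: "1 \<le> n" for n
  proof -
    have S: "{c \<in> space (?N n). \<epsilon> < coeff_distance n c} \<in> sets (?N n)"
      by (intro borel_measurable_less borel_measurable_const measurable_coeff_distance)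
    have sm: "sample_coeffs n \<in> measurable (cond_law n) (?N n)"
      unfolding sample_coeffs_def
      by (intro measurable_restrict borel_measurable_power measurable_cond_law_component) auto
    have "\<P>(\<omega> in M n. d n \<omega> > \<epsilon>) = measure (M n) (?B n -` {c \<in> space (?N n). \<epsilon> < coeff_distance n c} \<inter> space (M n))"
      unfolding d using measurable_space[OF Bm[OF n]] by (intro arg_cong[where f = "measure (M n)"]) auto
    also have "\<dots> = measure (beta_model n) {c \<in> space (?N n). \<epsilon> < coeff_distance n c}"
      unfolding assms(3)[OF n, symmetric] by (rule measure_distr[OF Bm[OF n] S, symmetric])
    also have "beta_model n = distr (cond_law n) (?N n) (sample_coeffs n)"
      unfolding beta_model_def cond_law_def sample_coeffs_def ..
    also have "measure \<dots> {c \<in> space (?N n). \<epsilon> < coeff_distance n c}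
        = measure (cond_law n) (sample_coeffs n -` {c \<in> space (?N n). \<epsilon> < coeff_distance n c} \<inter> space (cond_law n))"
      by (rule measure_distr[OF sm S])
    also have "\<dots> = measure (cond_law n) {u \<in> space (cond_law n). \<epsilon> < coeff_distance n (sample_coeffs n u)}"
      using measurable_space[OF sm] by (intro arg_cong[where f = "measure (cond_law n)"]) auto
    finally show ?thesis .
  qed
  then have "\<forall>\<^sub>F n in sequentially. measure (cond_law n) {u \<in> space (cond_law n). \<epsilon> < coeff_distance n (sample_coeffs n u)} = \<P>(\<omega> in M n. d n \<omega> > \<epsilon>)"
    by (intro eventually_sequentiallyI[of 1]) simp
  then show "(\<lambda>n. \<P>(\<omega> in M n. d n \<omega> > \<epsilon>)) \<longlonglongrightarrow> 0"
    by (rule Lim_transform_eventually[OF coeff_distance_prob[OF \<epsilon>]])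
qed

end
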